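(* Let $d\ge 1$ be an integer, $\alpha\in(0,2)$, let $f:\mathbb{R}^d\times\mathbb{R}^d\to[0,\infty]$ be a Borel function and $\phi:[0,\infty)\to(0,1]$ a Borel function. Assume: (A.1) There is a constant $M>0$ with $f(x,y)\le M\,\phi(|y-x|)\,|y-x|^{-\alpha-d}$ for all $x\ne y$ in $\mathbb{R}^d$, where $\phi$ satisfies: (a) $\phi(a)=1$ for $a\in[0,1]$ and there is a constant $c_1$ with $\phi(a)\le c_1\phi(b)$ whenever $a,b\ge 0$, $|a-b|\le 1$; (b) $\phi\in C^2(1,\infty)$ and there is a constant $c_2$ with $\max(|\phi'(a)|,|\phi''(a)|)\le c_2\phi(a)$ for every $a>1$; (c) there is a constant $c_3$ such that for all $x,y\in\mathbb{R}^d$ with $|x-y|>2$, $$\int_{|x-z|\ge 1,\,|y-z|\ge 1}\frac{\phi(|y-z|)}{|y-z|^{\alpha+d}}\,\frac{\phi(|z-x|)}{|z-x|^{\alpha+d}}\,dz\le c_3\,\frac{\phi(|y-x|)}{|y-x|^{\alpha+d}}.$$ (A.2) $f(x,x+h)=f(x,x-h)$ for all $x,h\in\mathbb{R}^d$, or $\alpha<1$. (A.3) $f(x,y)=f(y,x)$ for all $x,y\in\mathbb{R}^d$. (A.4) There is a constant $c_4>0$ with $\inf_{x\in\mathbb{R}^d}\int_{|y-x|>\varepsilon}\frac{f(x,y)}{\phi(|y-x|)}\,dy\ge c_4\varepsilon^{-\alpha}$ for every $\varepsilon>0$. (A.5) For every $y\in\mathbb{R}^d$ the function $x\mapsto f(x,y)$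 is continuous on $\mathbb{R}^d\setminus\{y\}$. (A.6) The operator $\mathcal{A}$ with domain $C_c^2(\mathbb{R}^d)$, regarded as an operator on $C_\infty(\mathbb{R}^d)$, is closable and its closure is the generator of a strongly continuous contraction semigroup $\{P_t,\ t\ge 0\}$ on $C_\infty(\mathbb{R}^d)$. Then there exist a function $p:(0,\infty)\times\mathbb{R}^d\times\mathbb{R}^d\to[0,\infty)$ and constants $C_1,C_2>0$ depending only on $d,\alpha,\phi,M,c_4$ such that $$P_t\varphi(x)=\int_{\mathbb{R}^d}\varphi(y)\,p(t,x,y)\,dy,\qquad x\in\mathbb{R}^d,\ t>0,\ \varphi\in C_\infty(\mathbb{R}^d),$$ and $$p(t,x,y)\le C_1e^{C_2t}\min\left(t^{-d/\alpha},\frac{t\,\phi(|y-x|)}{|y-x|^{\alpha+d}}\right),\qquad x,y\in\mathbb{R}^d,\ t>0.$$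
   Context: $C_c^2(\mathbb{R}^d)$ is the set of twice continuously differentiable functions with compact support; $C_\infty(\mathbb{R}^d)$ is the space of continuous functions vanishing at infinity, with the supremum norm. For $\varphi\in C_c^2(\mathbb{R}^d)$, $$\mathcal{A}\varphi(x)=\lim_{\varepsilon\downarrow 0}\int_{|y-x|>\varepsilon}(\varphi(y)-\varphi(x))f(x,y)\,dy$$ $$=\int_{\mathbb{R}^d}\left(\varphi(x+h)-\varphi(x)-h\cdot\nabla\varphi(x)\mathbf{1}_{|h|<1}\right)f(x,x+h)\,dh+\frac12\int_{|h|<1}h\cdot\nabla\varphi(x)\left(f(x,x+h)-f(x,x-h)\right)dh,$$ which is well defined under (A.1) and (A.2). It is known that under (A.1), (A.2), (A.5) the operator $\mathcal{A}$ maps $C_c^2(\mathbb{R}^d)$ into $C_\infty(\mathbb{R}^d)$. Convention: when $x=y$, $\frac{t\,\phi(0)}{0}=\infty$, so the minimum equals $t^{-d/\alpha}$. *)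

theory Defs
  imports "HOL-Analysis.Analysis"
begin

text \<open>
  The Banach space of continuous functions vanishing at infinity, as a subspace of the bounded
  continuous functions; the norm inherited from the latter is the supremum norm.
\<close>

definition C0 :: "((real ^ 'n) \<Rightarrow>\<^sub>C real) set" where
  "C0 = {u. (apply_bcontfun u \<longlongrightarrow> 0) at_infinity}"

definition C2 :: "((real ^ 'n) \<Rightarrow> real) \<Rightarrow> bool" where
  "C2 u \<longleftrightarrow>
     (\<exists>(u' :: real ^ 'n \<Rightarrow> (real ^ 'n) \<Rightarrow>\<^sub>L real) (u'' :: real ^ 'n \<Rightarrow> (real ^ 'n) \<Rightarrow>\<^sub>L (real ^ 'n) \<Rightarrow>\<^sub>L real).
        (\<forall>x. (u has_derivative blinfun_apply (u' x)) (at x)) \<and>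
        (\<forall>x. (u' has_derivative blinfun_apply (u'' x)) (at x)) \<and>
        continuous_on UNIV u'')"

definition C2c :: "((real ^ 'n) \<Rightarrow>\<^sub>C real) set" where
  "C2c = {u. C2 (apply_bcontfun u) \<and> compact (closure {x. apply_bcontfun u x \<noteq> 0})}"

definition C2_on_halfline :: "real \<Rightarrow> (real \<Rightarrow> real) \<Rightarrow> bool" where
  "C2_on_halfline a g \<longleftrightarrow>
     (\<forall>s>a. g differentiable at s) \<and>
     (\<forall>s>a. deriv g differentiable at s) \<and>
     continuous_on {a<..} (deriv (deriv g))"

text \<open>
  The nonlocal operator with jump kernel \<open>f\<close>. The kernel may be infinite, but the
  pointwise upper bound imposed on it makes it finite off the diagonal, and the truncated integrals
  avoid the diagonal; so the conversion to the reals loses nothing.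
\<close>

definition jump_op :: "(real ^ 'n \<Rightarrow> real ^ 'n \<Rightarrow> ennreal) \<Rightarrow> (real ^ 'n \<Rightarrow> real) \<Rightarrow> real ^ 'n \<Rightarrow> real" where
  "jump_op f u x =
     Lim (at_right 0)
       (\<lambda>\<epsilon>. LINT y:{y. norm (y - x) > \<epsilon>}|lborel. (u y - u x) * enn2real (f x y))"

text \<open>
  Unbounded operators are represented by their graphs, so that passing to the closure of an
  operator is taking the topological closure of its graph in the product space. Requiring
  \<open>v \<in> C0\<close> does not shrink the domain \<open>C2c\<close> under the assumptions made on the kernel: there the
  operator maps \<open>C2c\<close> into \<open>C0\<close>.
\<close>

definition jump_op_graph ::
    "(real ^ 'n \<Rightarrow> real ^ 'n \<Rightarrow> ennreal) \<Rightarrow> (((real ^ 'n) \<Rightarrow>\<^sub>C real) \<times> ((real ^ 'n) \<Rightarrow>\<^sub>C real)) set" where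
  "jump_op_graph f =
     {(u, v). u \<in> C2c \<and> v \<in> C0 \<and> (\<forall>x. apply_bcontfun v x = jump_op f (apply_bcontfun u) x)}"

definition closable :: "('b::real_normed_vector \<times> 'b) set \<Rightarrow> bool" where
  "closable G \<longleftrightarrow> single_valued (closure G)"

definition strongly_continuous_contraction_semigroup_on ::
    "'b::real_normed_vector set \<Rightarrow> (real \<Rightarrow> 'b \<Rightarrow> 'b) \<Rightarrow> bool" where
  "strongly_continuous_contraction_semigroup_on X P \<longleftrightarrow>
     (\<forall>t\<ge>0. \<forall>u\<in>X. P t u \<in> X) \<and>
     (\<forall>t\<ge>0. \<forall>u\<in>X. \<forall>v\<in>X. P t (u + v) = P t u + P t v) \<and>
     (\<forall>t\<ge>0. \<forall>c. \<forall>u\<in>X. P t (c *\<^sub>R u) = c *\<^sub>R P t u) \<and>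
     (\<forall>t\<ge>0. \<forall>u\<in>X. norm (P t u) \<le> norm u) \<and>
     (\<forall>u\<in>X. P 0 u = u) \<and>
     (\<forall>s\<ge>0. \<forall>t\<ge>0. \<forall>u\<in>X. P (s + t) u = P s (P t u)) \<and>
     (\<forall>u\<in>X. ((\<lambda>t. P t u) \<longlongrightarrow> u) (at_right 0))"

definition generator_on ::
    "'b::real_normed_vector set \<Rightarrow> (real \<Rightarrow> 'b \<Rightarrow> 'b) \<Rightarrow> ('b \<times> 'b) set" where
  "generator_on X P =
     {(u, v). u \<in> X \<and> v \<in> X \<and> ((\<lambda>t. (1 / t) *\<^sub>R (P t u - u)) \<longlongrightarrow> v) (at_right 0)}"

text \<open>
  The bound \<open>min (t powr (-d / \<alpha>)) (t * \<phi> r / r powr (\<alpha> + d))\<close> at distance \<open>r\<close>; the quotient is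
  read as infinite at \<open>r = 0\<close>, whereas division by zero in HOL yields zero.
\<close>

definition heat_bound :: "real \<Rightarrow> real \<Rightarrow> (real \<Rightarrow> real) \<Rightarrow> real \<Rightarrow> real \<Rightarrow> real" where
  "heat_bound d \<alpha> \<phi> t r =
     (if r = 0 then t powr (- d / \<alpha>)
      else min (t powr (- d / \<alpha>)) (t * \<phi> r / r powr (\<alpha> + d)))"

end

theory Submission
  imports Defs
begin

text \<open>
  Cutting off the jumps of length at most \<open>\<epsilon> = (M \<omega> h)\<^bsup>1/\<alpha>\<^esup>\<close> leaves a bounded operator \<open>A\<close> for which
  \<open>I + h A\<close> is the transition operator of a symmetric random walk, and by a Chernoff argument the powers
  of these operators converge to the semigroup. This replaces the Dirichlet form of the process by
  discrete estimates.

  On the diagonal, the lower bound on the jump intensity provides, at every scale, a part of the kernel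
  with bounded density and a definite mass; optimizing the scale as the number of steps grows gives a
  recursion of Nash type for the \<open>L\<^sup>2\<close> norm, hence the bound \<open>t\<^bsup>-d/\<alpha>\<^esup>\<close> by symmetry.

  Off the diagonal, let \<open>H\<^sub>s(z) = min (L s\<^bsup>-d/\<alpha>\<^esup>) (c s \<psi>(z))\<close> with \<open>\<psi>(z) = \<phi>(|z| + 1) |z|\<^bsup>-\<alpha>-d\<^esup>\<close>. Where the
  second term is the smaller one, \<open>exp (C s) H\<^sub>s\<close> is a supersolution: the small jumps are controlled by
  the second differences of \<open>\<psi>\<close>, and the large ones by the convolution condition and by the mass of
  \<open>H\<^sub>s\<close>, in which the ratio of \<open>c\<close> to \<open>L\<close> can be chosen large. Elsewhere the on-diagonal bound applies.
  Hence a tent function of radius \<open>\<eta>\<close> stays below a multiple of \<open>\<eta>\<^sup>d H\<^sub>t\<close> uniformly in \<open>\<eta>\<close>, which bounds the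
  density of the functional \<open>u \<mapsto> P\<^sub>t u(x)\<close>; this density exists because the functional is bounded on \<open>L\<^sup>2\<close>.
\<close>

subsection \<open>Contraction semigroups and Chernoff approximation\<close>

text \<open>The barrier constant \<open>A\<close> depends neither on \<open>L\<close> and
  \<open>c\<close> nor on the truncation. Hence \<open>L\<close> can be fixed by the on-diagonal
  estimate first and \<open>c\<close> afterwards, so large that
  \<open>A * (L / c) powr (\<alpha> / \<beta>) \<le> 1\<close>: this is the rate that the growth of
  the factor \<open>c * s\<close> in time compensates. The factor exp (C2 t) has two sources. The
  lower bound on the intensity, in which the kernel is divided by \<phi>, is used for the kernel
  itself only at distances where \<phi> = 1; so the recursion for the norm runs up to a fixed time
  \<open>t1\<close>, and afterwards the norm is only known not to increase. The other source is the
  term proportional to \<open>s\<close> in the barrier estimate. Comparison with the barrier is an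
  induction over the steps of a walk, and on the plateau it needs the on-diagonal bound at every
  intermediate step; so the convergence must be uniform over all powers up to the final time. At
  time 0 the barrier degenerates; the tent of radius \<eta> is placed below it after a time shift by
  \<open>\<eta> powr \<alpha>\<close>.\<close>

lemma integral_closed_subspace_commute:
  fixes f :: "real \<Rightarrow> 'b::banach" and Q :: "'b \<Rightarrow> 'b"
  assumes X: "subspace X" "closed X"
    and f: "(f has_integral y) {a..b}" "\<And>s. s \<in> {a..b} \<Longrightarrow> f s \<in> X"
    and g: "((\<lambda>s. Q (f s)) has_integral z) {a..b}"
    and add: "\<And>u v. u \<in> X \<Longrightarrow> v \<in> X \<Longrightarrow> Q (u + v) = Q u + Q v"
    and scale: "\<And>c u. u \<in> X \<Longrightarrow> Q (c *\<^sub>R u) = c *\<^sub>R Q u"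
    and contr: "\<And>u. u \<in> X \<Longrightarrow> norm (Q u) \<le> norm u"
  shows "y \<in> X" "Q y = z"
proof -
  have f': "(f has_integral y) (cbox a b)" and g': "((\<lambda>s. Q (f s)) has_integral z) (cbox a b)"
    using f(1) g by simp_all
  \<comment> \<open>\<open>Q\<close> is linear and contractive only on \<open>X\<close>, so it
    cannot be treated as a bounded linear map of the whole space. Riemann sums stay in
    \<open>X\<close>, and intersecting the two gauges gives one tagged division whose sum
    approximates \<open>y\<close> while its image under \<open>Q\<close> approximates
    \<open>z\<close>.\<close>
  have approx: "\<exists>w\<in>X. norm (w - y) < e \<and> norm (Q w - z) < e" if e: "e > 0" for e
  proof -
    obtain \<gamma>1 where g1: "gauge \<gamma>1"
      "\<And>D. D tagged_division_of cbox a b \<Longrightarrow> \<gamma>1 fine D \<Longrightarrow> norm ((\<Sum>(x,k)\<in>D. measure lborel k *\<^sub>R f x) - y) < e"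
      using has_integral[THEN iffD1, OF f', rule_format, OF e] by (elim exE conjE) (rule that, auto)
    obtain \<gamma>2 where g2: "gauge \<gamma>2"
      "\<And>D. D tagged_division_of cbox a b \<Longrightarrow> \<gamma>2 fine D \<Longrightarrow> norm ((\<Sum>(x,k)\<in>D. measure lborel k *\<^sub>R Q (f x)) - z) < e"
      using has_integral[THEN iffD1, OF g', rule_format, OF e] by (elim exE conjE) (rule that, auto)
    obtain D where D: "D tagged_division_of cbox a b" "(\<lambda>x. \<gamma>1 x \<inter> \<gamma>2 x) fine D"
      using fine_division_exists[OF gauge_Int[OF g1(1) g2(1)]] by blast
    define w where "w = (\<Sum>(x,k)\<in>D. measure lborel k *\<^sub>R f x)"
    have fin: "finite D" using D(1) by blast
    have inX: "f x \<in> X" if "(x,k) \<in> D" for x k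
      using f(2) tag_in_interval[OF D(1) that] by simp
    have *: "(\<Sum>(x,k)\<in>E. measure lborel k *\<^sub>R f x) \<in> X \<and>
        Q (\<Sum>(x,k)\<in>E. measure lborel k *\<^sub>R f x) = (\<Sum>(x,k)\<in>E. measure lborel k *\<^sub>R Q (f x))"
      if "finite E" "E \<subseteq> D" for E
      using that
    proof (induction E rule: finite_induct)
      case empty
      have "Q (0 *\<^sub>R 0) = 0 *\<^sub>R Q 0" by (rule scale) (rule subspace_0[OF X(1)])
      then show ?case using subspace_0[OF X(1)] by simp
    next
      case (insert p E)
      obtain x k where p: "p = (x,k)" by force
      have "f x \<in> X" using inX insert p by blast
      then show ?case using insert p by (simp add: add scale subspace_add[OF X(1)] subspace_scale[OF X(1)])
    qed
    have "w \<in> X" "Q w = (\<Sum>(x,k)\<in>D. measure lborel k *\<^sub>R Q (f x))"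
      using *[OF fin] by (auto simp: w_def)
    moreover have "norm (w - y) < e" using g1(2)[OF D(1)] D(2) by (simp add: fine_Int w_def)
    moreover have "norm (Q w - z) < e" using g2(2)[OF D(1)] D(2) calculation(2) by (simp add: fine_Int)
    ultimately show ?thesis by blast
  qed
  show y: "y \<in> X"
  proof -
    have "y \<in> closure X" using approx by (auto simp: closure_approachable dist_norm)
    then show ?thesis using X by simp
  qed
  have "norm (Q y - z) \<le> 2 * e" if e: "e > 0" for e
  proof -
    obtain w where w: "w \<in> X" "norm (w - y) < e" "norm (Q w - z) < e" using approx[OF e] by blast
    have "Q (w - y) = Q w - Q y"
      using add[OF subspace_diff[OF X(1) w(1) y] y] by simp
    then have "norm (Q w - Q y) < e" using contr[OF subspace_diff[OF X(1) w(1) y]] w by simp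
    then show ?thesis using w norm_triangle_ineq4[of "Q w - z" "Q w - Q y"] by simp
  qed
  then have "norm (Q y - z) \<le> 0 + e" if "e > 0" for e
    using that by (metis add_0 half_gt_zero mult_2 field_sum_of_halves)
  then have "norm (Q y - z) \<le> 0" by (rule field_le_epsilon)
  then show "Q y = z" by simp
qed

locale contraction_semigroup =
  fixes X :: "'b::banach set" and P :: "real \<Rightarrow> 'b \<Rightarrow> 'b"
  assumes scs: "strongly_continuous_contraction_semigroup_on X P"
    and X: "subspace X" "closed X"
begin

lemma P_in: "t \<ge> 0 \<Longrightarrow> u \<in> X \<Longrightarrow> P t u \<in> X"
  and P_add: "t \<ge> 0 \<Longrightarrow> u \<in> X \<Longrightarrow> v \<in> X \<Longrightarrow> P t (u + v) = P t u + P t v"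
  and P_scale: "t \<ge> 0 \<Longrightarrow> u \<in> X \<Longrightarrow> P t (c *\<^sub>R u) = c *\<^sub>R P t u"
  and P_contr: "t \<ge> 0 \<Longrightarrow> u \<in> X \<Longrightarrow> norm (P t u) \<le> norm u"
  and P_0: "u \<in> X \<Longrightarrow> P 0 u = u"
  and P_sg: "s \<ge> 0 \<Longrightarrow> t \<ge> 0 \<Longrightarrow> u \<in> X \<Longrightarrow> P (s + t) u = P s (P t u)"
  and P_cont0: "u \<in> X \<Longrightarrow> ((\<lambda>t. P t u) \<longlongrightarrow> u) (at_right 0)"
  using scs by (simp_all add: strongly_continuous_contraction_semigroup_on_def)

lemma P_diff: "t \<ge> 0 \<Longrightarrow> u \<in> X \<Longrightarrow> v \<in> X \<Longrightarrow> P t (u - v) = P t u - P t v"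
  using P_add[of t u "(-1) *\<^sub>R v"] P_scale[of t v "-1"] X by (auto simp: subspace_neg)

lemma P_small:
  assumes u: "u \<in> X" and e: "e > 0"
  obtains d where "d > 0" "\<And>s. 0 \<le> s \<Longrightarrow> s \<le> d \<Longrightarrow> norm (P s u - u) \<le> e"
proof -
  have "\<forall>\<^sub>F t in at_right 0. dist (P t u) u < e"
    using P_cont0[OF u] e by (rule tendstoD)
  then obtain d where d: "d > 0" "\<And>s. 0 < s \<Longrightarrow> s < d \<Longrightarrow> dist (P s u) u < e"
    by (auto simp: eventually_at_right_field)
  show thesis
  proof (rule that[of "d/2"])
    fix s assume "0 \<le> s" "s \<le> d/2"
    then show "norm (P s u - u) \<le> e"
      using d P_0[OF u] e by (cases "s = 0") (auto simp: dist_norm intro: less_imp_le)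
  qed (use d in auto)
qed

text \<open>By the semigroup law the difference is \<open>P s\<close> applied to
  \<open>P (r - s) u - u\<close>; continuity on the half-line is thereby reduced to continuity at
  0.\<close>

lemma P_lip:
  assumes u: "u \<in> X" and "0 \<le> s" "s \<le> r"
  shows "norm (P r u - P s u) \<le> norm (P (r - s) u - u)"
proof -
  have "P r u = P s (P (r - s) u)" using P_sg[of s "r - s" u] assms by simp
  then have "P r u - P s u = P s (P (r - s) u - u)" using assms by (simp add: P_diff P_in)
  then show ?thesis using assms by (simp add: P_contr P_in subspace_diff[OF X(1)])
qed

lemma P_cont:
  assumes u: "u \<in> X"
  shows "continuous_on {0..} (\<lambda>s. P s u)"
proof (unfold continuous_on_iff, intro ballI allI impI)
  fix s e :: real assume s: "s \<in> {0..}" "e > 0"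
  obtain d where d: "d > 0" "\<And>s. 0 \<le> s \<Longrightarrow> s \<le> d \<Longrightarrow> norm (P s u - u) \<le> e/2"
    using P_small[OF u, of "e/2"] s by auto
  show "\<exists>d>0. \<forall>x'\<in>{0..}. dist x' s < d \<longrightarrow> dist (P x' u) (P s u) < e"
  proof (intro exI conjI ballI impI)
    fix r assume r: "r \<in> {0..}" "dist r s < d"
    show "dist (P r u) (P s u) < e"
    proof (cases "s \<le> r")
      case True
      then show ?thesis using P_lip[OF u, of s r] d(2)[of "r - s"] r s by (auto simp: dist_norm)
    next
      case False
      then show ?thesis using P_lip[OF u, of r s] d(2)[of "s - r"] r s
        by (auto simp: dist_norm norm_minus_commute)
    qed
  qed (use d in auto)
qed

text \<open>\<open>P s\<close> commutes with the difference quotient at 0 and is a contraction, so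
  the quotients of \<open>P s u\<close> converge whenever those of \<open>u\<close> do.\<close>

lemma generator_invariant:
  assumes uv: "(u, v) \<in> generator_on X P" and s: "s \<ge> 0"
  shows "(P s u, P s v) \<in> generator_on X P"
proof -
  have u: "u \<in> X" and v: "v \<in> X" and lim: "((\<lambda>t. (1 / t) *\<^sub>R (P t u - u)) \<longlongrightarrow> v) (at_right 0)"
    using uv by (auto simp: generator_on_def)
  have "((\<lambda>t. (1 / t) *\<^sub>R (P t (P s u) - P s u)) \<longlongrightarrow> P s v) (at_right 0)"
  proof (rule Lim_transform_bound[where g = "\<lambda>t. (1 / t) *\<^sub>R (P t u - u) - v", THEN Lim_null[THEN iffD2]])
    show "\<forall>\<^sub>F t in at_right 0. norm ((1 / t) *\<^sub>R (P t (P s u) - P s u) - P s v) \<le> norm ((1 / t) *\<^sub>R (P t u - u) - v)"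
      unfolding eventually_at_right_field
    proof (intro exI[of _ 1] conjI allI impI)
      fix t :: real assume t: "0 < t" "t < 1"
      have "P t (P s u) = P s (P t u)" using P_sg[of t s u] P_sg[of s t u] t s u by (simp add: add.commute)
      then have "(1 / t) *\<^sub>R (P t (P s u) - P s u) - P s v = P s ((1 / t) *\<^sub>R (P t u - u) - v)"
        using t s u v by (simp add: P_diff P_in P_scale subspace_scale[OF X(1)] subspace_diff[OF X(1)])
      then show "norm ((1 / t) *\<^sub>R (P t (P s u) - P s u) - P s v) \<le> norm ((1 / t) *\<^sub>R (P t u - u) - v)"
        using t s u v by (simp add: P_contr P_in subspace_scale[OF X(1)] subspace_diff[OF X(1)])
    qed simp
    show "((\<lambda>t. (1 / t) *\<^sub>R (P t u - u) - v) \<longlongrightarrow> 0) (at_right 0)" using tendsto_diff[OF lim tendsto_const[of v]] by simp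
  qed
  then show ?thesis using u v s by (auto simp: generator_on_def P_in)
qed

text \<open>Averages of an orbit over short intervals \<open>{0..d}\<close> lie in the domain: the
  integral of the orbit is differentiable in its upper limit, and the generator maps the average to
  \<open>(P d u - u) / d\<close>.\<close>

lemma generator_dense:
  assumes u: "u \<in> X" and e: "e > 0"
  obtains y z where "(y, z) \<in> generator_on X P" "norm (y - u) < e"
proof -
  obtain d where d: "d > 0" "\<And>s. 0 \<le> s \<Longrightarrow> s \<le> d \<Longrightarrow> norm (P s u - u) \<le> e/2"
    using P_small[OF u, of "e/2"] e by auto
  define F where "F r = integral {0..r} (\<lambda>s. P s u)" for r
  have int: "(\<lambda>s. P s u) integrable_on {a..b}" if "0 \<le> a" for a b
    using that by (intro integrable_continuous_interval continuous_on_subset[OF P_cont[OF u]]) auto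
  have hF: "((\<lambda>s. P s u) has_integral F r) {0..r}" for r
    unfolding F_def using int[of 0 r] by (simp add: integrable_integral)
  \<comment> \<open>Translating the integration variable turns \<open>P h\<close> applied to the
    orbit into an increment of the primitive \<open>F\<close>.\<close>
  have shift: "((\<lambda>s. P h (P s u)) has_integral (F (h + r) - F h)) {0..r}" if "0 \<le> h" "0 \<le> r" for h r
  proof -
    have "F h + integral {h..h + r} (\<lambda>s. P s u) = F (h + r)"
      unfolding F_def using that int[of 0 "h + r"] by (intro Henstock_Kurzweil_Integration.integral_combine) auto
    then have "((\<lambda>s. P s u) has_integral (F (h + r) - F h)) {0 + h..r + h}"
      using int[OF that(1), of "h + r", THEN integrable_integral]
      by (metis add_0 add.commute add_diff_cancel_left')
    then have "((\<lambda>s. P s u) \<circ> (+) h has_integral (F (h + r) - F h)) {0..r}"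
      by (simp only: has_integral_shift_Icc_real)
    then show ?thesis
      by (rule has_integral_eq[rotated]) (use P_sg[OF that(1) _ u] in simp)
  qed
  have PF: "F r \<in> X \<and> P h (F r) = F (h + r) - F h" if "0 \<le> h" "0 \<le> r" for h r
  proof -
    note * = integral_closed_subspace_commute[OF X hF _ shift[OF that]]
    show ?thesis using * that by (simp add: P_in u P_add P_scale P_contr)
  qed
  have mean: "norm (F (r + t) - F r - t *\<^sub>R P r u) \<le> e' * t"
    if "r \<ge> 0" "t \<ge> 0" "e' \<ge> 0" and small: "\<And>s. 0 \<le> s \<Longrightarrow> s \<le> t \<Longrightarrow> norm (P s u - u) \<le> e'" for r t e'
  proof -
    have "((\<lambda>s. P r (P s u) - P r u) has_integral (F (r + t) - F r - t *\<^sub>R P r u)) {0..t}"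
      using has_integral_diff[OF shift[OF that(1,2)] has_integral_const_real[of "P r u" 0 t]] that by simp
    moreover have "norm (P r (P s u) - P r u) \<le> e'" if "s \<in> {0..t}" for s
    proof -
      have "P r (P s u) - P r u = P r (P s u - u)"
        using that \<open>r \<ge> 0\<close> u by (simp add: P_diff P_in)
      then show ?thesis
        using P_contr[OF \<open>r \<ge> 0\<close>, of "P s u - u"] small[of s] that u by (simp add: P_in subspace_diff[OF X(1)])
    qed
    ultimately show ?thesis
      using has_integral_bound[OF \<open>e' \<ge> 0\<close>, of "\<lambda>s. P r (P s u) - P r u" "F (r + t) - F r - t *\<^sub>R P r u" 0 t] that(2)
      by (simp add: cbox_interval)
  qed
  have deriv: "((\<lambda>t. (1 / t) *\<^sub>R (F (r + t) - F r)) \<longlongrightarrow> P r u) (at_right 0)" if "r \<ge> 0" for r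
  proof (rule tendstoI)
    fix e' :: real assume e': "e' > 0"
    obtain d where d: "d > 0" "\<And>s. 0 \<le> s \<Longrightarrow> s \<le> d \<Longrightarrow> norm (P s u - u) \<le> e'/2"
      using P_small[OF u, of "e'/2"] e' by auto
    show "\<forall>\<^sub>F t in at_right 0. dist ((1 / t) *\<^sub>R (F (r + t) - F r)) (P r u) < e'"
      unfolding eventually_at_right_field
    proof (intro exI[of _ d] conjI allI impI)
      fix t assume t: "0 < t" "t < d"
      have "(1 / t) *\<^sub>R (F (r + t) - F r) - P r u = (1 / t) *\<^sub>R (F (r + t) - F r - t *\<^sub>R P r u)"
        using t by (simp add: scaleR_diff_right)
      then have "dist ((1 / t) *\<^sub>R (F (r + t) - F r)) (P r u) = norm (F (r + t) - F r - t *\<^sub>R P r u) / t"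
        using t by (simp add: dist_norm)
      also have "\<dots> \<le> e' / 2"
        using mean[of r t "e'/2"] d t that e' by (simp add: divide_le_eq)
      finally show "dist ((1 / t) *\<^sub>R (F (r + t) - F r)) (P r u) < e'" using e' by simp
    qed (use d in auto)
  qed
  define y where "y = (1 / d) *\<^sub>R F d"
  define z where "z = (1 / d) *\<^sub>R (P d u - u)"
  have F0: "F 0 = 0" by (simp add: F_def)
  have yX: "y \<in> X" using PF[of 0 d] d by (simp add: y_def subspace_scale[OF X(1)])
  have zX: "z \<in> X" using d u by (simp add: z_def subspace_scale[OF X(1)] subspace_diff[OF X(1)] P_in)
  have "((\<lambda>t. (1 / d) *\<^sub>R ((1 / t) *\<^sub>R (F (d + t) - F d) - (1 / t) *\<^sub>R (F (0 + t) - F 0))) \<longlongrightarrow> (1 / d) *\<^sub>R (P d u - P 0 u)) (at_right 0)"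
    using d by (intro tendsto_intros deriv) auto
  moreover have "\<forall>\<^sub>F t in at_right 0. (1 / d) *\<^sub>R ((1 / t) *\<^sub>R (F (d + t) - F d) - (1 / t) *\<^sub>R (F (0 + t) - F 0))
      = (1 / t) *\<^sub>R (P t y - y)"
    unfolding eventually_at_right_field
  proof (intro exI[of _ 1] conjI allI impI)
    fix h :: real assume "0 < h" "h < 1"
    then have Phy: "P h y = (1 / d) *\<^sub>R (F (d + h) - F h)"
      using PF[of h d] d by (simp add: y_def P_scale add.commute)
    show "(1 / d) *\<^sub>R ((1 / h) *\<^sub>R (F (d + h) - F d) - (1 / h) *\<^sub>R (F (0 + h) - F 0)) = (1 / h) *\<^sub>R (P h y - y)"
      unfolding Phy by (simp add: y_def F0 algebra_simps)
  qed simp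
  ultimately have "((\<lambda>t. (1 / t) *\<^sub>R (P t y - y)) \<longlongrightarrow> z) (at_right 0)"
    using u by (simp add: z_def P_0 filterlim_cong)
  then have gen: "(y, z) \<in> generator_on X P" using yX zX by (simp add: generator_on_def)
  have "norm (F d - d *\<^sub>R u) \<le> e/2 * d"
    using mean[of 0 d "e/2"] d e u by (simp add: F0 P_0)
  then have "norm (y - u) \<le> e/2"
  proof -
    assume a: "norm (F d - d *\<^sub>R u) \<le> e/2 * d"
    have "y - u = (1/d) *\<^sub>R (F d - d *\<^sub>R u)" using d by (simp add: y_def scaleR_diff_right)
    then have "norm (y - u) = norm (F d - d *\<^sub>R u) / d" using d by simp
    then show ?thesis using a d by (simp add: divide_le_eq)
  qed
  then show thesis using that gen e by force
qed

text \<open>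
  The coarse grid of width \<open>t / 2 ^ a\<close> is fixed before the number of steps tends to infinity; then
  only finitely many elements of \<open>G\<close> are involved, although \<open>(T i u - u) / h\<close> is controlled on \<open>G\<close> only.
\<close>

lemma chernoff_generator_domain:
  fixes T :: "nat \<Rightarrow> 'b \<Rightarrow> 'b"
  assumes gen: "generator_on X P = closure G"
    and t: "t > 0"
    and T_lin: "\<And>i. linear (T i)"
    and T_contr: "\<And>i u. norm (T i u) \<le> norm u"
    and cons: "\<And>u v e. (u, v) \<in> G \<Longrightarrow> e > 0 \<Longrightarrow>
      \<forall>\<^sub>F i in sequentially. norm (T i u - u - (t / 2 ^ i) *\<^sub>R v) \<le> (t / 2 ^ i) * e"
    and uv: "(u, v) \<in> closure G" and e: "e > 0"
  shows "\<forall>\<^sub>F i in sequentially. \<forall>k\<le>2^i. norm ((T i ^^ k) u - P (k * (t / 2 ^ i)) u) \<le> e"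
proof -
  \<comment> \<open>The final estimate adds up to \<open>8 * t * d + 4 * d\<close>, which this
    choice keeps below \<open>e\<close>.\<close>
  define d where "d = e / (8 * t + 14)"
  have d: "d > 0" using e t by (auto simp: d_def)
  have "(8 * t + 14) * d = e" using t by (simp add: d_def)
  then have ed: "8 * t * d + 14 * d = e" by (simp add: algebra_simps)
  have u: "u \<in> X" and v: "v \<in> X" and lim: "((\<lambda>t. (1 / t) *\<^sub>R (P t u - u)) \<longlongrightarrow> v) (at_right 0)"
    using uv gen by (auto simp: generator_on_def)
  note sD = subspace_diff[OF X(1)] and sS = subspace_scale[OF X(1)]
  have Tk_lin: "linear (T i ^^ k)" for i k
    by (induction k) (auto simp: T_lin linear_id[unfolded id_def] id_def linear_compose[unfolded o_def] comp_def)
  have Tk_contr: "norm ((T i ^^ k) w) \<le> norm w" for i k w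
    by (induction k) (auto intro: order_trans[OF T_contr])
  have Tk_diff: "(T i ^^ k) (w - w') = (T i ^^ k) w - (T i ^^ k) w'" for i k w w'
    by (rule linear_diff[OF Tk_lin])
  have Tk_lip: "norm ((T i ^^ k) w - (T i ^^ k) w') \<le> norm (w - w')" for i k w w'
    using Tk_contr[where i=i and k=k and w="w - w'"] by (simp add: Tk_diff)
  have tele: "(T i ^^ k) w - w = (\<Sum>j<k. (T i ^^ j) (T i w - w))" for i k w
  proof (induction k)
    case (Suc k)
    have "(T i ^^ k) (T i w) - (T i ^^ k) w = (T i ^^ k) (T i w - w)" by (simp add: Tk_diff)
    moreover have "(T i ^^ Suc k) w = (T i ^^ k) (T i w)" by (simp add: funpow_swap1)
    ultimately show ?case using Suc by (simp add: algebra_simps del: funpow.simps)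
  qed simp
  have slow: "norm ((T i ^^ k) w - w) \<le> k * norm (T i w - w)" for i k w
  proof -
    have "norm ((T i ^^ k) w - w) \<le> (\<Sum>j<k. norm (T i w - w))"
      unfolding tele by (intro order_trans[OF norm_sum] sum_mono Tk_contr)
    then show ?thesis by simp
  qed
  have Gapp: "\<exists>y z. (y, z) \<in> G \<and> norm (y - y') < c \<and> norm (z - z') < c"
    if cl: "(y', z') \<in> closure G" "c > 0" for y' z' c
  proof -
    obtain p where "p \<in> G" "dist p (y', z') < c"
      using closure_approachable[THEN iffD1, rule_format, OF cl] by blast
    then show ?thesis
      using dist_fst_le[of p "(y',z')"] dist_snd_le[of p "(y',z')"]
      by (metis dist_norm fst_conv le_less_trans prod.collapse snd_conv)
  qed
  \<comment> \<open>A finite net \<open>W\<close> for the whole orbit of \<open>v\<close>, taken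
    from the domain of \<open>G\<close>. It is independent of the coarse grid, as it must be: the
    grid is chosen fine in terms of \<open>C\<close>, which depends on \<open>W\<close>.\<close>
  have "compact ((\<lambda>s. P s v) ` {0..t})"
    by (intro compact_continuous_image continuous_on_subset[OF P_cont[OF v]]) auto
  moreover have "(\<lambda>s. P s v) ` {0..t} \<subseteq> (\<Union>w\<in>Domain G. ball w d)"
  proof (safe)
    fix s assume s: "s \<in> {0..t}"
    obtain y z where yz: "(y, z) \<in> closure G" "norm (y - P s v) < d/2"
      using generator_dense[of "P s v" "d/2"] s v d P_in gen by auto
    obtain y' z' where "(y', z') \<in> G" "norm (y' - y) < d/2"
      using Gapp[OF yz(1), of "d/2"] d by auto
    then show "P s v \<in> (\<Union>w\<in>Domain G. ball w d)"
      using yz norm_triangle_ineq[of "y' - y" "y - P s v"]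
      by (auto simp: dist_norm intro!: bexI[of _ y'])
  qed
  ultimately obtain W where W: "W \<subseteq> Domain G" "finite W" "(\<lambda>s. P s v) ` {0..t} \<subseteq> (\<Union>w\<in>W. ball w d)"
    by - (rule compactE_image[where C = "Domain G" and f = "\<lambda>w. ball w d"], assumption, auto)
  have "\<forall>w\<in>W. \<exists>z. (w, z) \<in> G" using W(1) by blast
  from bchoice[OF this] obtain Z where Z: "\<And>w. w \<in> W \<Longrightarrow> (w, Z w) \<in> G" by blast
  \<comment> \<open>A speed bound: for late \<open>i\<close> one step moves each element of
    \<open>W\<close>, and the approximant \<open>y 0\<close> below, by at most \<open>h * C\<close>.
    Over a coarse interval of length \<open>\<tau>\<close> this amounts to at most
    \<open>d\<close>.\<close>
  define C where "C = 1 + (\<Sum>w\<in>W. norm (Z w)) + norm v + 2 * d"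
  have C: "norm (Z w) + 1 \<le> C" if "w \<in> W" for w
  proof -
    have "norm (Z w) \<le> (\<Sum>w\<in>W. norm (Z w))" using that W(2) by (intro member_le_sum) auto
    then show ?thesis using d norm_ge_zero[of v] unfolding C_def by linarith
  qed
  have "(\<Sum>w\<in>W. norm (Z w)) \<ge> 0" by (simp add: sum_nonneg)
  then have C0: "C > 0" "norm v + 2 * d \<le> C" using d norm_ge_zero[of v] unfolding C_def by linarith+
  obtain d1 where d1: "d1 > 0" "\<And>s. 0 \<le> s \<Longrightarrow> s \<le> d1 \<Longrightarrow> norm (P s u - u) \<le> d"
    using P_small[OF u d] by blast
  have "\<forall>\<^sub>F s in at_right 0. dist ((1 / s) *\<^sub>R (P s u - u)) v < d"
    using lim d by (rule tendstoD)
  then obtain d2 where d2: "d2 > 0" "\<And>s. 0 < s \<Longrightarrow> s < d2 \<Longrightarrow> dist ((1 / s) *\<^sub>R (P s u - u)) v < d"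
    by (auto simp: eventually_at_right_field)
  have "(\<lambda>a. t * (1/2) ^ a) \<longlonglongrightarrow> t * 0" by (intro tendsto_intros LIMSEQ_power_zero) auto
  then have "\<forall>\<^sub>F a in sequentially. t * (1/2) ^ a < min (min d1 d2) (min 1 (d / C))"
    using d d1 d2 C0 by (intro order_tendstoD) auto
  then obtain a where a: "t * (1/2) ^ a < min (min d1 d2) (min 1 (d / C))"
    by (auto simp: eventually_sequentially)
  define \<tau> where "\<tau> = t / 2 ^ a"
  have tau: "\<tau> > 0" "\<tau> < d1" "\<tau> < d2" "\<tau> * C \<le> d" "\<tau> < 1"
    using a t C0 by (auto simp: \<tau>_def field_simps power_divide)
  have step: "norm (P \<tau> u - u - \<tau> *\<^sub>R v) \<le> \<tau> * d"
  proof -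
    have "P \<tau> u - u - \<tau> *\<^sub>R v = \<tau> *\<^sub>R ((1 / \<tau>) *\<^sub>R (P \<tau> u - u) - v)" using tau by (simp add: scaleR_diff_right)
    then show ?thesis using d2(2)[of \<tau>] tau by (simp add: dist_norm)
  qed
  \<comment> \<open>Elements of \<open>G\<close> near the orbit at the grid points. The first
    components are close up to \<open>\<tau> * d\<close>, since these errors accumulate over all
    \<open>t / \<tau>\<close> coarse steps.\<close>
  have "\<exists>y z. (y, z) \<in> G \<and> norm (y - P (k * \<tau>) u) < \<tau> * d \<and> norm (z - P (k * \<tau>) v) < d" for k :: nat
  proof -
    have "(P (k * \<tau>) u, P (k * \<tau>) v) \<in> closure G"
      using generator_invariant[of u v "k * \<tau>"] uv tau gen by simp
    from Gapp[OF this, of "\<tau> * d"] obtain y z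
      where "(y, z) \<in> G" "norm (y - P (k * \<tau>) u) < \<tau> * d" "norm (z - P (k * \<tau>) v) < \<tau> * d"
      using tau d by auto
    moreover have "\<tau> * d \<le> d" using tau d by simp
    ultimately show ?thesis by force
  qed
  then obtain y z where yz: "\<And>k::nat. (y k, z k) \<in> G" "\<And>k. norm (y k - P (k * \<tau>) u) < \<tau> * d"
      "\<And>k. norm (z k - P (k * \<tau>) v) < d"
    by metis
  have "\<forall>\<^sub>F i in sequentially. a \<le> i \<and> (\<forall>w\<in>W. norm (T i w - w - (t / 2 ^ i) *\<^sub>R Z w) \<le> (t / 2 ^ i) * 1) \<and>
     (\<forall>k\<in>{..<2^a}. norm (T i (y k) - y k - (t / 2 ^ i) *\<^sub>R z k) \<le> (t / 2 ^ i) * d)"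
    using W(2) Z yz(1) d
    by (intro eventually_conj eventually_ge_at_top eventually_ball_finite cons) (auto intro: cons[simplified] cons[where e = 1, simplified])
  then show ?thesis
  proof (rule eventually_mono, intro allI impI, elim conjE)
    fix i k :: nat
    define h where "h = t / 2 ^ i"
    assume ai: "a \<le> i" and w1: "\<forall>w\<in>W. norm (T i w - w - (t / 2 ^ i) *\<^sub>R Z w) \<le> (t / 2 ^ i) * 1"
      and y1: "\<forall>k\<in>{..<2^a}. norm (T i (y k) - y k - (t / 2 ^ i) *\<^sub>R z k) \<le> (t / 2 ^ i) * d"
      and k: "k \<le> 2 ^ i"
    note w1 = w1[folded h_def] and y1 = y1[folded h_def]
    have h: "h > 0" using t by (simp add: h_def)
    define m :: nat where "m = 2 ^ (i - a)"
    have m: "m > 0" "m * h = \<tau>" "2 ^ a * m = 2 ^ i"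
      using ai by (auto simp: m_def h_def \<tau>_def field_simps simp flip: power_add)
    have Tw: "norm ((T i ^^ j) w - w) \<le> d" if "w \<in> W" "j \<le> m" for w j
    proof -
      have "norm (T i w - w) \<le> norm (T i w - w - h *\<^sub>R Z w) + norm (h *\<^sub>R Z w)"
        using norm_triangle_ineq[of "T i w - w - h *\<^sub>R Z w" "h *\<^sub>R Z w"] by simp
      also have "\<dots> \<le> h * C"
        proof -
        have "h * (1 + norm (Z w)) \<le> h * C" using C[OF that(1)] h by simp
        then show ?thesis using w1 that(1) h by (auto simp: algebra_simps)
      qed
      finally have "norm ((T i ^^ j) w - w) \<le> j * (h * C)"
        using slow[where i=i and k=j and w=w] by (meson mult_left_mono of_nat_0_le_iff order_trans)
      also have "\<dots> \<le> m * (h * C)" using that h C0 by (intro mult_right_mono) auto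
      also have "\<dots> = \<tau> * C" using m by (simp add: mult.assoc[symmetric])
      finally show ?thesis using tau by linarith
    qed
    have coarse1: "norm ((T i ^^ m) (P (k * \<tau>) u) - P (Suc k * \<tau>) u) \<le> 8 * \<tau> * d" if k: "k < 2 ^ a" for k
    proof -
      have "k * \<tau> \<le> 2 ^ a * \<tau>" using k tau by (intro mult_right_mono) (simp_all add: of_nat_less_imp_less less_imp_le)
      moreover have "0 \<le> k * \<tau>" using tau by simp
      ultimately have "k * \<tau> \<in> {0..t}" by (simp add: \<tau>_def)
      then have "P (k * \<tau>) v \<in> (\<Union>w\<in>W. ball w d)" using W(3) by blast
      then obtain w where w: "w \<in> W" "norm (w - P (k * \<tau>) v) < d" by (auto simp: dist_norm)
      \<comment> \<open>The powers of \<open>T i\<close> are controlled on the net only, so the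
        direction \<open>P (k * \<tau>) v\<close> is replaced by a nearby element \<open>w\<close>
        of \<open>W\<close>, which hardly moves during \<open>m\<close> steps.\<close>
      have "norm ((T i ^^ j) (T i (y k) - y k) - h *\<^sub>R P (k * \<tau>) v) \<le> h * (5 * d)" if "j < m" for j
      proof -
        have "norm ((T i ^^ j) (T i (y k) - y k) - (T i ^^ j) (h *\<^sub>R w)) \<le> norm (T i (y k) - y k - h *\<^sub>R w)"
          by (rule Tk_lip)
        also have "\<dots> \<le> norm (T i (y k) - y k - h *\<^sub>R z k) + norm (h *\<^sub>R ((z k - P (k * \<tau>) v) - (w - P (k * \<tau>) v)))"
          using norm_triangle_ineq[of "T i (y k) - y k - h *\<^sub>R z k" "h *\<^sub>R ((z k - P (k * \<tau>) v) - (w - P (k * \<tau>) v))"]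
          by (simp add: algebra_simps)
        also have "\<dots> \<le> h * d + h * (d + d)"
        proof -
          have "norm ((z k - P (k * \<tau>) v) - (w - P (k * \<tau>) v)) \<le> d + d"
            using norm_triangle_ineq4[of "z k - P (k * \<tau>) v" "w - P (k * \<tau>) v"] yz(3)[of k] w(2) by linarith
          then show ?thesis using y1 k h by (intro add_mono) (auto intro: mult_left_mono)
        qed
        finally have 1: "norm ((T i ^^ j) (T i (y k) - y k) - (T i ^^ j) (h *\<^sub>R w)) \<le> h * (3 * d)" by (simp add: algebra_simps)
        have 2: "norm ((T i ^^ j) (h *\<^sub>R w) - h *\<^sub>R w) \<le> h * d"
        proof -
          have "(T i ^^ j) (h *\<^sub>R w) - h *\<^sub>R w = h *\<^sub>R ((T i ^^ j) w - w)"
            by (simp add: linear_cmul[OF Tk_lin] scaleR_diff_right)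
          then show ?thesis using Tw[OF w(1), of j] that h by simp
        qed
        have 3: "norm (h *\<^sub>R w - h *\<^sub>R P (k * \<tau>) v) \<le> h * d"
          using w(2) h by (simp add: less_imp_le flip: scaleR_diff_right)
        have "(T i ^^ j) (T i (y k) - y k) - h *\<^sub>R P (k * \<tau>) v = ((T i ^^ j) (T i (y k) - y k) - (T i ^^ j) (h *\<^sub>R w))
           + ((T i ^^ j) (h *\<^sub>R w) - h *\<^sub>R w) + (h *\<^sub>R w - h *\<^sub>R P (k * \<tau>) v)" by simp
        also have "norm \<dots> \<le> h * (3 * d) + h * d + h * d"
          using 1 2 3 by (intro norm_triangle_mono)
        finally show ?thesis by (simp add: algebra_simps)
      qed
      then have "norm (\<Sum>j<m. (T i ^^ j) (T i (y k) - y k) - h *\<^sub>R P (k * \<tau>) v) \<le> (\<Sum>j<m. h * (5 * d))"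
        by (intro order_trans[OF norm_sum] sum_mono) auto
      moreover have "(\<Sum>j<m. (T i ^^ j) (T i (y k) - y k) - h *\<^sub>R P (k * \<tau>) v) = (T i ^^ m) (y k) - y k - \<tau> *\<^sub>R P (k * \<tau>) v"
        by (simp add: sum_subtractf tele sum_constant_scaleR m(2))
      moreover have "(\<Sum>j<m. h * (5 * d)) = 5 * \<tau> * d" by (simp add: m(2)[symmetric])
      ultimately have 1: "norm ((T i ^^ m) (y k) - y k - \<tau> *\<^sub>R P (k * \<tau>) v) \<le> 5 * \<tau> * d" by (simp only:)
      have 2: "norm ((T i ^^ m) (P (k * \<tau>) u) - (T i ^^ m) (y k)) \<le> \<tau> * d"
        using Tk_lip[where i=i and k=m and w="P (k * \<tau>) u" and w'="y k"] yz(2)[of k] by (simp add: norm_minus_commute)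
      have 3: "norm (y k - P (k * \<tau>) u) \<le> \<tau> * d" using yz(2)[of k] by simp
      have 4: "norm (P (k * \<tau>) u + \<tau> *\<^sub>R P (k * \<tau>) v - P (Suc k * \<tau>) u) \<le> \<tau> * d"
      proof -
        have kt: "k * \<tau> \<ge> 0" using tau by simp
        have "P (Suc k * \<tau>) u = P (k * \<tau>) (P \<tau> u)"
          using P_sg[OF kt, of \<tau> u] tau u by (simp add: algebra_simps)
        then have "P (Suc k * \<tau>) u - (P (k * \<tau>) u + \<tau> *\<^sub>R P (k * \<tau>) v) = P (k * \<tau>) (P \<tau> u - u - \<tau> *\<^sub>R v)"
          using kt tau u v by (simp add: P_diff P_in P_scale sS sD)
        then show ?thesis
          using P_contr[OF kt, of "P \<tau> u - u - \<tau> *\<^sub>R v"] step u v tau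
          by (simp add: norm_minus_commute P_in sS sD)
      qed
      have "(T i ^^ m) (P (k * \<tau>) u) - P (Suc k * \<tau>) u =
         ((T i ^^ m) (P (k * \<tau>) u) - (T i ^^ m) (y k)) + ((T i ^^ m) (y k) - y k - \<tau> *\<^sub>R P (k * \<tau>) v)
         + (y k - P (k * \<tau>) u) + (P (k * \<tau>) u + \<tau> *\<^sub>R P (k * \<tau>) v - P (Suc k * \<tau>) u)" by simp
      also have "norm \<dots> \<le> \<tau> * d + 5 * \<tau> * d + \<tau> * d + \<tau> * d"
        using 1 2 3 4 by (intro norm_triangle_mono)
      finally show ?thesis by simp
    qed
    have coarse: "norm ((T i ^^ (k * m)) u - P (k * \<tau>) u) \<le> k * (8 * \<tau> * d)" if "k \<le> 2 ^ a" for k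
      using that
    proof (induction k)
      case 0
      then show ?case using u by (simp add: P_0)
    next
      case (Suc k)
      have "(T i ^^ (Suc k * m)) u = (T i ^^ m) ((T i ^^ (k * m)) u)"
        by (simp add: funpow_add add.commute)
      then have "(T i ^^ (Suc k * m)) u - P (Suc k * \<tau>) u =
        ((T i ^^ m) ((T i ^^ (k * m)) u) - (T i ^^ m) (P (k * \<tau>) u)) + ((T i ^^ m) (P (k * \<tau>) u) - P (Suc k * \<tau>) u)"
        by simp
      also have "norm \<dots> \<le> k * (8 * \<tau> * d) + 8 * \<tau> * d"
        using Suc coarse1[of k] by (intro norm_triangle_mono order_trans[OF Tk_lip]) auto
      finally show ?case by (simp add: algebra_simps)
    qed
    \<comment> \<open>Write \<open>k\<close> as \<open>q\<close> coarse intervals and a remainder of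
      fewer than \<open>m\<close> steps; during the remainder both the iterates and the orbit move
      little.\<close>
    define q where "q = k div m"
    define j where "j = k mod m"
    have kq: "k = q * m + j" "j < m" using m by (auto simp: q_def j_def)
    have q: "q \<le> 2 ^ a" unfolding q_def using k m by (metis div_le_mono nonzero_mult_div_cancel_right less_numeral_extra(3))
    have jh: "j * h \<le> \<tau>" "0 \<le> j * h" using kq h m(2) by (auto intro!: mult_right_mono simp flip: m(2))
    have A: "norm ((T i ^^ (q * m)) u - P (q * \<tau>) u) \<le> 8 * t * d"
    proof -
      have "q * (8 * \<tau> * d) \<le> 2 ^ a * (8 * \<tau> * d)"
        using of_nat_mono[OF q, where 'a = real] tau d by (intro mult_right_mono) auto
      also have "\<dots> = 8 * t * d" by (simp add: \<tau>_def)
      finally show ?thesis using coarse[OF q] by linarith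
    qed
    have B: "norm ((T i ^^ k) u - (T i ^^ (q * m)) u) \<le> 3 * d"
    proof -
      have "(T i ^^ k) u = (T i ^^ (q * m)) ((T i ^^ j) u)" by (simp add: kq(1) funpow_add)
      then have "norm ((T i ^^ k) u - (T i ^^ (q * m)) u) \<le> norm ((T i ^^ j) u - u)" using Tk_lip by simp
      also have "\<dots> = norm (((T i ^^ j) u - (T i ^^ j) (y 0)) + ((T i ^^ j) (y 0) - y 0) + (y 0 - u))" by simp
      also have "\<dots> \<le> d + d + d"
      proof (intro norm_triangle_mono)
        have "norm (y 0 - u) < \<tau> * d" using yz(2)[of 0] u by (simp add: P_0)
        moreover have "\<tau> * d \<le> d" using tau d by simp
        ultimately show yu: "norm (y 0 - u) \<le> d" by simp
        then show "norm ((T i ^^ j) u - (T i ^^ j) (y 0)) \<le> d"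
          using Tk_lip[where i=i and k=j and w=u and w'="y 0"] by (simp add: norm_minus_commute)
        have "norm (T i (y 0) - y 0) \<le> norm (T i (y 0) - y 0 - h *\<^sub>R z 0) + norm (h *\<^sub>R z 0)"
          using norm_triangle_ineq[of "T i (y 0) - y 0 - h *\<^sub>R z 0" "h *\<^sub>R z 0"] by simp
        also have "\<dots> \<le> h * d + h * (norm v + d)"
        proof (intro add_mono)
          show "norm (T i (y 0) - y 0 - h *\<^sub>R z 0) \<le> h * d" using y1 by simp
          have "norm (z 0) \<le> norm v + d"
            using norm_triangle_ineq[of "z 0 - v" v] yz(3)[of 0] v by (simp add: P_0)
          then show "norm (h *\<^sub>R z 0) \<le> h * (norm v + d)" using h by simp
        qed
        also have "\<dots> \<le> h * C"
          using mult_left_mono[OF C0(2), of h] h by (simp add: algebra_simps)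
        finally have "norm ((T i ^^ j) (y 0) - y 0) \<le> j * (h * C)"
          using slow[where i=i and k=j and w="y 0"] by (meson mult_left_mono of_nat_0_le_iff order_trans)
        also have "\<dots> \<le> \<tau> * C" using jh C0 by (simp add: mult.assoc[symmetric])
        finally show "norm ((T i ^^ j) (y 0) - y 0) \<le> d" using tau by linarith
      qed
      finally show ?thesis by simp
    qed
    have D: "norm (P (q * \<tau>) u - P (k * h) u) \<le> d"
    proof -
      have kh: "k * h = q * \<tau> + j * h" by (simp add: kq(1) m(2)[symmetric] algebra_simps)
      show ?thesis
        using P_lip[OF u, of "q * \<tau>" "k * h"] d1(2)[of "j * h"] jh tau kh by (simp add: norm_minus_commute)
    qed
    have "(T i ^^ k) u - P (k * h) u = ((T i ^^ k) u - (T i ^^ (q * m)) u)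
       + ((T i ^^ (q * m)) u - P (q * \<tau>) u) + (P (q * \<tau>) u - P (k * h) u)" by simp
    also have "norm \<dots> \<le> 3 * d + 8 * t * d + d" using A B D by (intro norm_triangle_mono)
    also have "\<dots> \<le> e" using ed d by simp
    finally show "norm ((T i ^^ k) u - P (k * (t / 2 ^ i)) u) \<le> e" by (simp add: h_def)
  qed
qed

text \<open>The domain of the generator is dense and all operators involved are contractions, so
  convergence on the domain extends to \<open>X\<close> with an error split in three.\<close>

theorem chernoff:
  fixes T :: "nat \<Rightarrow> 'b \<Rightarrow> 'b"
  assumes gen: "generator_on X P = closure G"
    and t: "t > 0"
    and T_lin: "\<And>i. linear (T i)"
    and T_contr: "\<And>i u. norm (T i u) \<le> norm u"
    and cons: "\<And>u v e. (u, v) \<in> G \<Longrightarrow> e > 0 \<Longrightarrow>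
      \<forall>\<^sub>F i in sequentially. norm (T i u - u - (t / 2 ^ i) *\<^sub>R v) \<le> (t / 2 ^ i) * e"
    and u: "u \<in> X" and e: "e > 0"
  shows "\<forall>\<^sub>F i in sequentially. \<forall>k\<le>2^i. norm ((T i ^^ k) u - P (k * (t / 2 ^ i)) u) \<le> e"
proof -
  obtain y z where yz: "(y, z) \<in> generator_on X P" "norm (y - u) < e/3"
    using generator_dense[OF u, of "e/3"] e by auto
  have yX: "y \<in> X" using yz(1) by (simp add: generator_on_def)
  have Tk_lin: "linear (T i ^^ k)" for i k
    by (induction k) (auto simp: T_lin linear_id[unfolded id_def] id_def linear_compose[unfolded o_def] comp_def)
  have Tk_contr: "norm ((T i ^^ k) w) \<le> norm w" for i k w
    by (induction k) (auto intro: order_trans[OF T_contr])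
  have Tk_lip: "norm ((T i ^^ k) w - (T i ^^ k) w') \<le> norm (w - w')" for i k w w'
    using Tk_contr[where i=i and k=k and w="w - w'"] by (simp add: linear_diff[OF Tk_lin])
  have "\<forall>\<^sub>F i in sequentially. \<forall>k\<le>2^i. norm ((T i ^^ k) y - P (k * (t / 2 ^ i)) y) \<le> e/3"
    using chernoff_generator_domain[OF gen t T_lin T_contr cons, of y z "e/3"] yz e gen by simp
  then show ?thesis
  proof (rule eventually_mono, intro allI impI)
    fix i k :: nat
    assume "\<forall>k\<le>2^i. norm ((T i ^^ k) y - P (k * (t / 2 ^ i)) y) \<le> e/3" "k \<le> 2 ^ i"
    then have 1: "norm ((T i ^^ k) y - P (k * (t / 2 ^ i)) y) \<le> e/3" by blast
    have 2: "norm (P (k * (t / 2 ^ i)) y - P (k * (t / 2 ^ i)) u) \<le> e/3"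
      using P_contr[of "k * (t / 2 ^ i)" "y - u"] t yX u yz(2) by (simp add: P_diff subspace_diff[OF X(1)])
    have 3: "norm ((T i ^^ k) u - (T i ^^ k) y) \<le> e/3"
      using Tk_lip[where i=i and k=k and w=u and w'=y] yz(2) by (simp add: norm_minus_commute)
    have "(T i ^^ k) u - P (k * (t / 2 ^ i)) u = ((T i ^^ k) u - (T i ^^ k) y)
      + ((T i ^^ k) y - P (k * (t / 2 ^ i)) y) + (P (k * (t / 2 ^ i)) y - P (k * (t / 2 ^ i)) u)" by simp
    also have "norm \<dots> \<le> e/3 + e/3 + e/3" using 1 2 3 by (intro norm_triangle_mono)
    finally show "norm ((T i ^^ k) u - P (k * (t / 2 ^ i)) u) \<le> e" by simp
  qed
qed

end

subsection \<open>Integrals of powers of the norm\<close>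

text \<open>On the shell the integrand is comparable with \<open>s powr \<gamma>\<close>, whatever
  the sign of \<gamma>, which the factor \<open>max 1 (2 powr \<gamma>)\<close> accounts for, and
  the shell lies in the ball of radius \<open>2 * s\<close>.\<close>

lemma nn_integral_shell_le:
  fixes \<gamma> s :: real
  assumes s: "s > 0"
  shows "(\<integral>\<^sup>+v. ennreal (norm v powr \<gamma>) * indicator {v. s < norm v \<and> norm v \<le> 2 * s} (v :: 'a::euclidean_space) \<partial>lborel)
    \<le> ennreal ((max 1 (2 powr \<gamma>) * unit_ball_vol DIM('a) * 2 ^ DIM('a)) * s powr (\<gamma> + DIM('a)))"
proof -
  have "(\<integral>\<^sup>+v. ennreal (norm v powr \<gamma>) * indicator {v. s < norm v \<and> norm v \<le> 2 * s} (v :: 'a) \<partial>lborel)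
      \<le> (\<integral>\<^sup>+v. ennreal (max 1 (2 powr \<gamma>) * s powr \<gamma>) * indicator (cball 0 (2 * s)) (v :: 'a) \<partial>lborel)"
  proof (intro nn_integral_mono)
    fix v :: 'a
    have "norm v powr \<gamma> \<le> max 1 (2 powr \<gamma>) * s powr \<gamma>" if v: "s < norm v" "norm v \<le> 2 * s"
    proof (cases "\<gamma> \<ge> 0")
      case True
      then have "norm v powr \<gamma> \<le> (2 * s) powr \<gamma>" using v by (intro powr_mono2) auto
      also have "\<dots> = 2 powr \<gamma> * s powr \<gamma>" using s by (simp add: powr_mult)
      finally show ?thesis by (rule order_trans) (intro mult_right_mono, auto)
    next
      case False
      then have "norm v powr \<gamma> \<le> 1 * s powr \<gamma>" using v s by (auto intro: powr_mono2')
      then show ?thesis by (rule order_trans) (intro mult_right_mono, auto)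
    qed
    then show "ennreal (norm v powr \<gamma>) * indicator {v. s < norm v \<and> norm v \<le> 2 * s} v
        \<le> ennreal (max 1 (2 powr \<gamma>) * s powr \<gamma>) * indicator (cball 0 (2 * s)) v"
      by (auto simp: indicator_def intro!: ennreal_leI)
  qed
  also have "\<dots> = ennreal (max 1 (2 powr \<gamma>) * s powr \<gamma>) * ennreal (unit_ball_vol DIM('a) * (2 * s) ^ DIM('a))"
    using s by (simp add: nn_integral_cmult_indicator emeasure_cball)
  also have "\<dots> = ennreal ((max 1 (2 powr \<gamma>) * unit_ball_vol DIM('a) * 2 ^ DIM('a)) * s powr (\<gamma> + DIM('a)))"
    using s by (subst ennreal_mult[symmetric]) (auto simp: powr_add powr_realpow power_mult_distrib intro!: arg_cong[where f = ennreal])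
  finally show ?thesis .
qed

text \<open>The origin may stay uncovered because \<open>0 powr \<gamma>\<close> is 0 in
  HOL.\<close>

lemma nn_integral_shells_le:
  fixes \<gamma> :: real and s :: "nat \<Rightarrow> real" and A :: "'a::euclidean_space set"
  assumes s: "\<And>j. s j > 0" and A: "A \<in> sets borel"
    and cover: "\<And>v. v \<in> A \<Longrightarrow> v \<noteq> 0 \<Longrightarrow> \<exists>j. s j < norm v \<and> norm v \<le> 2 * s j"
    and L: "(\<lambda>j. s j powr (\<gamma> + DIM('a))) sums L"
  shows "(\<integral>\<^sup>+v. ennreal (norm v powr \<gamma>) * indicator A v \<partial>lborel)
    \<le> ennreal ((max 1 (2 powr \<gamma>) * unit_ball_vol DIM('a) * 2 ^ DIM('a)) * L)"
proof -
  let ?S = "\<lambda>j. {v :: 'a. s j < norm v \<and> norm v \<le> 2 * s j}"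
  let ?K = "max 1 (2 powr \<gamma>) * unit_ball_vol DIM('a) * 2 ^ DIM('a)"
  have K: "?K \<ge> 0" by (auto intro!: mult_nonneg_nonneg)
  have "(\<integral>\<^sup>+v. ennreal (norm v powr \<gamma>) * indicator A v \<partial>lborel)
      \<le> (\<integral>\<^sup>+v. (\<Sum>j. ennreal (norm v powr \<gamma>) * indicator (?S j) v) \<partial>lborel)"
  proof (intro nn_integral_mono)
    fix v :: 'a
    show "ennreal (norm v powr \<gamma>) * indicator A v \<le> (\<Sum>j. ennreal (norm v powr \<gamma>) * indicator (?S j) v)"
    proof (cases "v \<in> A \<and> v \<noteq> 0")
      case True
      then obtain j where j: "s j < norm v" "norm v \<le> 2 * s j" using cover by blast
      define f where "f j = ennreal (norm v powr \<gamma>) * indicator (?S j) v" for j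
      have "f j = sum f {j}" by simp
      also have "\<dots> \<le> suminf f" by (rule sum_le_suminf) auto
      finally have "ennreal (norm v powr \<gamma>) * indicator (?S j) v \<le> (\<Sum>j. ennreal (norm v powr \<gamma>) * indicator (?S j) v)"
        unfolding f_def .
      then show ?thesis using j True by simp
    qed auto
  qed
  also have "\<dots> = (\<Sum>j. \<integral>\<^sup>+v. ennreal (norm v powr \<gamma>) * indicator (?S j) v \<partial>lborel)"
    by (intro nn_integral_suminf) measurable
  also have "\<dots> \<le> (\<Sum>j. ennreal (?K * s j powr (\<gamma> + DIM('a))))"
    by (intro suminf_le nn_integral_shell_le s) auto
  also have "\<dots> = ennreal (?K * L)"
    using sums_mult[OF L, of ?K] K by (intro suminf_ennreal_eq) auto
  finally show ?thesis .
qed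

text \<open>Doubling shells \<open>2 ^ j * r\<close> give a geometric series of ratio
  \<open>2 powr (- \<alpha>)\<close>.\<close>

lemma nn_integral_norm_powr_tail:
  fixes \<alpha> :: real
  assumes a: "\<alpha> > 0"
  obtains C where "C > 0"
    "\<And>r. r > 0 \<Longrightarrow> (\<integral>\<^sup>+v. ennreal (norm v powr (- \<alpha> - DIM('a))) * indicator {v. r < norm v} (v :: 'a::euclidean_space) \<partial>lborel)
      \<le> ennreal (C * r powr (- \<alpha>))"
proof -
  define \<gamma> where "\<gamma> = - \<alpha> - DIM('a)"
  let ?K = "max 1 (2 powr \<gamma>) * unit_ball_vol DIM('a) * 2 ^ DIM('a)"
  define q where "q = (2 :: real) powr (- \<alpha>)"
  have q: "0 < q" "q < 1" using a by (auto simp: q_def powr_less_one)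
  show thesis
  proof (rule that)
    show "?K * (1 / (1 - q)) > 0" using q by (auto intro!: mult_pos_pos simp: less_max_iff_disj)
    fix r :: real assume r: "r > 0"
    define s where "s j = 2 ^ j * r" for j :: nat
    have sp: "s j powr (\<gamma> + DIM('a)) = r powr (- \<alpha>) * q ^ j" for j
      using r by (simp add: s_def \<gamma>_def q_def powr_mult powr_power powr_realpow[symmetric] powr_powr mult.commute)
    have "(\<lambda>j. s j powr (\<gamma> + DIM('a))) sums (r powr (- \<alpha>) * (1 / (1 - q)))"
      unfolding sp using q by (intro sums_mult geometric_sums) auto
    moreover have "\<exists>j. s j < norm v \<and> norm v \<le> 2 * s j" if "v \<in> {v :: 'a. r < norm v}" for v
    proof -
      obtain n where "norm v / r < 2 ^ n" using real_arch_pow[of 2 "norm v / r"] by auto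
      then have "norm v \<le> 2 ^ n * r" using r by (simp add: field_simps)
      moreover have "\<not> norm v \<le> 2 ^ 0 * r" using that by simp
      ultimately obtain k where "\<forall>i\<le>k. \<not> norm v \<le> 2 ^ i * r" "norm v \<le> 2 ^ (Suc k) * r"
        using ex_least_nat_less[of "\<lambda>n. norm v \<le> 2 ^ n * r" n] by blast
      then show ?thesis by (intro exI[of _ k]) (auto simp: s_def not_le)
    qed
    ultimately have "(\<integral>\<^sup>+v. ennreal (norm v powr \<gamma>) * indicator {v :: 'a. r < norm v} v \<partial>lborel)
        \<le> ennreal (?K * (r powr (- \<alpha>) * (1 / (1 - q))))"
      using r by (intro nn_integral_shells_le) (auto simp: s_def)
    then show "(\<integral>\<^sup>+v. ennreal (norm v powr (- \<alpha> - DIM('a))) * indicator {v :: 'a. r < norm v} v \<partial>lborel)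
        \<le> ennreal (?K * (1 / (1 - q)) * r powr (- \<alpha>))"
      by (simp add: \<gamma>_def mult_ac)
  qed
qed

text \<open>Halving shells give a geometric series of ratio \<open>2 powr (- p)\<close>. With
  \<open>p\<close> equal to 1 - \<alpha> or 2 - \<alpha> this measures the small jumps against first
  or second differences.\<close>

lemma nn_integral_norm_powr_ball:
  fixes p :: real
  assumes p: "p > 0"
  obtains C where "C > 0"
    "\<And>r. r > 0 \<Longrightarrow> (\<integral>\<^sup>+v. ennreal (norm v powr (p - DIM('a))) * indicator {v. norm v \<le> r} (v :: 'a::euclidean_space) \<partial>lborel)
      \<le> ennreal (C * r powr p)"
proof -
  define \<gamma> where "\<gamma> = p - DIM('a)"
  let ?K = "max 1 (2 powr \<gamma>) * unit_ball_vol DIM('a) * 2 ^ DIM('a)"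
  define q where "q = (1/2 :: real) powr p"
  have "q = 2 powr (- p)" by (simp add: q_def powr_minus powr_divide inverse_eq_divide)
  then have q: "0 < q" "q < 1" using p by (auto intro: powr_less_one)
  show thesis
  proof (rule that)
    show "?K * (q / (1 - q)) > 0" using q by (auto intro!: mult_pos_pos simp: less_max_iff_disj)
    fix r :: real assume r: "r > 0"
    define s where "s j = (1/2) ^ (Suc j) * r" for j :: nat
    have sp: "s j powr (\<gamma> + DIM('a)) = r powr p * q * q ^ j" for j
    proof -
      have "((1/2) ^ m) powr p = (1/2) powr (real m * p)" for m :: nat
        by (subst powr_realpow[symmetric]) (auto simp: powr_powr)
      moreover have "q ^ m = (1/2) powr (real m * p)" for m
        by (simp add: q_def powr_power)
      ultimately have "((1/2) ^ Suc j) powr p = q ^ Suc j" by metis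
      then show ?thesis
        using r by (simp add: s_def \<gamma>_def powr_mult mult_ac del: power_Suc) (simp add: mult_ac)
    qed
    have "(\<lambda>j. s j powr (\<gamma> + DIM('a))) sums (r powr p * q * (1 / (1 - q)))"
      unfolding sp using q by (intro sums_mult geometric_sums) auto
    moreover have "\<exists>j. s j < norm v \<and> norm v \<le> 2 * s j" if v: "v \<in> {v :: 'a. norm v \<le> r}" "v \<noteq> 0" for v
    proof -
      obtain n where "(1/2) ^ n < norm v / r" using real_arch_pow_inv[of "norm v / r" "1/2"] v r by auto
      then have "(1/2) ^ n * r < norm v" using r by (simp add: field_simps)
      moreover have "\<not> (1/2) ^ 0 * r < norm v" using v by simp
      ultimately obtain k where "\<forall>i\<le>k. \<not> (1/2) ^ i * r < norm v" "(1/2) ^ (Suc k) * r < norm v"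
        using ex_least_nat_less[of "\<lambda>n. (1/2) ^ n * r < norm v" n] by blast
      then show ?thesis by (intro exI[of _ k]) (auto simp: s_def not_less)
    qed
    ultimately have "(\<integral>\<^sup>+v. ennreal (norm v powr \<gamma>) * indicator {v :: 'a. norm v \<le> r} v \<partial>lborel)
        \<le> ennreal (?K * (r powr p * q * (1 / (1 - q))))"
      using r by (intro nn_integral_shells_le) (auto simp: s_def)
    then show "(\<integral>\<^sup>+v. ennreal (norm v powr (p - DIM('a))) * indicator {v :: 'a. norm v \<le> r} v \<partial>lborel)
        \<le> ennreal (?K * (q / (1 - q)) * r powr p)"
      by (simp add: \<gamma>_def mult_ac)
  qed
qed

subsection \<open>Symmetric random walks with a density\<close>

lemma ennreal_two_mult_le: "2 * a * b \<le> a\<^sup>2 + (b :: ennreal)\<^sup>2"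
proof (cases a; cases b)
  fix r s :: real assume "0 \<le> r" "a = ennreal r" "0 \<le> s" "b = ennreal s"
  moreover have "ennreal (2 * r * s) \<le> ennreal (r\<^sup>2 + s\<^sup>2)" by (intro ennreal_leI sum_squares_bound)
  ultimately show ?thesis by (simp add: ennreal_mult ennreal_plus ennreal_power)
qed (auto simp: power2_eq_square)

text \<open>\<open>k\<close> is the density of the jumps of a symmetric Markov chain; what
  \<open>k x\<close> lacks to mass one is the probability of staying at \<open>x\<close>.\<close>

locale walk =
  fixes k :: "'a::euclidean_space \<Rightarrow> 'a \<Rightarrow> real"
  assumes k_meas: "case_prod k \<in> borel_measurable borel"
    and k_nonneg: "0 \<le> k x y"
    and k_sym: "k x y = k y x"
    and k_mass: "(\<integral>\<^sup>+y. ennreal (k x y) \<partial>lborel) \<le> 1"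
begin

definition mass :: "'a \<Rightarrow> real" where "mass x = (LINT y|lborel. k x y)"

definition Tr :: "('a \<Rightarrow> real) \<Rightarrow> 'a \<Rightarrow> real" where
  "Tr u x = (1 - mass x) * u x + (LINT y|lborel. k x y * u y)"

text \<open>The operator \<open>Tr\<close> once more: \<open>Tr\<close> acts on bounded functions of
  either sign, \<open>Te\<close> on all nonnegative ones, where Tonelli and symmetry need no
  integrability.\<close>

definition Te :: "('a \<Rightarrow> ennreal) \<Rightarrow> 'a \<Rightarrow> ennreal" where
  "Te u x = ennreal (1 - mass x) * u x + (\<integral>\<^sup>+y. ennreal (k x y) * u y \<partial>lborel)"

lemma k_meas_pair [measurable]: "case_prod k \<in> borel_measurable (borel \<Otimes>\<^sub>M borel)"
  using k_meas by (simp add: borel_prod)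

lemma k_meas_right [measurable]: "k x \<in> borel_measurable borel"
  by measurable

lemma k_integrable: "integrable lborel (k x)"
  using k_mass[of x] k_nonneg by (intro integrableI_nonneg) (auto intro: le_less_trans)

lemma nn_integral_k: "(\<integral>\<^sup>+y. ennreal (k x y) \<partial>lborel) = ennreal (mass x)"
  unfolding mass_def using k_integrable k_nonneg by (intro nn_integral_eq_integral) auto

lemma mass_nonneg: "0 \<le> mass x"
  unfolding mass_def by (intro integral_nonneg_AE) (auto simp: k_nonneg)

lemma mass_le: "mass x \<le> 1"
  using k_mass[of x] mass_nonneg[of x] by (simp add: nn_integral_k)

lemma mass_meas [measurable]: "mass \<in> borel_measurable borel"
proof -
  have "(\<lambda>x. LINT y|lborel. k x y) \<in> borel_measurable borel"
    by (rule lborel.borel_measurable_lebesgue_integral) (simp cong: measurable_cong_sets)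
  then show ?thesis by (simp add: mass_def[abs_def])
qed

lemma Te_meas [measurable]:
  assumes [measurable]: "u \<in> borel_measurable borel"
  shows "Te u \<in> borel_measurable borel"
proof -
  have "(\<lambda>x. \<integral>\<^sup>+y. ennreal (k x y) * u y \<partial>lborel) \<in> borel_measurable borel"
    by (rule lborel.borel_measurable_nn_integral) (simp cong: measurable_cong_sets)
  then show ?thesis unfolding Te_def[abs_def] by measurable
qed

lemma Te_pow_meas [measurable]:
  "u \<in> borel_measurable borel \<Longrightarrow> (Te ^^ n) u \<in> borel_measurable borel"
  by (induction n) auto

lemma Te_one: "Te (\<lambda>_. 1) x = 1"
  using mass_le[of x] mass_nonneg[of x]
  by (simp add: Te_def nn_integral_k flip: ennreal_plus)

section \<open>Symmetry, conservation of mass and the one-step smoothing estimate\<close>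

lemma nn_integral_swap_sym:
  assumes r[measurable]: "case_prod r \<in> borel_measurable (borel \<Otimes>\<^sub>M borel)" and sym: "\<And>x y. r x y = (r y x :: real)"
    and [measurable]: "u \<in> borel_measurable borel" "w \<in> borel_measurable borel"
  shows "(\<integral>\<^sup>+x. (\<integral>\<^sup>+y. ennreal (r x y) * u y \<partial>lborel) * w x \<partial>lborel)
       = (\<integral>\<^sup>+x. u x * (\<integral>\<^sup>+y. ennreal (r x y) * w y \<partial>lborel) \<partial>lborel)"
    (is "?l = ?r")
proof -
  have "?l = (\<integral>\<^sup>+x. (\<integral>\<^sup>+y. ennreal (r x y) * u y * w x \<partial>lborel) \<partial>lborel)"
    by (intro nn_integral_cong nn_integral_multc[symmetric]) auto
  also have "\<dots> = (\<integral>\<^sup>+y. (\<integral>\<^sup>+x. ennreal (r x y) * u y * w x \<partial>lborel) \<partial>lborel)"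
    by (rule lborel_pair.Fubini') (simp cong: measurable_cong_sets)
  also have "\<dots> = (\<integral>\<^sup>+y. u y * (\<integral>\<^sup>+x. ennreal (r y x) * w x \<partial>lborel) \<partial>lborel)"
    by (intro nn_integral_cong) (subst nn_integral_cmult[symmetric], auto simp: mult_ac sym)
  finally show ?thesis .
qed

lemma Te_sym:
  assumes [measurable]: "u \<in> borel_measurable borel" "w \<in> borel_measurable borel"
  shows "(\<integral>\<^sup>+x. Te u x * w x \<partial>lborel) = (\<integral>\<^sup>+x. u x * Te w x \<partial>lborel)"
proof -
  have m[measurable]: "(\<lambda>x. \<integral>\<^sup>+y. ennreal (k x y) * v y \<partial>lborel) \<in> borel_measurable borel"
    if [measurable]: "v \<in> borel_measurable borel" for v
    by (rule lborel.borel_measurable_nn_integral) (simp cong: measurable_cong_sets)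
  have "(\<integral>\<^sup>+x. Te u x * w x \<partial>lborel) = (\<integral>\<^sup>+x. ennreal (1 - mass x) * u x * w x \<partial>lborel)
     + (\<integral>\<^sup>+x. (\<integral>\<^sup>+y. ennreal (k x y) * u y \<partial>lborel) * w x \<partial>lborel)"
    unfolding Te_def by (subst nn_integral_add[symmetric]) (auto simp: distrib_right)
  also have "\<dots> = (\<integral>\<^sup>+x. u x * (ennreal (1 - mass x) * w x) \<partial>lborel)
     + (\<integral>\<^sup>+x. u x * (\<integral>\<^sup>+y. ennreal (k x y) * w y \<partial>lborel) \<partial>lborel)"
    by (subst nn_integral_swap_sym) (auto simp: mult_ac k_sym)
  also have "\<dots> = (\<integral>\<^sup>+x. u x * Te w x \<partial>lborel)"
    unfolding Te_def by (subst nn_integral_add[symmetric]) (auto simp: distrib_left)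
  finally show ?thesis .
qed

lemma Te_pow_sym:
  assumes [measurable]: "u \<in> borel_measurable borel" "w \<in> borel_measurable borel"
  shows "(\<integral>\<^sup>+x. (Te ^^ n) u x * w x \<partial>lborel) = (\<integral>\<^sup>+x. u x * (Te ^^ n) w x \<partial>lborel)"
  using assms
proof (induction n arbitrary: w)
  case (Suc n)
  have "(\<integral>\<^sup>+x. (Te ^^ Suc n) u x * w x \<partial>lborel) = (\<integral>\<^sup>+x. (Te ^^ n) u x * Te w x \<partial>lborel)"
    using Suc.prems by (simp add: Te_sym)
  also have "\<dots> = (\<integral>\<^sup>+x. u x * (Te ^^ n) (Te w) x \<partial>lborel)"
    using Suc by simp
  finally show ?case by (simp add: funpow_swap1)
qed simp

text \<open>Symmetry turns \<open>Te_one\<close> into conservation of the integral: pair with the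
  constant 1.\<close>

lemma nn_integral_Te:
  assumes [measurable]: "u \<in> borel_measurable borel"
  shows "(\<integral>\<^sup>+x. Te u x \<partial>lborel) = (\<integral>\<^sup>+x. u x \<partial>lborel)"
  using Te_sym[of u "\<lambda>_. 1"] by (simp add: Te_one)

lemma nn_integral_Te_pow:
  assumes [measurable]: "u \<in> borel_measurable borel"
  shows "(\<integral>\<^sup>+x. (Te ^^ n) u x \<partial>lborel) = (\<integral>\<^sup>+x. u x \<partial>lborel)"
  by (induction n) (auto simp: nn_integral_Te assms)

text \<open>
  The part \<open>r\<close> of the kernel with bounded density smooths from \<open>L\<^sup>1\<close> to \<open>L\<^sup>\<infinity>\<close>, and the rest
  loses mass at least \<open>\<kappa>\<close> in each step, so it is a strict contraction of \<open>L\<^sup>2\<close>.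
\<close>

lemma nash_step:
  assumes r[measurable]: "case_prod r \<in> borel_measurable borel"
    and r_range: "\<And>x y. 0 \<le> r x y" "\<And>x y. r x y \<le> k x y" "\<And>x y. r x y \<le> q"
    and r_sym: "\<And>x y. r x y = r y x"
    and r_mass: "\<And>x. ennreal \<kappa> \<le> (\<integral>\<^sup>+y. ennreal (r x y) \<partial>lborel)" and kappa: "\<kappa> \<ge> 0"
    and u[measurable]: "u \<in> borel_measurable borel"
  shows "(\<integral>\<^sup>+x. (Te u x)\<^sup>2 \<partial>lborel) \<le> ennreal (1 - \<kappa>) * (\<integral>\<^sup>+x. (u x)\<^sup>2 \<partial>lborel) + ennreal (2 * q) * (\<integral>\<^sup>+x. u x \<partial>lborel)\<^sup>2"
proof -
  have r_pair[measurable]: "case_prod r \<in> borel_measurable (borel \<Otimes>\<^sub>M borel)"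
    using r by (simp add: borel_prod)
  have q: "q \<ge> 0" using r_range(1,3) order_trans by blast
  define s where "s x y = k x y - r x y" for x y
  have s_nonneg: "0 \<le> s x y" and ks: "k x y = s x y + r x y" and s_sym: "s x y = s y x" for x y
    using r_range(2)[of x y] k_sym[of x y] r_sym[of x y] by (auto simp: s_def)
  have s_pair[measurable]: "case_prod s \<in> borel_measurable (borel \<Otimes>\<^sub>M borel)"
    unfolding s_def by measurable
  define R where "R v x = (\<integral>\<^sup>+y. ennreal (r x y) * v y \<partial>lborel)" for v x
  define S0 where "S0 v x = (\<integral>\<^sup>+y. ennreal (s x y) * v y \<partial>lborel)" for v x
  define S where "S v x = ennreal (1 - mass x) * v x + S0 v x" for v x
  have R_meas[measurable]: "R v \<in> borel_measurable borel" and S0_meas[measurable]: "S0 v \<in> borel_measurable borel"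
    if [measurable]: "v \<in> borel_measurable borel" for v
    unfolding R_def[abs_def] S0_def[abs_def]
    by (rule lborel.borel_measurable_nn_integral, simp cong: measurable_cong_sets)+
  have S_meas[measurable]: "S v \<in> borel_measurable borel" if [measurable]: "v \<in> borel_measurable borel" for v
    unfolding S_def[abs_def] by measurable
  have r_int: "integrable lborel (r x)" for x
    by (rule Bochner_Integration.integrable_bound[OF k_integrable[of x]])
       (use r_range k_nonneg in \<open>auto intro!: AE_I2\<close>)
  have r_eq: "(\<integral>\<^sup>+y. ennreal (r x y) \<partial>lborel) = ennreal (LINT y|lborel. r x y)" for x
    using r_int r_range by (intro nn_integral_eq_integral) auto
  have s_eq: "(\<integral>\<^sup>+y. ennreal (s x y) \<partial>lborel) = ennreal (mass x - (LINT y|lborel. r x y))" for x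
  proof -
    have "s x = (\<lambda>y. k x y - r x y)" by (auto simp: s_def)
    then have "integrable lborel (s x)" "integral\<^sup>L lborel (s x) = mass x - (LINT y|lborel. r x y)"
      using k_integrable[of x] r_int[of x] by (simp_all add: mass_def)
    then show ?thesis using s_nonneg by (subst nn_integral_eq_integral) auto
  qed
  have Rmass: "\<kappa> \<le> (LINT y|lborel. r x y)" "(LINT y|lborel. r x y) \<le> mass x" for x
  proof -
    show "\<kappa> \<le> (LINT y|lborel. r x y)"
      using r_mass[of x] r_range by (simp add: r_eq integral_nonneg_AE)
    show "(LINT y|lborel. r x y) \<le> mass x"
      unfolding mass_def by (intro integral_mono r_int k_integrable r_range)
  qed
  have S1: "ennreal (1 - mass x) + (\<integral>\<^sup>+y. ennreal (s x y) \<partial>lborel) \<le> ennreal (1 - \<kappa>)" for x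
    unfolding s_eq using Rmass[of x] mass_le[of x] by (subst ennreal_plus[symmetric]) (auto intro!: ennreal_leI)
  have Te_eq: "Te u x = S u x + R u x" for x
    unfolding Te_def S_def S0_def R_def
    by (simp add: ks ennreal_plus s_nonneg r_range distrib_right nn_integral_add add.assoc)
  \<comment> \<open>Jensen's inequality for a subprobability, without assuming finiteness: integrate
    \<open>2 * c * u y \<le> c\<^sup>2 + (u y)\<^sup>2\<close> against the kernel and insert
    \<open>c = S u x\<close>; an infinite value is treated separately with
    \<open>c = 1\<close>.\<close>
  have jensen: "(S u x)\<^sup>2 \<le> S (\<lambda>y. (u y)\<^sup>2) x" for x
  proof -
    have *: "2 * c * S u x \<le> c\<^sup>2 + S (\<lambda>y. (u y)\<^sup>2) x" for c
    proof -
      have "2 * c * S u x = ennreal (1 - mass x) * (2 * c * u x) + (\<integral>\<^sup>+y. ennreal (s x y) * (2 * c * u y) \<partial>lborel)"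
        unfolding S_def S0_def by (simp add: distrib_left nn_integral_cmult[symmetric] mult_ac)
      also have "\<dots> \<le> ennreal (1 - mass x) * (c\<^sup>2 + (u x)\<^sup>2) + (\<integral>\<^sup>+y. ennreal (s x y) * (c\<^sup>2 + (u y)\<^sup>2) \<partial>lborel)"
        by (intro add_mono mult_left_mono nn_integral_mono ennreal_two_mult_le) auto
      also have "\<dots> = c\<^sup>2 * (ennreal (1 - mass x) + (\<integral>\<^sup>+y. ennreal (s x y) \<partial>lborel)) + S (\<lambda>y. (u y)\<^sup>2) x"
        unfolding S_def S0_def
        by (simp add: distrib_left nn_integral_add nn_integral_multc mult_ac add_ac)
      also have "\<dots> \<le> c\<^sup>2 * 1 + S (\<lambda>y. (u y)\<^sup>2) x"
        using kappa order_trans[OF S1[of x], of 1] by (intro add_mono mult_left_mono) auto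
      finally show ?thesis by simp
    qed
    show ?thesis
    proof (cases "S u x = top")
      case True
      then show ?thesis using *[of 1] by (simp add: top_unique)
    next
      case False
      have "(S u x)\<^sup>2 + (S u x)\<^sup>2 \<le> (S u x)\<^sup>2 + S (\<lambda>y. (u y)\<^sup>2) x"
        using *[of "S u x"] by (simp add: power2_eq_square mult_2 distrib_right)
      then show ?thesis using False by (simp add: ennreal_add_left_cancel_le power2_eq_square ennreal_mult_eq_top_iff)
    qed
  qed
  \<comment> \<open>Integrating the Jensen bound and moving \<open>s\<close> to the other side by
    symmetry leaves the total weight of the rest of the kernel, which is at most
    \<open>1 - \<kappa>\<close>.\<close>
  have S_sq: "(\<integral>\<^sup>+x. (S u x)\<^sup>2 \<partial>lborel) \<le> ennreal (1 - \<kappa>) * (\<integral>\<^sup>+x. (u x)\<^sup>2 \<partial>lborel)"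
  proof -
    have "(\<integral>\<^sup>+x. (S u x)\<^sup>2 \<partial>lborel) \<le> (\<integral>\<^sup>+x. S (\<lambda>y. (u y)\<^sup>2) x \<partial>lborel)"
      by (intro nn_integral_mono jensen)
    also have "\<dots> = (\<integral>\<^sup>+x. ennreal (1 - mass x) * (u x)\<^sup>2 \<partial>lborel) + (\<integral>\<^sup>+x. S0 (\<lambda>y. (u y)\<^sup>2) x * 1 \<partial>lborel)"
      unfolding S_def by (subst nn_integral_add) auto
    also have "(\<integral>\<^sup>+x. S0 (\<lambda>y. (u y)\<^sup>2) x * 1 \<partial>lborel) = (\<integral>\<^sup>+x. (u x)\<^sup>2 * (\<integral>\<^sup>+y. ennreal (s x y) * 1 \<partial>lborel) \<partial>lborel)"
      unfolding S0_def by (intro nn_integral_swap_sym s_sym) auto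
    also have "(\<integral>\<^sup>+x. ennreal (1 - mass x) * (u x)\<^sup>2 \<partial>lborel) + \<dots>
       = (\<integral>\<^sup>+x. (ennreal (1 - mass x) + (\<integral>\<^sup>+y. ennreal (s x y) \<partial>lborel)) * (u x)\<^sup>2 \<partial>lborel)"
    proof -
      have [measurable]: "(\<lambda>x. \<integral>\<^sup>+y. ennreal (s x y) * 1 \<partial>lborel) \<in> borel_measurable borel"
        using S0_meas[of "\<lambda>_. 1"] by (simp add: S0_def[abs_def])
      show ?thesis by (subst nn_integral_add[symmetric]) (auto simp: distrib_left mult.commute)
    qed
    also have "\<dots> \<le> (\<integral>\<^sup>+x. ennreal (1 - \<kappa>) * (u x)\<^sup>2 \<partial>lborel)"
      by (intro nn_integral_mono mult_right_mono S1) auto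
    also have "\<dots> = ennreal (1 - \<kappa>) * (\<integral>\<^sup>+x. (u x)\<^sup>2 \<partial>lborel)"
      by (rule nn_integral_cmult) measurable
    finally show ?thesis .
  qed
  \<comment> \<open>A bound for \<open>R u\<close>, uniform in \<open>x\<close>. Expanding the
    square of \<open>S u + R u\<close> leaves \<open>(S u x)\<^sup>2\<close> and a remainder of at
    most \<open>2 * Q * Te u x\<close>, whose integral is known because \<open>Te\<close> preserves
    integrals.\<close>
  define Q where "Q = ennreal q * (\<integral>\<^sup>+x. u x \<partial>lborel)"
  have R_le: "R u x \<le> Q" for x
    unfolding R_def Q_def using r_range(3)
    by (subst nn_integral_cmult[symmetric]) (auto intro!: nn_integral_mono mult_right_mono ennreal_leI)
  have "(\<integral>\<^sup>+x. (Te u x)\<^sup>2 \<partial>lborel) \<le> (\<integral>\<^sup>+x. (S u x)\<^sup>2 + 2 * Q * Te u x \<partial>lborel)"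
  proof (intro nn_integral_mono)
    fix x
    have "(Te u x)\<^sup>2 = (S u x)\<^sup>2 + (S u x + (S u x + R u x)) * R u x"
      unfolding Te_eq by (simp add: power2_eq_square algebra_simps)
    also have "\<dots> \<le> (S u x)\<^sup>2 + ((S u x + R u x) + (S u x + R u x)) * Q"
      by (intro add_mono mult_mono R_le) auto
    finally show "(Te u x)\<^sup>2 \<le> (S u x)\<^sup>2 + 2 * Q * Te u x"
      by (simp add: Te_eq mult_2 algebra_simps)
  qed
  also have "\<dots> = (\<integral>\<^sup>+x. (S u x)\<^sup>2 \<partial>lborel) + 2 * Q * (\<integral>\<^sup>+x. u x \<partial>lborel)"
    by (simp add: nn_integral_add nn_integral_cmult nn_integral_Te)
  also have "2 * Q * (\<integral>\<^sup>+x. u x \<partial>lborel) = ennreal (2 * q) * (\<integral>\<^sup>+x. u x \<partial>lborel)\<^sup>2"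
    unfolding Q_def using q by (simp add: ennreal_mult power2_eq_square mult_ac)
  finally show ?thesis using S_sq by (meson add_right_mono order_trans)
qed

lemma L2_decreasing:
  assumes [measurable]: "u \<in> borel_measurable borel"
  shows "(\<integral>\<^sup>+x. (Te u x)\<^sup>2 \<partial>lborel) \<le> (\<integral>\<^sup>+x. (u x)\<^sup>2 \<partial>lborel)"
  using nash_step[of "\<lambda>_ _. 0" 0 0 u] by (simp add: k_nonneg)

section \<open>The walk on bounded functions of either sign\<close>

lemma k_mult_integrable:
  assumes [measurable]: "u \<in> borel_measurable borel" and b: "\<And>y. \<bar>u y\<bar> \<le> c"
  shows "integrable lborel (\<lambda>y. k x y * u y)"
proof (rule Bochner_Integration.integrable_bound)
  show "integrable lborel (\<lambda>y. c * k x y)" using k_integrable by simp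
  show "AE y in lborel. norm (k x y * u y) \<le> norm (c * k x y)"
    using b k_nonneg[of x] by (intro AE_I2) (auto simp: abs_mult mult.commute[of _ "k x _"] intro!: mult_left_mono order_trans[OF b abs_ge_self])
qed measurable

lemma Tr_meas [measurable]:
  assumes [measurable]: "u \<in> borel_measurable borel"
  shows "Tr u \<in> borel_measurable borel"
proof -
  have "(\<lambda>x. LINT y|lborel. k x y * u y) \<in> borel_measurable borel"
    by (rule lborel.borel_measurable_lebesgue_integral) (simp cong: measurable_cong_sets)
  then show ?thesis unfolding Tr_def[abs_def] by measurable
qed

lemma Tr_mono:
  assumes [measurable]: "u \<in> borel_measurable borel" "w \<in> borel_measurable borel"
    and b: "\<And>y. \<bar>u y\<bar> \<le> c" "\<And>y. \<bar>w y\<bar> \<le> c'" and le: "\<And>y. u y \<le> w y"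
  shows "Tr u x \<le> Tr w x"
  unfolding Tr_def using mass_le[of x] le k_nonneg
  by (intro add_mono mult_left_mono integral_mono k_mult_integrable[OF _ b(1)] k_mult_integrable[OF _ b(2)]) auto

lemma Tr_const: "Tr (\<lambda>_. c) x = c"
  by (simp add: Tr_def mass_def algebra_simps)

lemma Tr_bound:
  assumes [measurable]: "u \<in> borel_measurable borel" and b: "\<And>y. \<bar>u y\<bar> \<le> c"
  shows "\<bar>Tr u x\<bar> \<le> c"
proof -
  have "u y \<le> c" "- c \<le> u y" for y using b[of y] by auto
  then have "Tr u x \<le> Tr (\<lambda>_. c) x" "Tr (\<lambda>_. - c) x \<le> Tr u x"
    using b by (auto intro!: Tr_mono[where c = c and c' = c] order_trans[OF abs_ge_zero b] intro: order_trans[OF _ b])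
  then show ?thesis by (simp add: Tr_const)
qed

lemma Tr_lincomb:
  assumes [measurable]: "u \<in> borel_measurable borel" "w \<in> borel_measurable borel"
    and b: "\<And>y. \<bar>u y\<bar> \<le> c" "\<And>y. \<bar>w y\<bar> \<le> c'"
  shows "Tr (\<lambda>y. a * u y + e * w y) x = a * Tr u x + e * Tr w x"
proof -
  note i = k_mult_integrable[OF assms(1) b(1), of x] k_mult_integrable[OF assms(2) b(2), of x]
  have "(LINT y|lborel. k x y * (a * u y + e * w y)) = (LINT y|lborel. a * (k x y * u y) + e * (k x y * w y))"
    by (intro Bochner_Integration.integral_cong) (auto simp: algebra_simps)
  also have "\<dots> = a * (LINT y|lborel. k x y * u y) + e * (LINT y|lborel. k x y * w y)"
    using i by simp
  finally show ?thesis by (simp add: Tr_def algebra_simps)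
qed

lemma Tr_minus_id:
  assumes [measurable]: "u \<in> borel_measurable borel" and b: "\<And>y. \<bar>u y\<bar> \<le> c"
  shows "integrable lborel (\<lambda>y. (u y - u x) * k x y)" "Tr u x - u x = (LINT y|lborel. (u y - u x) * k x y)"
proof -
  note i = k_mult_integrable[OF assms, of x]
  have eq: "(\<lambda>y. (u y - u x) * k x y) = (\<lambda>y. k x y * u y - u x * k x y)"
    by (auto simp: algebra_simps)
  show "integrable lborel (\<lambda>y. (u y - u x) * k x y)"
    unfolding eq using i k_integrable[of x] by simp
  show "Tr u x - u x = (LINT y|lborel. (u y - u x) * k x y)"
    unfolding eq using i k_integrable[of x] by (simp add: Tr_def mass_def algebra_simps)
qed

lemma ennreal_Tr:
  assumes [measurable]: "u \<in> borel_measurable borel" and b: "\<And>y. 0 \<le> u y" "\<And>y. u y \<le> c"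
  shows "ennreal (Tr u x) = Te (\<lambda>y. ennreal (u y)) x"
proof -
  have i: "integrable lborel (\<lambda>y. k x y * u y)" using b by (intro k_mult_integrable) auto
  have "0 \<le> (LINT y|lborel. k x y * u y)" using b k_nonneg by (intro integral_nonneg_AE) auto
  then have "ennreal (Tr u x) = ennreal (1 - mass x) * ennreal (u x) + ennreal (LINT y|lborel. k x y * u y)"
    unfolding Tr_def using mass_le[of x] b by (simp add: ennreal_plus ennreal_mult)
  also have "ennreal (LINT y|lborel. k x y * u y) = (\<integral>\<^sup>+y. ennreal (k x y) * ennreal (u y) \<partial>lborel)"
    using i b k_nonneg by (subst nn_integral_eq_integral[symmetric]) (auto simp: ennreal_mult)
  finally show ?thesis by (simp add: Te_def)
qed

lemma Tr_pow:
  assumes [measurable]: "u \<in> borel_measurable borel" and b: "\<And>y. 0 \<le> u y" "\<And>y. u y \<le> c"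
  shows "(Tr ^^ n) u \<in> borel_measurable borel" "0 \<le> (Tr ^^ n) u x" "(Tr ^^ n) u x \<le> c"
    "ennreal ((Tr ^^ n) u x) = (Te ^^ n) (\<lambda>y. ennreal (u y)) x"
proof -
  have *: "(Tr ^^ n) u \<in> borel_measurable borel \<and> (\<forall>x. 0 \<le> (Tr ^^ n) u x \<and> (Tr ^^ n) u x \<le> c \<and>
    ennreal ((Tr ^^ n) u x) = (Te ^^ n) (\<lambda>y. ennreal (u y)) x)"
  proof (induction n)
    case (Suc n)
    let ?w = "(Tr ^^ n) u"
    have [measurable]: "?w \<in> borel_measurable borel" and w: "0 \<le> ?w x" "?w x \<le> c" for x using Suc by auto
    have "(\<lambda>y. ennreal (?w y)) = (Te ^^ n) (\<lambda>y. ennreal (u y))" using Suc by auto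
    then have "ennreal (Tr ?w x) = Te ((Te ^^ n) (\<lambda>y. ennreal (u y))) x" for x
      using ennreal_Tr[where u = ?w and c = c and x = x] w by simp
    moreover have "0 \<le> Tr ?w x" for x using Tr_mono[of "\<lambda>_. 0" ?w 0 c x] w by (simp add: Tr_const)
    moreover have "Tr ?w x \<le> c" for x using Tr_bound[of ?w c x] w by (simp add: abs_le_iff)
    ultimately show ?case by simp
  qed (use b in auto)
  show "(Tr ^^ n) u \<in> borel_measurable borel" "0 \<le> (Tr ^^ n) u x" "(Tr ^^ n) u x \<le> c"
    "ennreal ((Tr ^^ n) u x) = (Te ^^ n) (\<lambda>y. ennreal (u y)) x" using * by auto
qed

end

section \<open>A recursion of Nash type\<close>

lemma one_minus_div_le_powr:
  fixes p x :: real
  assumes "p \<ge> 0" "x > 0"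
  shows "(1 - p / x) * x powr (- p) \<le> (x + 1) powr (- p)"
proof -
  have "1 - p / x \<le> exp (- (p / x))" using exp_ge_add_one_self[of "- (p / x)"] by simp
  also have "\<dots> \<le> exp (- p * ln (1 + 1 / x))"
    using ln_add_one_self_le_self[of "1 / x"] assms mult_left_mono[of "ln (1 + 1/x)" "1/x" p] by simp
  also have "\<dots> = (1 + 1 / x) powr (- p)"
  proof -
    have "1 + 1 / x > 0" using assms by (simp add: add_pos_pos)
    then show ?thesis by (simp add: powr_def)
  qed
  finally have "(1 - p / x) * x powr (- p) \<le> (1 + 1 / x) powr (- p) * x powr (- p)"
    by (rule mult_right_mono) simp
  also have "\<dots> = ((1 + 1 / x) * x) powr (- p)" using assms by (subst powr_mult) auto
  also have "(1 + 1 / x) * x = x + 1" using assms by (simp add: field_simps)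
  finally show ?thesis .
qed

text \<open>The coefficient is \<open>\<delta> + 1\<close> and not \<delta> on purpose:
  \<open>C * (n * h) powr (- \<delta>)\<close> needs only the factor \<open>1 - \<delta> / n\<close>
  to go from \<open>n\<close> to \<open>n + 1\<close>, and the spare \<open>1 / n\<close> absorbs
  the inhomogeneous term. The initial value decays like \<open>n powr (- (\<delta> + 1))\<close>, so
  it disappears when \<open>h\<close> tends to 0 with \<open>n * h\<close> fixed.\<close>

lemma nash_recursion:
  fixes v :: "nat \<Rightarrow> real" and n0 :: nat
  assumes h: "h > 0" and C: "C \<ge> 0" and \<delta>: "\<delta> > 0" and n0: "n0 > 0" and nonneg: "\<And>n. v n \<ge> 0"
    and step: "\<And>n. n0 \<le> n \<Longrightarrow> n < n1 \<Longrightarrow> (\<delta> + 1) / n \<le> 1 \<and>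
      v (Suc n) \<le> (1 - (\<delta> + 1) / n) * v n + C * h * (n * h) powr (- \<delta> - 1)"
    and n: "n0 \<le> n" "n \<le> n1"
  shows "v n \<le> C * (n * h) powr (- \<delta>) + real n0 powr (\<delta> + 1) * v n0 * real n powr (- (\<delta> + 1))"
  using n
proof (induction n rule: dec_induct)
  case base
  have "real n0 powr (\<delta> + 1) * real n0 powr (- (\<delta> + 1)) = 1"
    using n0 by (simp flip: powr_add)
  then have "real n0 powr (\<delta> + 1) * v n0 * real n0 powr (- (\<delta> + 1)) = v n0"
    by (metis mult.assoc mult.commute mult_1)
  moreover have "0 \<le> C * (real n0 * h) powr (- \<delta>)" using C by simp
  ultimately show ?case by linarith
next
  case (step n)
  let ?V = "real n0 powr (\<delta> + 1) * v n0"
  have npos: "real n > 0" using step n0 by simp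
  have st: "(\<delta> + 1) / n \<le> 1" "v (Suc n) \<le> (1 - (\<delta> + 1) / n) * v n + C * h * (n * h) powr (- \<delta> - 1)"
    using assms(6)[of n] step by auto
  have IH: "v n \<le> C * (n * h) powr (- \<delta>) + ?V * real n powr (- (\<delta> + 1))" using step by simp
  have "v (Suc n) \<le> (1 - (\<delta> + 1) / n) * (C * (n * h) powr (- \<delta>) + ?V * real n powr (- (\<delta> + 1))) + C * h * (n * h) powr (- \<delta> - 1)"
    using mult_left_mono[OF IH, of "1 - (\<delta> + 1) / n"] st by linarith
  also have "C * h * (n * h) powr (- \<delta> - 1) = C * (n * h) powr (- \<delta>) * (1 / n)"
  proof -
    have "(n * h) powr (- \<delta> - 1) = (n * h) powr (- \<delta>) / (n * h)"
      using npos h by (simp add: powr_diff)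
    then show ?thesis using npos h by simp
  qed
  also have "(1 - (\<delta> + 1) / n) * (C * (n * h) powr (- \<delta>) + ?V * real n powr (- (\<delta> + 1))) + C * (n * h) powr (- \<delta>) * (1 / n)
     = C * h powr (- \<delta>) * ((1 - \<delta> / n) * real n powr (- \<delta>)) + ?V * ((1 - (\<delta> + 1) / n) * real n powr (- (\<delta> + 1)))"
    using npos h by (simp add: powr_mult field_simps)
  also have "\<dots> \<le> C * h powr (- \<delta>) * (real n + 1) powr (- \<delta>) + ?V * (real n + 1) powr (- (\<delta> + 1))"
    using npos C \<delta> nonneg[of n0] by (intro add_mono mult_left_mono one_minus_div_le_powr) auto
  also have "\<dots> = C * (Suc n * h) powr (- \<delta>) + ?V * real (Suc n) powr (- (\<delta> + 1))"
    using npos h by (simp add: powr_mult add.commute mult_ac)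
  finally show ?case .
qed

subsection \<open>Preliminaries on Lebesgue measure\<close>

lemma lborel_distr_isometry:
  assumes "c = 1 \<or> c = -1"
  shows "distr lborel borel (\<lambda>v. x + c *\<^sub>R v) = (lborel :: 'a::euclidean_space measure)"
proof -
  have "\<bar>c\<bar> = 1" "c \<noteq> 0" using assms by auto
  then show ?thesis using lborel_affine[of c x] by (simp add: density_1)
qed

lemma nn_integral_shift:
  fixes f :: "'a::euclidean_space \<Rightarrow> ennreal"
  assumes [measurable]: "f \<in> borel_measurable borel"
  shows "(\<integral>\<^sup>+v. f (x + v) \<partial>lborel) = (\<integral>\<^sup>+y. f y \<partial>lborel)"
  by (subst (2) lborel_distr_isometry[of 1 x, symmetric]) (auto simp: nn_integral_distr)

lemma integral_shift:
  fixes f :: "'a::euclidean_space \<Rightarrow> real"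
  assumes [measurable]: "f \<in> borel_measurable borel"
  shows "(LINT v|lborel. f (x + v)) = (LINT y|lborel. f y)"
  by (subst (2) lborel_distr_isometry[of 1 x, symmetric]) (auto simp: integral_distr)

lemma integrable_shift:
  fixes f :: "'a::euclidean_space \<Rightarrow> real"
  assumes [measurable]: "f \<in> borel_measurable borel"
  shows "integrable lborel (\<lambda>v. f (x + v)) \<longleftrightarrow> integrable lborel f"
  by (subst (2) lborel_distr_isometry[of 1 x, symmetric]) (auto simp: integrable_distr_eq)

lemma integral_reflect:
  fixes f :: "'a::euclidean_space \<Rightarrow> real"
  assumes [measurable]: "f \<in> borel_measurable borel"
  shows "(LINT v|lborel. f (- v)) = (LINT y|lborel. f y)"
  by (subst (2) lborel_distr_isometry[of "-1" 0, symmetric]) (auto simp: integral_distr)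

lemma integrable_reflect:
  fixes f :: "'a::euclidean_space \<Rightarrow> real"
  assumes [measurable]: "f \<in> borel_measurable borel"
  shows "integrable lborel (\<lambda>v. f (- v)) \<longleftrightarrow> integrable lborel f"
  by (subst (2) lborel_distr_isometry[of "-1" 0, symmetric]) (auto simp: integrable_distr_eq)

lemma abs_integral_le_nn_integral:
  fixes f :: "'a \<Rightarrow> real"
  assumes f: "integrable M f" and le: "(\<integral>\<^sup>+x. ennreal \<bar>f x\<bar> \<partial>M) \<le> ennreal C" and C: "0 \<le> C"
  shows "\<bar>LINT x|M. f x\<bar> \<le> C"
proof -
  have "ennreal \<bar>LINT x|M. f x\<bar> \<le> ennreal C"
    using order_trans[OF integral_norm_bound_ennreal[OF f]] le by simp
  then show ?thesis using C by simp
qed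

section \<open>Differences and the cancellation of small jumps\<close>

lemma second_difference_le:
  fixes q q' q'' :: "real \<Rightarrow> real"
  assumes "\<And>\<tau>. \<bar>\<tau>\<bar> \<le> 1 \<Longrightarrow> (q has_real_derivative q' \<tau>) (at \<tau>)"
    and "\<And>\<tau>. \<bar>\<tau>\<bar> \<le> 1 \<Longrightarrow> (q' has_real_derivative q'' \<tau>) (at \<tau>)"
    and K: "\<And>\<tau>. \<bar>\<tau>\<bar> \<le> 1 \<Longrightarrow> \<bar>q'' \<tau>\<bar> \<le> K"
  shows "\<bar>q 1 + q (-1) - 2 * q 0\<bar> \<le> 2 * K"
proof -
  obtain a where a: "0 < a" "a < 1" "q 1 - q 0 = (1 - 0) * q' a"
    using MVT2[of 0 1 q q'] assms(1) by auto
  obtain b where b: "-1 < b" "b < 0" "q 0 - q (-1) = (0 - (-1)) * q' b"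
    using MVT2[of "-1" 0 q q'] assms(1) by auto
  obtain c where c: "b < c" "c < a" "q' a - q' b = (a - b) * q'' c"
    using MVT2[of b a q' q''] assms(2) a b by auto
  have "q 1 + q (-1) - 2 * q 0 = (a - b) * q'' c"
  proof -
    have "q 1 - q 0 = q' a" "q 0 - q (-1) = q' b" using a b by simp_all
    then show ?thesis unfolding c(3)[symmetric] by linarith
  qed
  then have "\<bar>q 1 + q (-1) - 2 * q 0\<bar> = (a - b) * \<bar>q'' c\<bar>"
    using a b by (simp add: abs_mult)
  also have "\<dots> \<le> 2 * K" using a b c K[of c] by (intro mult_mono) auto
  finally show ?thesis .
qed

lemma first_difference_le:
  fixes q q' :: "real \<Rightarrow> real"
  assumes "\<And>\<tau>. \<bar>\<tau>\<bar> \<le> 1 \<Longrightarrow> (q has_real_derivative q' \<tau>) (at \<tau>)"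
    and K: "\<And>\<tau>. \<bar>\<tau>\<bar> \<le> 1 \<Longrightarrow> \<bar>q' \<tau>\<bar> \<le> K"
  shows "\<bar>q 1 - q 0\<bar> \<le> K"
proof -
  obtain a where a: "0 < a" "a < 1" "q 1 - q 0 = (1 - 0) * q' a"
    using MVT2[of 0 1 q q'] assms(1) by auto
  then show ?thesis using K[of a] by simp
qed

text \<open>The kernel may be of order \<open>norm v powr (- \<alpha> - d)\<close>, so a merely
  bounded \<open>w\<close> would not do near 0. Either the kernel is even, and the integral sees
  only the even part of \<open>w\<close>, which is of second order; or \<alpha> < 1, and first order
  suffices. With \<open>B\<close> normalised at the radius \<rho>, both cases give the bound of
  order \<open>\<rho> powr (- \<alpha>)\<close>. It serves the barrier and the truncation error
  alike.\<close>

lemma local_integral_le: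
  fixes \<kappa> w :: "'a::euclidean_space \<Rightarrow> real" and \<alpha> \<rho> B M C1 C2 :: real
  assumes [measurable]: "\<kappa> \<in> borel_measurable borel" "w \<in> borel_measurable borel"
    and int: "integrable lborel (\<lambda>v. indicator {v. norm v \<le> \<rho>} v * (w v * \<kappa> v))"
    and \<kappa>: "\<And>v. 0 \<le> \<kappa> v" "\<And>v. \<kappa> v \<le> M * norm v powr (- \<alpha> - DIM('a))" and B: "B \<ge> 0" and M: "M \<ge> 0"
    and C1: "\<alpha> < 1 \<Longrightarrow> (\<integral>\<^sup>+v. ennreal (norm v powr ((1 - \<alpha>) - DIM('a))) * indicator {v. norm v \<le> \<rho>} (v :: 'a) \<partial>lborel)
      \<le> ennreal (C1 * \<rho> powr (1 - \<alpha>))" "C1 \<ge> 0"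
    and C2: "(\<integral>\<^sup>+v. ennreal (norm v powr ((2 - \<alpha>) - DIM('a))) * indicator {v. norm v \<le> \<rho>} (v :: 'a) \<partial>lborel)
      \<le> ennreal (C2 * \<rho> powr (2 - \<alpha>))" "C2 \<ge> 0"
    and \<rho>: "\<rho> > 0"
    and sym: "(\<forall>v. \<kappa> (- v) = \<kappa> v) \<and> (\<forall>v. norm v \<le> \<rho> \<longrightarrow> \<bar>w v + w (- v)\<bar> \<le> B * (norm v)\<^sup>2 / \<rho>\<^sup>2) \<or>
      \<alpha> < 1 \<and> (\<forall>v. norm v \<le> \<rho> \<longrightarrow> \<bar>w v\<bar> \<le> B * norm v / \<rho>)"
  shows "\<bar>LINT v|lborel. indicator {v. norm v \<le> \<rho>} v * (w v * \<kappa> v)\<bar> \<le> B * M * (C1 + C2) * \<rho> powr (- \<alpha>)"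
  using sym
proof
  assume "\<alpha> < 1 \<and> (\<forall>v. norm v \<le> \<rho> \<longrightarrow> \<bar>w v\<bar> \<le> B * norm v / \<rho>)"
  then have a1: "\<alpha> < 1" and w1: "\<And>v. norm v \<le> \<rho> \<Longrightarrow> \<bar>w v\<bar> \<le> B * norm v / \<rho>" by auto
  have "\<bar>LINT v|lborel. indicator {v. norm v \<le> \<rho>} v * (w v * \<kappa> v)\<bar> \<le> B * M / \<rho> * (C1 * \<rho> powr (1 - \<alpha>))"
  proof (rule abs_integral_le_nn_integral[OF int])
    have "(\<integral>\<^sup>+v. ennreal \<bar>indicator {v. norm v \<le> \<rho>} v * (w v * \<kappa> v)\<bar> \<partial>lborel)
      \<le> (\<integral>\<^sup>+v. ennreal (B * M / \<rho>) * (ennreal (norm v powr ((1 - \<alpha>) - DIM('a))) * indicator {v. norm v \<le> \<rho>} (v :: 'a)) \<partial>lborel)"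
    proof (intro nn_integral_mono)
      fix v :: 'a
      have "\<bar>w v * \<kappa> v\<bar> \<le> (B * M / \<rho>) * norm v powr ((1 - \<alpha>) - DIM('a))" if v: "norm v \<le> \<rho>"
      proof -
        have "\<bar>w v * \<kappa> v\<bar> \<le> (B * norm v / \<rho>) * (M * norm v powr (- \<alpha> - DIM('a)))"
          unfolding abs_mult using w1[OF v] \<kappa>[of v] \<rho> B by (intro mult_mono) auto
        also have "\<dots> = (B * M / \<rho>) * (norm v powr 1 * norm v powr (- \<alpha> - DIM('a)))" by simp
        also have "norm v powr 1 * norm v powr (- \<alpha> - DIM('a)) = norm v powr ((1 - \<alpha>) - DIM('a))"
          by (subst powr_add[symmetric]) (simp add: algebra_simps)
        finally show ?thesis .
      qed
      then show "ennreal \<bar>indicator {v. norm v \<le> \<rho>} v * (w v * \<kappa> v)\<bar>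
         \<le> ennreal (B * M / \<rho>) * (ennreal (norm v powr ((1 - \<alpha>) - DIM('a))) * indicator {v. norm v \<le> \<rho>} v)"
        using B M \<rho> by (auto simp: indicator_def simp flip: ennreal_mult intro!: ennreal_leI)
    qed
    also have "\<dots> \<le> ennreal (B * M / \<rho>) * ennreal (C1 * \<rho> powr (1 - \<alpha>))"
      by (subst nn_integral_cmult) (auto intro!: mult_left_mono C1 a1)
    also have "\<dots> = ennreal (B * M / \<rho> * (C1 * \<rho> powr (1 - \<alpha>)))"
      using B M \<rho> C1 by (intro ennreal_mult[symmetric]) auto
    finally show "(\<integral>\<^sup>+v. ennreal \<bar>indicator {v. norm v \<le> \<rho>} v * (w v * \<kappa> v)\<bar> \<partial>lborel) \<le> ennreal (B * M / \<rho> * (C1 * \<rho> powr (1 - \<alpha>)))" .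
  qed (use B M \<rho> C1 in auto)
  also have "\<dots> = B * M * C1 * \<rho> powr (- \<alpha>)"
    using \<rho> by (simp add: powr_diff powr_minus divide_simps)
  also have "\<dots> \<le> B * M * (C1 + C2) * \<rho> powr (- \<alpha>)"
    using B M C1 C2 by (intro mult_right_mono mult_left_mono) auto
  finally show ?thesis .
next
  assume "(\<forall>v. \<kappa> (- v) = \<kappa> v) \<and> (\<forall>v. norm v \<le> \<rho> \<longrightarrow> \<bar>w v + w (- v)\<bar> \<le> B * (norm v)\<^sup>2 / \<rho>\<^sup>2)"
  then have even: "\<forall>v. \<kappa> (- v) = \<kappa> v"
    and w2: "\<And>v. norm v \<le> \<rho> \<Longrightarrow> \<bar>w v + w (- v)\<bar> \<le> B * (norm v)\<^sup>2 / \<rho>\<^sup>2" by auto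
  let ?f = "\<lambda>v. indicator {v. norm v \<le> \<rho>} v * (w v * \<kappa> v)"
  have int': "integrable lborel (\<lambda>v. ?f (- v))" by (subst integrable_reflect) (auto intro: int)
  have int2: "integrable lborel (\<lambda>v. ?f v + ?f (- v))" using int int' by simp
  have "2 * (LINT v|lborel. ?f v) = (LINT v|lborel. ?f v) + (LINT v|lborel. ?f (- v))"
    using integral_reflect[of ?f] by simp
  also have "\<dots> = (LINT v|lborel. ?f v + ?f (- v))"
    by (rule Bochner_Integration.integral_add[OF int int', symmetric])
  finally have "2 * \<bar>LINT v|lborel. ?f v\<bar> = \<bar>LINT v|lborel. ?f v + ?f (- v)\<bar>" by simp
  also have "\<dots> \<le> B * M / \<rho>\<^sup>2 * (C2 * \<rho> powr (2 - \<alpha>))"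
  proof (rule abs_integral_le_nn_integral[OF int2])
    have "(\<integral>\<^sup>+v. ennreal \<bar>?f v + ?f (- v)\<bar> \<partial>lborel)
      \<le> (\<integral>\<^sup>+v. ennreal (B * M / \<rho>\<^sup>2) * (ennreal (norm v powr ((2 - \<alpha>) - DIM('a))) * indicator {v. norm v \<le> \<rho>} (v :: 'a)) \<partial>lborel)"
    proof (intro nn_integral_mono)
      fix v :: 'a
      have eq: "?f v + ?f (- v) = indicator {v. norm v \<le> \<rho>} v * ((w v + w (- v)) * \<kappa> v)"
        using even by (auto simp: indicator_def algebra_simps)
      have "\<bar>(w v + w (- v)) * \<kappa> v\<bar> \<le> (B * M / \<rho>\<^sup>2) * norm v powr ((2 - \<alpha>) - DIM('a))" if v: "norm v \<le> \<rho>"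
      proof (cases "v = 0")
        case False
        have "\<bar>(w v + w (- v)) * \<kappa> v\<bar> \<le> (B * (norm v)\<^sup>2 / \<rho>\<^sup>2) * (M * norm v powr (- \<alpha> - DIM('a)))"
          unfolding abs_mult using w2[OF v] \<kappa>[of v] \<rho> B by (intro mult_mono) auto
        also have "\<dots> = (B * M / \<rho>\<^sup>2) * (norm v powr 2 * norm v powr (- \<alpha> - DIM('a)))"
          using False by (simp add: powr_numeral)
        also have "norm v powr 2 * norm v powr (- \<alpha> - DIM('a)) = norm v powr ((2 - \<alpha>) - DIM('a))"
          by (subst powr_add[symmetric]) (simp add: algebra_simps)
        finally show ?thesis .
      next
        case True
        then show ?thesis using \<kappa>[of 0] by simp
      qed
      then show "ennreal \<bar>?f v + ?f (- v)\<bar>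
         \<le> ennreal (B * M / \<rho>\<^sup>2) * (ennreal (norm v powr ((2 - \<alpha>) - DIM('a))) * indicator {v. norm v \<le> \<rho>} v)"
        unfolding eq using B M \<rho> by (auto simp: indicator_def simp flip: ennreal_mult intro!: ennreal_leI)
    qed
    also have "\<dots> \<le> ennreal (B * M / \<rho>\<^sup>2) * ennreal (C2 * \<rho> powr (2 - \<alpha>))"
      by (subst nn_integral_cmult) (auto intro!: mult_left_mono C2)
    also have "\<dots> = ennreal (B * M / \<rho>\<^sup>2 * (C2 * \<rho> powr (2 - \<alpha>)))"
      using B M \<rho> C2 by (intro ennreal_mult[symmetric]) auto
    finally show "(\<integral>\<^sup>+v. ennreal \<bar>?f v + ?f (- v)\<bar> \<partial>lborel) \<le> ennreal (B * M / \<rho>\<^sup>2 * (C2 * \<rho> powr (2 - \<alpha>)))" .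
  qed (use B M \<rho> C2 in auto)
  also have "\<dots> = B * M * C2 * \<rho> powr (- \<alpha>)"
    using \<rho> by (simp add: powr_diff powr_minus powr_numeral divide_simps)
  finally have "\<bar>LINT v|lborel. ?f v\<bar> \<le> B * M * C2 * \<rho> powr (- \<alpha>)" by simp
  also have "\<dots> \<le> B * M * (C1 + C2) * \<rho> powr (- \<alpha>)"
    using B M C1 C2 by (intro mult_right_mono mult_left_mono) auto
  finally show ?thesis .
qed

subsection \<open>The decay profile\<close>

text \<open>
  The shift by one in \<open>\<psi>\<close> makes it twice differentiable off the origin: \<open>\<phi>\<close> itself need not even be
  continuous at \<open>1\<close>.
\<close>

locale profile =
  fixes \<alpha> \<beta> M c1 c2 c3 :: real and \<phi> :: "real \<Rightarrow> real" and \<psi> :: "real ^ 'n \<Rightarrow> real"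
  assumes alpha: "0 < \<alpha>" "\<alpha> < 2"
    and beta: "\<beta> = \<alpha> + CARD('n)"
    and M: "0 < M" and c3: "0 \<le> c3"
    and phi_borel: "\<phi> \<in> borel_measurable (restrict_space borel {0..})"
    and phi_range: "\<And>a. a \<ge> 0 \<Longrightarrow> 0 < \<phi> a" "\<And>a. a \<ge> 0 \<Longrightarrow> \<phi> a \<le> 1"
    and phi_one: "\<And>a. 0 \<le> a \<Longrightarrow> a \<le> 1 \<Longrightarrow> \<phi> a = 1"
    and phi_comp: "\<And>a b. 0 \<le> a \<Longrightarrow> 0 \<le> b \<Longrightarrow> \<bar>a - b\<bar> \<le> 1 \<Longrightarrow> \<phi> a \<le> c1 * \<phi> b"
    and phi_C2: "C2_on_halfline 1 \<phi>"
    and phi_deriv: "\<And>a. a > 1 \<Longrightarrow> \<bar>deriv \<phi> a\<bar> \<le> c2 * \<phi> a" "\<And>a. a > 1 \<Longrightarrow> \<bar>deriv (deriv \<phi>) a\<bar> \<le> c2 * \<phi> a"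
    and conv: "\<And>x y :: real ^ 'n. norm (x - y) > 2 \<Longrightarrow>
                 (\<integral>\<^sup>+z\<in>{z. norm (x - z) \<ge> 1 \<and> norm (y - z) \<ge> 1}.
                    ennreal (\<phi> (norm (y - z)) / norm (y - z) powr \<beta> *
                             (\<phi> (norm (z - x)) / norm (z - x) powr \<beta>)) \<partial>lborel)
                 \<le> ennreal (c3 * (\<phi> (norm (y - x)) / norm (y - x) powr \<beta>))"
    and psi: "\<psi> = (\<lambda>z. \<phi> (norm z + 1) * norm z powr (- \<beta>))"
begin

lemma card_pos: "real CARD('n) > 0"
  by (simp add: zero_less_card_finite)

lemma beta_pos: "\<beta> > 0"
  using alpha card_pos by (simp add: beta)

lemma c1_ge: "c1 \<ge> 1"
  using phi_comp[of 0 0] by (simp add: phi_one)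

lemma c2_ge: "c2 \<ge> 0"
proof -
  have "0 \<le> c2 * \<phi> 2" using phi_deriv(1)[of 2] by linarith
  then show ?thesis using phi_range(1)[of 2] by (simp add: zero_le_mult_iff)
qed

lemma phi_norm_meas [measurable]: "(\<lambda>z :: real ^ 'n. \<phi> (norm z)) \<in> borel_measurable borel"
proof -
  have "norm \<in> borel \<rightarrow>\<^sub>M restrict_space borel {0..}"
    by (rule measurable_restrict_space2) auto
  from measurable_comp[OF this phi_borel] show ?thesis by (simp add: comp_def)
qed

lemma psi_meas [measurable]: "\<psi> \<in> borel_measurable borel"
proof -
  have "(\<lambda>z. norm z + 1) \<in> borel \<rightarrow>\<^sub>M restrict_space borel {0..}"
    by (rule measurable_restrict_space2) auto
  from measurable_comp[OF this phi_borel]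
  have [measurable]: "(\<lambda>z. \<phi> (norm z + 1)) \<in> borel_measurable borel" by (simp add: comp_def)
  show ?thesis unfolding psi by measurable
qed

lemma psi_nonneg: "0 \<le> \<psi> z"
  using phi_range(1)[of "norm z + 1"] by (simp add: psi)

lemma phi_shift: "a \<ge> 0 \<Longrightarrow> \<phi> a \<le> c1 * \<phi> (a + 1)" "a \<ge> 0 \<Longrightarrow> \<phi> (a + 1) \<le> c1 * \<phi> a"
  using phi_comp by auto

lemma psi_le: "\<psi> z \<le> norm z powr (- \<beta>)"
  using phi_range[of "norm z + 1"] by (simp add: psi mult_left_le_one_le)

text \<open>Comparability at distance 1, used three times starting from \<phi> = 1 on the unit
  interval. The range reaches 4 because \<psi> shifts the argument by 1 and the bound is applied to
  norms up to 3.\<close>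

lemma phi_low: "0 \<le> r \<Longrightarrow> r \<le> 4 \<Longrightarrow> 1 \<le> c1 ^ 3 * \<phi> r"
proof -
  have step: "1 \<le> c1 ^ Suc n * \<phi> r" if "r \<ge> 0" "1 \<le> c1 ^ n * \<phi> (max 1 (r - 1))" for n r
  proof -
    have "\<phi> (max 1 (r - 1)) \<le> c1 * \<phi> r" if "r \<ge> 1" using that by (intro phi_comp) auto
    moreover have "\<phi> (max 1 (r - 1)) \<le> c1 * \<phi> r" if "r < 1" using that \<open>r \<ge> 0\<close> by (intro phi_comp) auto
    ultimately have "\<phi> (max 1 (r - 1)) \<le> c1 * \<phi> r" by linarith
    then have "c1 ^ n * \<phi> (max 1 (r - 1)) \<le> c1 ^ n * (c1 * \<phi> r)" using c1_ge by (intro mult_left_mono) auto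
    then show ?thesis using that by (simp add: mult_ac)
  qed
  have 0: "1 \<le> c1 ^ 0 * \<phi> r" if "0 \<le> r" "r \<le> 1" for r using that by (simp add: phi_one)
  have 1: "1 \<le> c1 ^ 1 * \<phi> r" if "0 \<le> r" "r \<le> 2" for r using step[of r 0] 0[of "max 1 (r - 1)"] that by auto
  have 2: "1 \<le> c1 ^ 2 * \<phi> r" if "0 \<le> r" "r \<le> 3" for r
    using step[of r 1] 1[of "max 1 (r - 1)"] that by (auto simp: numeral_2_eq_2)
  show "0 \<le> r \<Longrightarrow> r \<le> 4 \<Longrightarrow> 1 \<le> c1 ^ 3 * \<phi> r"
    using step[of r 2] 2[of "max 1 (r - 1)"] by (auto simp: numeral_3_eq_3 numeral_2_eq_2)
qed

text \<open>The length on which \<psi> is regular near \<open>z\<close>: the power of the norm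
  varies on the scale of \<open>norm z\<close>, \<phi> on the scale 1. The factor 1/2 keeps
  \<open>z + v\<close> away from the origin.\<close>

definition scale :: "real ^ 'n \<Rightarrow> real" where "scale z = min (norm z) 1 / 2"

lemma scale_pos: "z \<noteq> 0 \<Longrightarrow> 0 < scale z"
  by (simp add: scale_def)

lemma norm_near:
  assumes "norm v \<le> scale z" "z \<noteq> 0"
  shows "norm z / 2 \<le> norm (z + v)" "\<bar>norm (z + v) - norm z\<bar> \<le> 1" "z + v \<noteq> 0" "1 / norm (z + v) \<le> 1 / scale z"
proof -
  have v: "norm v \<le> norm z / 2" "norm v \<le> 1/2" using assms(1) by (auto simp: scale_def)
  show *: "norm z / 2 \<le> norm (z + v)" using norm_triangle_ineq4[of "z + v" v] v by simp
  show "\<bar>norm (z + v) - norm z\<bar> \<le> 1" using norm_triangle_ineq3[of "z + v" z] v by simp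
  show "z + v \<noteq> 0" using * assms(2) by auto
  have "scale z \<le> norm (z + v)" using * by (simp add: scale_def)
  then show "1 / norm (z + v) \<le> 1 / scale z" using scale_pos[OF assms(2)] by (intro divide_left_mono) (auto simp: zero_less_mult_iff)
qed

lemma powr_half_le: "0 < r \<Longrightarrow> r / 2 \<le> s \<Longrightarrow> s powr (- \<beta>) \<le> 2 powr \<beta> * r powr (- \<beta>)"
proof -
  assume r: "0 < r" "r / 2 \<le> s"
  then have "s powr (- \<beta>) \<le> (r / 2) powr (- \<beta>)" using beta_pos by (intro powr_mono2') auto
  also have "\<dots> = 2 powr \<beta> * r powr (- \<beta>)" using r by (simp add: powr_divide powr_minus divide_simps)
  finally show ?thesis .
qed

lemma psi_near:
  assumes "norm v \<le> scale z" "z \<noteq> 0"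
  shows "\<psi> (z + v) \<le> c1 * 2 powr \<beta> * \<psi> z"
proof -
  note n = norm_near[OF assms]
  have "\<phi> (norm (z + v) + 1) \<le> c1 * \<phi> (norm z + 1)" using n by (intro phi_comp) auto
  moreover have "norm (z + v) powr (- \<beta>) \<le> 2 powr \<beta> * norm z powr (- \<beta>)"
    using n assms by (intro powr_half_le) auto
  ultimately have "\<psi> (z + v) \<le> (c1 * \<phi> (norm z + 1)) * (2 powr \<beta> * norm z powr (- \<beta>))"
    unfolding psi using phi_range(1)[of "norm z + 1"] c1_ge by (intro mult_mono) auto
  then show ?thesis by (simp add: psi mult_ac)
qed

text \<open>The first derivative of the radial function
  \<open>\<phi> (r + 1) * r powr (- \<beta>)\<close>; \<open>gpp\<close> is the second.\<close>

definition gp :: "real \<Rightarrow> real" where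
  "gp r = deriv \<phi> (r + 1) * r powr (- \<beta>) - \<beta> * \<phi> (r + 1) * r powr (- \<beta> - 1)"

definition gpp :: "real \<Rightarrow> real" where
  "gpp r = deriv (deriv \<phi>) (r + 1) * r powr (- \<beta>) - 2 * \<beta> * deriv \<phi> (r + 1) * r powr (- \<beta> - 1)
     + \<beta> * (\<beta> + 1) * \<phi> (r + 1) * r powr (- \<beta> - 2)"

lemma radial_deriv:
  assumes r: "r > 0"
  shows "((\<lambda>r. \<phi> (r + 1) * r powr (- \<beta>)) has_real_derivative gp r) (at r)"
    and "(gp has_real_derivative gpp r) (at r)"
proof -
  have "(\<phi> has_real_derivative deriv \<phi> (r + 1)) (at (r + 1))"
    and "(deriv \<phi> has_real_derivative deriv (deriv \<phi>) (r + 1)) (at (r + 1))"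
    using phi_C2 r by (auto simp: C2_on_halfline_def DERIV_deriv_iff_real_differentiable)
  then have d: "((\<lambda>r. \<phi> (r + 1)) has_real_derivative deriv \<phi> (r + 1)) (at r)"
    and dd: "((\<lambda>r. deriv \<phi> (r + 1)) has_real_derivative deriv (deriv \<phi>) (r + 1)) (at r)"
    by (auto simp: DERIV_shift)
  have p: "((\<lambda>r. r powr a) has_real_derivative a * r powr (a - 1)) (at r)" for a
    using r by (rule has_real_derivative_powr)
  show "((\<lambda>r. \<phi> (r + 1) * r powr (- \<beta>)) has_real_derivative gp r) (at r)"
    using DERIV_mult[OF d p[of "- \<beta>"]] by (simp add: gp_def algebra_simps)
  have "((\<lambda>r. deriv \<phi> (r + 1) * r powr (- \<beta>) - \<beta> * (\<phi> (r + 1) * r powr (- \<beta> - 1))) has_real_derivative gpp r) (at r)"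
    by (rule DERIV_cong[OF DERIV_diff[OF DERIV_mult[OF dd p[of "- \<beta>"]] DERIV_cmult[OF DERIV_mult[OF d p[of "- \<beta> - 1"]]]]])
       (simp add: gpp_def algebra_simps)
  then show "(gp has_real_derivative gpp r) (at r)"
    by (simp add: gp_def[abs_def] mult.assoc)
qed

text \<open>The sum of the two constants in \<open>radial_bounds\<close>: the second derivative
  along a segment involves both radial derivatives.\<close>

definition K0 :: real where "K0 = 2 * c2 + 2 * \<beta> * c2 + \<beta> * (\<beta> + 1) + \<beta>"

lemma K0_nonneg: "0 \<le> K0"
  using c2_ge beta_pos by (auto simp: K0_def)

text \<open>Each derivative costs at most a factor \<open>1 / l\<close>: on the power it produces
  \<open>1 / r\<close>, and on \<phi> the constant \<open>c2\<close>, which is at most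
  \<open>c2 / l\<close> since \<open>l\<close> is at most 1.\<close>

lemma radial_bounds:
  assumes r: "r > 0" and l: "0 < l" "l \<le> 1" "1 / r \<le> 1 / l"
  defines "g \<equiv> \<phi> (r + 1) * r powr (- \<beta>)"
  shows "\<bar>gp r\<bar> \<le> (c2 + \<beta>) * g / l" "\<bar>gpp r\<bar> \<le> (c2 + 2 * \<beta> * c2 + \<beta> * (\<beta> + 1)) * g / l\<^sup>2"
proof -
  let ?P = "\<phi> (r + 1)" and ?R = "r powr (- \<beta>)"
  have P: "?P > 0" using phi_range r by simp
  have g: "g > 0" using P r by (simp add: g_def)
  have r1: "r powr (- \<beta> - 1) = ?R / r" using r by (simp add: powr_diff)
  have r2: "r powr (- \<beta> - 2) = ?R / r\<^sup>2" using r by (simp add: powr_diff powr_numeral)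
  have d1: "\<bar>deriv \<phi> (r + 1) * ?R\<bar> \<le> c2 * g"
    using mult_right_mono[OF phi_deriv(1)[of "r + 1"], of ?R] r by (simp add: abs_mult g_def mult_ac)
  have d2: "\<bar>deriv (deriv \<phi>) (r + 1) * ?R\<bar> \<le> c2 * g"
    using mult_right_mono[OF phi_deriv(2)[of "r + 1"], of ?R] r by (simp add: abs_mult g_def mult_ac)
  have l1: "1 \<le> 1 / l" using l by simp
  then have l2: "1 \<le> 1 / l\<^sup>2" "1 / l \<le> 1 / l\<^sup>2" using l by (simp_all add: power2_eq_square field_simps mult_le_one)
  have rl: "1 / r * (1 / r) \<le> 1 / l * (1 / l)" using r l by (intro mult_mono) auto
  have "\<bar>gp r\<bar> \<le> \<bar>deriv \<phi> (r + 1) * ?R\<bar> + \<bar>\<beta> * g * (1 / r)\<bar>"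
    unfolding gp_def r1 g_def by (rule order_trans[OF abs_triangle_ineq4]) simp
  also have "\<dots> \<le> c2 * g * (1 / l) + \<beta> * g * (1 / l)"
  proof (intro add_mono)
    show "\<bar>deriv \<phi> (r + 1) * ?R\<bar> \<le> c2 * g * (1 / l)"
      using d1 mult_left_mono[OF l1, of "c2 * g"] c2_ge g by simp
    show "\<bar>\<beta> * g * (1 / r)\<bar> \<le> \<beta> * g * (1 / l)"
      using l(3) g beta_pos r by (simp only: abs_mult) (intro mult_mono, auto)
  qed
  finally show "\<bar>gp r\<bar> \<le> (c2 + \<beta>) * g / l" by (simp add: add_divide_distrib distrib_right)
  have "gpp r = deriv (deriv \<phi>) (r + 1) * ?R - 2 * \<beta> * (deriv \<phi> (r + 1) * ?R) * (1 / r) + \<beta> * (\<beta> + 1) * g * (1 / r * (1 / r))"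
    unfolding gpp_def r1 r2 g_def by (simp add: power2_eq_square)
  also have "\<bar>\<dots>\<bar> \<le> \<bar>deriv (deriv \<phi>) (r + 1) * ?R\<bar> + \<bar>2 * \<beta> * (deriv \<phi> (r + 1) * ?R) * (1 / r)\<bar> + \<bar>\<beta> * (\<beta> + 1) * g * (1 / r * (1 / r))\<bar>"
    by (intro order_trans[OF abs_triangle_ineq] add_mono abs_triangle_ineq4 order_refl)
  also have "\<dots> \<le> c2 * g * (1 / l\<^sup>2) + 2 * \<beta> * (c2 * g) * (1 / l\<^sup>2) + \<beta> * (\<beta> + 1) * g * (1 / l * (1 / l))"
  proof (intro add_mono)
    show "\<bar>deriv (deriv \<phi>) (r + 1) * ?R\<bar> \<le> c2 * g * (1 / l\<^sup>2)"
      using d2 mult_left_mono[OF l2(1), of "c2 * g"] c2_ge g by simp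
    have "\<bar>2 * \<beta> * (deriv \<phi> (r + 1) * ?R) * (1 / r)\<bar> = 2 * \<beta> * \<bar>deriv \<phi> (r + 1) * ?R\<bar> * (1 / r)"
      using beta_pos r by (simp add: abs_mult)
    also have "\<dots> \<le> 2 * \<beta> * (c2 * g) * (1 / l\<^sup>2)"
      using d1 l(3) l2(2) beta_pos c2_ge g r by (intro mult_mono) auto
    finally show "\<bar>2 * \<beta> * (deriv \<phi> (r + 1) * ?R) * (1 / r)\<bar> \<le> 2 * \<beta> * (c2 * g) * (1 / l\<^sup>2)" .
    have "\<bar>\<beta> * (\<beta> + 1) * g * (1 / r * (1 / r))\<bar> = \<beta> * (\<beta> + 1) * g * (1 / r * (1 / r))"
      using beta_pos g r by (intro abs_of_nonneg) auto
    also have "\<dots> \<le> \<beta> * (\<beta> + 1) * g * (1 / l * (1 / l))"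
      using beta_pos g by (intro mult_left_mono rl) auto
    finally show "\<bar>\<beta> * (\<beta> + 1) * g * (1 / r * (1 / r))\<bar> \<le> \<beta> * (\<beta> + 1) * g * (1 / l * (1 / l))" .
  qed
  finally show "\<bar>gpp r\<bar> \<le> (c2 + 2 * \<beta> * c2 + \<beta> * (\<beta> + 1)) * g / l\<^sup>2"
    by (simp add: power2_eq_square algebra_simps add_divide_distrib)
qed

definition D0 :: real where "D0 = 2 * K0 * (c1 * 2 powr \<beta>)"

lemma D0_nonneg: "0 \<le> D0"
  using K0_nonneg c1_ge by (simp add: D0_def)

text \<open>\<psi> is differentiated along the segment from \<open>z - v\<close> to
  \<open>z + v\<close>. The norm along it has slope at most \<open>norm v\<close> in absolute value
  and second derivative \<open>((norm v)\<^sup>2 - (N' \<tau>)\<^sup>2) / N \<tau>\<close>, which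
  lies between 0 and \<open>(norm v)\<^sup>2 / N \<tau>\<close>; the chain rule and the mean value
  theorem do the rest.\<close>

lemma psi_differences:
  assumes v: "norm v \<le> scale z" and z: "z \<noteq> 0"
  shows "\<bar>\<psi> (z + v) - \<psi> z\<bar> \<le> D0 * \<psi> z * norm v / scale z"
    and "\<bar>\<psi> (z + v) + \<psi> (z - v) - 2 * \<psi> z\<bar> \<le> D0 * \<psi> z * (norm v)\<^sup>2 / (scale z)\<^sup>2"
proof -
  let ?l = "scale z"
  define N where "N \<tau> = norm (z + \<tau> *\<^sub>R v)" for \<tau>
  define N' where "N' \<tau> = inner (z + \<tau> *\<^sub>R v) v / N \<tau>" for \<tau>
  have l: "0 < ?l" "?l \<le> 1" using scale_pos[OF z] by (auto simp: scale_def)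
  have near: "norm (\<tau> *\<^sub>R v) \<le> ?l" if "\<bar>\<tau>\<bar> \<le> 1" for \<tau>
  proof -
    have "norm (\<tau> *\<^sub>R v) \<le> 1 * norm v" using that by (simp only: norm_scaleR) (intro mult_right_mono, auto)
    then show ?thesis using v by simp
  qed
  have N: "N \<tau> > 0" "1 / N \<tau> \<le> 1 / ?l" "\<psi> (z + \<tau> *\<^sub>R v) \<le> c1 * 2 powr \<beta> * \<psi> z" if "\<bar>\<tau>\<bar> \<le> 1" for \<tau>
    using norm_near[OF near[OF that] z] psi_near[OF near[OF that] z] by (auto simp: N_def)
  have dN: "(N has_real_derivative N' \<tau>) (at \<tau>)" if "\<bar>\<tau>\<bar> \<le> 1" for \<tau>
  proof -
    have "((\<lambda>\<tau>. z + \<tau> *\<^sub>R v) has_derivative (\<lambda>h. h *\<^sub>R v)) (at \<tau>)"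
      by (auto intro!: derivative_eq_intros)
    from has_derivative_compose[OF this has_derivative_norm] N(1)[OF that]
    have "(N has_derivative (\<lambda>h. inner (sgn (z + \<tau> *\<^sub>R v)) (h *\<^sub>R v))) (at \<tau>)"
      by (simp add: N_def[abs_def] inner_commute)
    moreover have "(\<lambda>h. inner (sgn (z + \<tau> *\<^sub>R v)) (h *\<^sub>R v)) = (*) (N' \<tau>)"
      by (auto simp: N'_def N_def sgn_div_norm divide_inverse mult_ac)
    ultimately show ?thesis by (simp add: has_field_derivative_def)
  qed
  have absN': "\<bar>N' \<tau>\<bar> \<le> norm v" if "\<bar>\<tau>\<bar> \<le> 1" for \<tau>
  proof -
    have "\<bar>inner (z + \<tau> *\<^sub>R v) v\<bar> \<le> N \<tau> * norm v" unfolding N_def by (rule Cauchy_Schwarz_ineq2)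
    then show ?thesis using N(1)[OF that] by (simp add: N'_def abs_div divide_le_eq mult.commute)
  qed
  have dN': "(N' has_real_derivative ((norm v)\<^sup>2 - (N' \<tau>)\<^sup>2) / N \<tau>) (at \<tau>)" if "\<bar>\<tau>\<bar> \<le> 1" for \<tau>
  proof -
    have "((\<lambda>\<tau>. inner (z + \<tau> *\<^sub>R v) v) has_real_derivative inner v v) (at \<tau>)"
      by (auto simp: inner_add_left intro!: derivative_eq_intros)
    from DERIV_divide[OF this dN[OF that]] N(1)[OF that]
    have "((\<lambda>\<tau>. inner (z + \<tau> *\<^sub>R v) v / N \<tau>) has_real_derivative (inner v v * N \<tau> - inner (z + \<tau> *\<^sub>R v) v * N' \<tau>) / (N \<tau> * N \<tau>)) (at \<tau>)"
      by simp
    moreover have "(inner v v * N \<tau> - inner (z + \<tau> *\<^sub>R v) v * N' \<tau>) / (N \<tau> * N \<tau>) = ((norm v)\<^sup>2 - (N' \<tau>)\<^sup>2) / N \<tau>"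
    proof -
      have "inner (z + \<tau> *\<^sub>R v) v = N' \<tau> * N \<tau>" using N(1)[OF that] by (simp add: N'_def)
      moreover have "inner v v = norm v * norm v" by (metis dot_square_norm power2_eq_square)
      ultimately show ?thesis using N(1)[OF that]
        by (simp add: power2_norm_eq_inner power2_eq_square divide_simps) (simp add: algebra_simps)
    qed
    ultimately show ?thesis by (simp add: N'_def[abs_def])
  qed
  define q where "q \<tau> = \<psi> (z + \<tau> *\<^sub>R v)" for \<tau>
  define q' where "q' \<tau> = gp (N \<tau>) * N' \<tau>" for \<tau>
  define q'' where "q'' \<tau> = gpp (N \<tau>) * N' \<tau> * N' \<tau> + ((norm v)\<^sup>2 - (N' \<tau>)\<^sup>2) / N \<tau> * gp (N \<tau>)" for \<tau>
  have qN: "q = (\<lambda>\<tau>. \<phi> (N \<tau> + 1) * N \<tau> powr (- \<beta>))" by (auto simp: q_def psi N_def)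
  have dq: "(q has_real_derivative q' \<tau>) (at \<tau>)" if "\<bar>\<tau>\<bar> \<le> 1" for \<tau>
    unfolding qN q'_def using DERIV_chain2[OF radial_deriv(1)[OF N(1)[OF that]] dN[OF that]] .
  have dq': "(q' has_real_derivative q'' \<tau>) (at \<tau>)" if "\<bar>\<tau>\<bar> \<le> 1" for \<tau>
    unfolding q'_def[abs_def] q''_def
    using DERIV_mult[OF DERIV_chain2[OF radial_deriv(2)[OF N(1)[OF that]] dN[OF that]] dN'[OF that]] by simp
  have gb: "\<bar>gp (N \<tau>)\<bar> \<le> (c2 + \<beta>) * (c1 * 2 powr \<beta> * \<psi> z) / ?l"
    "\<bar>gpp (N \<tau>)\<bar> \<le> (c2 + 2 * \<beta> * c2 + \<beta> * (\<beta> + 1)) * (c1 * 2 powr \<beta> * \<psi> z) / ?l\<^sup>2" if t: "\<bar>\<tau>\<bar> \<le> 1" for \<tau>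
  proof -
    note rb = radial_bounds[OF N(1)[OF t] l N(2)[OF t]]
    have g: "\<phi> (N \<tau> + 1) * N \<tau> powr (- \<beta>) \<le> c1 * 2 powr \<beta> * \<psi> z"
      using N(3)[OF t] by (simp add: psi N_def)
    show "\<bar>gp (N \<tau>)\<bar> \<le> (c2 + \<beta>) * (c1 * 2 powr \<beta> * \<psi> z) / ?l"
      using l c2_ge beta_pos by (intro order_trans[OF rb(1)] divide_right_mono mult_left_mono g) auto
    show "\<bar>gpp (N \<tau>)\<bar> \<le> (c2 + 2 * \<beta> * c2 + \<beta> * (\<beta> + 1)) * (c1 * 2 powr \<beta> * \<psi> z) / ?l\<^sup>2"
      using l c2_ge beta_pos by (intro order_trans[OF rb(2)] divide_right_mono mult_left_mono g) auto
  qed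
  let ?G = "c1 * 2 powr \<beta> * \<psi> z"
  have G: "?G \<ge> 0" using c1_ge psi_nonneg by simp
  have "\<bar>q 1 - q 0\<bar> \<le> (c2 + \<beta>) * ?G / ?l * norm v"
  proof (rule first_difference_le[OF dq])
    fix \<tau> :: real assume t: "\<bar>\<tau>\<bar> \<le> 1"
    show "\<bar>q' \<tau>\<bar> \<le> (c2 + \<beta>) * ?G / ?l * norm v"
      unfolding q'_def abs_mult using gb(1)[OF t] absN'[OF t] G l c2_ge beta_pos by (intro mult_mono) auto
  qed
  also have "\<dots> \<le> 2 * K0 * ?G / ?l * norm v"
    using G l c2_ge beta_pos by (intro mult_right_mono divide_right_mono) (auto simp: K0_def)
  finally show "\<bar>\<psi> (z + v) - \<psi> z\<bar> \<le> D0 * \<psi> z * norm v / ?l" by (simp add: q_def D0_def mult_ac)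
  have "\<bar>q 1 + q (-1) - 2 * q 0\<bar> \<le> 2 * (K0 * ?G / ?l\<^sup>2 * (norm v)\<^sup>2)"
  proof (rule second_difference_le[OF dq dq'])
    fix \<tau> :: real assume t: "\<bar>\<tau>\<bar> \<le> 1"
    have N2: "(N' \<tau>)\<^sup>2 \<le> (norm v)\<^sup>2" using absN'[OF t] by (simp add: abs_le_square_iff[symmetric])
    have "\<bar>q'' \<tau>\<bar> \<le> \<bar>gpp (N \<tau>)\<bar> * (N' \<tau>)\<^sup>2 + ((norm v)\<^sup>2 - (N' \<tau>)\<^sup>2) * (1 / N \<tau>) * \<bar>gp (N \<tau>)\<bar>"
      unfolding q''_def using N(1)[OF t] N2
      by (intro order_trans[OF abs_triangle_ineq]) (auto simp: abs_mult power2_eq_square[symmetric] mult.assoc)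
    also have "\<dots> \<le> ((c2 + 2 * \<beta> * c2 + \<beta> * (\<beta> + 1)) * ?G / ?l\<^sup>2) * (norm v)\<^sup>2
       + (norm v)\<^sup>2 * (1 / ?l) * ((c2 + \<beta>) * ?G / ?l)"
      using gb[OF t] N(1,2)[OF t] N2 G l c2_ge beta_pos by (intro add_mono mult_mono) auto
    also have "\<dots> = K0 * ?G / ?l\<^sup>2 * (norm v)\<^sup>2"
      unfolding K0_def by (simp add: power2_eq_square add_divide_distrib algebra_simps)
    finally show "\<bar>q'' \<tau>\<bar> \<le> K0 * ?G / ?l\<^sup>2 * (norm v)\<^sup>2" .
  qed
  then show "\<bar>\<psi> (z + v) + \<psi> (z - v) - 2 * \<psi> z\<bar> \<le> D0 * \<psi> z * (norm v)\<^sup>2 / ?l\<^sup>2"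
    by (simp add: q_def D0_def mult_ac)
qed

end

subsection \<open>The barrier\<close>

lemma integrable_bounded_mult:
  fixes f \<kappa> :: "'a::euclidean_space \<Rightarrow> real"
  assumes \<kappa>: "integrable lborel \<kappa>" and [measurable]: "f \<in> borel_measurable borel" and B: "\<And>v. \<bar>f v\<bar> \<le> B"
  shows "integrable lborel (\<lambda>v. f v * \<kappa> v)"
proof (rule Bochner_Integration.integrable_bound)
  show "integrable lborel (\<lambda>v. B * \<kappa> v)" using \<kappa> by simp
  show "(\<lambda>v. f v * \<kappa> v) \<in> borel_measurable lborel"
    using borel_measurable_integrable[OF \<kappa>] by measurable
  show "AE v in lborel. norm (f v * \<kappa> v) \<le> norm (B * \<kappa> v)"
    using order_trans[OF B abs_ge_self] by (intro AE_I2) (auto simp: abs_mult intro!: mult_right_mono)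
qed

context profile
begin

text \<open>The on-diagonal exponent; note \<open>\<alpha> * (dlt + 1) = \<beta>\<close>.\<close>

definition dlt :: real where "dlt = CARD('n) / \<alpha>"

lemma dlt_pos: "dlt > 0"
  using alpha card_pos by (simp add: dlt_def)

text \<open>The amplitudes \<open>L\<close> and \<open>c\<close> stay free until the constants are
  balanced. The value at the origin is set by hand because \<psi> vanishes there in HOL, where it
  should be infinite.\<close>

definition H :: "real \<Rightarrow> real \<Rightarrow> real \<Rightarrow> real ^ 'n \<Rightarrow> real" where
  "H L c s z = (if z = 0 then L * s powr (- dlt) else min (L * s powr (- dlt)) (c * s * \<psi> z))"

text \<open>What is used of the jump density \<open>v \<mapsto> ke \<epsilon> x (x + v)\<close> at a
  fixed point. Integrability enters only qualitatively, so that no estimate derived from it depends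
  on \<epsilon>.\<close>

definition admissible :: "(real ^ 'n \<Rightarrow> real) \<Rightarrow> bool" where
  "admissible \<kappa> \<longleftrightarrow> integrable lborel \<kappa> \<and> \<kappa> \<in> borel_measurable borel \<and>
     (\<forall>v. 0 \<le> \<kappa> v \<and> \<kappa> v \<le> M * \<phi> (norm v) * norm v powr (- \<beta>)) \<and> ((\<forall>v. \<kappa> (- v) = \<kappa> v) \<or> \<alpha> < 1)"

lemma admissible_le: "admissible \<kappa> \<Longrightarrow> \<kappa> v \<le> M * norm v powr (- \<beta>)"
proof -
  assume "admissible \<kappa>"
  then have "\<kappa> v \<le> M * \<phi> (norm v) * norm v powr (- \<beta>)" by (auto simp: admissible_def)
  also have "\<dots> \<le> M * 1 * norm v powr (- \<beta>)"
    using M phi_range[of "norm v"] by (intro mult_right_mono mult_left_mono) auto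
  finally show ?thesis by simp
qed

lemma H_meas [measurable]: "H L c s \<in> borel_measurable borel"
  unfolding H_def[abs_def] by measurable

lemma H_bounds:
  assumes "L > 0" "c > 0" "s > 0"
  shows "0 \<le> H L c s z" "H L c s z \<le> L * s powr (- dlt)" "z \<noteq> 0 \<Longrightarrow> H L c s z \<le> c * s * \<psi> z"
  using assms psi_nonneg[of z] by (auto simp: H_def)

lemma local_constants:
  obtains C1 C2 where "C1 > 0" "\<And>r. \<alpha> < 1 \<Longrightarrow> r > 0 \<Longrightarrow>
     (\<integral>\<^sup>+v. ennreal (norm v powr ((1 - \<alpha>) - DIM(real ^ 'n))) * indicator {v. norm v \<le> r} (v :: real ^ 'n) \<partial>lborel)
      \<le> ennreal (C1 * r powr (1 - \<alpha>))" "C2 > 0"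
    "\<And>r. r > 0 \<Longrightarrow> (\<integral>\<^sup>+v. ennreal (norm v powr ((2 - \<alpha>) - DIM(real ^ 'n))) * indicator {v. norm v \<le> r} (v :: real ^ 'n) \<partial>lborel)
      \<le> ennreal (C2 * r powr (2 - \<alpha>))"
proof -
  have a2: "2 - \<alpha> > 0" using alpha by simp
  obtain C2 where C2: "C2 > 0"
    "\<And>r. r > 0 \<Longrightarrow> (\<integral>\<^sup>+v. ennreal (norm v powr ((2 - \<alpha>) - DIM(real ^ 'n))) * indicator {v. norm v \<le> r} (v :: real ^ 'n) \<partial>lborel)
      \<le> ennreal (C2 * r powr (2 - \<alpha>))"
    using nn_integral_norm_powr_ball[OF a2, where 'a = "real ^ 'n"] by blast
  show thesis
  proof (cases "\<alpha> < 1")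
    case True
    then have a1: "1 - \<alpha> > 0" by simp
    obtain C1 where C1: "C1 > 0"
      "\<And>r. r > 0 \<Longrightarrow> (\<integral>\<^sup>+v. ennreal (norm v powr ((1 - \<alpha>) - DIM(real ^ 'n))) * indicator {v. norm v \<le> r} (v :: real ^ 'n) \<partial>lborel)
        \<le> ennreal (C1 * r powr (1 - \<alpha>))"
      using nn_integral_norm_powr_ball[OF a1, where 'a = "real ^ 'n"] by blast
    show thesis by (rule that[OF C1(1) _ C2]) (rule C1(2))
  next
    case False
    show thesis by (rule that[OF zero_less_one _ C2]) (use False in simp)
  qed
qed

lemma tail_meas:
  "(\<lambda>y :: real ^ 'n. ennreal (norm y powr a) * indicator {v. R < norm v} y) \<in> borel_measurable lborel"
proof -
  have "open {v :: real ^ 'n. R < norm v}" by (intro open_Collect_less continuous_intros)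
  then have [measurable]: "{v :: real ^ 'n. R < norm v} \<in> sets borel" by simp
  show ?thesis by measurable
qed

text \<open>The two branches meet roughly at the radius \<open>R\<close>, where
  \<open>L * s powr (- dlt) = c * s * R powr (- \<beta>)\<close>. The plateau and the tail then both
  have mass of order \<open>c * (L / c) powr (\<alpha> / \<beta>)\<close>, independent of
  \<open>s\<close> and small compared with \<open>c\<close> when \<open>c\<close> is large compared
  with \<open>L\<close>.\<close>

lemma H_mass:
  obtains A where "A > 0"
    "\<And>L c s. L > 0 \<Longrightarrow> c > 0 \<Longrightarrow> s > 0 \<Longrightarrow>
      (\<integral>\<^sup>+y. ennreal (H L c s y) \<partial>lborel) \<le> ennreal (A * (c * (L / c) powr (\<alpha> / \<beta>)))"
proof -
  obtain \<omega> where \<omega>: "\<omega> > 0"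
    "\<And>r. r > 0 \<Longrightarrow> (\<integral>\<^sup>+v. ennreal (norm v powr (- \<alpha> - DIM(real ^ 'n))) * indicator {v. r < norm v} (v :: real ^ 'n) \<partial>lborel)
      \<le> ennreal (\<omega> * r powr (- \<alpha>))"
    using nn_integral_norm_powr_tail[OF alpha(1)] by blast
  let ?V = "unit_ball_vol (real CARD('n))"
  show thesis
  proof (rule that)
    show "?V + \<omega> > 0" using \<omega>(1) by (simp add: add_nonneg_pos)
    fix L c s :: real assume p: "L > 0" "c > 0" "s > 0"
    define x where "x = L / c"
    have x: "x > 0" "L = c * x" using p by (auto simp: x_def)
    define R where "R = x powr (- 1 / \<beta>) * s powr (1 / \<alpha>)"
    have R: "R > 0" using x p by (simp add: R_def)
    have Rd: "R ^ CARD('n) = x powr (\<alpha> / \<beta> - 1) * s powr dlt"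
    proof -
      have "R ^ CARD('n) = R powr CARD('n)" using R by (simp add: powr_realpow)
      also have "\<dots> = x powr (- 1 / \<beta> * CARD('n)) * s powr dlt"
        using x p by (simp add: R_def powr_mult powr_powr dlt_def)
      also have "- 1 / \<beta> * CARD('n) = \<alpha> / \<beta> - 1" using beta beta_pos by (simp add: field_simps)
      finally show ?thesis .
    qed
    have Ra: "R powr (- \<alpha>) = x powr (\<alpha> / \<beta>) * s powr (- 1)"
      using x p alpha by (simp add: R_def powr_mult powr_powr)
    have "(\<integral>\<^sup>+y. ennreal (H L c s y) \<partial>lborel)
       \<le> (\<integral>\<^sup>+y. ennreal (L * s powr (- dlt)) * indicator (cball 0 R) y
           + ennreal (c * s) * (ennreal (norm y powr (- \<alpha> - DIM(real ^ 'n))) * indicator {v. R < norm v} (y :: real ^ 'n)) \<partial>lborel)"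
    proof (intro nn_integral_mono)
      fix y :: "real ^ 'n"
      show "ennreal (H L c s y) \<le> ennreal (L * s powr (- dlt)) * indicator (cball 0 R) y
           + ennreal (c * s) * (ennreal (norm y powr (- \<alpha> - DIM(real ^ 'n))) * indicator {v. R < norm v} y)"
      proof (cases "norm y \<le> R")
        case True
        then show ?thesis using H_bounds(2)[OF p, of y] by (simp add: ennreal_leI)
      next
        case False
        then have "y \<noteq> 0" using R by auto
        then have "H L c s y \<le> c * s * \<psi> y" using H_bounds(3)[OF p] by blast
        also have "\<dots> \<le> c * s * norm y powr (- \<beta>)" using p by (intro mult_left_mono psi_le) auto
        finally have "ennreal (H L c s y) \<le> ennreal (c * s) * ennreal (norm y powr (- \<beta>))"
          using p by (simp add: ennreal_leI flip: ennreal_mult)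
        then show ?thesis using False by (simp add: beta)
      qed
    qed
    also have "\<dots> = (\<integral>\<^sup>+y. ennreal (L * s powr (- dlt)) * indicator (cball 0 R) (y :: real ^ 'n) \<partial>lborel)
      + (\<integral>\<^sup>+y. ennreal (c * s) * (ennreal (norm y powr (- \<alpha> - DIM(real ^ 'n))) * indicator {v. R < norm v} (y :: real ^ 'n)) \<partial>lborel)"
      by (intro nn_integral_add borel_measurable_times_ennreal borel_measurable_const tail_meas borel_measurable_indicator) simp
    also have "\<dots> = ennreal (L * s powr (- dlt)) * emeasure lborel (cball 0 R :: (real ^ 'n) set)
      + ennreal (c * s) * (\<integral>\<^sup>+y. (ennreal (norm y powr (- \<alpha> - DIM(real ^ 'n))) * indicator {v. R < norm v} (y :: real ^ 'n)) \<partial>lborel)"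
      by (intro arg_cong2[where f = "(+)"] nn_integral_cmult_indicator nn_integral_cmult tail_meas) simp
    also have "\<dots> \<le> ennreal (L * s powr (- dlt)) * ennreal (?V * R ^ CARD('n)) + ennreal (c * s) * ennreal (\<omega> * R powr (- \<alpha>))"
      using R by (intro add_mono mult_left_mono \<omega>(2)) (auto simp: emeasure_cball)
    also have "\<dots> = ennreal (L * s powr (- dlt) * (?V * R ^ CARD('n)) + c * s * (\<omega> * R powr (- \<alpha>)))"
      using p R \<omega>(1) by (simp add: ennreal_mult ennreal_plus)
    also have "L * s powr (- dlt) * (?V * R ^ CARD('n)) = ?V * (c * x powr (\<alpha> / \<beta>))"
    proof -
      have "x * x powr (\<alpha> / \<beta> - 1) = x powr (\<alpha> / \<beta>)" using x by (simp add: powr_diff)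
      moreover have "s powr (- dlt) * s powr dlt = 1" using p by (simp flip: powr_add)
      moreover have "L * s powr (- dlt) * (?V * R ^ CARD('n))
        = ?V * (c * (x * x powr (\<alpha> / \<beta> - 1))) * (s powr (- dlt) * s powr dlt)"
        unfolding Rd x(2) by (simp add: mult_ac)
      ultimately show ?thesis by simp
    qed
    also have "c * s * (\<omega> * R powr (- \<alpha>)) = \<omega> * (c * x powr (\<alpha> / \<beta>))"
      unfolding Ra using p by (simp add: powr_minus)
    finally show "(\<integral>\<^sup>+y. ennreal (H L c s y) \<partial>lborel) \<le> ennreal ((?V + \<omega>) * (c * (L / c) powr (\<alpha> / \<beta>)))"
      by (simp add: x_def distrib_right)
  qed
qed

text \<open>Small jumps at \<open>z\<close> act at a rate of order
  \<open>scale z powr (- \<alpha>)\<close>; this bounds their effect over time \<open>s\<close>.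
  Where the \<psi> branch is active, \<open>norm z\<close> cannot be small compared with the meeting
  radius of the two branches; raising \<open>\<psi> z \<le> L / c * s powr (- dlt - 1)\<close> to
  the power \<open>\<alpha> / \<beta>\<close> makes this quantitative. Beyond distance 1 the scale
  is constant and the summand \<open>s\<close> suffices.\<close>

lemma scale_powr_le:
  assumes p: "0 < L" "0 < c" "0 < s" and z: "z \<noteq> 0" and out: "c * s * \<psi> z \<le> L * s powr (- dlt)"
  shows "s * scale z powr (- \<alpha>) \<le> 2 powr \<alpha> * (1 + c1 ^ 3) * (s + (L / c) powr (\<alpha> / \<beta>))"
proof -
  let ?\<xi> = "(L / c) powr (\<alpha> / \<beta>)"
  have c13: "c1 ^ 3 \<ge> 1" "c1 \<ge> 0" using c1_ge by (simp_all add: one_le_power)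
  show ?thesis
  proof (cases "norm z \<ge> 1")
    case True
    then have "scale z powr (- \<alpha>) = 2 powr \<alpha>" by (simp add: scale_def powr_divide powr_minus)
    moreover have "2 powr \<alpha> * s \<le> 2 powr \<alpha> * ((1 + c1 ^ 3) * (s + ?\<xi>))"
      using c13 p mult_mono[of 1 "1 + c1 ^ 3" s "s + ?\<xi>"] by (intro mult_left_mono) auto
    ultimately show ?thesis by (simp add: mult_ac)
  next
    case False
    let ?r = "norm z"
    have r: "0 < ?r" "?r < 1" using z False by auto
    have sc: "scale z powr (- \<alpha>) = 2 powr \<alpha> * ?r powr (- \<alpha>)"

    proof -
      have "scale z = ?r * (1/2)" using r by (simp add: scale_def)
      then have "scale z powr (- \<alpha>) = ?r powr (- \<alpha>) * (1/2) powr (- \<alpha>)" by (simp only: powr_mult)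
      moreover have "(1/2) powr (- \<alpha>) = 2 powr \<alpha>" by (simp add: powr_minus powr_divide)
      ultimately show ?thesis by simp
    qed
    have "?r powr (- \<beta>) * 1 \<le> ?r powr (- \<beta>) * (c1 ^ 3 * \<phi> (?r + 1))"
      using r by (intro mult_left_mono phi_low) auto
    then have "c * s * ?r powr (- \<beta>) \<le> c * s * (c1 ^ 3 * \<psi> z)"
      using p by (intro mult_left_mono) (auto simp: psi mult_ac)
    also have "\<dots> \<le> c1 ^ 3 * (L * s powr (- dlt))"
      using mult_left_mono[OF out, of "c1 ^ 3"] c13 by (simp add: mult_ac)
    finally have "?r powr (- \<beta>) \<le> c1 ^ 3 * (L / c) * (s powr (- dlt) / s)"
      using p by (simp add: field_simps)
    also have "s powr (- dlt) / s = s powr (- dlt - 1)" using p by (simp add: powr_diff)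
    finally have "(?r powr (- \<beta>)) powr (\<alpha> / \<beta>) \<le> (c1 ^ 3 * (L / c) * s powr (- dlt - 1)) powr (\<alpha> / \<beta>)"
      using alpha beta_pos by (intro powr_mono2) auto
    also have "\<dots> = (c1 ^ 3) powr (\<alpha> / \<beta>) * ?\<xi> * (s powr (- dlt - 1)) powr (\<alpha> / \<beta>)"
    proof -
      have "0 \<le> c1 ^ 3" "0 \<le> L / c" "0 \<le> c1 ^ 3 * (L / c)" "0 \<le> s powr (- dlt - 1)" using p c13 by auto
      then show ?thesis by (simp only: powr_mult)
    qed
    also have "(s powr (- dlt - 1)) powr (\<alpha> / \<beta>) = s powr (- 1)"
    proof -
      have "(- dlt - 1) * \<alpha> = - \<beta>" using alpha by (simp add: dlt_def beta field_simps)
      then have "(- dlt - 1) * (\<alpha> / \<beta>) = - 1" using beta_pos by (simp only: times_divide_eq_right) simp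
      then show ?thesis by (simp only: powr_powr)
    qed
    finally have "?r powr (- \<alpha>) \<le> (c1 ^ 3) powr (\<alpha> / \<beta>) * ?\<xi> * s powr (- 1)"
      using beta_pos by (simp add: powr_powr)
    then have "s * ?r powr (- \<alpha>) \<le> (c1 ^ 3) powr (\<alpha> / \<beta>) * ?\<xi>"
      using p by (simp add: powr_minus field_simps)
    also have "\<dots> \<le> (c1 ^ 3) powr 1 * ?\<xi>"
      using c13 alpha beta_pos card_pos by (intro mult_right_mono powr_mono) (auto simp: beta)
    also have "\<dots> \<le> (1 + c1 ^ 3) * (s + ?\<xi>)"
      using c13 p by (intro mult_mono) auto
    finally have "2 powr \<alpha> * (s * ?r powr (- \<alpha>)) \<le> 2 powr \<alpha> * ((1 + c1 ^ 3) * (s + ?\<xi>))" by (intro mult_left_mono) auto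
    then show ?thesis unfolding sc by (simp add: mult_ac)
  qed
qed

section \<open>Large jumps\<close>

definition A0 :: real where "A0 = M * 2 powr \<beta> * c1 ^ 3"

lemma A0_facts: "A0 \<ge> 0" "M * 2 powr \<beta> * c1 \<le> A0" "M * 2 powr \<beta> * c1\<^sup>2 \<le> A0" "M * c1 \<le> A0"
proof -
  have "c1 \<le> c1 ^ 3" "c1\<^sup>2 \<le> c1 ^ 3" using c1_ge self_le_power[of c1 3] power_increasing[of 2 3 c1] by auto
  moreover have "2 powr \<beta> \<ge> (1::real)" using beta_pos by (simp add: ge_one_powr_ge_zero)
  ultimately show "A0 \<ge> 0" "M * 2 powr \<beta> * c1 \<le> A0" "M * 2 powr \<beta> * c1\<^sup>2 \<le> A0" "M * c1 \<le> A0"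
    using M c1_ge mult_mono[of 1 "2 powr \<beta>" c1 "c1 ^ 3"] by (auto simp: A0_def mult.assoc)
qed

text \<open>Of \<open>v\<close> and \<open>y = z + v\<close> at least one has length at least
  \<open>norm z / 2\<close>, and the density at it is comparable with \<open>\<psi> z\<close> as
  long as \<phi> can be compared. If it is \<open>v\<close>, the remaining factor is
  \<open>H\<close> (first term); if it is \<open>y\<close>, it is the jump tail (second term).
  \<phi> can be compared when \<open>z\<close> is bounded, or when the other of the two vectors has
  length at most 1, since then the norms differ by at most 1. The remaining case is left to the
  convolution condition (third term).\<close>

lemma large_jump_pointwise:
  assumes p: "L > 0" "c > 0" "s > 0" and z: "z \<noteq> 0" and v: "scale z < norm v"
    and \<kappa>: "admissible \<kappa>"
  defines "y \<equiv> z + v"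
  shows "H L c s y * \<kappa> v \<le> \<psi> z * A0 * H L c s y + \<psi> z * A0 * c * s * norm v powr (- \<beta>)
    + A0 * c * s * (if 3 < norm z \<and> 1 \<le> norm v \<and> 1 \<le> norm y
        then \<phi> (norm y) / norm y powr \<beta> * (\<phi> (norm v) / norm v powr \<beta>) else 0)"
    (is "_ \<le> ?a + ?b + ?c")
proof -
  have phiv: "0 < \<phi> (norm v)" "0 < \<phi> (norm y)" and phiz: "0 < \<phi> (norm z + 1)" using phi_range(1) by auto
  have \<kappa>0: "0 \<le> \<kappa> v" and \<kappa>1: "\<kappa> v \<le> M * \<phi> (norm v) * norm v powr (- \<beta>)"
    using \<kappa> by (auto simp: admissible_def)
  note \<kappa>2 = admissible_le[OF \<kappa>, of v]
  have H0: "0 \<le> H L c s y" using H_bounds(1)[OF p] .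
  have nonneg: "0 \<le> ?a" "0 \<le> ?b" "0 \<le> ?c"
    using psi_nonneg[of z] A0_facts(1) H0 p phiv by auto
  have Hy: "H L c s y \<le> c * s * \<psi> y" if "y \<noteq> 0" using H_bounds(3)[OF p that] .
  have tri: "norm z \<le> norm y + norm v" using norm_triangle_ineq4[of y v] by (simp add: y_def)
  have A: ?thesis if "\<kappa> v \<le> \<psi> z * A0"
  proof -
    have "H L c s y * \<kappa> v \<le> ?a" using mult_left_mono[OF that H0] by (simp add: mult_ac)
    then show ?thesis using nonneg by linarith
  qed
  have B: ?thesis if "y \<noteq> 0" "\<psi> y * M \<le> \<psi> z * A0"
  proof -
    have "H L c s y * \<kappa> v \<le> (c * s * \<psi> y) * (M * norm v powr (- \<beta>))"
      using Hy[OF that(1)] \<kappa>2 \<kappa>0 H0 p psi_nonneg[of y] by (intro mult_mono) auto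
    also have "\<dots> = (\<psi> y * M) * (c * s * norm v powr (- \<beta>))" by simp
    also have "\<dots> \<le> (\<psi> z * A0) * (c * s * norm v powr (- \<beta>))" using p by (intro mult_right_mono that) auto
    finally show ?thesis using nonneg by (simp add: mult_ac)
  qed
  show ?thesis
  proof (cases "norm z \<le> 3")
    case True
    \<comment> \<open>Here \<phi> is bounded below by \<open>phi_low\<close>, so that only the
      powers of the norms matter.\<close>
    have zb: "norm z powr (- \<beta>) \<le> c1 ^ 3 * \<psi> z"
    proof -
      have "norm z powr (- \<beta>) * 1 \<le> norm z powr (- \<beta>) * (c1 ^ 3 * \<phi> (norm z + 1))"
        using True by (intro mult_left_mono phi_low) auto
      then show ?thesis by (simp add: psi mult_ac)
    qed
    have M2: "M * (2 powr \<beta> * norm z powr (- \<beta>)) \<le> \<psi> z * A0"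
    proof -
      have "M * 2 powr \<beta> * norm z powr (- \<beta>) \<le> M * 2 powr \<beta> * (c1 ^ 3 * \<psi> z)"
        using M zb by (intro mult_left_mono) auto
      then show ?thesis by (simp add: A0_def mult_ac)
    qed
    show ?thesis
    proof (cases "norm y \<le> norm z / 2")
      case True
      then have "norm v powr (- \<beta>) \<le> 2 powr \<beta> * norm z powr (- \<beta>)" using tri z by (intro powr_half_le) auto
      then have "M * norm v powr (- \<beta>) \<le> M * (2 powr \<beta> * norm z powr (- \<beta>))" using M by (intro mult_left_mono) auto
      then show ?thesis using \<kappa>2 M2 by (intro A) linarith
    next
      case False
      then have "norm y powr (- \<beta>) \<le> 2 powr \<beta> * norm z powr (- \<beta>)" using z by (intro powr_half_le) auto
      then have "M * \<psi> y \<le> M * (2 powr \<beta> * norm z powr (- \<beta>))" using M psi_le[of y] by (intro mult_left_mono) auto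
      moreover have "y \<noteq> 0" using False z by auto
      ultimately show ?thesis using M2 by (intro B) (auto simp: mult.commute)
    qed
  next
    case False
    show ?thesis
    proof (cases "norm y \<le> 1")
      case True
      \<comment> \<open>The landing point is within 1 of the origin, so \<open>norm v\<close>
        differs from \<open>norm z\<close> by at most 1. One comparison of \<phi> passes from
        \<open>v\<close> to \<open>z\<close>, a second one introduces the shift in \<psi>.\<close>
      have nv: "norm z / 2 \<le> norm v" "\<bar>norm v - norm z\<bar> \<le> 1"
        using True False tri norm_triangle_ineq3[of "- v" z] norm_minus_commute[of z "- v"] by (auto simp: y_def)
      have "norm v powr (- \<beta>) \<le> 2 powr \<beta> * norm z powr (- \<beta>)" using nv z by (intro powr_half_le) auto
      moreover have "\<phi> (norm v) \<le> c1\<^sup>2 * \<phi> (norm z + 1)"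
      proof -
        have "\<phi> (norm v) \<le> c1 * \<phi> (norm z)" using nv by (intro phi_comp) auto
        also have "\<dots> \<le> c1 * (c1 * \<phi> (norm z + 1))" using c1_ge by (intro mult_left_mono phi_shift) auto
        finally show ?thesis by (simp add: power2_eq_square)
      qed
      ultimately have "M * \<phi> (norm v) * norm v powr (- \<beta>) \<le> M * (c1\<^sup>2 * \<phi> (norm z + 1)) * (2 powr \<beta> * norm z powr (- \<beta>))"
        using M phiv phiz c1_ge by (intro mult_mono) auto
      also have "\<dots> = (M * 2 powr \<beta> * c1\<^sup>2) * \<psi> z" by (simp add: psi mult_ac)
      also have "\<dots> \<le> A0 * \<psi> z" using A0_facts psi_nonneg by (intro mult_right_mono)
      finally show ?thesis using \<kappa>1 by (intro A) (simp add: mult.commute)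
    next
      case y1: False
      then have y0: "y \<noteq> 0" by auto
      show ?thesis
      proof (cases "norm v \<le> 1")
        case True
        have ny: "norm z / 2 \<le> norm y" "\<bar>norm y - norm z\<bar> \<le> 1"
          using True False tri norm_triangle_ineq3[of y z] by (auto simp: y_def)
        have "norm y powr (- \<beta>) \<le> 2 powr \<beta> * norm z powr (- \<beta>)" using ny z by (intro powr_half_le) auto
        moreover have "\<phi> (norm y + 1) \<le> c1 * \<phi> (norm z + 1)" using ny by (intro phi_comp) auto
        ultimately have "\<psi> y \<le> (c1 * \<phi> (norm z + 1)) * (2 powr \<beta> * norm z powr (- \<beta>))"
          unfolding psi using c1_ge phiz by (intro mult_mono) auto
        then have "\<psi> y * M \<le> (c1 * \<phi> (norm z + 1)) * (2 powr \<beta> * norm z powr (- \<beta>)) * M"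
          using M by (intro mult_right_mono) auto
        also have "\<dots> = (M * 2 powr \<beta> * c1) * \<psi> z" by (simp add: psi mult_ac)
        also have "\<dots> \<le> A0 * \<psi> z" using A0_facts psi_nonneg by (intro mult_right_mono)
        finally show ?thesis by (intro B[OF y0]) (simp add: mult.commute)
      next
        case v1: False
        have "\<psi> y \<le> c1 * \<phi> (norm y) * norm y powr (- \<beta>)"
          unfolding psi by (intro mult_right_mono phi_shift) auto
        then have "c * s * \<psi> y \<le> c * s * (c1 * \<phi> (norm y) * norm y powr (- \<beta>))" using p by (intro mult_left_mono) auto
        then have "H L c s y * \<kappa> v \<le> (c * s * (c1 * \<phi> (norm y) * norm y powr (- \<beta>))) * (M * \<phi> (norm v) * norm v powr (- \<beta>))"
          using order_trans[OF Hy[OF y0]] \<kappa>1 \<kappa>0 H0 p c1_ge phiv by (intro mult_mono) auto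
        also have "\<dots> = (M * c1) * (c * s * (\<phi> (norm y) / norm y powr \<beta> * (\<phi> (norm v) / norm v powr \<beta>)))"
          by (simp add: powr_minus divide_inverse mult_ac)
        also have "\<dots> \<le> A0 * (c * s * (\<phi> (norm y) / norm y powr \<beta> * (\<phi> (norm v) / norm v powr \<beta>)))"
          using p phiv by (intro mult_right_mono A0_facts) auto
        also have "\<dots> = ?c" using v1 y1 False by simp
        finally show ?thesis using nonneg by linarith
      qed
    qed
  qed
qed

text \<open>At \<open>z\<close> the barrier touches \<open>c * s * \<psi>\<close> from below, so
  jumps within \<open>scale z\<close> are bounded by differences of \<psi>; for longer jumps the
  negative term is dropped and the pointwise bound is integrated. Measured against
  \<open>c * \<psi> z\<close>, the time derivative of the active branch, the result is a multiple of
  \<open>s\<close> plus a term that is small when \<open>c\<close> is large compared with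
  \<open>L\<close>.\<close>

lemma barrier:
  obtains A where "A > 0"
    "\<And>L c s z \<kappa>. L > 0 \<Longrightarrow> c > 0 \<Longrightarrow> s > 0 \<Longrightarrow> z \<noteq> 0 \<Longrightarrow> admissible \<kappa> \<Longrightarrow>
      c * s * \<psi> z \<le> L * s powr (- dlt) \<Longrightarrow>
      (LINT v|lborel. (H L c s (z + v) - H L c s z) * \<kappa> v) \<le> c * \<psi> z * A * (s + (L / c) powr (\<alpha> / \<beta>))"
proof -
  obtain \<omega> where \<omega>: "\<omega> > 0"
    "\<And>r. r > 0 \<Longrightarrow> (\<integral>\<^sup>+v. ennreal (norm v powr (- \<alpha> - DIM(real ^ 'n))) * indicator {v. r < norm v} (v :: real ^ 'n) \<partial>lborel)
      \<le> ennreal (\<omega> * r powr (- \<alpha>))"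
    using nn_integral_norm_powr_tail[OF alpha(1)] by blast
  obtain C1 C2 where C1: "C1 > 0" "\<And>r. \<alpha> < 1 \<Longrightarrow> r > 0 \<Longrightarrow>
     (\<integral>\<^sup>+v. ennreal (norm v powr ((1 - \<alpha>) - DIM(real ^ 'n))) * indicator {v. norm v \<le> r} (v :: real ^ 'n) \<partial>lborel)
      \<le> ennreal (C1 * r powr (1 - \<alpha>))" and C2: "C2 > 0"
    "\<And>r. r > 0 \<Longrightarrow> (\<integral>\<^sup>+v. ennreal (norm v powr ((2 - \<alpha>) - DIM(real ^ 'n))) * indicator {v. norm v \<le> r} (v :: real ^ 'n) \<partial>lborel)
      \<le> ennreal (C2 * r powr (2 - \<alpha>))"
    using local_constants by blast
  obtain Am where Am: "Am > 0" "\<And>L c s. L > 0 \<Longrightarrow> c > 0 \<Longrightarrow> s > 0 \<Longrightarrow>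
      (\<integral>\<^sup>+y. ennreal (H L c s y) \<partial>lborel) \<le> ennreal (Am * (c * (L / c) powr (\<alpha> / \<beta>)))"
    using H_mass by blast
  define E where "E = 2 powr \<alpha> * (1 + c1 ^ 3)"
  define A where "A = D0 * M * (C1 + C2) * E + A0 * Am + A0 * \<omega> * E + A0 * c3 * c1 + 1"
  have E: "E \<ge> 0" using c1_ge by (simp add: E_def)
  note A0 = A0_facts(1)
  show thesis
  proof (rule that)
    show "A > 0" using D0_nonneg M C1(1) C2(1) E A0 Am(1) \<omega>(1) c3 c1_ge by (auto simp: A_def intro!: add_nonneg_pos add_nonneg_nonneg)
    fix L c s :: real and z :: "real ^ 'n" and \<kappa>
    assume p: "L > 0" "c > 0" "s > 0" and z: "z \<noteq> 0" and \<kappa>: "admissible \<kappa>" and out: "c * s * \<psi> z \<le> L * s powr (- dlt)"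
    have \<kappa>i: "integrable lborel \<kappa>" and [measurable]: "\<kappa> \<in> borel_measurable borel" and \<kappa>0: "\<And>v. 0 \<le> \<kappa> v"
      and \<kappa>s: "(\<forall>v. \<kappa> (- v) = \<kappa> v) \<or> \<alpha> < 1" using \<kappa> by (auto simp: admissible_def)
    let ?\<xi> = "(L / c) powr (\<alpha> / \<beta>)" and ?l = "scale z" and ?H = "H L c s"
    note l = scale_pos[OF z]
    have sl: "s * ?l powr (- \<alpha>) \<le> E * (s + ?\<xi>)" using scale_powr_le[OF p z out] by (simp add: E_def)
    let ?I = "indicator {v. norm v \<le> ?l} :: real ^ 'n \<Rightarrow> real"
    have Hz: "?H z = c * s * \<psi> z" using z out by (simp add: H_def)
    let ?m = "L * s powr (- dlt)"
    have Hb: "\<bar>?H y - ?H z\<bar> \<le> ?m" for y using H_bounds(1,2)[OF p, of y] H_bounds(1,2)[OF p, of z] by linarith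
    have i1: "integrable lborel (\<lambda>v. (?I v * (?H (z + v) - ?H z)) * \<kappa> v)"
      using Hb p by (intro integrable_bounded_mult[OF \<kappa>i, where B = ?m]) (auto simp: indicator_def)
    have i2: "integrable lborel (\<lambda>v. ((1 - ?I v) * (?H (z + v) - ?H z)) * \<kappa> v)"
      using Hb p by (intro integrable_bounded_mult[OF \<kappa>i, where B = ?m]) (auto simp: indicator_def)
    have i3: "integrable lborel (\<lambda>v. ((1 - ?I v) * ?H (z + v)) * \<kappa> v)"
      using H_bounds(1,2)[OF p] p by (intro integrable_bounded_mult[OF \<kappa>i, where B = ?m]) (auto simp: indicator_def)
    define w where "w v = c * s * (\<psi> (z + v) - \<psi> z)" for v
    have w_meas[measurable]: "w \<in> borel_measurable borel" unfolding w_def[abs_def] by measurable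
    define B where "B = c * s * (D0 * \<psi> z)"
    have B: "B \<ge> 0" using p D0_nonneg psi_nonneg by (simp add: B_def)
    have w1: "\<bar>w v\<bar> \<le> B * norm v / ?l" if "norm v \<le> ?l" for v
      using mult_left_mono[OF psi_differences(1)[OF that z], of "c * s"] p
      by (simp add: w_def B_def abs_mult mult_ac)
    have w2: "\<bar>w v + w (- v)\<bar> \<le> B * (norm v)\<^sup>2 / ?l\<^sup>2" if "norm v \<le> ?l" for v
    proof -
      have "w v + w (- v) = c * s * (\<psi> (z + v) + \<psi> (z - v) - 2 * \<psi> z)" by (simp add: w_def algebra_simps)
      then show ?thesis
        using mult_left_mono[OF psi_differences(2)[OF that z], of "c * s"] p by (simp add: B_def abs_mult mult_ac)
    qed
    have wB: "\<bar>?I v * w v\<bar> \<le> B" for v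
    proof (cases "norm v \<le> ?l")
      case True
      then have "B * norm v / ?l \<le> B * ?l / ?l" using B l by (intro divide_right_mono mult_left_mono) auto
      then show ?thesis using w1[OF True] True l by simp
    qed (use B in auto)
    have iw: "integrable lborel (\<lambda>v. (?I v * w v) * \<kappa> v)"
      using wB by (intro integrable_bounded_mult[OF \<kappa>i, where B = B]) auto
    have "(LINT v|lborel. (?I v * (?H (z + v) - ?H z)) * \<kappa> v) \<le> (LINT v|lborel. (?I v * w v) * \<kappa> v)"
    proof (rule integral_mono[OF i1 iw])
      fix v
      show "(?I v * (?H (z + v) - ?H z)) * \<kappa> v \<le> (?I v * w v) * \<kappa> v"
      proof (cases "norm v \<le> ?l")
        case True
        then have "z + v \<noteq> 0" using norm_near(3)[OF _ z] by blast
        then have "?H (z + v) - ?H z \<le> w v" using H_bounds(3)[OF p, of "z + v"] by (simp add: Hz w_def algebra_simps)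
        then show ?thesis using \<kappa>0 by (intro mult_right_mono mult_left_mono) auto
      qed simp
    qed
    also have "\<dots> \<le> B * M * (C1 + C2) * ?l powr (- \<alpha>)"
    proof -
      have "\<bar>LINT v|lborel. ?I v * (w v * \<kappa> v)\<bar> \<le> B * M * (C1 + C2) * ?l powr (- \<alpha>)"
      proof (rule local_integral_le)
        show "\<kappa> v \<le> M * norm v powr (- \<alpha> - real DIM(real ^ 'n))" for v
          using admissible_le[OF \<kappa>, of v] by (simp add: beta)
      qed (use iw \<kappa>0 B M C1 C2 l \<kappa>s w1 w2 in \<open>auto simp: mult.assoc\<close>)
      then show ?thesis by (simp add: mult.assoc)
    qed
    also have "\<dots> = c * \<psi> z * (D0 * M * (C1 + C2)) * (s * ?l powr (- \<alpha>))" by (simp add: B_def mult_ac)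
    also have "\<dots> \<le> c * \<psi> z * (D0 * M * (C1 + C2)) * (E * (s + ?\<xi>))"
      using p psi_nonneg[of z] D0_nonneg M C1 C2 by (intro mult_left_mono sl) auto
    finally have I1: "(LINT v|lborel. (?I v * (?H (z + v) - ?H z)) * \<kappa> v) \<le> c * \<psi> z * (D0 * M * (C1 + C2)) * (E * (s + ?\<xi>))" .
    \<comment> \<open>The integrals of the three terms of \<open>large_jump_pointwise\<close>: the
      mass of \<open>H\<close>, the jump tail beyond \<open>scale z\<close>, and the
      convolution.\<close>
    define X where "X = \<psi> z * A0 * (Am * (c * ?\<xi>)) + \<psi> z * A0 * c * s * (\<omega> * ?l powr (- \<alpha>)) + A0 * c * s * (c3 * (c1 * \<psi> z))"
    have X0: "X \<ge> 0" using psi_nonneg[of z] A0 Am(1) p \<omega>(1) c3 c1_ge by (simp add: X_def)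
    \<comment> \<open>The convolution integrand in the variable \<zeta> = z + v, in the shape of the
      condition \<open>conv\<close>. It is used only for \<open>norm z > 3\<close>, inside the range
      \<open>norm z > 2\<close> of that condition.\<close>
    define J where "J \<zeta> = ennreal (\<phi> (norm (0 - \<zeta>)) / norm (0 - \<zeta>) powr \<beta> * (\<phi> (norm (\<zeta> - z)) / norm (\<zeta> - z) powr \<beta>))
      * indicator {\<zeta>. 1 \<le> norm (z - \<zeta>) \<and> 1 \<le> norm (0 - \<zeta>)} \<zeta>" for \<zeta>
    have [measurable]: "(\<lambda>\<zeta>. \<phi> (norm (\<zeta> - z))) \<in> borel_measurable borel"
      by (rule measurable_compose[OF _ phi_norm_meas]) measurable
    have [measurable]: "(\<lambda>\<zeta>::real^'n. \<phi> (norm (0 - \<zeta>))) \<in> borel_measurable borel"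
      by (rule measurable_compose[OF _ phi_norm_meas]) measurable
    have J_meas[measurable]: "J \<in> borel_measurable borel" unfolding J_def[abs_def] by measurable
    define Jz where "Jz v = (if 3 < norm z then J (z + v) else 0)" for v
    have Jz_meas[measurable]: "Jz \<in> borel_measurable borel" unfolding Jz_def[abs_def] by measurable
    have J_le: "(\<integral>\<^sup>+v. Jz v \<partial>lborel) \<le> ennreal (c3 * (c1 * \<psi> z))"
    proof (cases "3 < norm z")
      case True
      have "(\<integral>\<^sup>+v. Jz v \<partial>lborel) = (\<integral>\<^sup>+\<zeta>. J \<zeta> \<partial>lborel)"
        using True by (simp add: Jz_def nn_integral_shift)
      also have "\<dots> \<le> ennreal (c3 * (\<phi> (norm (0 - z)) / norm (0 - z) powr \<beta>))"
        unfolding J_def using True by (intro conv) simp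
      also have "\<dots> \<le> ennreal (c3 * (c1 * \<psi> z))"
        using phi_shift(1)[of "norm z"] c3
        by (intro ennreal_leI mult_left_mono) (auto simp: psi powr_minus divide_inverse mult.assoc[symmetric] intro!: mult_right_mono)
      finally show ?thesis .
    qed (simp add: Jz_def)
    have "(\<integral>\<^sup>+v. ennreal \<bar>((1 - ?I v) * ?H (z + v)) * \<kappa> v\<bar> \<partial>lborel)
      \<le> (\<integral>\<^sup>+v. ennreal (\<psi> z * A0) * ennreal (?H (z + v))
          + ennreal (\<psi> z * A0 * c * s) * (ennreal (norm v powr (- \<alpha> - DIM(real ^ 'n))) * indicator {v. ?l < norm v} v)
          + ennreal (A0 * c * s) * Jz v \<partial>lborel)"
    proof (intro nn_integral_mono)
      fix v
      show "ennreal \<bar>((1 - ?I v) * ?H (z + v)) * \<kappa> v\<bar> \<le> ennreal (\<psi> z * A0) * ennreal (?H (z + v))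
          + ennreal (\<psi> z * A0 * c * s) * (ennreal (norm v powr (- \<alpha> - DIM(real ^ 'n))) * indicator {v. ?l < norm v} v)
          + ennreal (A0 * c * s) * Jz v"
      proof (cases "norm v \<le> ?l")
        case False
        then have v: "?l < norm v" by simp
        define j where "j = (if 3 < norm z \<and> 1 \<le> norm v \<and> 1 \<le> norm (z + v)
          then \<phi> (norm (z + v)) / norm (z + v) powr \<beta> * (\<phi> (norm v) / norm v powr \<beta>) else 0)"
        have j: "0 \<le> j" using phi_range(1)[of "norm v"] phi_range(1)[of "norm (z + v)"] by (simp add: j_def)
        have n0: "norm (- z - v) = norm (z + v)" by (metis minus_add_distrib diff_conv_add_uminus norm_minus_cancel)
        have jJ: "ennreal j \<le> Jz v"
          by (auto simp: j_def Jz_def J_def indicator_def n0)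
        have "\<bar>((1 - ?I v) * ?H (z + v)) * \<kappa> v\<bar> = ?H (z + v) * \<kappa> v"
          using v H_bounds(1)[OF p, of "z + v"] \<kappa>0[of v] by simp
        also have "\<dots> \<le> \<psi> z * A0 * ?H (z + v) + \<psi> z * A0 * c * s * norm v powr (- \<beta>) + A0 * c * s * j"
          unfolding j_def by (rule large_jump_pointwise[OF p z v \<kappa>])
        finally have "ennreal \<bar>((1 - ?I v) * ?H (z + v)) * \<kappa> v\<bar> \<le> ennreal (\<psi> z * A0) * ennreal (?H (z + v))
            + ennreal (\<psi> z * A0 * c * s) * ennreal (norm v powr (- \<beta>)) + ennreal (A0 * c * s) * ennreal j"
          using psi_nonneg[of z] A0 H_bounds(1)[OF p, of "z + v"] p j
          by (simp add: ennreal_leI flip: ennreal_mult ennreal_plus)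
        also have "\<dots> \<le> ennreal (\<psi> z * A0) * ennreal (?H (z + v))
            + ennreal (\<psi> z * A0 * c * s) * ennreal (norm v powr (- \<beta>)) + ennreal (A0 * c * s) * Jz v"
          by (intro add_left_mono mult_left_mono jJ) auto
        finally show ?thesis using v by (simp add: beta)
      qed simp
    qed
    also have "\<dots> = ennreal (\<psi> z * A0) * (\<integral>\<^sup>+y. ennreal (?H y) \<partial>lborel)
          + ennreal (\<psi> z * A0 * c * s) * (\<integral>\<^sup>+v. (ennreal (norm v powr (- \<alpha> - DIM(real ^ 'n))) * indicator {v. ?l < norm v} (v :: real ^ 'n)) \<partial>lborel)
          + ennreal (A0 * c * s) * (\<integral>\<^sup>+v. Jz v \<partial>lborel)"
      using nn_integral_shift[of "\<lambda>y. ennreal (?H y)" z] by (simp add: nn_integral_add nn_integral_cmult)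
    also have "\<dots> \<le> ennreal (\<psi> z * A0) * ennreal (Am * (c * ?\<xi>)) + ennreal (\<psi> z * A0 * c * s) * ennreal (\<omega> * ?l powr (- \<alpha>))
          + ennreal (A0 * c * s) * ennreal (c3 * (c1 * \<psi> z))"
      by (intro add_mono mult_left_mono J_le \<omega>(2) l Am(2) p) auto
    also have "\<dots> = ennreal X"
      unfolding X_def using psi_nonneg[of z] A0 Am(1) p \<omega>(1) c3 c1_ge by (simp add: ennreal_mult ennreal_plus)
    finally have "\<bar>LINT v|lborel. ((1 - ?I v) * ?H (z + v)) * \<kappa> v\<bar> \<le> X"
      by (rule abs_integral_le_nn_integral[OF i3 _ X0])
    moreover have "(LINT v|lborel. ((1 - ?I v) * (?H (z + v) - ?H z)) * \<kappa> v) \<le> (LINT v|lborel. ((1 - ?I v) * ?H (z + v)) * \<kappa> v)"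
      using H_bounds(1)[OF p, of z] \<kappa>0 by (intro integral_mono[OF i2 i3] mult_right_mono mult_left_mono) (auto simp: indicator_def)
    ultimately have I2: "(LINT v|lborel. ((1 - ?I v) * (?H (z + v) - ?H z)) * \<kappa> v) \<le> X" by linarith
    have "(LINT v|lborel. (?H (z + v) - ?H z) * \<kappa> v)
       = (LINT v|lborel. (?I v * (?H (z + v) - ?H z)) * \<kappa> v + ((1 - ?I v) * (?H (z + v) - ?H z)) * \<kappa> v)"
      by (intro Bochner_Integration.integral_cong) (auto simp: algebra_simps)
    also have "\<dots> = (LINT v|lborel. (?I v * (?H (z + v) - ?H z)) * \<kappa> v) + (LINT v|lborel. ((1 - ?I v) * (?H (z + v) - ?H z)) * \<kappa> v)"
      by (rule Bochner_Integration.integral_add[OF i1 i2])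
    also have "\<dots> \<le> c * \<psi> z * (D0 * M * (C1 + C2)) * (E * (s + ?\<xi>)) + X" using I1 I2 by linarith
    also have "X \<le> c * \<psi> z * (A0 * Am) * (s + ?\<xi>) + c * \<psi> z * (A0 * \<omega> * E) * (s + ?\<xi>) + c * \<psi> z * (A0 * c3 * c1) * (s + ?\<xi>)"
    proof -
      have "\<psi> z * A0 * (Am * (c * ?\<xi>)) = c * \<psi> z * (A0 * Am) * ?\<xi>" by (simp add: mult_ac)
      also have "\<dots> \<le> c * \<psi> z * (A0 * Am) * (s + ?\<xi>)"
        using p psi_nonneg[of z] A0 Am(1) by (intro mult_left_mono) auto
      finally have 1: "\<psi> z * A0 * (Am * (c * ?\<xi>)) \<le> c * \<psi> z * (A0 * Am) * (s + ?\<xi>)" .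
      have "\<psi> z * A0 * c * s * (\<omega> * ?l powr (- \<alpha>)) = c * \<psi> z * (A0 * \<omega>) * (s * ?l powr (- \<alpha>))" by (simp add: mult_ac)
      also have "\<dots> \<le> c * \<psi> z * (A0 * \<omega>) * (E * (s + ?\<xi>))"
        using p psi_nonneg[of z] A0 \<omega>(1) by (intro mult_left_mono sl) auto
      finally have 2: "\<psi> z * A0 * c * s * (\<omega> * ?l powr (- \<alpha>)) \<le> c * \<psi> z * (A0 * \<omega> * E) * (s + ?\<xi>)" by (simp add: mult_ac)
      have "A0 * c * s * (c3 * (c1 * \<psi> z)) = c * \<psi> z * (A0 * c3 * c1) * s" by (simp add: mult_ac)
      also have "\<dots> \<le> c * \<psi> z * (A0 * c3 * c1) * (s + ?\<xi>)"
        using p psi_nonneg[of z] A0 c3 c1_ge by (intro mult_left_mono) auto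
      finally have 3: "A0 * c * s * (c3 * (c1 * \<psi> z)) \<le> c * \<psi> z * (A0 * c3 * c1) * (s + ?\<xi>)" .
      show ?thesis unfolding X_def using 1 2 3 by linarith
    qed
    finally have "(LINT v|lborel. (?H (z + v) - ?H z) * \<kappa> v) \<le> c * \<psi> z * (A - 1) * (s + ?\<xi>)"
      by (simp add: A_def algebra_simps)
    also have "\<dots> \<le> c * \<psi> z * A * (s + ?\<xi>)"
      using p psi_nonneg[of z] by (intro mult_right_mono mult_left_mono) auto
    finally show "(LINT v|lborel. (?H (z + v) - ?H z) * \<kappa> v) \<le> c * \<psi> z * A * (s + ?\<xi>)" .
  qed
qed

end

lemma bcontfun_meas [measurable]: "apply_bcontfun u \<in> borel_measurable borel"
  by (intro borel_measurable_continuous_onI continuous_on_apply_bcontfun)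

lemma abs_bcontfun_le: "\<bar>apply_bcontfun u x\<bar> \<le> norm (u :: 'a::topological_space \<Rightarrow>\<^sub>C real)"
  using norm_bounded[of u x] by simp

subsection \<open>Twice differentiable functions of compact support\<close>

text \<open>Both derivatives are continuous and vanish off the compact support, hence they are
  bounded; this makes the constant uniform in \<open>x\<close>.\<close>

lemma C2c_differences:
  fixes u :: "(real ^ 'n) \<Rightarrow>\<^sub>C real"
  assumes u: "u \<in> C2c"
  obtains B where "B \<ge> 0" "\<And>x v. \<bar>u (x + v) - u x\<bar> \<le> B * norm v"
    "\<And>x v. \<bar>u (x + v) + u (x - v) - 2 * u x\<bar> \<le> B * (norm v)\<^sup>2"
proof -
  let ?S = "closure {x. apply_bcontfun u x \<noteq> 0}"
  obtain u' :: "real ^ 'n \<Rightarrow> (real ^ 'n) \<Rightarrow>\<^sub>L real" and u'' :: "real ^ 'n \<Rightarrow> (real ^ 'n) \<Rightarrow>\<^sub>L (real ^ 'n) \<Rightarrow>\<^sub>L real"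
    where d1: "\<And>x. (apply_bcontfun u has_derivative blinfun_apply (u' x)) (at x)"
      and d2: "\<And>x. (u' has_derivative blinfun_apply (u'' x)) (at x)" and c2: "continuous_on UNIV u''"
    using u by (auto simp: C2c_def C2_def)
  have S: "compact ?S" using u by (simp add: C2c_def)
  have op: "open (- ?S)" by (rule open_Compl) simp
  have z1: "u' x = 0" if "x \<notin> ?S" for x
  proof -
    have "(apply_bcontfun u has_derivative (\<lambda>_. 0)) (at x)"
    proof (rule has_derivative_transform_within_open[OF _ op])
      show "((\<lambda>_. 0) has_derivative (\<lambda>_. 0)) (at x)" by simp
      show "0 = u y" if "y \<in> - ?S" for y using that closure_subset[of "{x. u x \<noteq> 0}"] by auto
    qed (use that in simp)
    from has_derivative_unique[OF d1 this] show ?thesis by (intro blinfun_eqI) simp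
  qed
  have z2: "u'' x = 0" if "x \<notin> ?S" for x
  proof -
    have "(u' has_derivative (\<lambda>_. 0)) (at x)"
    proof (rule has_derivative_transform_within_open[OF _ op])
      show "((\<lambda>_. 0) has_derivative (\<lambda>_. 0)) (at x)" by simp
      show "0 = u' y" if "y \<in> - ?S" for y using z1[of y] that by simp
    qed (use that in simp)
    from has_derivative_unique[OF d2 this] show ?thesis by (intro blinfun_eqI) simp
  qed
  have c1: "continuous_on UNIV u'" by (rule has_derivative_continuous_on[OF has_derivative_at_withinI]) (rule d2)
  have "bounded (u' ` ?S)" "bounded (u'' ` ?S)"
    by (intro compact_imp_bounded compact_continuous_image S continuous_on_subset[OF c1] continuous_on_subset[OF c2] subset_UNIV)+
  then obtain K1 K2 where K: "\<And>x. x \<in> ?S \<Longrightarrow> norm (u' x) \<le> K1" "\<And>x. x \<in> ?S \<Longrightarrow> norm (u'' x) \<le> K2"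
    unfolding bounded_iff by blast
  define K where "K = max 0 (max K1 K2)"
  have K': "norm (u' x) \<le> K" "norm (u'' x) \<le> K" for x
    using K[of x] z1[of x] z2[of x] by (cases "x \<in> ?S"; force simp: K_def)+
  have dq: "((\<lambda>\<tau>. u (x + \<tau> *\<^sub>R v)) has_real_derivative u' (x + \<tau> *\<^sub>R v) v) (at \<tau>)" for x v \<tau>
  proof -
    have "((\<lambda>\<tau>. x + \<tau> *\<^sub>R v) has_derivative (\<lambda>h. h *\<^sub>R v)) (at \<tau>)" by (auto intro!: derivative_eq_intros)
    from has_derivative_compose[OF this d1]
    have "((\<lambda>\<tau>. u (x + \<tau> *\<^sub>R v)) has_derivative (\<lambda>h. u' (x + \<tau> *\<^sub>R v) (h *\<^sub>R v))) (at \<tau>)" .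
    moreover have "(\<lambda>h. u' (x + \<tau> *\<^sub>R v) (h *\<^sub>R v)) = (*) (u' (x + \<tau> *\<^sub>R v) v)"
      by (auto simp: blinfun.scaleR_right)
    ultimately show ?thesis by (simp add: has_field_derivative_def)
  qed
  have dq': "((\<lambda>\<tau>. u' (x + \<tau> *\<^sub>R v) v) has_real_derivative u'' (x + \<tau> *\<^sub>R v) v v) (at \<tau>)" for x v \<tau>
  proof -
    have "((\<lambda>\<tau>. x + \<tau> *\<^sub>R v) has_derivative (\<lambda>h. h *\<^sub>R v)) (at \<tau>)" by (auto intro!: derivative_eq_intros)
    from has_derivative_compose[OF this d2]
    have "((\<lambda>\<tau>. u' (x + \<tau> *\<^sub>R v)) has_derivative (\<lambda>h. u'' (x + \<tau> *\<^sub>R v) (h *\<^sub>R v))) (at \<tau>)" .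
    then have "((\<lambda>\<tau>. u' (x + \<tau> *\<^sub>R v) v) has_derivative (\<lambda>h. u'' (x + \<tau> *\<^sub>R v) (h *\<^sub>R v) v)) (at \<tau>)"
      by (rule bounded_linear.has_derivative[OF blinfun.bounded_linear_left])
    moreover have "(\<lambda>h. u'' (x + \<tau> *\<^sub>R v) (h *\<^sub>R v) v) = (*) (u'' (x + \<tau> *\<^sub>R v) v v)"
      by (auto simp: blinfun.scaleR_right blinfun.scaleR_left)
    ultimately show ?thesis by (simp add: has_field_derivative_def)
  qed
  have b1: "\<bar>u' y v\<bar> \<le> K * norm v" for y v
    using norm_blinfun[of "u' y" v] mult_right_mono[OF K'(1)[of y], of "norm v"] by simp
  have b2: "\<bar>u'' y v v\<bar> \<le> K * (norm v)\<^sup>2" for y v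
  proof -
    have "\<bar>u'' y v v\<bar> \<le> norm (u'' y v) * norm v" using norm_blinfun[of "u'' y v" v] by simp
    also have "\<dots> \<le> (norm (u'' y) * norm v) * norm v" by (intro mult_right_mono norm_blinfun) auto
    also have "\<dots> \<le> (K * norm v) * norm v" by (intro mult_right_mono K') auto
    finally show ?thesis by (simp add: power2_eq_square)
  qed
  show thesis
  proof (rule that)
    show "2 * K \<ge> 0" by (simp add: K_def)
    show "\<bar>u (x + v) - u x\<bar> \<le> 2 * K * norm v" for x v
    proof -
      have "\<bar>u (x + v) - u x\<bar> \<le> K * norm v"
        using first_difference_le[OF dq b1, of x v] by simp
      also have "\<dots> \<le> 2 * K * norm v" by (intro mult_right_mono) (auto simp: K_def)
      finally show ?thesis .
    qed
    show "\<bar>u (x + v) + u (x - v) - 2 * u x\<bar> \<le> 2 * K * (norm v)\<^sup>2" for x v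
      using second_difference_le[OF dq dq' b2, of x v] by simp
  qed
qed

text \<open>Lets \<open>contraction_semigroup\<close>, which integrates orbits, be used for bounded
  continuous functions.\<close>

instance bcontfun :: (metric_space, banach) banach ..

subsection \<open>The approximating random walks\<close>

text \<open>Neither kernel nor semigroup occurs here. The constants of the final estimate are
  defined in this locale or obtained in \<open>profile\<close>, which is why they depend on the
  dimension, \<alpha>, \<phi>, \<open>M\<close> and \<open>c4\<close> only; \<omega> will be a
  constant of the dimension and \<alpha>.\<close>

locale profile_const = profile \<alpha> \<beta> M c1 c2 c3 \<phi> \<psi>
  for \<alpha> \<beta> M c1 c2 c3 :: real and \<phi> :: "real \<Rightarrow> real" and \<psi> :: "real ^ 'n \<Rightarrow> real" +
  fixes c4 \<omega> :: real
  assumes c4: "c4 > 0"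
    and \<omega>: "\<omega> > 0"
    and tail: "\<And>r. r > 0 \<Longrightarrow> (\<integral>\<^sup>+v. ennreal (norm v powr (- \<beta>)) * indicator {v. r < norm v} (v :: real ^ 'n) \<partial>lborel)
      \<le> ennreal (\<omega> * r powr (- \<alpha>))"

locale jump = profile_const \<alpha> \<beta> M c1 c2 c3 \<phi> \<psi> c4 \<omega> + contraction_semigroup C0 P
  for \<alpha> \<beta> M c1 c2 c3 c4 \<omega> :: real and \<phi> :: "real \<Rightarrow> real" and \<psi> :: "real ^ 'n \<Rightarrow> real"
    and P :: "real \<Rightarrow> ((real ^ 'n) \<Rightarrow>\<^sub>C real) \<Rightarrow> ((real ^ 'n) \<Rightarrow>\<^sub>C real)" +
  fixes f :: "real ^ 'n \<Rightarrow> real ^ 'n \<Rightarrow> ennreal"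
  assumes f_meas: "case_prod f \<in> borel_measurable borel"
    and f_bound: "\<And>x y. x \<noteq> y \<Longrightarrow> f x y \<le> ennreal (M * \<phi> (norm (y - x)) * norm (y - x) powr (- \<beta>))"
    and f_even: "(\<forall>x h. f x (x + h) = f x (x - h)) \<or> \<alpha> < 1"
    and f_sym: "\<And>x y. f x y = f y x"
    and f_lower: "\<And>\<epsilon> x. \<epsilon> > 0 \<Longrightarrow> ennreal (c4 * \<epsilon> powr (- \<alpha>))
        \<le> (\<integral>\<^sup>+y\<in>{y. norm (y - x) > \<epsilon>}. f x y / ennreal (\<phi> (norm (y - x))) \<partial>lborel)"
    and f_cont: "\<And>y. continuous_on (UNIV - {y}) (\<lambda>x. f x y)"
    and gen: "generator_on C0 P = closure (jump_op_graph f)"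
begin

definition ke :: "real \<Rightarrow> real ^ 'n \<Rightarrow> real ^ 'n \<Rightarrow> real" where
  "ke \<epsilon> x y = (if \<epsilon> < norm (y - x) then enn2real (f x y) else 0)"

lemma ke_meas: "case_prod (ke \<epsilon>) \<in> borel_measurable (borel \<Otimes>\<^sub>M borel)"
proof -
  have [measurable]: "case_prod f \<in> borel_measurable (borel \<Otimes>\<^sub>M borel)" using f_meas by (simp add: borel_prod)
  show ?thesis unfolding ke_def by measurable
qed

lemma ke_meas_right [measurable]: "ke \<epsilon> x \<in> borel_measurable borel"
proof -
  note ke_meas[measurable]
  show ?thesis by measurable
qed

lemma ke_nonneg: "0 \<le> ke \<epsilon> x y" by (simp add: ke_def)

lemma ke_sym: "ke \<epsilon> x y = ke \<epsilon> y x"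
  using f_sym[of x y] by (simp add: ke_def norm_minus_commute)

lemma f_finite: "x \<noteq> y \<Longrightarrow> f x y \<noteq> top"
  using f_bound[of x y] by (metis ennreal_neq_top infinity_ennreal_def neq_top_trans)

lemma enn2real_f_le: "x \<noteq> y \<Longrightarrow> enn2real (f x y) \<le> M * \<phi> (norm (y - x)) * norm (y - x) powr (- \<beta>)"
  using enn2real_mono[OF f_bound, of x y] M phi_range(1)[of "norm (y - x)"] by simp

lemma ke_le:
  assumes "\<epsilon> \<ge> 0"
  shows "ke \<epsilon> x y \<le> M * \<phi> (norm (y - x)) * norm (y - x) powr (- \<beta>)"
proof (cases "\<epsilon> < norm (y - x)")
  case True
  then have "x \<noteq> y" using assms by auto
  then show ?thesis using enn2real_f_le True by (simp add: ke_def)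
next
  case False
  then show ?thesis using M phi_range(1)[of "norm (y - x)"] by (simp add: ke_def)
qed

lemma ke_le':
  assumes "\<epsilon> \<ge> 0"
  shows "ke \<epsilon> x y \<le> M * (norm (y - x) powr (- \<beta>) * indicator {v. \<epsilon> < norm v} (y - x))"
proof (cases "\<epsilon> < norm (y - x)")
  case True
  have "M * \<phi> (norm (y - x)) * norm (y - x) powr (- \<beta>) \<le> M * 1 * norm (y - x) powr (- \<beta>)"
    using M phi_range[of "norm (y - x)"] by (intro mult_right_mono mult_left_mono) auto
  then show ?thesis using ke_le[OF assms, of x y] True by simp
qed (simp add: ke_def)

lemma tail_integrable:
  assumes "r > 0"
  shows "integrable lborel (\<lambda>v :: real ^ 'n. norm v powr (- \<beta>) * indicator {v. r < norm v} v)"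
proof (rule integrableI_nonneg)
  have "open {v :: real ^ 'n. r < norm v}" by (intro open_Collect_less continuous_intros)
  then have [measurable]: "{v :: real ^ 'n. r < norm v} \<in> sets borel" by simp
  show "(\<lambda>v :: real ^ 'n. norm v powr (- \<beta>) * indicator {v. r < norm v} v) \<in> borel_measurable lborel" by measurable
  have "(\<integral>\<^sup>+v. ennreal (norm v powr (- \<beta>) * indicator {v. r < norm v} (v :: real ^ 'n)) \<partial>lborel)
    = (\<integral>\<^sup>+v. ennreal (norm v powr (- \<beta>)) * indicator {v. r < norm v} (v :: real ^ 'n) \<partial>lborel)"
    by (intro nn_integral_cong) (auto simp: indicator_def)
  also have "\<dots> < \<infinity>" using le_less_trans[OF tail[OF assms] ennreal_less_top] by simp
  finally show "(\<integral>\<^sup>+v. ennreal (norm v powr (- \<beta>) * indicator {v. r < norm v} (v :: real ^ 'n)) \<partial>lborel) < \<infinity>" .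
qed simp

lemma ke_mass:
  assumes "\<epsilon> > 0"
  shows "(\<integral>\<^sup>+y. ennreal (ke \<epsilon> x y) \<partial>lborel) \<le> ennreal (M * \<omega> * \<epsilon> powr (- \<alpha>))"
proof -
  have "(\<integral>\<^sup>+y. ennreal (ke \<epsilon> x y) \<partial>lborel) = (\<integral>\<^sup>+v. ennreal (ke \<epsilon> x (x + v)) \<partial>lborel)"
    by (subst nn_integral_shift) auto
  also have "\<dots> \<le> (\<integral>\<^sup>+v. ennreal M * (ennreal (norm v powr (- \<beta>)) * indicator {v. \<epsilon> < norm v} (v :: real ^ 'n)) \<partial>lborel)"
  proof (intro nn_integral_mono)
    fix v
    have "ennreal (ke \<epsilon> x (x + v)) \<le> ennreal (M * (norm v powr (- \<beta>) * indicator {v. \<epsilon> < norm v} v))"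
      using ke_le'[of \<epsilon> x "x + v"] assms by (intro ennreal_leI) simp
    then show "ennreal (ke \<epsilon> x (x + v)) \<le> ennreal M * (ennreal (norm v powr (- \<beta>)) * indicator {v. \<epsilon> < norm v} v)"
      using M by (auto simp: indicator_def ennreal_mult)
  qed
  also have "\<dots> = ennreal M * (\<integral>\<^sup>+v. (ennreal (norm v powr (- \<beta>)) * indicator {v. \<epsilon> < norm v} (v :: real ^ 'n)) \<partial>lborel)"
    by (rule nn_integral_cmult) (rule tail_meas)
  also have "\<dots> \<le> ennreal M * ennreal (\<omega> * \<epsilon> powr (- \<alpha>))" by (intro mult_left_mono tail assms) auto
  finally show ?thesis using M \<omega> by (simp add: ennreal_mult mult.assoc)
qed

lemma ke_integrable:
  assumes "\<epsilon> > 0" shows "integrable lborel (ke \<epsilon> x)"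
  using ke_mass[OF assms, of x] ke_nonneg by (intro integrableI_nonneg) (auto intro: le_less_trans)

lemma ke_admissible:
  assumes "\<epsilon> > 0"
  shows "admissible (\<lambda>v. ke \<epsilon> x (x + v))"
proof -
  have "ke \<epsilon> x (x + v) = ke \<epsilon> x (x - v)" if "\<forall>x h. f x (x + h) = f x (x - h)" for v
    using that by (simp add: ke_def)
  then show ?thesis
    using f_even ke_le[of \<epsilon> x "x + _"] ke_integrable[OF assms, of x] assms ke_nonneg
    by (auto simp: admissible_def integrable_shift)
qed

text \<open>The truncation at which \<open>h\<close> times the bound in \<open>ke_mass\<close> is
  exactly 1, so that \<open>kh h\<close> is a jump density of mass at most 1.\<close>

definition eps :: "real \<Rightarrow> real" where "eps h = (M * \<omega> * h) powr (1 / \<alpha>)"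

lemma eps_pos: "h > 0 \<Longrightarrow> eps h > 0"
  using M \<omega> by (simp add: eps_def)

lemma eps_powr: "h > 0 \<Longrightarrow> eps h powr \<alpha> = M * \<omega> * h"
  using M \<omega> alpha by (simp add: eps_def powr_powr)

definition kh :: "real \<Rightarrow> real ^ 'n \<Rightarrow> real ^ 'n \<Rightarrow> real" where "kh h x y = h * ke (eps h) x y"

lemma walk_kh: "h > 0 \<Longrightarrow> walk (kh h)"
proof
  fix x y
  assume h: "h > 0"
  note ke_meas[measurable]
  show "case_prod (kh h) \<in> borel_measurable borel"
    unfolding kh_def[abs_def] borel_prod[symmetric] by measurable
  show "0 \<le> kh h x y" using h ke_nonneg by (simp add: kh_def)
  show "kh h x y = kh h y x" using ke_sym[of "eps h" x y] by (simp add: kh_def)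
  have "(\<integral>\<^sup>+y. ennreal (kh h x y) \<partial>lborel) = ennreal h * (\<integral>\<^sup>+y. ennreal (ke (eps h) x y) \<partial>lborel)"
    unfolding kh_def using h ke_nonneg by (subst nn_integral_cmult[symmetric]) (auto simp: ennreal_mult)
  also have "\<dots> \<le> ennreal h * ennreal (M * \<omega> * eps h powr (- \<alpha>))"
    by (intro mult_left_mono ke_mass eps_pos h) auto
  also have "\<dots> = ennreal (h * (M * \<omega> * eps h powr (- \<alpha>)))"
    using h M \<omega> by (intro ennreal_mult[symmetric]) auto
  also have "h * (M * \<omega> * eps h powr (- \<alpha>)) = 1"
    using h M \<omega> eps_powr[OF h] by (simp add: powr_minus field_simps)
  finally show "(\<integral>\<^sup>+y. ennreal (kh h x y) \<partial>lborel) \<le> 1" by simp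
qed

lemma Tr_generator:
  assumes h: "h > 0" and [measurable]: "u \<in> borel_measurable borel" and b: "\<And>y. \<bar>u y\<bar> \<le> c"
  shows "walk.Tr (kh h) u x - u x = h * (LINT v|lborel. (u (x + v) - u x) * ke (eps h) x (x + v))"
proof -
  interpret walk "kh h" by (rule walk_kh[OF h])
  have "Tr u x - u x = (LINT y|lborel. (u y - u x) * kh h x y)" by (rule Tr_minus_id(2)[OF assms(2) b])
  also have "\<dots> = (LINT y|lborel. h * ((u y - u x) * ke (eps h) x y))"
    by (intro Bochner_Integration.integral_cong) (auto simp: kh_def)
  also have "\<dots> = h * (LINT y|lborel. (u y - u x) * ke (eps h) x y)" by simp
  also have "(LINT y|lborel. (u y - u x) * ke (eps h) x y) = (LINT v|lborel. (u (x + v) - u x) * ke (eps h) x (x + v))"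
    by (subst integral_shift) auto
  finally show ?thesis .
qed

subsection \<open>Consistency with the generator\<close>

text \<open>Only jumps of length at most \<epsilon> are lost, and differences of order
  \<open>p\<close> in the jump length contribute \<open>\<epsilon> powr (p - \<alpha>)\<close>. The
  order is 1 if \<alpha> < 1, and otherwise 2, where evenness of the kernel is available.\<close>

lemma truncation_error:
  assumes u: "u \<in> C2c"
  obtains C \<gamma> where "C \<ge> 0" "\<gamma> > 0"
    "\<And>\<epsilon> \<epsilon>' x. 0 < \<epsilon>' \<Longrightarrow> \<epsilon>' \<le> \<epsilon> \<Longrightarrow>
      \<bar>(LINT y|lborel. (u y - u x) * ke \<epsilon>' x y) - (LINT y|lborel. (u y - u x) * ke \<epsilon> x y)\<bar> \<le> C * \<epsilon> powr \<gamma>"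
proof -
  obtain B where B: "B \<ge> 0" "\<And>x v. \<bar>u (x + v) - u x\<bar> \<le> B * norm v"
    "\<And>x v. \<bar>u (x + v) + u (x - v) - 2 * u x\<bar> \<le> B * (norm v)\<^sup>2"
    using C2c_differences[OF u] by blast
  obtain C1 C2 where C1: "C1 > 0" "\<And>r. \<alpha> < 1 \<Longrightarrow> r > 0 \<Longrightarrow>
     (\<integral>\<^sup>+v. ennreal (norm v powr ((1 - \<alpha>) - DIM(real ^ 'n))) * indicator {v. norm v \<le> r} (v :: real ^ 'n) \<partial>lborel)
      \<le> ennreal (C1 * r powr (1 - \<alpha>))" and C2: "C2 > 0"
    "\<And>r. r > 0 \<Longrightarrow> (\<integral>\<^sup>+v. ennreal (norm v powr ((2 - \<alpha>) - DIM(real ^ 'n))) * indicator {v. norm v \<le> r} (v :: real ^ 'n) \<partial>lborel)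
      \<le> ennreal (C2 * r powr (2 - \<alpha>))"
    using local_constants by blast
  define p :: real where "p = (if \<alpha> < 1 then 1 else 2)"
  have p: "p - \<alpha> > 0" using alpha by (simp add: p_def)
  have ub: "\<bar>u y - u x\<bar> \<le> 2 * norm u" for x y
    using norm_bounded[of u x] norm_bounded[of u y] by (simp add: abs_le_iff)
  show thesis
  proof (rule that)
    show "B * M * (C1 + C2) \<ge> 0" using B(1) M C1(1) C2(1) by simp
    show "p - \<alpha> > 0" by (rule p)
    fix \<epsilon> \<epsilon>' :: real and x :: "real ^ 'n"
    assume e: "0 < \<epsilon>'" "\<epsilon>' \<le> \<epsilon>"
    let ?w = "\<lambda>v. u (x + v) - u x"
    let ?\<kappa> = "\<lambda>v. ke \<epsilon>' x (x + v)"
    let ?I = "indicator {v. norm v \<le> \<epsilon>} :: real ^ 'n \<Rightarrow> real"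
    note adm = ke_admissible[OF e(1), of x]
    have [measurable]: "?w \<in> borel_measurable borel" by measurable
    have i0: "integrable lborel (\<lambda>y. (u y - u x) * ke \<epsilon> x y)" if "\<epsilon> > 0" for \<epsilon>
      using ub ke_integrable[OF that]
      by (intro integrable_bounded_mult) auto
    have i1: "integrable lborel (\<lambda>v. (?I v * ?w v) * ?\<kappa> v)"
      using adm ub by (intro integrable_bounded_mult[where B = "2 * norm u"]) (auto simp: admissible_def indicator_def)
    have "(LINT y|lborel. (u y - u x) * ke \<epsilon>' x y) - (LINT y|lborel. (u y - u x) * ke \<epsilon> x y)
      = (LINT y|lborel. (u y - u x) * ke \<epsilon>' x y - (u y - u x) * ke \<epsilon> x y)"
      using i0[of \<epsilon>] i0[of \<epsilon>'] e by simp
    also have "\<dots> = (LINT y|lborel. ?I (y - x) * ((u y - u x) * ke \<epsilon>' x y))"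
      using e by (intro Bochner_Integration.integral_cong) (auto simp: ke_def indicator_def)
    also have "\<dots> = (LINT v|lborel. ?I v * (?w v * ?\<kappa> v))"
    proof -
      show ?thesis by (subst integral_shift[symmetric, where x = x]) auto
    qed
    finally have eq: "(LINT y|lborel. (u y - u x) * ke \<epsilon>' x y) - (LINT y|lborel. (u y - u x) * ke \<epsilon> x y)
      = (LINT v|lborel. ?I v * (?w v * ?\<kappa> v))" .
    have "\<bar>LINT v|lborel. ?I v * (?w v * ?\<kappa> v)\<bar> \<le> (B * \<epsilon> powr p) * M * (C1 + C2) * \<epsilon> powr (- \<alpha>)"
    proof (rule local_integral_le)
      show "?\<kappa> v \<le> M * norm v powr (- \<alpha> - real DIM(real ^ 'n))" for v
        using admissible_le[OF adm, of v] by (simp add: beta)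
      show "(\<forall>v. ?\<kappa> (- v) = ?\<kappa> v) \<and> (\<forall>v. norm v \<le> \<epsilon> \<longrightarrow> \<bar>?w v + ?w (- v)\<bar> \<le> B * \<epsilon> powr p * (norm v)\<^sup>2 / \<epsilon>\<^sup>2) \<or>
        \<alpha> < 1 \<and> (\<forall>v. norm v \<le> \<epsilon> \<longrightarrow> \<bar>?w v\<bar> \<le> B * \<epsilon> powr p * norm v / \<epsilon>)"
      proof (cases "\<alpha> < 1")
        case True
        then show ?thesis using B(2)[of x] e by (auto simp: p_def)
      next
        case False
        have "?w v + ?w (- v) = u (x + v) + u (x - v) - 2 * u x" for v by simp
        then show ?thesis using B(3)[of x] e False adm by (auto simp: p_def admissible_def powr_numeral)
      qed
    qed (use adm i1 ke_nonneg B M C1 C2 e in \<open>auto simp: mult.assoc admissible_def\<close>)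
    also have "\<dots> = B * M * (C1 + C2) * \<epsilon> powr (p - \<alpha>)"
      using e by (simp add: powr_diff powr_minus divide_inverse)
    finally show "\<bar>(LINT y|lborel. (u y - u x) * ke \<epsilon>' x y) - (LINT y|lborel. (u y - u x) * ke \<epsilon> x y)\<bar>
      \<le> B * M * (C1 + C2) * \<epsilon> powr (p - \<alpha>)" unfolding eq .
  qed
qed

text \<open>\<open>Lim\<close> is meaningful only if the limit exists, so existence is derived
  first: the truncation error makes the integrals Cauchy along the truncations \<open>s n\<close>,
  and the same bound then gives the convergence of the full family and its rate.\<close>

lemma jump_op_error:
  assumes u: "u \<in> C2c"
  obtains C \<gamma> where "C \<ge> 0" "\<gamma> > 0"
    "\<And>\<epsilon> x. 0 < \<epsilon> \<Longrightarrow> \<bar>(LINT y|lborel. (u y - u x) * ke \<epsilon> x y) - jump_op f u x\<bar> \<le> C * \<epsilon> powr \<gamma>"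
proof -
  obtain C \<gamma> where C: "C \<ge> 0" "\<gamma> > 0"
    "\<And>\<epsilon> \<epsilon>' x. 0 < \<epsilon>' \<Longrightarrow> \<epsilon>' \<le> \<epsilon> \<Longrightarrow>
      \<bar>(LINT y|lborel. (u y - u x) * ke \<epsilon>' x y) - (LINT y|lborel. (u y - u x) * ke \<epsilon> x y)\<bar> \<le> C * \<epsilon> powr \<gamma>"
    using truncation_error[OF u] by blast
  show thesis
  proof (rule that[OF C(1,2)])
    fix \<epsilon> x assume e: "(0 :: real) < \<epsilon>"
    define D where "D \<epsilon> = (LINT y|lborel. (u y - u x) * ke \<epsilon> x y)" for \<epsilon>
    have CD: "\<bar>D \<epsilon>' - D \<epsilon>\<bar> \<le> C * \<epsilon> powr \<gamma>" if "0 < \<epsilon>'" "\<epsilon>' \<le> \<epsilon>" for \<epsilon> \<epsilon>'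
      unfolding D_def using C(3)[OF that] .
    have lim0: "((\<lambda>\<epsilon>. C * \<epsilon> powr \<gamma>) \<longlongrightarrow> 0) (at_right 0)"
    proof -
      have "((\<lambda>\<epsilon>. C * \<epsilon> powr \<gamma>) \<longlongrightarrow> C * 0 powr \<gamma>) (at_right 0)"
        using C(2) by (intro tendsto_intros tendsto_powr') (auto simp: eventually_at_right_field intro: exI[of _ 1])
      then show ?thesis by simp
    qed
    define s where "s n = 1 / real (Suc n)" for n
    have s: "s n > 0" "m \<le> n \<Longrightarrow> s n \<le> s m" for m n by (auto simp: s_def intro!: divide_left_mono)
    have s0: "s \<longlonglongrightarrow> 0" unfolding s_def by (rule LIMSEQ_Suc[OF lim_1_over_n])
    have sr: "filterlim s (at_right 0) sequentially"
    proof -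
      have "s n \<noteq> 0" for n using s(1)[of n] by simp
      then show ?thesis using s0 s by (auto simp: filterlim_at)
    qed
    have "Cauchy (\<lambda>n. D (s n))"
    proof (rule metric_CauchyI)
      fix e' :: real assume e': "e' > 0"
      have "(\<lambda>n. C * s n powr \<gamma>) \<longlonglongrightarrow> 0" using filterlim_compose[OF lim0 sr] .
      then have "\<forall>\<^sub>F n in sequentially. C * s n powr \<gamma> < e' / 2" using e' by (intro order_tendstoD) auto
      then obtain N where N: "C * s N powr \<gamma> < e' / 2" by (auto simp: eventually_sequentially)
      show "\<exists>N. \<forall>m\<ge>N. \<forall>n\<ge>N. dist (D (s m)) (D (s n)) < e'"
      proof (intro exI allI impI)
        fix m n assume "N \<le> m" "N \<le> n"
        then have "\<bar>D (s m) - D (s N)\<bar> < e' / 2" "\<bar>D (s n) - D (s N)\<bar> < e' / 2"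
          using CD[of "s m" "s N"] CD[of "s n" "s N"] s N by (auto intro: le_less_trans)
        then show "dist (D (s m)) (D (s n)) < e'" unfolding dist_real_def by linarith
      qed
    qed
    then obtain l where l: "(\<lambda>n. D (s n)) \<longlonglongrightarrow> l" by (auto simp: Cauchy_convergent_iff convergent_def)
    have err: "\<bar>D \<epsilon> - l\<bar> \<le> C * \<epsilon> powr \<gamma>" if "\<epsilon> > 0" for \<epsilon>
    proof (rule tendsto_upperbound)
      show "(\<lambda>n. \<bar>D \<epsilon> - D (s n)\<bar>) \<longlonglongrightarrow> \<bar>D \<epsilon> - l\<bar>" by (intro tendsto_intros l)
      have "\<forall>\<^sub>F n in sequentially. s n < \<epsilon>" using s0 that by (rule order_tendstoD)
      then show "\<forall>\<^sub>F n in sequentially. \<bar>D \<epsilon> - D (s n)\<bar> \<le> C * \<epsilon> powr \<gamma>"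
      proof (rule eventually_mono)
        fix n assume "s n < \<epsilon>"
        then show "\<bar>D \<epsilon> - D (s n)\<bar> \<le> C * \<epsilon> powr \<gamma>"
          using CD[of "s n" \<epsilon>] s(1)[of n] by (simp add: abs_minus_commute)
      qed
    qed simp
    have "((\<lambda>\<epsilon>. D \<epsilon> - l) \<longlongrightarrow> 0) (at_right 0)"
      by (rule Lim_null_comparison[OF _ lim0]) (auto simp: eventually_at_right_field err intro: exI[of _ 1])
    then have "(D \<longlongrightarrow> l) (at_right 0)" using Lim_null by blast
    moreover have "(LINT y:{y. norm (y - x) > \<epsilon>}|lborel. (u y - u x) * enn2real (f x y)) = D \<epsilon>" for \<epsilon>
      unfolding set_lebesgue_integral_def D_def
      by (intro Bochner_Integration.integral_cong) (auto simp: ke_def indicator_def)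
    ultimately have "jump_op f u x = l" unfolding jump_op_def by (simp add: tendsto_Lim)
    then show "\<bar>(LINT y|lborel. (u y - u x) * ke \<epsilon> x y) - jump_op f u x\<bar> \<le> C * \<epsilon> powr \<gamma>"
      using err[OF e] by (simp add: D_def)
  qed
qed

subsection \<open>Convergence of the random walks\<close>

text \<open>The truncated kernel jumps across the sphere of radius \<epsilon>; being a null set, the
  sphere does not disturb dominated convergence.\<close>

lemma AE_not_sphere: "AE y in lborel. norm (y - x) \<noteq> (\<epsilon> :: real)" for x :: "real ^ 'n"
proof -
  have "sphere x \<epsilon> \<in> null_sets lebesgue" using negligible_sphere[of x \<epsilon>] by (simp add: negligible_iff_null_sets)
  then have "sphere x \<epsilon> \<in> null_sets lborel" by (simp add: null_sets_completion_iff)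
  from AE_not_in[OF this] show ?thesis by eventually_elim (auto simp: dist_norm norm_minus_commute)
qed

lemma ke_tendsto:
  assumes xs: "xs \<longlonglongrightarrow> x" and y: "norm (y - x) \<noteq> \<epsilon>" and e: "\<epsilon> > 0"
  shows "(\<lambda>n. ke \<epsilon> (xs n) y) \<longlonglongrightarrow> ke \<epsilon> x y"
proof -
  have n: "(\<lambda>n. norm (y - xs n)) \<longlonglongrightarrow> norm (y - x)" by (intro tendsto_intros xs)
  show ?thesis
  proof (cases "\<epsilon> < norm (y - x)")
    case True
    then have xy: "x \<noteq> y" using e by auto
    have "isCont (\<lambda>x. f x y) x"
      using f_cont[of y] xy by (subst (asm) continuous_on_eq_continuous_at) (auto intro: open_delete)
    then have "(\<lambda>n. f (xs n) y) \<longlonglongrightarrow> f x y" by (rule isCont_tendsto_compose) (rule xs)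
    then have "(\<lambda>n. enn2real (f (xs n) y)) \<longlonglongrightarrow> enn2real (f x y)"
      using f_finite[OF xy] by (intro tendsto_enn2real) (auto simp: less_top)
    moreover have "\<forall>\<^sub>F n in sequentially. enn2real (f (xs n) y) = ke \<epsilon> (xs n) y"
      using order_tendstoD(1)[OF n True] by eventually_elim (simp add: ke_def)
    ultimately show ?thesis using True by (simp add: ke_def[of \<epsilon> x y] tendsto_cong)
  next
    case False
    then have "norm (y - x) < \<epsilon>" using y by simp
    then have "\<forall>\<^sub>F n in sequentially. ke \<epsilon> (xs n) y = 0"
      using order_tendstoD(2)[OF n, of \<epsilon>] by (auto elim!: eventually_mono simp: ke_def)
    then show ?thesis using False by (simp add: ke_def[of \<epsilon> x y] tendsto_eventually)
  qed
qed

text \<open>Dominated convergence. Once \<open>xs n\<close> is within \<open>\<epsilon> / 2\<close>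
  of the limit, a point farther than \<epsilon> from \<open>xs n\<close> is farther than
  \<open>\<epsilon> / 2\<close> from the limit, and the two distances are comparable; so one
  integrable majorant centred at the limit and truncated at \<open>\<epsilon> / 2\<close> serves all
  kernels.\<close>

lemma continuous_ke_integral:
  fixes u :: "(real ^ 'n) \<Rightarrow>\<^sub>C real"
  assumes e: "\<epsilon> > 0"
  shows "continuous_on UNIV (\<lambda>x. LINT y|lborel. ke \<epsilon> x y * u y)"
proof (subst continuous_on_sequentially, intro allI ballI impI, unfold comp_def)
  fix xs :: "nat \<Rightarrow> real ^ 'n" and x
  assume "(\<forall>n. xs n \<in> UNIV) \<and> xs \<longlonglongrightarrow> x"
  then have xs: "xs \<longlonglongrightarrow> x" by simp
  have "\<forall>\<^sub>F n in sequentially. dist (xs n) x < \<epsilon> / 2" using xs e by (intro tendstoD) auto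
  then obtain N where "\<forall>n\<ge>N. dist (xs n) x < \<epsilon> / 2"
    unfolding eventually_sequentially by blast
  then have N: "dist (xs (n + N)) x < \<epsilon> / 2" for n by simp
  define G where "G y = norm u * (M * (2 powr \<beta> * (norm (y - x) powr (- \<beta>) * indicator {v. \<epsilon> / 2 < norm v} (y - x))))" for y
  have G: "integrable lborel G"
  proof -
    have "open {v :: real ^ 'n. \<epsilon> / 2 < norm v}" by (intro open_Collect_less continuous_intros)
    then have [measurable]: "{v :: real ^ 'n. \<epsilon> / 2 < norm v} \<in> sets borel" by simp
    have "integrable lborel (\<lambda>y. norm (y - x) powr (- \<beta>) * indicator {v. \<epsilon> / 2 < norm v} (y - x))"
      using tail_integrable[of "\<epsilon> / 2"] e by (subst integrable_shift[where x = x, symmetric]) auto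
    then show ?thesis unfolding G_def by simp
  qed
  have "(\<lambda>n. LINT y|lborel. ke \<epsilon> (xs (n + N)) y * u y) \<longlonglongrightarrow> (LINT y|lborel. ke \<epsilon> x y * u y)"
  proof (rule integral_dominated_convergence[OF _ _ G])
    have "AE y in lborel. norm (y - x) \<noteq> \<epsilon>" by (rule AE_not_sphere)
    then show "AE y in lborel. (\<lambda>n. ke \<epsilon> (xs (n + N)) y * u y) \<longlonglongrightarrow> ke \<epsilon> x y * u y"
      by eventually_elim (intro tendsto_intros ke_tendsto LIMSEQ_ignore_initial_segment xs e)
    show "AE y in lborel. norm (ke \<epsilon> (xs (n + N)) y * u y) \<le> G y" for n
    proof (rule AE_I2)
      fix y
      let ?z = "xs (n + N)"
      have "ke \<epsilon> ?z y \<le> M * (2 powr \<beta> * (norm (y - x) powr (- \<beta>) * indicator {v. \<epsilon> / 2 < norm v} (y - x)))"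
      proof (cases "\<epsilon> < norm (y - ?z)")
        case True
        have t: "norm (y - x) \<le> norm (y - ?z) + \<epsilon> / 2" "norm (y - ?z) \<le> norm (y - x) + \<epsilon> / 2"
          using norm_triangle_ineq[of "y - ?z" "?z - x"] norm_triangle_ineq[of "y - x" "x - ?z"] N[of n]
          by (auto simp: dist_norm norm_minus_commute)
        have "norm (y - ?z) powr (- \<beta>) \<le> 2 powr \<beta> * norm (y - x) powr (- \<beta>)"
          using t True e by (intro powr_half_le) auto
        moreover have "ke \<epsilon> ?z y \<le> M * norm (y - ?z) powr (- \<beta>)" using ke_le'[of \<epsilon> ?z y] e True by simp
        ultimately have "ke \<epsilon> ?z y \<le> M * (2 powr \<beta> * norm (y - x) powr (- \<beta>))"
          using M by (meson mult_left_mono less_imp_le order_trans)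
        then show ?thesis using t True by (simp add: indicator_def)
      next
        case False
        then show ?thesis using M by (simp add: ke_def)
      qed
      then have "ke \<epsilon> ?z y * \<bar>u y\<bar> \<le> (M * (2 powr \<beta> * (norm (y - x) powr (- \<beta>) * indicator {v. \<epsilon> / 2 < norm v} (y - x)))) * norm u"
        using ke_nonneg M by (intro mult_mono abs_bcontfun_le) auto
      then show "norm (ke \<epsilon> ?z y * u y) \<le> G y"
        using ke_nonneg[of \<epsilon> ?z y] by (simp add: G_def abs_mult mult_ac)
    qed
  qed measurable
  then show "(\<lambda>n. LINT y|lborel. ke \<epsilon> (xs n) y * u y) \<longlonglongrightarrow> (LINT y|lborel. ke \<epsilon> x y * u y)"
    by (rule LIMSEQ_offset)
qed

text \<open>The walk acts on bounded continuous functions and not only on \<open>C0\<close>: the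
  Chernoff argument takes operators that are contractions of the whole space, which avoids proving
  that a step preserves decay at infinity.\<close>

definition Tb :: "real \<Rightarrow> ((real ^ 'n) \<Rightarrow>\<^sub>C real) \<Rightarrow> ((real ^ 'n) \<Rightarrow>\<^sub>C real)" where
  "Tb h u = Bcontfun (walk.Tr (kh h) u)"

text \<open>Continuity is the point. \<open>mass\<close> is the integral of the kernel against the
  constant 1, so one continuity statement covers both terms of \<open>Tr\<close>.\<close>

lemma Tb_apply:
  assumes h: "h > 0"
  shows "apply_bcontfun (Tb h u) = walk.Tr (kh h) u"
proof -
  interpret walk "kh h" by (rule walk_kh[OF h])
  have "continuous_on UNIV (\<lambda>x. LINT y|lborel. kh h x y * u y)" for u :: "(real ^ 'n) \<Rightarrow>\<^sub>C real"
  proof -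
    have "(LINT y|lborel. kh h x y * u y) = h * (LINT y|lborel. ke (eps h) x y * u y)" for x
      unfolding kh_def by (simp add: mult.assoc)
    then show ?thesis using continuous_ke_integral[OF eps_pos[OF h], of u] by (simp add: continuous_on_mult_left)
  qed
  from this[of u] this[of "const_bcontfun 1"]
  have "continuous_on UNIV (Tr u)"
    unfolding Tr_def[abs_def] mass_def by (intro continuous_intros) (auto simp: const_bcontfun.rep_eq)
  moreover have "norm (Tr u x) \<le> norm u" for x
    using Tr_bound[of u "norm u" x] abs_bcontfun_le[of u] by simp
  ultimately have "Tr u \<in> bcontfun" by (rule bcontfun_normI)
  then show ?thesis by (simp add: Tb_def Bcontfun_inverse)
qed

lemma Tb_contr: "h > 0 \<Longrightarrow> norm (Tb h u) \<le> norm u"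
proof -
  assume h: "h > 0"
  interpret walk "kh h" by (rule walk_kh[OF h])
  show ?thesis by (rule norm_bound) (simp add: Tb_apply[OF h] Tr_bound abs_bcontfun_le)
qed

lemma Tb_linear: "h > 0 \<Longrightarrow> linear (Tb h)"
proof -
  assume h: "h > 0"
  interpret walk "kh h" by (rule walk_kh[OF h])
  show ?thesis
  proof (rule linearI; rule bcontfun_eqI)
    fix u v :: "(real ^ 'n) \<Rightarrow>\<^sub>C real" and x
    show "Tb h (u + v) x = (Tb h u + Tb h v) x"
      using Tr_lincomb[of u v "norm u" "norm v" 1 1 x, OF _ _ abs_bcontfun_le abs_bcontfun_le] by (simp add: Tb_apply[OF h] plus_bcontfun.rep_eq)
  next
    fix r and u :: "(real ^ 'n) \<Rightarrow>\<^sub>C real" and x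
    show "Tb h (r *\<^sub>R u) x = (r *\<^sub>R Tb h u) x"
      using Tr_lincomb[of u u "norm u" "norm u" r 0 x, OF _ _ abs_bcontfun_le abs_bcontfun_le] by (simp add: Tb_apply[OF h] scaleR_bcontfun.rep_eq)
  qed
qed

lemma Tb_pow: "h > 0 \<Longrightarrow> apply_bcontfun ((Tb h ^^ k) u) = (walk.Tr (kh h) ^^ k) u"
  by (induction k) (simp_all add: Tb_apply)

text \<open>The difference quotient of the walk is the integral truncated at \<open>eps h\<close>,
  whose distance to the operator is at most a power of \<open>eps h\<close>, uniformly in
  \<open>x\<close>.\<close>

lemma Tb_consistent:
  assumes uv: "(u, v) \<in> jump_op_graph f" and e: "e > 0" and t: "t > 0"
  shows "\<forall>\<^sub>F i in sequentially. norm (Tb (t / 2 ^ i) u - u - (t / 2 ^ i) *\<^sub>R v) \<le> (t / 2 ^ i) * e"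
proof -
  have u: "u \<in> C2c" and v: "\<And>x. v x = jump_op f u x" using uv by (auto simp: jump_op_graph_def)
  obtain C \<gamma> where C: "C \<ge> 0" "\<gamma> > 0"
    "\<And>\<epsilon> x. 0 < \<epsilon> \<Longrightarrow> \<bar>(LINT y|lborel. (u y - u x) * ke \<epsilon> x y) - jump_op f u x\<bar> \<le> C * \<epsilon> powr \<gamma>"
    using jump_op_error[OF u] by blast
  have "(\<lambda>i. M * \<omega> * (t * (1/2) ^ i)) \<longlonglongrightarrow> M * \<omega> * (t * 0)" by (intro tendsto_intros LIMSEQ_power_zero) auto
  then have "(\<lambda>i. C * ((M * \<omega> * (t * (1/2) ^ i)) powr (1 / \<alpha>)) powr \<gamma>) \<longlonglongrightarrow> C * ((M * \<omega> * (t * 0)) powr (1 / \<alpha>)) powr \<gamma>"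
    using alpha C(2) M \<omega> t by (intro tendsto_mult tendsto_const tendsto_powr') (auto intro!: always_eventually)
  then have "\<forall>\<^sub>F i in sequentially. C * ((M * \<omega> * (t * (1/2) ^ i)) powr (1 / \<alpha>)) powr \<gamma> < e"
    using e C(2) alpha by (intro order_tendstoD) auto
  then show ?thesis
  proof (rule eventually_mono)
    fix i :: nat
    define h where "h = t / 2 ^ i"
    have h: "h > 0" using t by (simp add: h_def)
    assume "C * ((M * \<omega> * (t * (1/2) ^ i)) powr (1 / \<alpha>)) powr \<gamma> < e"
    then have ce: "C * eps h powr \<gamma> < e" by (simp add: eps_def h_def power_divide)
    show "norm (Tb (t / 2 ^ i) u - u - (t / 2 ^ i) *\<^sub>R v) \<le> (t / 2 ^ i) * e"
    proof (rule norm_bound)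
      fix x
      have "Tb h u x - u x = h * (LINT y|lborel. (u y - u x) * ke (eps h) x y)"
      proof -
        interpret walk "kh h" by (rule walk_kh[OF h])
        have "Tr u x - u x = (LINT y|lborel. (u y - u x) * kh h x y)"
          by (rule Tr_minus_id(2)) (auto intro: abs_bcontfun_le)
        also have "\<dots> = (LINT y|lborel. h * ((u y - u x) * ke (eps h) x y))"
          by (intro Bochner_Integration.integral_cong) (auto simp: kh_def)
        finally show ?thesis by (simp add: Tb_apply[OF h])
      qed
      then have "(Tb h u - u - h *\<^sub>R v) x = h * ((LINT y|lborel. (u y - u x) * ke (eps h) x y) - jump_op f u x)"
        by (simp add: minus_bcontfun.rep_eq scaleR_bcontfun.rep_eq v algebra_simps)
      also have "\<bar>\<dots>\<bar> \<le> h * e"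
        using C(3)[OF eps_pos[OF h], of x] ce h by (simp add: abs_mult)
      finally show "norm ((Tb (t / 2 ^ i) u - u - (t / 2 ^ i) *\<^sub>R v) x) \<le> (t / 2 ^ i) * e" by (simp add: h_def)
    qed
  qed
qed

text \<open>Uniform over all numbers of steps up to \<open>2 ^ i\<close>, not only at the final
  time: the comparison with the barrier transfers the bound for \<open>P\<close> to the intermediate
  powers of the walk.\<close>

lemma walk_converges:
  assumes t: "t > 0" and u: "u \<in> C0" and e: "e > 0"
  shows "\<forall>\<^sub>F i in sequentially. \<forall>k\<le>2^i. \<forall>x. \<bar>(walk.Tr (kh (t / 2 ^ i)) ^^ k) u x - P (real k * (t / 2 ^ i)) u x\<bar> \<le> e"
proof -
  have h: "t / 2 ^ i > 0" for i :: nat using t by simp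
  have "\<forall>\<^sub>F i in sequentially. \<forall>k\<le>2^i. norm ((Tb (t / 2 ^ i) ^^ k) u - P (real k * (t / 2 ^ i)) u) \<le> e"
    using chernoff[OF gen t, of "\<lambda>i. Tb (t / 2 ^ i)", OF Tb_linear[OF h] Tb_contr[OF h] Tb_consistent[OF _ _ t] u e] by blast
  then show ?thesis
  proof (rule eventually_mono, intro allI impI)
    fix i k :: nat and x
    assume "\<forall>k\<le>2^i. norm ((Tb (t / 2 ^ i) ^^ k) u - P (real k * (t / 2 ^ i)) u) \<le> e" "k \<le> 2 ^ i"
    then have "norm ((Tb (t / 2 ^ i) ^^ k) u - P (real k * (t / 2 ^ i)) u) \<le> e" by blast
    then have "\<bar>((Tb (t / 2 ^ i) ^^ k) u - P (real k * (t / 2 ^ i)) u) x\<bar> \<le> e" using abs_bcontfun_le order_trans by blast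
    then show "\<bar>(walk.Tr (kh (t / 2 ^ i)) ^^ k) u x - P (real k * (t / 2 ^ i)) u x\<bar> \<le> e"
      by (simp add: minus_bcontfun.rep_eq Tb_pow[OF h])
  qed
qed

end

subsection \<open>Tent functions\<close>

lemma compact_support_C0:
  fixes u :: "(real ^ 'n) \<Rightarrow>\<^sub>C real"
  assumes "\<And>x. norm x \<ge> R \<Longrightarrow> u x = 0"
  shows "u \<in> C0"
proof -
  have "\<forall>\<^sub>F x in at_infinity. u x = 0"
    unfolding eventually_at_infinity using assms by blast
  then show ?thesis by (simp add: C0_def tendsto_eventually)
qed

definition tent :: "real ^ 'n \<Rightarrow> real \<Rightarrow> (real ^ 'n) \<Rightarrow>\<^sub>C real" where
  "tent y \<eta> = Bcontfun (\<lambda>x. max 0 (1 - norm (x - y) / \<eta>))"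

lemma tent_apply: "\<eta> > 0 \<Longrightarrow> tent y \<eta> x = max 0 (1 - norm (x - y) / \<eta>)"
proof -
  assume e: "\<eta> > 0"
  have "(\<lambda>x. max 0 (1 - norm (x - y) / \<eta>)) \<in> bcontfun"
    using e by (intro bcontfun_normI[where b = 1] continuous_intros) auto
  then show ?thesis by (simp add: tent_def Bcontfun_inverse)
qed

lemma tent_facts:
  assumes "\<eta> > 0"
  shows "0 \<le> tent y \<eta> x" "tent y \<eta> x \<le> 1" "norm (x - y) \<ge> \<eta> \<Longrightarrow> tent y \<eta> x = 0"
  using assms by (auto simp: tent_apply)

lemma tent_C0:
  fixes y :: "real ^ 'n"
  shows "\<eta> > 0 \<Longrightarrow> tent y \<eta> \<in> C0"
proof (rule compact_support_C0)
  fix x :: "real ^ 'n" assume "\<eta> > 0" "norm y + \<eta> \<le> norm x"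
  then show "tent y \<eta> x = 0" using norm_triangle_ineq[of "x - y" y] by (intro tent_facts(3)) auto
qed

lemma tent_integral_le:
  fixes y :: "real ^ 'n"
  assumes e: "\<eta> > 0"
  shows "(\<integral>\<^sup>+x. ennreal (tent y \<eta> x) \<partial>lborel) \<le> ennreal (unit_ball_vol (real CARD('n)) * \<eta> ^ CARD('n))"
proof -
  have "(\<integral>\<^sup>+x. ennreal (tent y \<eta> x) \<partial>lborel) \<le> (\<integral>\<^sup>+x. indicator (cball y \<eta>) x \<partial>lborel)"
  proof (intro nn_integral_mono)
    fix x show "ennreal (tent y \<eta> x) \<le> indicator (cball y \<eta>) x"
      using tent_facts[OF e, where y = y and x = x] by (cases "norm (x - y) \<le> \<eta>") (auto simp: dist_norm norm_minus_commute[of y x] indicator_def ennreal_le_1)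
  qed
  also have "\<dots> = ennreal (unit_ball_vol (real CARD('n)) * \<eta> ^ CARD('n))"
    using e by (simp add: emeasure_cball)
  finally show ?thesis .
qed

lemma tent_integral_ge:
  fixes y :: "real ^ 'n"
  assumes e: "\<eta> > 0"
  shows "(\<integral>\<^sup>+x. ennreal (tent y \<eta> x) \<partial>lborel) \<ge> ennreal (1/2 * (unit_ball_vol (real CARD('n)) * (\<eta> / 2) ^ CARD('n)))"
proof -
  have "ennreal (1/2 * (unit_ball_vol (real CARD('n)) * (\<eta> / 2) ^ CARD('n)))
     = (\<integral>\<^sup>+x. ennreal (1/2) * indicator (cball y (\<eta> / 2)) x \<partial>lborel)"
    by (subst nn_integral_cmult_indicator, simp, subst ennreal_mult) (use e in \<open>simp_all add: emeasure_cball\<close>)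
  also have "\<dots> \<le> (\<integral>\<^sup>+x. ennreal (tent y \<eta> x) \<partial>lborel)"
  proof (intro nn_integral_mono)
    fix x
    show "ennreal (1/2) * indicator (cball y (\<eta> / 2)) x \<le> ennreal (tent y \<eta> x)"
    proof (cases "x \<in> cball y (\<eta> / 2)")
      case True
      then have "norm (x - y) / \<eta> \<le> 1/2" using e by (simp add: dist_norm norm_minus_commute divide_le_eq)
      then have "ennreal (1/2) \<le> ennreal (tent y \<eta> x)" using e by (intro ennreal_leI) (simp add: tent_apply)
      then show ?thesis using True by simp
    qed simp
  qed
  finally show ?thesis .
qed

subsection \<open>Ultracontractivity\<close>

context profile_const
begin

text \<open>Ratio of the radii of the annulus used for smoothing: beyond \<open>Kc * \<rho>\<close>
  the upper bound on the kernel leaves at most half of the mass guaranteed beyond \<rho>, see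
  \<open>Kc_tail\<close>.\<close>

definition Kc :: real where "Kc = max 1 ((2 * M * \<omega> / c4) powr (1 / \<alpha>))"
text \<open>At step \<open>n\<close> the scale \<rho> with
  \<open>\<rho> powr \<alpha> = a0 * (n * h)\<close> is used; \<open>a0\<close> makes the mass moved
  in one step, \<open>h * (c4 / 2 * \<rho> powr (- \<alpha>))\<close>, equal to
  \<open>(dlt + 1) / n\<close>.\<close>

definition a0 :: real where "a0 = c4 / (2 * (dlt + 1))"
text \<open>Up to this time \<open>Kc * \<rho> \<le> 1\<close>, the range where \<phi> = 1.\<close>

definition t1 :: real where "t1 = 1 / (a0 * Kc powr \<alpha>)"
text \<open>Arises from twice the density bound \<open>h * M * \<rho> powr (- \<beta>)\<close> at
  the scale \<rho>.\<close>

definition CN :: real where "CN = 2 * M * a0 powr (- dlt - 1)"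
text \<open>From this step on \<rho> is not below the truncation \<open>eps h\<close>, and
  \<open>(dlt + 1) / n \<le> 1\<close>.\<close>

definition n0 :: nat where "n0 = Suc (nat \<lceil>M * \<omega> / a0 + dlt + 1\<rceil>)"

lemma const_pos: "Kc \<ge> 1" "a0 > 0" "t1 > 0" "CN > 0" "n0 > 0"
proof -
  show k: "Kc \<ge> 1" by (simp add: Kc_def)
  show a: "a0 > 0" using c4 dlt_pos by (simp add: a0_def)
  show "t1 > 0" using k a by (simp add: t1_def)
  show "CN > 0" using M a by (simp add: CN_def)
  show "n0 > 0" by (simp add: n0_def)
qed

lemma n0_ge: "M * \<omega> / a0 \<le> n0" "dlt + 1 \<le> n0"
proof -
  have "0 \<le> M * \<omega> / a0" using M \<omega> const_pos by simp
  moreover have "M * \<omega> / a0 + dlt + 1 \<le> n0" unfolding n0_def by linarith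
  ultimately show "M * \<omega> / a0 \<le> n0" "dlt + 1 \<le> n0" using dlt_pos by linarith+
qed

lemma Kc_tail: "M * \<omega> * Kc powr (- \<alpha>) \<le> c4 / 2"
proof -
  define x where "x = 2 * M * \<omega> / c4"
  have x: "x > 0" using M \<omega> c4 by (simp add: x_def)
  have "x = (x powr (1 / \<alpha>)) powr \<alpha>" using x alpha by (simp add: powr_powr)
  also have "\<dots> \<le> Kc powr \<alpha>" using alpha by (intro powr_mono2) (auto simp: Kc_def x_def)
  finally have "2 * M * \<omega> / c4 \<le> Kc powr \<alpha>" unfolding x_def .
  then have "2 * M * \<omega> \<le> c4 * Kc powr \<alpha>" using c4 by (simp add: field_simps)
  then show ?thesis using const_pos(1) by (simp add: powr_minus field_simps)
qed

text \<open>Large enough for the trivial bound 1 at times up to \<open>\<eta> powr \<alpha>\<close>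
  and for the on-diagonal bound afterwards; the outer \<open>2 powr dlt\<close> pays for the shift
  of time, which costs at most a factor 2 in the time.\<close>

definition Lb :: real where "Lb = 2 powr dlt * (1 + CN * 2 powr dlt * unit_ball_vol (real CARD('n)))"
text \<open>The summand \<open>c1\<^sup>2\<close> makes the initial barrier flat on the support of
  the tent; the other one gives
  \<open>A * (Lb / cb A) powr (\<alpha> / \<beta>) \<le> 1\<close>.\<close>

definition cb :: "real \<Rightarrow> real" where "cb A = Lb * (c1\<^sup>2 + A powr (\<beta> / \<alpha>))"
text \<open>\<open>A\<close> is the exponential rate of the barrier, \<open>dlt / t1\<close> that of
  the on-diagonal bound.\<close>

definition Cb :: "real \<Rightarrow> real" where "Cb A = A + dlt / t1"

lemma barrier_const:
  assumes A: "A > 0"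
  shows "Lb > 0" "cb A > 0" "Lb * c1\<^sup>2 \<le> cb A" "A * (Lb / cb A) powr (\<alpha> / \<beta>) \<le> 1" "Cb A > 0" "A \<le> Cb A" "dlt / t1 \<le> Cb A"
proof -
  have V: "unit_ball_vol (real CARD('n)) \<ge> 0" by simp
  show L: "Lb > 0" unfolding Lb_def using V const_pos by (intro mult_pos_pos add_pos_nonneg) auto
  have x: "c1\<^sup>2 + A powr (\<beta> / \<alpha>) > 0" using c1_ge by (intro add_pos_nonneg) auto
  show c: "cb A > 0" using L x by (simp add: cb_def)
  show "Lb * c1\<^sup>2 \<le> cb A" using L by (simp add: cb_def distrib_left)
  have "Lb / cb A = 1 / (c1\<^sup>2 + A powr (\<beta> / \<alpha>))" using L by (simp add: cb_def)
  also have "\<dots> \<le> 1 / (A powr (\<beta> / \<alpha>))"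
    using x A by (intro divide_left_mono) auto
  finally have "(Lb / cb A) powr (\<alpha> / \<beta>) \<le> (1 / (A powr (\<beta> / \<alpha>))) powr (\<alpha> / \<beta>)"
    using L c alpha beta_pos by (intro powr_mono2) auto
  also have "\<dots> = 1 / A"
    using A alpha beta_pos by (simp add: powr_divide powr_powr)
  finally show "A * (Lb / cb A) powr (\<alpha> / \<beta>) \<le> 1" using A by (simp add: field_simps)
  show "Cb A > 0" "A \<le> Cb A" "dlt / t1 \<le> Cb A" using A dlt_pos const_pos by (auto simp: Cb_def add_pos_nonneg)
qed

end

section \<open>Smoothing by the random walks\<close>

context jump
begin

text \<open>The guaranteed mass beyond \<rho> is counted with the weight 1 / \<phi>. Beyond
  \<open>Kc * \<rho>\<close> the upper bound cancels this weight, so the share of that part is at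
  most half; in the annulus the weight is 1, so the other half is mass of the kernel itself.\<close>

lemma annulus_mass:
  assumes e: "0 < \<epsilon>" "\<epsilon> \<le> \<rho>" and \<rho>: "Kc * \<rho> \<le> 1"
  shows "ennreal (c4 / 2 * \<rho> powr (- \<alpha>)) \<le> (\<integral>\<^sup>+y. ennreal (if \<rho> < norm (y - x) \<and> norm (y - x) \<le> Kc * \<rho> then ke \<epsilon> x y else 0) \<partial>lborel)"
    (is "_ \<le> ?X")
proof -
  have r: "\<rho> > 0" using e by simp
  have Kr: "Kc * \<rho> > 0" using const_pos r by simp
  note ke_meas_right[measurable]
  have [measurable]: "(\<lambda>y. ennreal (if \<rho> < norm (y - x) \<and> norm (y - x) \<le> Kc * \<rho> then ke \<epsilon> x y else 0)) \<in> borel_measurable borel"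
    by measurable
  let ?Y = "\<lambda>v. ennreal M * (ennreal (norm v powr (- \<beta>)) * indicator {v. Kc * \<rho> < norm v} (v :: real ^ 'n))"
  have Ym: "?Y \<in> borel_measurable borel" using tail_meas by (intro borel_measurable_times_ennreal) auto
  have Ym': "(\<lambda>y. ?Y (y - x)) \<in> borel_measurable lborel"
    using measurable_compose[OF _ Ym, of "\<lambda>y. y - x" borel] by simp
  have "ennreal (c4 * \<rho> powr (- \<alpha>)) \<le> (\<integral>\<^sup>+y\<in>{y. norm (y - x) > \<rho>}. f x y / ennreal (\<phi> (norm (y - x))) \<partial>lborel)"
    by (rule f_lower[OF r])
  also have "\<dots> \<le> (\<integral>\<^sup>+y. ennreal (if \<rho> < norm (y - x) \<and> norm (y - x) \<le> Kc * \<rho> then ke \<epsilon> x y else 0) + ?Y (y - x) \<partial>lborel)"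
  proof (intro nn_integral_mono)
    fix y
    show "f x y / ennreal (\<phi> (norm (y - x))) * indicator {y. norm (y - x) > \<rho>} y
      \<le> ennreal (if \<rho> < norm (y - x) \<and> norm (y - x) \<le> Kc * \<rho> then ke \<epsilon> x y else 0) + ?Y (y - x)"
    proof (cases "\<rho> < norm (y - x)")
      case True
      then have xy: "x \<noteq> y" using r by auto
      show ?thesis
      proof (cases "norm (y - x) \<le> Kc * \<rho>")
        case le: True
        have "f x y / ennreal (\<phi> (norm (y - x))) = f x y"
          using le \<rho> by (simp add: phi_one divide_ennreal_def)
        also have "\<dots> = ennreal (ke \<epsilon> x y)"
          using True e f_finite[OF xy] by (simp add: ke_def less_top)
        finally show ?thesis using True le by simp
      next
        case False
        have p: "0 < \<phi> (norm (y - x))" using phi_range(1) by simp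
        have "f x y / ennreal (\<phi> (norm (y - x))) \<le> ennreal (M * \<phi> (norm (y - x)) * norm (y - x) powr (- \<beta>)) / ennreal (\<phi> (norm (y - x)))"
          by (intro divide_right_mono_ennreal f_bound xy)
        also have "\<dots> = ennreal (M * norm (y - x) powr (- \<beta>))"
          using p M by (subst divide_ennreal) auto
        finally show ?thesis using False True M by (simp add: ennreal_mult)
      qed
    qed simp
  qed
  also have "\<dots> = ?X + (\<integral>\<^sup>+y. ?Y (y - x) \<partial>lborel)"
    by (rule nn_integral_add[OF _ Ym']) measurable
  also have "(\<integral>\<^sup>+y. ?Y (y - x) \<partial>lborel) = (\<integral>\<^sup>+v. ?Y v \<partial>lborel)"
    using nn_integral_shift[of "\<lambda>v. ?Y (v - x)" x] Ym' by simp
  also have "\<dots> = ennreal M * (\<integral>\<^sup>+v. (ennreal (norm v powr (- \<beta>)) * indicator {v. Kc * \<rho> < norm v} (v :: real ^ 'n)) \<partial>lborel)"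
    by (rule nn_integral_cmult) (rule tail_meas)
  also have "\<dots> \<le> ennreal M * ennreal (\<omega> * (Kc * \<rho>) powr (- \<alpha>))"
    by (intro mult_left_mono tail Kr) auto
  also have "\<dots> = ennreal (M * \<omega> * Kc powr (- \<alpha>) * \<rho> powr (- \<alpha>))"
    using M \<omega> const_pos(1) r by (simp add: ennreal_mult[symmetric] powr_mult mult_ac)
  also have "\<dots> \<le> ennreal (c4 / 2 * \<rho> powr (- \<alpha>))"
    by (intro ennreal_leI mult_right_mono Kc_tail) auto
  finally have "ennreal (c4 * \<rho> powr (- \<alpha>)) \<le> ?X + ennreal (c4 / 2 * \<rho> powr (- \<alpha>))"
    by (simp add: add_left_mono)
  moreover have "ennreal (c4 * \<rho> powr (- \<alpha>)) = ennreal (c4 / 2 * \<rho> powr (- \<alpha>)) + ennreal (c4 / 2 * \<rho> powr (- \<alpha>))"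
    using c4 by (subst ennreal_plus[symmetric]) auto
  ultimately have "ennreal (c4 / 2 * \<rho> powr (- \<alpha>)) + ennreal (c4 / 2 * \<rho> powr (- \<alpha>)) \<le> ennreal (c4 / 2 * \<rho> powr (- \<alpha>)) + ?X"
    by (simp only: add.commute)
  then show ?thesis by (simp only: ennreal_add_left_cancel_le) simp
qed

text \<open>The scale is adapted to the number of steps: a mass of at least
  \<open>(dlt + 1) / n\<close> is spread with density at most
  \<open>h * M * \<rho> powr (- \<beta>)\<close>, which produces the coefficients of
  \<open>nash_recursion\<close> with \<delta> = \<open>dlt\<close>.\<close>

lemma nash_walk_step:
  assumes h: "h > 0" and n: "n0 \<le> n" "n * h \<le> t1" and u: "u \<in> borel_measurable borel"
  shows "(\<integral>\<^sup>+x. (walk.Te (kh h) u x)\<^sup>2 \<partial>lborel) \<le> ennreal (1 - (dlt + 1) / n) * (\<integral>\<^sup>+x. (u x)\<^sup>2 \<partial>lborel)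
    + ennreal (CN * h * (n * h) powr (- dlt - 1)) * (\<integral>\<^sup>+x. u x \<partial>lborel)\<^sup>2"
proof -
  interpret walk "kh h" by (rule walk_kh[OF h])
  have npos: "real n > 0" using n const_pos(5) by simp
  define \<rho> where "\<rho> = (a0 * (n * h)) powr (1 / \<alpha>)"
  have r: "\<rho> > 0" using const_pos npos h by (simp add: \<rho>_def)
  have ra: "\<rho> powr \<alpha> = a0 * (n * h)" using const_pos npos h alpha by (simp add: \<rho>_def powr_powr)
  have er: "eps h \<le> \<rho>"
  proof -
    have "M * \<omega> / a0 \<le> n" using n0_ge(1) n(1) by linarith
    then have "M * \<omega> \<le> a0 * n" using const_pos by (simp add: divide_le_eq mult.commute)
    then have "M * \<omega> * h \<le> a0 * n * h" using h by (intro mult_right_mono) auto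
    then show ?thesis unfolding eps_def \<rho>_def using M \<omega> h alpha by (intro powr_mono2) (auto simp: mult_ac)
  qed
  have Kr: "Kc * \<rho> \<le> 1"
  proof -
    have "(Kc * \<rho>) powr \<alpha> = Kc powr \<alpha> * (a0 * (n * h))" using const_pos r by (simp add: powr_mult ra)
    also have "\<dots> \<le> Kc powr \<alpha> * (a0 * t1)" using n const_pos by (intro mult_left_mono) auto
    also have "\<dots> = 1" using const_pos by (simp add: t1_def)
    finally have "(Kc * \<rho>) powr \<alpha> \<le> 1 powr \<alpha>" by simp
    then show ?thesis using powr_less_mono2[of \<alpha> 1 "Kc * \<rho>"] alpha by (meson not_le zero_le_one)
  qed
  define r where "r x y = (if \<rho> < norm (y - x) \<and> norm (y - x) \<le> Kc * \<rho> then kh h x y else 0)" for x y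
  have r_meas: "case_prod r \<in> borel_measurable borel"
    unfolding r_def[abs_def] borel_prod[symmetric] by measurable
  have q: "r x y \<le> h * M * \<rho> powr (- \<beta>)" for x y
  proof (cases "\<rho> < norm (y - x) \<and> norm (y - x) \<le> Kc * \<rho>")
    case True
    have "ke (eps h) x y \<le> M * norm (y - x) powr (- \<beta>)"
      using ke_le'[of "eps h" x y] eps_pos[OF h] M by (auto simp: indicator_def split: if_splits intro: order_trans)
    also have "\<dots> \<le> M * \<rho> powr (- \<beta>)"
      using True r M beta_pos by (intro mult_left_mono powr_mono2') auto
    finally show ?thesis using h True by (simp add: r_def kh_def)
  next
    case False
    then show ?thesis using h M by (auto simp: r_def)
  qed
  have kap: "h * (c4 / 2 * \<rho> powr (- \<alpha>)) = (dlt + 1) / n"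
    using h npos const_pos c4 dlt_pos unfolding powr_minus ra by (simp add: a0_def field_simps)
  have mass: "ennreal ((dlt + 1) / n) \<le> (\<integral>\<^sup>+y. ennreal (r x y) \<partial>lborel)" for x
  proof -
    have "ennreal ((dlt + 1) / n) = ennreal h * ennreal (c4 / 2 * \<rho> powr (- \<alpha>))"
      by (subst kap[symmetric], rule ennreal_mult) (use h c4 in auto)
    also have "\<dots> \<le> ennreal h * (\<integral>\<^sup>+y. ennreal (if \<rho> < norm (y - x) \<and> norm (y - x) \<le> Kc * \<rho> then ke (eps h) x y else 0) \<partial>lborel)"
      by (intro mult_left_mono annulus_mass eps_pos h er Kr) auto
    also have "\<dots> = (\<integral>\<^sup>+y. ennreal (r x y) \<partial>lborel)"
      using h by (subst nn_integral_cmult[symmetric]) (auto simp: r_def kh_def ennreal_mult ke_nonneg intro!: nn_integral_cong)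
    finally show ?thesis .
  qed
  have "(\<integral>\<^sup>+x. (Te u x)\<^sup>2 \<partial>lborel) \<le> ennreal (1 - (dlt + 1) / n) * (\<integral>\<^sup>+x. (u x)\<^sup>2 \<partial>lborel)
     + ennreal (2 * (h * M * \<rho> powr (- \<beta>))) * (\<integral>\<^sup>+x. u x \<partial>lborel)\<^sup>2"
  proof (rule nash_step[OF r_meas _ _ q _ mass _ u])
    show "r x y = r y x" for x y using k_sym[of x y] by (simp add: r_def norm_minus_commute)
  qed (use k_nonneg dlt_pos npos in \<open>auto simp: r_def\<close>)
  also have "2 * (h * M * \<rho> powr (- \<beta>)) = CN * h * (n * h) powr (- dlt - 1)"
  proof -
    have "\<rho> powr (- \<beta>) = (\<rho> powr \<alpha>) powr (- dlt - 1)"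
    proof -
      have "\<alpha> * (- dlt - 1) = - \<beta>" using alpha by (simp add: dlt_def beta field_simps)
      then show ?thesis by (simp only: powr_powr)
    qed
    also have "\<dots> = a0 powr (- dlt - 1) * (n * h) powr (- dlt - 1)"
      unfolding ra using const_pos npos h by (simp add: powr_mult)
    finally show ?thesis by (simp add: CN_def)
  qed
  finally show ?thesis .
qed

text \<open>The recursion starts at \<open>n0\<close>, before which the norm is bounded by its
  initial value, and stops at time \<open>t1\<close>, after which the norm is only known not to
  increase. The gain is therefore measured by \<tau>, which is at most \<open>t1 / 2\<close>; the
  half leaves room for rounding \<open>t1 / h\<close> down.\<close>

lemma nash_walk:
  fixes h \<tau> :: real and n :: nat
  assumes h: "h > 0" "h \<le> t1 / 2" and w: "w \<in> borel_measurable borel"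
    and I: "(\<integral>\<^sup>+x. w x \<partial>lborel) = ennreal I" "I \<ge> 0" and S: "(\<integral>\<^sup>+x. (w x)\<^sup>2 \<partial>lborel) = ennreal S" "S \<ge> 0"
    and \<tau>: "\<tau> \<le> n * h" "\<tau> \<le> t1 / 2" "n0 * h \<le> \<tau>"
  shows "(\<integral>\<^sup>+x. ((walk.Te (kh h) ^^ n) w x)\<^sup>2 \<partial>lborel)
    \<le> ennreal (CN * I\<^sup>2 * \<tau> powr (- dlt) + n0 powr (dlt + 1) * S * (\<tau> / h) powr (- (dlt + 1)))"
proof -
  interpret walk "kh h" by (rule walk_kh[OF h(1)])
  define E where "E n = (\<integral>\<^sup>+x. ((Te ^^ n) w x)\<^sup>2 \<partial>lborel)" for n
  have Edec: "E (Suc n) \<le> E n" for n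
    unfolding E_def using L2_decreasing[OF Te_pow_meas[OF w, of n]] by simp
  then have Ele: "E n \<le> E m" if "m \<le> n" for m n using that by (rule lift_Suc_antimono_le)
  have E0: "E 0 = ennreal S" by (simp add: E_def S)
  then have Efin: "E n < top" for n using Ele[of 0 n] by (simp add: le_less_trans)
  define v where "v n = enn2real (E n)" for n
  have Ev: "E n = ennreal (v n)" for n using Efin[of n] by (simp add: v_def)
  have v: "0 \<le> v n" "v n \<le> S" for n
  proof -
    show "0 \<le> v n" by (simp add: v_def)
    have "ennreal (v n) \<le> ennreal S" using Ele[of 0 n] unfolding E0 Ev[of n] by simp
    then show "v n \<le> S" using S(2) by simp
  qed
  define m where "m = min n (nat \<lfloor>t1 / h\<rfloor>)"
  have tpos: "\<tau> > 0" using \<tau>(3) const_pos(5) h by (meson less_le_trans mult_pos_pos of_nat_0_less_iff)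
  have m1: "m * h \<le> t1"
  proof -
    have "real (nat \<lfloor>t1 / h\<rfloor>) \<le> t1 / h" using const_pos h by (intro of_nat_floor) auto
    moreover have "real m \<le> real (nat \<lfloor>t1 / h\<rfloor>)" by (simp add: m_def)
    ultimately have "real m \<le> t1 / h" by linarith
    then show ?thesis using h by (simp add: pos_le_divide_eq)
  qed
  have m2: "\<tau> \<le> m * h"
  proof (cases "n \<le> nat \<lfloor>t1 / h\<rfloor>")
    case True
    then show ?thesis using \<tau> by (simp add: m_def)
  next
    case False
    have "t1 / h - 1 \<le> nat \<lfloor>t1 / h\<rfloor>" by linarith
    then have "(t1 / h - 1) * h \<le> m * h" using False h by (intro mult_right_mono) (auto simp: m_def)
    then show ?thesis using h \<tau>(2) by (simp add: left_diff_distrib)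
  qed
  have m0: "n0 \<le> m"
  proof -
    have "n0 * h \<le> m * h" using m2 \<tau>(3) by linarith
    then show ?thesis using h by simp
  qed
  have step: "(dlt + 1) / k \<le> 1 \<and> v (Suc k) \<le> (1 - (dlt + 1) / k) * v k + (CN * I\<^sup>2) * h * (k * h) powr (- dlt - 1)"
    if k: "n0 \<le> k" "k < m" for k :: nat
  proof
    have kpos: "real k > 0" using k const_pos(5) by simp
    show le: "(dlt + 1) / k \<le> 1" using n0_ge(2) k kpos by (simp add: divide_le_eq)
    have "k * h \<le> m * h" using k h by (intro mult_right_mono) auto
    then have kt: "k * h \<le> t1" using m1 by linarith
    have "E (Suc k) \<le> ennreal (1 - (dlt + 1) / k) * E k + ennreal (CN * h * (k * h) powr (- dlt - 1)) * (ennreal I)\<^sup>2"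
      using nash_walk_step[OF h(1) k(1) kt Te_pow_meas[OF w, of k]] by (simp add: E_def nn_integral_Te_pow[OF w] I)
    then have "ennreal (v (Suc k)) \<le> ennreal ((1 - (dlt + 1) / k) * v k + CN * h * (k * h) powr (- dlt - 1) * I\<^sup>2)"
      using le v(1)[of k] const_pos h I by (simp add: Ev ennreal_mult ennreal_plus ennreal_power)
    then show "v (Suc k) \<le> (1 - (dlt + 1) / k) * v k + (CN * I\<^sup>2) * h * (k * h) powr (- dlt - 1)"
      using le v(1)[of k] const_pos h I by (subst (asm) ennreal_le_iff) (auto simp: mult_ac)
  qed
  have "v n \<le> v m" using Ele[of m n] v(1) by (simp add: m_def Ev)
  also have "v m \<le> CN * I\<^sup>2 * (m * h) powr (- dlt) + real n0 powr (dlt + 1) * v n0 * real m powr (- (dlt + 1))"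
    by (rule nash_recursion[where ?n1.0 = m and h = h]) (use const_pos h dlt_pos v step m0 in auto)
  also have "\<dots> \<le> CN * I\<^sup>2 * \<tau> powr (- dlt) + real n0 powr (dlt + 1) * S * (\<tau> / h) powr (- (dlt + 1))"
  proof -
    have "\<tau> / h \<le> m" using m2 h by (simp add: divide_le_eq)
    then show ?thesis
      using m2 tpos h const_pos dlt_pos v S by (intro add_mono mult_mono mult_left_mono powr_mono2') auto
  qed
  finally show ?thesis unfolding E_def[symmetric] Ev by (rule ennreal_leI)
qed

text \<open>Bounds the square of the norm from L1 to L2 after time \<open>t / 2\<close>, with that
  time capped at \<open>t1 / 2\<close>. Half the time is taken because in the bound by the L1 norm
  each factor of a pairing gets half of the steps.\<close>

definition DN :: "real \<Rightarrow> real" where "DN t = CN * (min t t1 / 2) powr (- dlt)"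

text \<open>The contribution of the initial L2 norm is of order
  \<open>(h / \<tau>) powr (dlt + 1)\<close> and vanishes with \<open>h\<close>, however large that
  norm is.\<close>

lemma nash_limit:
  assumes t: "t > 0" and w: "w \<in> borel_measurable borel"
    and I: "(\<integral>\<^sup>+x. w x \<partial>lborel) = ennreal I" "I \<ge> 0" and S: "(\<integral>\<^sup>+x. (w x)\<^sup>2 \<partial>lborel) = ennreal S" "S \<ge> 0"
    and e: "e > 0"
  shows "\<forall>\<^sub>F i in sequentially. \<forall>n. t / 2 \<le> real n * (t / 2 ^ i) \<longrightarrow>
    (\<integral>\<^sup>+x. ((walk.Te (kh (t / 2 ^ i)) ^^ n) w x)\<^sup>2 \<partial>lborel) \<le> ennreal (DN t * I\<^sup>2 + e)"
proof -
  define \<tau> where "\<tau> = min t t1 / 2"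
  have tau: "\<tau> > 0" using t const_pos by (simp add: \<tau>_def)
  have h0: "(\<lambda>i. t * (1/2) ^ i) \<longlonglongrightarrow> t * 0" by (intro tendsto_intros LIMSEQ_power_zero) auto
  then have "(\<lambda>i. n0 powr (dlt + 1) * S * (\<tau> powr (- (dlt + 1)) * (t * (1/2) ^ i) powr (dlt + 1)))
     \<longlonglongrightarrow> n0 powr (dlt + 1) * S * (\<tau> powr (- (dlt + 1)) * (t * 0) powr (dlt + 1))"
    using dlt_pos t by (intro tendsto_mult tendsto_const tendsto_powr') (auto intro!: always_eventually)
  then have 1: "\<forall>\<^sub>F i in sequentially. n0 powr (dlt + 1) * S * (\<tau> powr (- (dlt + 1)) * (t * (1/2) ^ i) powr (dlt + 1)) < e"
    using e dlt_pos by (intro order_tendstoD) auto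
  have 2: "\<forall>\<^sub>F i in sequentially. t * (1/2) ^ i < min (t1 / 2) (\<tau> / n0)"
    using h0 const_pos tau by (intro order_tendstoD) auto
  show ?thesis using 1 2
  proof eventually_elim
    case (elim i)
    define h where "h = t / 2 ^ i"
    have h: "h > 0" using t by (simp add: h_def)
    have h1: "h \<le> t1 / 2" "n0 * h \<le> \<tau>" using elim(2) const_pos(5) by (auto simp: h_def field_simps power_divide)
    show ?case
    proof (intro allI impI)
      fix n :: nat assume n: "t / 2 \<le> real n * (t / 2 ^ i)"
      have "(\<integral>\<^sup>+x. ((walk.Te (kh h) ^^ n) w x)\<^sup>2 \<partial>lborel)
        \<le> ennreal (CN * I\<^sup>2 * \<tau> powr (- dlt) + n0 powr (dlt + 1) * S * (\<tau> / h) powr (- (dlt + 1)))"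
        using n by (intro nash_walk h h1 w I S) (auto simp: \<tau>_def h_def)
      also have "\<dots> \<le> ennreal (DN t * I\<^sup>2 + e)"
      proof (intro ennreal_leI add_mono)
        show "CN * I\<^sup>2 * \<tau> powr (- dlt) \<le> DN t * I\<^sup>2" by (simp add: DN_def \<tau>_def)
        have "(\<tau> / h) powr (- (dlt + 1)) = \<tau> powr (- (dlt + 1)) * h powr (dlt + 1)"
        proof -
          have "(\<tau> / h) powr (- (dlt + 1)) = \<tau> powr (- (dlt + 1)) / h powr (- (dlt + 1))" by (rule powr_divide)
          also have "\<dots> = \<tau> powr (- (dlt + 1)) * h powr (dlt + 1)"
            by (simp only: powr_minus[of h] divide_inverse inverse_inverse_eq)
          finally show ?thesis .
        qed
        then show "n0 powr (dlt + 1) * S * (\<tau> / h) powr (- (dlt + 1)) \<le> e"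
          using elim(1) by (simp add: h_def power_divide)
      qed
      finally show "(\<integral>\<^sup>+x. ((walk.Te (kh (t / 2 ^ i)) ^^ n) w x)\<^sup>2 \<partial>lborel) \<le> ennreal (DN t * I\<^sup>2 + e)"
        by (simp add: h_def)
    qed
  qed
qed

text \<open>The estimates for the walk are integrated ones. Testing with the normalised indicator of
  a small ball around \<open>x0\<close>, on which \<open>P t u\<close> is nearly constant, recovers
  the value at a point. For this, \<open>B\<close> must not depend on the L2 norm of the test
  function, which blows up as the ball shrinks.\<close>

lemma pointwise_from_pairing:
  assumes t: "t > 0" and u: "u \<in> C0" "\<And>x. 0 \<le> u x" and B: "B \<ge> 0"
    and pair: "\<And>w e. w \<in> borel_measurable borel \<Longrightarrow> (\<integral>\<^sup>+x. w x \<partial>lborel) = 1 \<Longrightarrow> (\<integral>\<^sup>+x. (w x)\<^sup>2 \<partial>lborel) < top \<Longrightarrow> e > 0 \<Longrightarrow>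
      \<forall>\<^sub>F i in sequentially. (\<integral>\<^sup>+x. ennreal ((walk.Tr (kh (t / 2 ^ i)) ^^ 2 ^ i) u x) * w x \<partial>lborel) \<le> ennreal (B + e)"
  shows "P t u x0 \<le> B"
proof (rule field_le_epsilon)
  fix e :: real assume e: "e > 0"
  have "isCont (P t u) x0" using continuous_on_apply_bcontfun[of UNIV "P t u"] by (simp only: continuous_on_eq_continuous_at open_UNIV) simp
  then obtain r where r: "r > 0" "\<And>y. dist y x0 < r \<Longrightarrow> dist (P t u y) (P t u x0) < e / 3"
    unfolding continuous_at_eps_delta using e by (metis zero_less_divide_iff zero_less_numeral)
  let ?V = "measure lborel (ball x0 r)"
  have V: "?V > 0" using r content_ball_pos[of r x0] by simp
  have Ve: "emeasure lborel (ball x0 r) = ennreal ?V"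
    by (rule emeasure_eq_ennreal_measure) (use emeasure_lborel_ball_finite[of x0 r] in auto)
  define w where "w x = ennreal (1 / ?V) * indicator (ball x0 r) x" for x
  have w[measurable]: "w \<in> borel_measurable borel" unfolding w_def[abs_def]
    by (intro borel_measurable_times_ennreal borel_measurable_const borel_measurable_indicator) simp
  have w1: "(\<integral>\<^sup>+x. w x \<partial>lborel) = 1"
    unfolding w_def using V by (simp add: nn_integral_cmult_indicator Ve flip: ennreal_mult)
  have "(\<integral>\<^sup>+x. (w x)\<^sup>2 \<partial>lborel) = (\<integral>\<^sup>+x. (ennreal (1 / ?V))\<^sup>2 * indicator (ball x0 r) x \<partial>lborel)"
    by (intro nn_integral_cong) (auto simp: w_def indicator_def)
  also have "\<dots> = (ennreal (1 / ?V))\<^sup>2 * ennreal ?V" by (simp add: nn_integral_cmult_indicator Ve)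
  also have "\<dots> < top" by (simp add: ennreal_mult_less_top power2_eq_square)
  finally have w2: "(\<integral>\<^sup>+x. (w x)\<^sup>2 \<partial>lborel) < top" .
  have "\<forall>\<^sub>F i in sequentially. (\<integral>\<^sup>+x. ennreal ((walk.Tr (kh (t / 2 ^ i)) ^^ 2 ^ i) u x) * w x \<partial>lborel) \<le> ennreal (B + e / 3)"
    using e by (intro pair w w1 w2) auto
  moreover have "\<forall>\<^sub>F i in sequentially. \<forall>k\<le>2^i. \<forall>x. \<bar>(walk.Tr (kh (t / 2 ^ i)) ^^ k) u x - P (real k * (t / 2 ^ i)) u x\<bar> \<le> e / 3"
    using e by (intro walk_converges t u) auto
  ultimately have "\<forall>\<^sub>F i in sequentially. (\<integral>\<^sup>+x. ennreal ((walk.Tr (kh (t / 2 ^ i)) ^^ 2 ^ i) u x) * w x \<partial>lborel) \<le> ennreal (B + e / 3)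
    \<and> (\<forall>x. \<bar>(walk.Tr (kh (t / 2 ^ i)) ^^ (2 ^ i)) u x - P t u x\<bar> \<le> e / 3)"
    by eventually_elim auto
  then obtain i where i: "(\<integral>\<^sup>+x. ennreal ((walk.Tr (kh (t / 2 ^ i)) ^^ 2 ^ i) u x) * w x \<partial>lborel) \<le> ennreal (B + e / 3)"
    "\<And>x. \<bar>(walk.Tr (kh (t / 2 ^ i)) ^^ (2 ^ i)) u x - P t u x\<bar> \<le> e / 3"
    by (auto simp: eventually_sequentially)
  have "ennreal (P t u x0 - 2 * e / 3) = (\<integral>\<^sup>+x. ennreal (P t u x0 - 2 * e / 3) * w x \<partial>lborel)"
    by (simp add: nn_integral_cmult w1)
  also have "\<dots> \<le> (\<integral>\<^sup>+x. ennreal ((walk.Tr (kh (t / 2 ^ i)) ^^ 2 ^ i) u x) * w x \<partial>lborel)"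
  proof (intro nn_integral_mono)
    fix x
    show "ennreal (P t u x0 - 2 * e / 3) * w x \<le> ennreal ((walk.Tr (kh (t / 2 ^ i)) ^^ 2 ^ i) u x) * w x"
    proof (cases "x \<in> ball x0 r")
      case True
      then have "P t u x0 - 2 * e / 3 \<le> (walk.Tr (kh (t / 2 ^ i)) ^^ 2 ^ i) u x"
      proof -
        have "\<bar>P t u x - P t u x0\<bar> < e / 3" using True r(2)[of x] by (simp add: dist_real_def dist_commute)
        then show ?thesis using i(2)[of x] by linarith
      qed
      then show ?thesis by (intro mult_right_mono ennreal_leI) auto
    qed (simp add: w_def)
  qed
  also have "\<dots> \<le> ennreal (B + e / 3)" by (rule i)
  finally have "P t u x0 - 2 * e / 3 \<le> B + e / 3"
    using B e by (subst (asm) ennreal_le_iff) auto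
  then show "P t u x0 \<le> B + e" by simp
qed

lemma P_nonneg:
  assumes t: "t > 0" and u: "u \<in> C0" "\<And>x. 0 \<le> u x"
  shows "0 \<le> P t u x"
proof -
  have "- P t u x \<le> 0"
  proof (rule field_le_epsilon)
    fix e :: real assume e: "e > 0"
    have "\<forall>\<^sub>F i in sequentially. \<forall>k\<le>2^i. \<forall>x. \<bar>(walk.Tr (kh (t / 2 ^ i)) ^^ k) u x - P (real k * (t / 2 ^ i)) u x\<bar> \<le> e"
      using e by (intro walk_converges t u) auto
    then obtain i where i: "\<forall>k\<le>2^i. \<forall>x. \<bar>(walk.Tr (kh (t / 2 ^ i)) ^^ k) u x - P (real k * (t / 2 ^ i)) u x\<bar> \<le> e"
      by (auto simp: eventually_sequentially)
    have "t / 2 ^ i > 0" using t by simp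
    then interpret walk "kh (t / 2 ^ i)" by (rule walk_kh)
    have "0 \<le> (Tr ^^ 2 ^ i) u x" using u(2) abs_bcontfun_le[of u] by (intro Tr_pow) (auto simp: abs_le_iff)
    moreover have "\<bar>(Tr ^^ 2 ^ i) u x - P t u x\<bar> \<le> e" using spec[OF i, of "2 ^ i"] by auto
    ultimately show "- P t u x \<le> 0 + e" by linarith
  qed
  then show ?thesis by simp
qed

lemma ennreal_pairing_le:
  assumes [measurable]: "g \<in> borel_measurable borel" "w \<in> borel_measurable borel" and l: "l > 0"
  shows "2 * (\<integral>\<^sup>+x. g x * w x \<partial>lborel) \<le> ennreal l * (\<integral>\<^sup>+x. (g x)\<^sup>2 \<partial>lborel) + ennreal (1 / l) * (\<integral>\<^sup>+x. (w x)\<^sup>2 \<partial>(lborel :: (real ^ 'n) measure))"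
proof -
  have 1: "ennreal (sqrt l) * ennreal (sqrt (1 / l)) = 1"
    using l by (simp add: real_sqrt_divide flip: ennreal_mult)
  have 2: "(ennreal (sqrt l))\<^sup>2 = ennreal l" "(ennreal (sqrt (1 / l)))\<^sup>2 = ennreal (1 / l)"
    using l by (simp_all add: ennreal_power)
  have "2 * (\<integral>\<^sup>+x. g x * w x \<partial>lborel) = (\<integral>\<^sup>+x. 2 * (g x * w x) \<partial>lborel)"
    by (rule nn_integral_cmult[symmetric]) measurable
  also have "\<dots> \<le> (\<integral>\<^sup>+x. ennreal l * (g x)\<^sup>2 + ennreal (1 / l) * (w x)\<^sup>2 \<partial>lborel)"
  proof (intro nn_integral_mono)
    fix x :: "real ^ 'n"
    have "2 * (ennreal (sqrt l) * g x) * (ennreal (sqrt (1 / l)) * w x)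
      = (ennreal (sqrt l) * ennreal (sqrt (1 / l))) * (2 * (g x * w x))" by (simp only: mult_ac)
    then have "2 * (g x * w x) = 2 * (ennreal (sqrt l) * g x) * (ennreal (sqrt (1 / l)) * w x)"
      by (simp only: 1 mult_1)
    also have "\<dots> \<le> (ennreal (sqrt l) * g x)\<^sup>2 + (ennreal (sqrt (1 / l)) * w x)\<^sup>2" by (rule ennreal_two_mult_le)
    also have "\<dots> = ennreal l * (g x)\<^sup>2 + ennreal (1 / l) * (w x)\<^sup>2" by (simp only: power_mult_distrib 2)
    finally show "2 * (g x * w x) \<le> ennreal l * (g x)\<^sup>2 + ennreal (1 / l) * (w x)\<^sup>2" .
  qed
  also have "\<dots> = ennreal l * (\<integral>\<^sup>+x. (g x)\<^sup>2 \<partial>lborel) + ennreal (1 / l) * (\<integral>\<^sup>+x. (w x)\<^sup>2 \<partial>lborel)"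
    by (subst nn_integral_add) (auto simp: nn_integral_cmult)
  finally show ?thesis .
qed

lemma DN_nonneg: "DN t \<ge> 0"
  using const_pos by (simp add: DN_def)

text \<open>All steps are moved onto \<open>w\<close> by symmetry, where the smoothing from L1 to L2
  applies. It controls the value at a point by the L2 norm, which will give the existence of a
  density.\<close>

lemma P_L2_bound:
  assumes t: "t > 0" and u: "u \<in> C0" "\<And>x. 0 \<le> u x"
    and S: "(\<integral>\<^sup>+x. (ennreal (u x))\<^sup>2 \<partial>lborel) \<le> ennreal S" "S \<ge> 0"
  shows "2 * P t u x \<le> S + DN t"
proof -
  have "P t u x \<le> (S + DN t) / 2"
  proof (rule pointwise_from_pairing[OF t u])
    show "(S + DN t) / 2 \<ge> 0" using S DN_nonneg by simp
    fix w :: "real ^ 'n \<Rightarrow> ennreal" and e :: real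
    assume w[measurable]: "w \<in> borel_measurable borel" and w1: "(\<integral>\<^sup>+x. w x \<partial>lborel) = 1"
      and w2: "(\<integral>\<^sup>+x. (w x)\<^sup>2 \<partial>lborel) < top" and e: "e > 0"
    obtain S' where S': "(\<integral>\<^sup>+x. (w x)\<^sup>2 \<partial>lborel) = ennreal S'" "S' \<ge> 0"
      using w2 by (cases "\<integral>\<^sup>+x. (w x)\<^sup>2 \<partial>lborel") auto
    have "\<forall>\<^sub>F i in sequentially. \<forall>n. t / 2 \<le> real n * (t / 2 ^ i) \<longrightarrow>
      (\<integral>\<^sup>+x. ((walk.Te (kh (t / 2 ^ i)) ^^ n) w x)\<^sup>2 \<partial>lborel) \<le> ennreal (DN t * 1\<^sup>2 + e)"
      by (rule nash_limit[OF t w _ _ S' e]) (auto simp: w1)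
    then show "\<forall>\<^sub>F i in sequentially. (\<integral>\<^sup>+x. ennreal ((walk.Tr (kh (t / 2 ^ i)) ^^ 2 ^ i) u x) * w x \<partial>lborel) \<le> ennreal ((S + DN t) / 2 + e)"
    proof eventually_elim
      case (elim i)
      have "t / 2 ^ i > 0" using t by simp
      then interpret walk "kh (t / 2 ^ i)" by (rule walk_kh)
      let ?N = "2 ^ i :: nat"
      have ub: "u y \<le> norm u" for y using abs_bcontfun_le[of u y] by simp
      have "(\<integral>\<^sup>+x. ennreal ((Tr ^^ ?N) u x) * w x \<partial>lborel) = (\<integral>\<^sup>+x. (Te ^^ ?N) (\<lambda>y. ennreal (u y)) x * w x \<partial>lborel)"
        using Tr_pow(4)[of u, OF _ u(2) ub] by simp
      also have "\<dots> = (\<integral>\<^sup>+x. ennreal (u x) * (Te ^^ ?N) w x \<partial>lborel)"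
        by (rule Te_pow_sym) measurable
      finally have "2 * (\<integral>\<^sup>+x. ennreal ((Tr ^^ ?N) u x) * w x \<partial>lborel) = 2 * (\<integral>\<^sup>+x. ennreal (u x) * (Te ^^ ?N) w x \<partial>lborel)" by simp
      also have "\<dots> \<le> ennreal 1 * (\<integral>\<^sup>+x. (ennreal (u x))\<^sup>2 \<partial>lborel) + ennreal (1 / 1) * (\<integral>\<^sup>+x. ((Te ^^ ?N) w x)\<^sup>2 \<partial>lborel)"
        by (rule ennreal_pairing_le) auto
      also have "\<dots> \<le> ennreal S + ennreal (DN t + e)"
        using elim[rule_format, of ?N] t S(1) by (simp add: add_mono)
      also have "\<dots> = ennreal (S + DN t + e)" using S DN_nonneg e by (simp add: ennreal_plus[symmetric] add.assoc del: ennreal_plus)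
      finally have "2 * (\<integral>\<^sup>+x. ennreal ((Tr ^^ ?N) u x) * w x \<partial>lborel) \<le> 2 * ennreal ((S + DN t) / 2 + e / 2)"
      proof -
        have "2 * ennreal ((S + DN t) / 2 + e / 2) = ennreal (2 * ((S + DN t) / 2 + e / 2))"
          using S DN_nonneg[of t] e by (subst ennreal_mult) auto
        also have "2 * ((S + DN t) / 2 + e / 2) = S + DN t + e" by simp
        finally show "2 * (\<integral>\<^sup>+x. ennreal ((Tr ^^ ?N) u x) * w x \<partial>lborel) \<le> ennreal (S + DN t + e) \<Longrightarrow> ?thesis" by simp
      qed
      then have "(\<integral>\<^sup>+x. ennreal ((Tr ^^ ?N) u x) * w x \<partial>lborel) \<le> ennreal ((S + DN t) / 2 + e / 2)"
        by (subst (asm) ennreal_mult_le_mult_iff) auto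
      also have "\<dots> \<le> ennreal ((S + DN t) / 2 + e)" using e by (intro ennreal_leI) auto
      finally show ?case .
    qed
  qed
  then show ?thesis by simp
qed

text \<open>Half of the steps stay with \<open>u\<close> and half are moved onto \<open>w\<close>;
  both halves smooth from L1 to L2. The weight \<open>l\<close> balances the two squares,
  \<open>DN t * I\<^sup>2\<close> and \<open>DN t\<close>.\<close>

lemma P_L1_bound:
  assumes t: "t > 0" and u: "u \<in> C0" "\<And>x. 0 \<le> u x"
    and I: "(\<integral>\<^sup>+x. ennreal (u x) \<partial>lborel) = ennreal I" "I \<ge> 0"
  shows "P t u x \<le> DN t * I"
proof -
  have ub: "u y \<le> norm u" for y using abs_bcontfun_le[of u y] by simp
  have "(\<integral>\<^sup>+x. (ennreal (u x))\<^sup>2 \<partial>lborel) \<le> (\<integral>\<^sup>+x. ennreal (norm u) * ennreal (u x) \<partial>lborel)"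
    unfolding power2_eq_square using ub by (intro nn_integral_mono mult_right_mono ennreal_leI) auto
  also have "\<dots> = ennreal (norm u * I)" by (simp add: nn_integral_cmult I ennreal_mult)
  finally obtain S where S: "(\<integral>\<^sup>+x. (ennreal (u x))\<^sup>2 \<partial>lborel) = ennreal S" "S \<ge> 0"
    by (cases "\<integral>\<^sup>+x. (ennreal (u x))\<^sup>2 \<partial>lborel") (auto simp: top_unique)
  \<comment> \<open>The slack \<theta> keeps the weight \<open>l = 1 / (I + \<theta>)\<close>
    meaningful when \<open>I\<close> is 0.\<close>
  have "P t u x \<le> DN t * (I + \<theta>)" if \<theta>: "\<theta> > 0" for \<theta>
  proof (rule pointwise_from_pairing[OF t u])
    show "DN t * (I + \<theta>) \<ge> 0" using I DN_nonneg \<theta> by simp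
    fix w :: "real ^ 'n \<Rightarrow> ennreal" and e :: real
    assume w[measurable]: "w \<in> borel_measurable borel" and w1: "(\<integral>\<^sup>+x. w x \<partial>lborel) = 1"
      and w2: "(\<integral>\<^sup>+x. (w x)\<^sup>2 \<partial>lborel) < top" and e: "e > 0"
    obtain S' where S': "(\<integral>\<^sup>+x. (w x)\<^sup>2 \<partial>lborel) = ennreal S'" "S' \<ge> 0"
      using w2 by (cases "\<integral>\<^sup>+x. (w x)\<^sup>2 \<partial>lborel") auto
    define l where "l = 1 / (I + \<theta>)"
    have l: "l > 0" "1 / l = I + \<theta>" using I \<theta> by (auto simp: l_def)
    \<comment> \<open>Small enough that the error is at most \<open>e\<close> after multiplication
      with \<open>l\<close> as well as with \<open>1 / l\<close>.\<close>
    define e' where "e' = min (e / l) (e * l)"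
    have e': "e' > 0" using e l by (simp add: e'_def)
    have A: "\<forall>\<^sub>F i in sequentially. \<forall>n. t / 2 \<le> real n * (t / 2 ^ i) \<longrightarrow>
      (\<integral>\<^sup>+x. ((walk.Te (kh (t / 2 ^ i)) ^^ n) w x)\<^sup>2 \<partial>lborel) \<le> ennreal (DN t * 1\<^sup>2 + e')"
      by (rule nash_limit[OF t w _ _ S' e']) (auto simp: w1)
    have B: "\<forall>\<^sub>F i in sequentially. \<forall>n. t / 2 \<le> real n * (t / 2 ^ i) \<longrightarrow>
      (\<integral>\<^sup>+x. ((walk.Te (kh (t / 2 ^ i)) ^^ n) (\<lambda>y. ennreal (u y)) x)\<^sup>2 \<partial>lborel) \<le> ennreal (DN t * I\<^sup>2 + e')"
      by (rule nash_limit[OF t _ I S e']) measurable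
    show "\<forall>\<^sub>F i in sequentially. (\<integral>\<^sup>+x. ennreal ((walk.Tr (kh (t / 2 ^ i)) ^^ 2 ^ i) u x) * w x \<partial>lborel) \<le> ennreal (DN t * (I + \<theta>) + e)"
      using A B eventually_ge_at_top[of 1]
    proof eventually_elim
      case (elim i)
      have "t / 2 ^ i > 0" using t by simp
      then interpret walk "kh (t / 2 ^ i)" by (rule walk_kh)
      define n :: nat where "n = 2 ^ (i - 1)"
      have n: "2 ^ i = n + n" using elim(3) by (cases i) (auto simp: n_def)
      have nt: "t / 2 \<le> real n * (t / 2 ^ i)" using elim(3) by (cases i) (auto simp: n_def)
      have "(\<integral>\<^sup>+x. ennreal ((Tr ^^ 2 ^ i) u x) * w x \<partial>lborel) = (\<integral>\<^sup>+x. (Te ^^ n) ((Te ^^ n) (\<lambda>y. ennreal (u y))) x * w x \<partial>lborel)"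
        using Tr_pow(4)[of u, OF _ u(2) ub, of "2 ^ i"] by (simp add: n funpow_add del: power_numeral)
      also have "\<dots> = (\<integral>\<^sup>+x. (Te ^^ n) (\<lambda>y. ennreal (u y)) x * (Te ^^ n) w x \<partial>lborel)"
        by (rule Te_pow_sym) measurable
      finally have "2 * (\<integral>\<^sup>+x. ennreal ((Tr ^^ 2 ^ i) u x) * w x \<partial>lborel) = 2 * (\<integral>\<^sup>+x. (Te ^^ n) (\<lambda>y. ennreal (u y)) x * (Te ^^ n) w x \<partial>lborel)" by simp
      also have "\<dots> \<le> ennreal l * (\<integral>\<^sup>+x. ((Te ^^ n) (\<lambda>y. ennreal (u y)) x)\<^sup>2 \<partial>lborel) + ennreal (1 / l) * (\<integral>\<^sup>+x. ((Te ^^ n) w x)\<^sup>2 \<partial>lborel)"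
        using l by (intro ennreal_pairing_le) auto
      also have "\<dots> \<le> ennreal l * ennreal (DN t * I\<^sup>2 + e') + ennreal (1 / l) * ennreal (DN t * 1\<^sup>2 + e')"
        using elim(1,2) nt by (intro add_mono mult_left_mono) auto
      also have "\<dots> = ennreal (l * (DN t * I\<^sup>2 + e') + 1 / l * (DN t * 1\<^sup>2 + e'))"
      proof -
        have n: "0 \<le> DN t * I\<^sup>2 + e'" "0 \<le> DN t * 1\<^sup>2 + e'" "0 \<le> 1 / l" "0 \<le> l"
          using l(1) DN_nonneg[of t] e' by auto
        show ?thesis
          by (subst ennreal_plus) (intro mult_nonneg_nonneg n, intro mult_nonneg_nonneg n, simp only: ennreal_mult n)
      qed
      also have "\<dots> \<le> ennreal (2 * (DN t * (I + \<theta>) + e))"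
      proof (rule ennreal_leI)
        have "l * I\<^sup>2 \<le> I + \<theta>"
        proof -
          have "I\<^sup>2 \<le> (I + \<theta>) * (I + \<theta>)" using I \<theta> unfolding power2_eq_square by (intro mult_mono) auto
          then show ?thesis using I \<theta> by (simp add: l_def divide_le_eq)
        qed
        then have "DN t * (l * I\<^sup>2) \<le> DN t * (I + \<theta>)" using DN_nonneg by (intro mult_left_mono)
        moreover have "l * e' \<le> e" "1 / l * e' \<le> e" using l(1) e by (auto simp: e'_def min_def field_simps)
        ultimately show "l * (DN t * I\<^sup>2 + e') + 1 / l * (DN t * 1\<^sup>2 + e') \<le> 2 * (DN t * (I + \<theta>) + e)"
          unfolding l(2)[symmetric] by (simp add: algebra_simps)
      qed
      also have "\<dots> = 2 * ennreal (DN t * (I + \<theta>) + e)"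
        using I DN_nonneg[of t] e \<theta> by (subst ennreal_mult) auto
      finally show ?case by (subst (asm) ennreal_mult_le_mult_iff) auto
    qed
  qed
  then have "P t u x \<le> DN t * I + e" if "e > 0" for e
  proof -
    have "P t u x \<le> DN t * (I + e / (DN t + 1))"
      using DN_nonneg[of t] that by (intro \<open>\<And>\<theta>. 0 < \<theta> \<Longrightarrow> P t u x \<le> DN t * (I + \<theta>)\<close>) auto
    also have "\<dots> \<le> DN t * I + e"
    proof -
      have "DN t * (e / (DN t + 1)) \<le> (DN t + 1) * (e / (DN t + 1))"
        using DN_nonneg[of t] that by (intro mult_right_mono) auto
      also have "\<dots> = e" using DN_nonneg[of t] by simp
      finally show ?thesis by (simp add: distrib_left)
    qed
    finally show ?thesis .
  qed
  then show ?thesis by (rule field_le_epsilon)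
qed

text \<open>Uses \<open>min t t1 \<ge> t / (1 + t / t1)\<close> and
  \<open>1 + x \<le> exp x\<close>: the saturation at \<open>t1\<close> is paid for by an
  exponential in \<open>t\<close>.\<close>

lemma DN_le: "t > 0 \<Longrightarrow> DN t \<le> CN * 2 powr dlt * t powr (- dlt) * exp (dlt / t1 * t)"
proof -
  assume t: "t > 0"
  have t1: "t1 > 0" by (rule const_pos)
  have m: "t / (1 + t / t1) \<le> min t t1"
  proof -
    have "1 + t / t1 > 0" using t t1 by (simp add: add_pos_pos)
    then show ?thesis using t t1 by (auto simp: divide_le_eq algebra_simps)
  qed
  have "(min t t1 / 2) powr (- dlt) \<le> ((t / (1 + t / t1)) / 2) powr (- dlt)"
  proof (rule powr_mono2')
    show "- dlt \<le> 0" using dlt_pos by simp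
    show "0 < t / (1 + t / t1) / 2" using t t1 by (simp add: add_pos_pos)
    show "t / (1 + t / t1) / 2 \<le> min t t1 / 2" using m by (rule divide_right_mono) simp
  qed
  also have "\<dots> = 2 powr dlt * t powr (- dlt) * (1 + t / t1) powr dlt"
  proof -
    define y where "y = 1 + t / t1"
    have y: "y > 0" using t t1 by (simp add: y_def add_pos_pos)
    then show ?thesis unfolding y_def[symmetric] using t by (simp add: powr_divide powr_mult powr_minus field_simps)
  qed
  also have "\<dots> \<le> 2 powr dlt * t powr (- dlt) * exp (t / t1) powr dlt"
    using t t1 dlt_pos by (intro mult_left_mono powr_mono2 exp_ge_add_one_self) (auto simp: add_nonneg_nonneg)
  also have "exp (t / t1) powr dlt = exp (dlt / t1 * t)" by (simp add: powr_def mult.commute)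
  finally show ?thesis using const_pos(4) mult_left_mono[of _ _ CN] by (simp add: DN_def mult.assoc)
qed

subsection \<open>Evolution of a tent function\<close>

definition Theta :: "real \<Rightarrow> real \<Rightarrow> real ^ 'n \<Rightarrow> real" where
  "Theta A s z = exp (Cb A * s) * H Lb (cb A) s z"

text \<open>One Euler step. If the \<psi> branch is active at time \<open>s + h\<close>, it is so at
  time \<open>s\<close>, since it grows in time while the plateau sinks. The barrier estimate adds
  at most \<open>h * (A * s + 1)\<close> to the factor \<open>s\<close>, where the 1 comes from the
  balance of \<open>Lb\<close> and \<open>cb A\<close>; since
  \<open>s + h + A * h * s \<le> (s + h) * (1 + A * h)\<close>, the exponential absorbs the
  rest.\<close>

lemma Theta_step:
  assumes A: "A > 0"
    and bar: "\<And>L c s z \<kappa>. L > 0 \<Longrightarrow> c > 0 \<Longrightarrow> s > 0 \<Longrightarrow> z \<noteq> 0 \<Longrightarrow> admissible \<kappa> \<Longrightarrow>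
      c * s * \<psi> z \<le> L * s powr (- dlt) \<Longrightarrow>
      (LINT v|lborel. (H L c s (z + v) - H L c s z) * \<kappa> v) \<le> c * \<psi> z * A * (s + (L / c) powr (\<alpha> / \<beta>))"
    and s: "s > 0" and h: "h > 0"
    and out: "x \<noteq> y" "cb A * (s + h) * \<psi> (x - y) \<le> Lb * (s + h) powr (- dlt)"
  shows "walk.Tr (kh h) (\<lambda>x. Theta A s (x - y)) x \<le> Theta A (s + h) (x - y)"
proof -
  interpret walk "kh h" by (rule walk_kh[OF h])
  let ?z = "x - y" and ?c = "cb A" and ?E = "exp (Cb A * s)" and ?H = "H Lb (cb A) s"
  note b = barrier_const[OF A]
  have z: "?z \<noteq> 0" using out by simp
  have psi0: "0 \<le> \<psi> ?z" by (rule psi_nonneg)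
  have outs: "?c * s * \<psi> ?z \<le> Lb * s powr (- dlt)"
  proof -
    have "?c * s * \<psi> ?z \<le> ?c * (s + h) * \<psi> ?z" using b h psi0 by (intro mult_right_mono mult_left_mono) auto
    also have "\<dots> \<le> Lb * (s + h) powr (- dlt)" by (rule out)
    also have "\<dots> \<le> Lb * s powr (- dlt)" using b(1) s h dlt_pos by (intro mult_left_mono powr_mono2') auto
    finally show ?thesis .
  qed
  have [measurable]: "(\<lambda>x. ?H (x - y)) \<in> borel_measurable borel"
    by (rule measurable_compose[OF _ H_meas]) measurable
  have Hb: "\<bar>?H v\<bar> \<le> Lb * s powr (- dlt)" for v using H_bounds[OF b(1,2) s, of v] by simp
  have "Tr (\<lambda>x. ?H (x - y)) x - ?H (x - y) = h * (LINT v|lborel. (?H (x + v - y) - ?H (x - y)) * ke (eps h) x (x + v))"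
    by (rule Tr_generator[OF h, where u = "\<lambda>x. ?H (x - y)" and c = "Lb * s powr (- dlt)"]) (measurable, rule Hb)
  also have "\<dots> = h * (LINT v|lborel. (?H (?z + v) - ?H ?z) * ke (eps h) x (x + v))" by (simp add: algebra_simps)
  finally have 0: "Tr (\<lambda>x. ?H (x - y)) x - ?H ?z = h * (LINT v|lborel. (?H (?z + v) - ?H ?z) * ke (eps h) x (x + v))" .
  have 1: "Tr (\<lambda>x. ?H (x - y)) x - ?H ?z \<le> h * (?c * \<psi> ?z * A * (s + (Lb / ?c) powr (\<alpha> / \<beta>)))"
    unfolding 0 using h by (intro mult_left_mono bar b(1,2) s z ke_admissible eps_pos outs) auto
  have "?c * \<psi> ?z * A * (s + (Lb / ?c) powr (\<alpha> / \<beta>)) = ?c * \<psi> ?z * (A * s + A * (Lb / ?c) powr (\<alpha> / \<beta>))"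
    by (simp add: algebra_simps)
  also have "\<dots> \<le> ?c * \<psi> ?z * (A * s + 1)"
    using b psi0 by (intro mult_left_mono add_left_mono) auto
  finally have "h * (?c * \<psi> ?z * A * (s + (Lb / ?c) powr (\<alpha> / \<beta>))) \<le> h * (?c * \<psi> ?z * (A * s + 1))"
    using h by (intro mult_left_mono) auto
  then have 2: "Tr (\<lambda>x. ?H (x - y)) x \<le> ?H ?z + h * (?c * \<psi> ?z * (A * s + 1))" using 1 by linarith
  have Hz: "?H ?z = ?c * s * \<psi> ?z" using outs z by (simp add: H_def)
  have "Tr (\<lambda>x. ?H (x - y)) x \<le> ?c * \<psi> ?z * (s + h + A * h * s)"
    using 2 unfolding Hz by (simp add: algebra_simps)
  also have "\<dots> \<le> ?c * \<psi> ?z * ((s + h) * (1 + A * h))"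
    using b psi0 A h by (intro mult_left_mono) (auto simp: algebra_simps)
  also have "\<dots> \<le> ?c * \<psi> ?z * ((s + h) * exp (Cb A * h))"
  proof -
    have "1 + A * h \<le> 1 + Cb A * h" using b h by simp
    also have "\<dots> \<le> exp (Cb A * h)" by (rule exp_ge_add_one_self)
    finally show ?thesis using b psi0 s h by (intro mult_left_mono) auto
  qed
  finally have 3: "Tr (\<lambda>x. ?H (x - y)) x \<le> ?c * \<psi> ?z * ((s + h) * exp (Cb A * h))" .
  have "Tr (\<lambda>x. Theta A s (x - y)) x = ?E * Tr (\<lambda>x. ?H (x - y)) x"
    using Tr_lincomb[where u = "\<lambda>x. ?H (x - y)" and w = "\<lambda>x. ?H (x - y)" and a = ?E and e = 0 and x = x
        and c = "Lb * s powr (- dlt)" and c' = "Lb * s powr (- dlt)"] Hb by (simp add: Theta_def)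
  also have "\<dots> \<le> ?E * (?c * \<psi> ?z * ((s + h) * exp (Cb A * h)))" by (intro mult_left_mono 3) auto
  also have "\<dots> = exp (Cb A * (s + h)) * (?c * (s + h) * \<psi> ?z)"
  proof -
    have "exp (Cb A * (s + h)) = ?E * exp (Cb A * h)" by (simp only: distrib_left exp_add)
    then show ?thesis by (simp only: mult_ac)
  qed
  also have "\<dots> = Theta A (s + h) ?z" using z out(2) by (simp add: Theta_def H_def)
  finally show ?thesis .
qed

text \<open>Induction over the steps of one walk, fixed by the tolerance \<open>e\<close>. Where the
  \<psi> branch is active, \<open>Theta_step\<close> applies; on the plateau the claim is the
  on-diagonal bound, which holds for the walk up to \<open>e / 2\<close>. This additive error does
  not grow because the walk preserves constants.\<close>

lemma tent_bound:
  assumes A: "A > 0"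
    and bar: "\<And>L c s z \<kappa>. L > 0 \<Longrightarrow> c > 0 \<Longrightarrow> s > 0 \<Longrightarrow> z \<noteq> 0 \<Longrightarrow> admissible \<kappa> \<Longrightarrow>
      c * s * \<psi> z \<le> L * s powr (- dlt) \<Longrightarrow>
      (LINT v|lborel. (H L c s (z + v) - H L c s z) * \<kappa> v) \<le> c * \<psi> z * A * (s + (L / c) powr (\<alpha> / \<beta>))"
    and t: "t > 0" and \<eta>: "0 < \<eta>" "\<eta> \<le> 1"
  shows "P t (tent y \<eta>) x \<le> \<eta> ^ CARD('n) * Theta A (t + \<eta> powr \<alpha>) (x - y)"
proof (rule field_le_epsilon)
  fix e :: real assume e: "e > 0"
  let ?u = "tent y \<eta>" and ?V = "unit_ball_vol (real CARD('n))" and ?d = "CARD('n)"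
  \<comment> \<open>The natural time for the radius \<eta>:
    \<open>\<eta> ^ ?d * s0 powr (- dlt) = 1\<close>, so that at time \<open>s0\<close> the plateau,
    multiplied by \<open>\<eta> ^ ?d\<close>, has a height bounded below.\<close>
  define s0 where "s0 = \<eta> powr \<alpha>"
  have s0: "s0 > 0" using \<eta> by (simp add: s0_def)
  have s0d: "s0 powr dlt = \<eta> ^ ?d" "\<eta> ^ ?d * s0 powr (- dlt) = 1"
  proof -
    have "s0 powr dlt = \<eta> powr ?d" using alpha by (simp add: s0_def powr_powr dlt_def)
    then show *: "s0 powr dlt = \<eta> ^ ?d" using \<eta> by (simp add: powr_realpow)
    show "\<eta> ^ ?d * s0 powr (- dlt) = 1" unfolding *[symmetric] using s0 by (simp flip: powr_add)
  qed
  note b = barrier_const[OF A] and tf = tent_facts[OF \<eta>(1), where y = y]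
  have CV: "0 \<le> CN * 2 powr dlt * ?V" using const_pos by simp
  have sup: "P s ?u x \<le> \<eta> ^ ?d * (Lb * (s0 + s) powr (- dlt) * exp (Cb A * (s0 + s)))" if s: "s \<ge> s0" for s x
  proof -
    have sp: "s > 0" using s s0 by simp
    obtain I where I: "(\<integral>\<^sup>+x. ennreal (?u x) \<partial>lborel) = ennreal I" "I \<ge> 0"
      using tent_integral_le[OF \<eta>(1), of y] by (cases "\<integral>\<^sup>+x. ennreal (?u x) \<partial>lborel") (auto simp: top_unique)
    have IV: "I \<le> ?V * \<eta> ^ ?d"
      using tent_integral_le[OF \<eta>(1), of y] \<eta> unfolding I(1) by (subst (asm) ennreal_le_iff) auto
    have "P s ?u x \<le> DN s * I" by (rule P_L1_bound[OF sp tent_C0[OF \<eta>(1)] tf(1) I])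
    also have "\<dots> \<le> (CN * 2 powr dlt * s powr (- dlt) * exp (dlt / t1 * s)) * (?V * \<eta> ^ ?d)"
      using IV I DN_le[OF sp] const_pos by (intro mult_mono) auto
    also have "\<dots> = \<eta> ^ ?d * ((CN * 2 powr dlt * ?V) * s powr (- dlt) * exp (dlt / t1 * s))" by (simp add: mult_ac)
    also have "\<dots> \<le> \<eta> ^ ?d * ((CN * 2 powr dlt * ?V) * (2 powr dlt * (s0 + s) powr (- dlt)) * exp (Cb A * (s0 + s)))"
    proof -
      have "s powr (- dlt) \<le> ((s0 + s) / 2) powr (- dlt)" using s s0 dlt_pos by (intro powr_mono2') auto
      also have "\<dots> = 2 powr dlt * (s0 + s) powr (- dlt)"
        by (simp only: powr_divide powr_minus[of 2]) (simp add: divide_inverse)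
      finally have 1: "s powr (- dlt) \<le> 2 powr dlt * (s0 + s) powr (- dlt)" .
      have "dlt / t1 * s \<le> Cb A * (s0 + s)"
        using b s0 sp dlt_pos const_pos by (intro mult_mono) auto
      then show ?thesis using 1 \<eta> CV by (intro mult_left_mono mult_mono) auto
    qed
    also have "\<dots> \<le> \<eta> ^ ?d * (Lb * (s0 + s) powr (- dlt) * exp (Cb A * (s0 + s)))"
    proof -
      have "CN * 2 powr dlt * ?V * 2 powr dlt \<le> Lb" by (simp add: Lb_def algebra_simps)
      then have "CN * 2 powr dlt * ?V * 2 powr dlt * ((s0 + s) powr (- dlt) * exp (Cb A * (s0 + s))) \<le> Lb * ((s0 + s) powr (- dlt) * exp (Cb A * (s0 + s)))"
        by (intro mult_right_mono) auto
      then show ?thesis using \<eta> by (intro mult_left_mono) (auto simp: mult_ac)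
    qed
    finally show ?thesis .
  qed
  \<comment> \<open>Up to time \<open>s0\<close> the maximum 1 of the tent already lies below the
    plateau, so smoothing has nothing to contribute yet.\<close>
  have one: "1 \<le> \<eta> ^ ?d * (Lb * (s0 + s) powr (- dlt) * exp (Cb A * (s0 + s)))" if s: "0 \<le> s" "s \<le> s0" for s
  proof -
    have "2 powr (- dlt) * s0 powr (- dlt) \<le> (s0 + s) powr (- dlt)"
      using s s0 dlt_pos by (subst powr_mult[symmetric]) (auto intro!: powr_mono2')
    moreover have "2 powr dlt \<le> Lb" using CV by (simp add: Lb_def)
    ultimately have "2 powr dlt * (2 powr (- dlt) * s0 powr (- dlt)) * 1 \<le> Lb * (s0 + s) powr (- dlt) * exp (Cb A * (s0 + s))"
      using b s s0 by (intro mult_mono) auto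
    moreover have "2 powr dlt * (2 powr (- dlt) * s0 powr (- dlt)) = s0 powr (- dlt)"
      by (simp add: mult.assoc[symmetric] flip: powr_add)
    ultimately have "\<eta> ^ ?d * s0 powr (- dlt) \<le> \<eta> ^ ?d * (Lb * (s0 + s) powr (- dlt) * exp (Cb A * (s0 + s)))"
      using \<eta> by (intro mult_left_mono) auto
    then show ?thesis by (simp only: s0d)
  qed
  have "\<forall>\<^sub>F i in sequentially. \<forall>k\<le>2^i. \<forall>x. \<bar>(walk.Tr (kh (t / 2 ^ i)) ^^ k) ?u x - P (real k * (t / 2 ^ i)) ?u x\<bar> \<le> e / 2"
    using e by (intro walk_converges t tent_C0 \<eta>) auto
  then obtain i where "\<forall>k\<le>2^i. \<forall>x. \<bar>(walk.Tr (kh (t / 2 ^ i)) ^^ k) ?u x - P (real k * (t / 2 ^ i)) ?u x\<bar> \<le> e / 2"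
    unfolding eventually_sequentially by blast
  moreover define h where "h = t / 2 ^ i"
  ultimately have conv: "\<bar>(walk.Tr (kh h) ^^ k) ?u x - P (real k * h) ?u x\<bar> \<le> e / 2" if "k \<le> 2 ^ i" for k x using that by blast
  have h: "h > 0" using t by (simp add: h_def)
  interpret walk "kh h" by (rule walk_kh[OF h])
  note pow = Tr_pow[of ?u, OF _ tf(1,2)]
  \<comment> \<open>The on-diagonal bound was proved for \<open>P\<close>; uniform convergence
    carries it over to every power of the walk, at the price of \<open>e / 2\<close>.\<close>
  have supw: "(Tr ^^ k) ?u x \<le> \<eta> ^ ?d * (Lb * (s0 + real k * h) powr (- dlt) * exp (Cb A * (s0 + real k * h))) + e / 2"
    if k: "k \<le> 2 ^ i" for k x
  proof (cases "real k * h \<le> s0")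
    case True
    have "(Tr ^^ k) ?u x \<le> 1" by (rule pow) measurable
    also have "\<dots> \<le> \<eta> ^ ?d * (Lb * (s0 + real k * h) powr (- dlt) * exp (Cb A * (s0 + real k * h)))"
      using one[OF _ True] h by simp
    finally show ?thesis using e by linarith
  next
    case False
    then show ?thesis using sup[of "real k * h" x] conv[OF k, of x] by linarith
  qed
  have main: "(Tr ^^ k) ?u x \<le> \<eta> ^ ?d * Theta A (s0 + real k * h) (x - y) + e / 2" if "k \<le> 2 ^ i" for k x
    using that
  proof (induction k arbitrary: x)
    case 0
    show ?case
    proof (cases "norm (x - y) < \<eta>")
      case True
      \<comment> \<open>On the support of the tent the \<psi> branch is not below the plateau at
        time \<open>s0\<close>; this is what \<open>c1\<^sup>2\<close> in \<open>cb\<close> is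
        for.\<close>
      have "H Lb (cb A) s0 (x - y) = Lb * s0 powr (- dlt)"
      proof (cases "x = y")
        case False
        let ?r = "norm (x - y)"
        have r: "0 < ?r" "?r \<le> 1" using False True \<eta> by auto
        have "1 \<le> c1 * \<phi> (?r + 1)" using phi_shift(1)[of ?r] r by (simp add: phi_one)
        then have "\<eta> powr (- \<beta>) * 1 \<le> ?r powr (- \<beta>) * (c1 * \<phi> (?r + 1))"
          using r True beta_pos by (intro mult_mono powr_mono2') auto
        then have "\<eta> powr (- \<beta>) \<le> c1 * \<psi> (x - y)" by (simp add: psi mult_ac)
        also have "\<dots> \<le> c1\<^sup>2 * \<psi> (x - y)"
          using c1_ge psi_nonneg self_le_power[of c1 2] by (intro mult_right_mono) auto
        finally have "Lb * (s0 * \<eta> powr (- \<beta>)) \<le> Lb * (s0 * (c1\<^sup>2 * \<psi> (x - y)))"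
          using b s0 by (intro mult_left_mono) auto
        also have "\<dots> = (Lb * c1\<^sup>2) * (s0 * \<psi> (x - y))" by simp
        also have "\<dots> \<le> cb A * (s0 * \<psi> (x - y))"
          using b s0 psi_nonneg by (intro mult_right_mono) auto
        also have "s0 * \<eta> powr (- \<beta>) = s0 powr (- dlt)"
        proof -
          have "\<alpha> - \<beta> = \<alpha> * (- dlt)" using alpha by (simp add: beta dlt_def)
          then have "\<eta> powr (\<alpha> - \<beta>) = s0 powr (- dlt)" by (simp add: s0_def powr_powr)
          then show ?thesis by (simp add: s0_def powr_diff powr_minus divide_inverse)
        qed
        finally show ?thesis using False by (simp add: H_def mult.assoc)
      qed (simp add: H_def)
      then have "1 \<le> \<eta> ^ ?d * Theta A s0 (x - y)" using one[of 0] s0 by (simp add: Theta_def mult_ac)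
      then show ?thesis using tf(2)[of x] e by simp
    next
      case False
      then have "?u x = 0" using tf(3) by simp
      moreover have "0 \<le> Theta A s0 (x - y)" using H_bounds(1)[OF b(1,2) s0] by (simp add: Theta_def)
      ultimately show ?thesis using \<eta> e by simp
    qed
  next
    case (Suc k)
    define s where "s = s0 + real k * h"
    have s: "s > 0" using s0 h by (simp add: s_def add_pos_nonneg)
    have sh: "s0 + real (Suc k) * h = s + h" by (simp add: s_def algebra_simps)
    let ?z = "x - y"
    show ?case
    proof (cases "x \<noteq> y \<and> cb A * (s + h) * \<psi> ?z \<le> Lb * (s + h) powr (- dlt)")
      case True
      have [measurable]: "(\<lambda>x. Theta A s (x - y)) \<in> borel_measurable borel"
        unfolding Theta_def by (intro borel_measurable_times borel_measurable_const measurable_compose[OF _ H_meas]) measurable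
      let ?T = "exp (Cb A * s) * (Lb * s powr (- dlt))"
      have Tb: "\<bar>Theta A s v\<bar> \<le> ?T" for v
        using H_bounds[OF b(1,2) s, of v] by (simp add: Theta_def abs_mult)
      have 1: "\<bar>\<eta> ^ ?d * Theta A s (v - y) + e / 2 * 1\<bar> \<le> \<eta> ^ ?d * ?T + e / 2" for v
        using mult_left_mono[OF Tb[of "v - y"], of "\<eta> ^ ?d"] \<eta> e
        by (intro order_trans[OF abs_triangle_ineq]) (simp add: abs_mult)
      have "(Tr ^^ Suc k) ?u x = Tr ((Tr ^^ k) ?u) x" by simp
      also have "\<dots> \<le> Tr (\<lambda>x. \<eta> ^ ?d * Theta A s (x - y) + e / 2 * 1) x"
      proof (rule Tr_mono[where c = 1 and c' = "\<eta> ^ ?d * ?T + e / 2"])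
        show "\<bar>\<eta> ^ ?d * Theta A s (v - y) + e / 2 * 1\<bar> \<le> \<eta> ^ ?d * ?T + e / 2" for v by (rule 1)
        show "\<bar>(Tr ^^ k) ?u v\<bar> \<le> 1" for v using pow(2,3)[of k v] by simp
        show "(Tr ^^ k) ?u v \<le> \<eta> ^ ?d * Theta A s (v - y) + e / 2 * 1" for v
          using Suc.IH[of v] Suc.prems by (simp add: s_def)
      qed (use pow(1) in measurable)
      also have "\<dots> = \<eta> ^ ?d * Tr (\<lambda>x. Theta A s (x - y)) x + e / 2 * Tr (\<lambda>_. 1) x"
        by (rule Tr_lincomb[where u = "\<lambda>x. Theta A s (x - y)" and w = "\<lambda>_. 1" and c = ?T and c' = 1]) (measurable, rule Tb, simp)
      also have "\<dots> \<le> \<eta> ^ ?d * Theta A (s + h) ?z + e / 2"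
      proof -
        have "Tr (\<lambda>x. Theta A s (x - y)) x \<le> Theta A (s + h) ?z"
          by (rule Theta_step[OF A bar s h]) (use True in auto)
        then have "\<eta> ^ ?d * Tr (\<lambda>x. Theta A s (x - y)) x \<le> \<eta> ^ ?d * Theta A (s + h) ?z"
          using \<eta> by (intro mult_left_mono) auto
        then show ?thesis unfolding Tr_const by linarith
      qed
      finally show ?thesis by (simp only: sh)
    next
      case False
      then have "H Lb (cb A) (s + h) ?z = Lb * (s + h) powr (- dlt)" by (auto simp: H_def)
      then have "\<eta> ^ ?d * Theta A (s + h) ?z = \<eta> ^ ?d * (Lb * (s + h) powr (- dlt) * exp (Cb A * (s + h)))"
        unfolding Theta_def by (simp only: mult_ac)
      then show ?thesis using supw[OF Suc.prems, of x] unfolding sh by (simp only:)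
    qed
  qed
  have "P t ?u x \<le> (Tr ^^ 2 ^ i) ?u x + e / 2"
  proof -
    have "real (2 ^ i) * h = t" by (simp add: h_def)
    then have "\<bar>(Tr ^^ 2 ^ i) ?u x - P t ?u x\<bar> \<le> e / 2" using conv[of "2 ^ i" x] by (simp only: order_refl)
    then show ?thesis by linarith
  qed
  also have "\<dots> \<le> \<eta> ^ ?d * Theta A (s0 + t) (x - y) + e / 2 + e / 2"
    using main[of "2 ^ i" x] by (simp add: h_def)
  finally show "P t ?u x \<le> \<eta> ^ ?d * Theta A (t + \<eta> powr \<alpha>) (x - y) + e" by (simp add: s0_def add.commute)
qed

end

subsection \<open>Densities of functionals that are bounded in \<open>L\<^sup>2\<close>\<close>

lemma Bcontfun_apply:
  fixes f :: "'a::topological_space \<Rightarrow> real"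
  assumes "continuous_on UNIV f" "\<And>x. \<bar>f x\<bar> \<le> b"
  shows "apply_bcontfun (Bcontfun f) = f"
proof -
  have "f \<in> bcontfun" using assms by (intro bcontfun_normI[where b = b]) auto
  then show ?thesis by (simp add: Bcontfun_inverse)
qed

lemma C0_dominated:
  assumes "u \<in> C0" "\<And>x. \<bar>apply_bcontfun v x\<bar> \<le> \<bar>apply_bcontfun u x\<bar>"
  shows "v \<in> C0"
proof -
  have "((\<lambda>x. \<bar>u x\<bar>) \<longlongrightarrow> 0) at_infinity" using assms(1) by (auto simp: C0_def intro: tendsto_rabs_zero)
  then have "(apply_bcontfun v \<longlongrightarrow> 0) at_infinity"
    using assms(2) by (intro Lim_null_comparison[of v "\<lambda>x. \<bar>u x\<bar>"]) auto
  then show ?thesis by (simp add: C0_def)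
qed

lemma subspace_C0: "subspace (C0 :: ((real ^ 'n) \<Rightarrow>\<^sub>C real) set)"
proof (rule subspaceI)
  show "(0 :: (real ^ 'n) \<Rightarrow>\<^sub>C real) \<in> C0" by (simp add: C0_def)
  show "u + v \<in> C0" if "u \<in> C0" "v \<in> C0" for u v :: "(real ^ 'n) \<Rightarrow>\<^sub>C real"
    using tendsto_add[of u 0 at_infinity v 0] that by (simp add: C0_def plus_bcontfun.rep_eq)
  show "c *\<^sub>R u \<in> C0" if "u \<in> C0" for c and u :: "(real ^ 'n) \<Rightarrow>\<^sub>C real"
    using tendsto_mult_left[of u 0 at_infinity c] that by (simp add: C0_def scaleR_bcontfun.rep_eq)
qed

lemma closed_C0: "closed (C0 :: ((real ^ 'n) \<Rightarrow>\<^sub>C real) set)"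
proof (subst closed_sequential_limits, intro allI impI, elim conjE)
  fix us and u :: "(real ^ 'n) \<Rightarrow>\<^sub>C real"
  assume us: "\<forall>n. us n \<in> C0" and lim: "us \<longlonglongrightarrow> u"
  have "(apply_bcontfun u \<longlongrightarrow> 0) at_infinity"
  proof (rule tendstoI)
    fix e :: real assume e: "e > 0"
    have "\<forall>\<^sub>F n in sequentially. dist (us n) u < e/2" using lim e by (intro tendstoD) auto
    then obtain n where n: "dist (us n) u < e/2" by (auto simp: eventually_sequentially)
    have "(us n \<longlongrightarrow> 0) at_infinity" using us by (simp add: C0_def)
    then have "\<forall>\<^sub>F x in at_infinity. dist (us n x) 0 < e/2" using e by (intro tendstoD) auto
    then show "\<forall>\<^sub>F x in at_infinity. dist (u x) 0 < e"
    proof (rule eventually_mono)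
      fix x assume "dist (us n x) 0 < e/2"
      moreover have "dist (us n x) (u x) < e/2" using dist_bounded[of "us n" x u] n by linarith
      ultimately show "dist (u x) 0 < e" unfolding dist_real_def by linarith
    qed
  qed
  then show "u \<in> C0" by (simp add: C0_def)
qed

text \<open>Continuous functions instead of classes of L2: the functional is evaluated on them
  directly, and \<open>ip\<close> supplies the geometry.\<close>

definition VL :: "((real ^ 'n) \<Rightarrow>\<^sub>C real) set" where
  "VL = {u \<in> C0. integrable lborel (\<lambda>y. (u y)\<^sup>2)}"

definition ip :: "((real ^ 'n) \<Rightarrow>\<^sub>C real) \<Rightarrow> ((real ^ 'n) \<Rightarrow>\<^sub>C real) \<Rightarrow> real" where
  "ip u w = (LINT y|lborel. u y * w y)"

lemma VL_integrable:
  assumes "u \<in> VL" "w \<in> VL" shows "integrable lborel (\<lambda>y. u y * w y)"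
proof (rule Bochner_Integration.integrable_bound)
  show "integrable lborel (\<lambda>y. (u y)\<^sup>2 + (w y)\<^sup>2)" using assms by (simp add: VL_def)
  show "AE y in lborel. norm (u y * w y) \<le> norm ((u y)\<^sup>2 + (w y)\<^sup>2)"
  proof (rule AE_I2)
    fix y
    have "2 * \<bar>u y\<bar> * \<bar>w y\<bar> \<le> (u y)\<^sup>2 + (w y)\<^sup>2" using sum_squares_bound[of "\<bar>u y\<bar>" "\<bar>w y\<bar>"] by simp
    moreover have "0 \<le> \<bar>u y\<bar> * \<bar>w y\<bar>" by simp
    ultimately have "\<bar>u y\<bar> * \<bar>w y\<bar> \<le> (u y)\<^sup>2 + (w y)\<^sup>2" by linarith
    then show "norm (u y * w y) \<le> norm ((u y)\<^sup>2 + (w y)\<^sup>2)"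
      by (simp add: abs_mult)
  qed
qed measurable

lemma VL_comb:
  assumes "u \<in> VL" "w \<in> VL" shows "u + r *\<^sub>R w \<in> VL"
    and "ip (u + r *\<^sub>R w) (u + r *\<^sub>R w) = ip u u + 2 * r * ip u w + r\<^sup>2 * ip w w"
proof -
  have eq: "((u + r *\<^sub>R w) y)\<^sup>2 = u y * u y + (2 * r) * (u y * w y) + r\<^sup>2 * (w y * w y)" for y
    by (simp add: plus_bcontfun.rep_eq scaleR_bcontfun.rep_eq power2_eq_square algebra_simps)
  note i = VL_integrable[OF assms(1) assms(1)] VL_integrable[OF assms] VL_integrable[OF assms(2) assms(2)]
  show "u + r *\<^sub>R w \<in> VL"
    using assms i unfolding VL_def mem_Collect_eq eq
    by (auto intro!: subspace_add[OF subspace_C0] subspace_scale[OF subspace_C0])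
  show "ip (u + r *\<^sub>R w) (u + r *\<^sub>R w) = ip u u + 2 * r * ip u w + r\<^sup>2 * ip w w"
    unfolding ip_def power2_eq_square[symmetric, of "apply_bcontfun (u + r *\<^sub>R w) _"] eq using i by simp
qed

lemma zero_VL: "0 \<in> VL"
  by (simp add: VL_def subspace_0[OF subspace_C0])

lemma ip_nonneg: "0 \<le> ip u u"
  unfolding ip_def by (intro integral_nonneg_AE) auto

text \<open>
  A minimizing sequence of \<open>\<parallel>u\<parallel>\<^sup>2 - 2 \<Lambda> u\<close>, chosen to converge fast enough to converge almost everywhere.
\<close>

lemma L2_density:
  fixes \<Lambda> :: "((real ^ 'n) \<Rightarrow>\<^sub>C real) \<Rightarrow> real" and W :: "nat \<Rightarrow> (real ^ 'n) \<Rightarrow>\<^sub>C real"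
  assumes lin: "\<And>u w r. u \<in> C0 \<Longrightarrow> w \<in> C0 \<Longrightarrow> \<Lambda> (u + r *\<^sub>R w) = \<Lambda> u + r * \<Lambda> w"
    and bound: "\<And>u. u \<in> VL \<Longrightarrow> 2 * \<Lambda> u \<le> ip u u + D"
    and W: "\<And>n. W n \<in> VL" "\<And>y. \<exists>n. W n y \<noteq> 0"
  obtains g us where "g \<in> borel_measurable borel" "\<And>k. us k \<in> VL"
    "AE y in lborel. (\<lambda>k. us k y) \<longlonglongrightarrow> g y"
    "\<And>w. w \<in> VL \<Longrightarrow> integrable lborel (\<lambda>y. g y * w y)"
    "\<And>w. w \<in> VL \<Longrightarrow> \<Lambda> w = (LINT y|lborel. g y * w y)"
proof -
  define J where "J u = ip u u - 2 * \<Lambda> u" for u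
  define m where "m = Inf (J ` VL)"
  have bdd: "bdd_below (J ` VL)" unfolding bdd_below_def J_def
    by (rule exI[of _ "- D"]) (use bound in force)
  have m: "m \<le> J u" if "u \<in> VL" for u unfolding m_def using bdd that by (intro cInf_lower) auto
  have "\<exists>u\<in>VL. J u < m + (1/4) ^ k" for k :: nat
  proof -
    have "\<exists>x\<in>J ` VL. x < m + (1/4) ^ k"
      unfolding m_def using zero_VL bdd by (intro cInf_less_iff[THEN iffD1]) auto
    then show ?thesis by blast
  qed
  then obtain us where us: "\<And>k. us k \<in> VL" "\<And>k. J (us k) < m + (1/4) ^ k" by metis
  have usC: "us k \<in> C0" for k using us(1)[of k] by (simp add: VL_def)
  \<comment> \<open>An approximate minimizer is compared with its perturbations by \<open>w\<close>
    times plus or minus \<open>q = (1/2) ^ k\<close>: its excess over the infimum is below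
    \<open>q\<^sup>2\<close>, so the first variation is of order \<open>q\<close>.\<close>
  have conv: "\<bar>ip (us k) w - \<Lambda> w\<bar> \<le> (1/2) ^ k * (ip w w + 1)" if w: "w \<in> VL" for w and k :: nat
  proof -
    have wC: "w \<in> C0" using w by (simp add: VL_def)
    define a where "a = ip (us k) w - \<Lambda> w"
    define q :: real where "q = (1/2) ^ k"
    have q: "q > 0" "q\<^sup>2 = (1/4) ^ k" by (auto simp: q_def power_mult[symmetric] mult.commute[of _ 2]) (simp add: power_mult power_one_over power2_eq_square)
    have *: "0 \<le> 2 * r * a + r\<^sup>2 * ip w w + q\<^sup>2" for r
    proof -
      have "J (us k + r *\<^sub>R w) = J (us k) + 2 * r * a + r\<^sup>2 * ip w w"
        unfolding J_def VL_comb(2)[OF us(1) w] lin[OF usC wC] by (simp add: a_def algebra_simps)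
      then show ?thesis using m[OF VL_comb(1)[OF us(1) w, of k r]] us(2)[of k] q(2) by linarith
    qed
    have "2 * q * \<bar>a\<bar> \<le> q\<^sup>2 * (ip w w + 1)"
    proof (cases "a \<ge> 0")
      case True then show ?thesis using *[of "- q"] by (simp add: algebra_simps)
    next
      case False then show ?thesis using *[of q] by (simp add: algebra_simps)
    qed
    then have "2 * \<bar>a\<bar> \<le> q * (ip w w + 1)" using q by (simp add: power2_eq_square)
    moreover have "0 \<le> q * (ip w w + 1)" using q ip_nonneg[of w] by simp
    moreover have "\<bar>a\<bar> \<le> b" if "2 * \<bar>a\<bar> \<le> b" "0 \<le> b" for b using that by linarith
    ultimately have "\<bar>a\<bar> \<le> q * (ip w w + 1)" by blast
    then show ?thesis unfolding a_def q_def .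
  qed
  define df where "df k = us (Suc k) + (-1) *\<^sub>R us k" for k
  have dfV: "df k \<in> VL" for k unfolding df_def by (rule VL_comb(1)[OF us(1) us(1)])
  have df_apply: "df k y = us (Suc k) y - us k y" for k y
    by (simp add: df_def plus_bcontfun.rep_eq scaleR_bcontfun.rep_eq)
  \<comment> \<open>At the midpoint of two consecutive approximate minimizers the functional is at
    least its infimum; the parallelogram identity turns this into a bound for their squared
    distance.\<close>
  have dfs: "ip (df k) (df k) \<le> 4 * (1/4) ^ k" for k
  proof -
    define mid where "mid = us k + (1/2) *\<^sub>R df k"
    have midV: "mid \<in> VL" unfolding mid_def by (rule VL_comb(1)[OF us(1) dfV])
    have dfC: "df k \<in> C0" using dfV[of k] by (simp add: VL_def)
    have us': "us (Suc k) = us k + 1 *\<^sub>R df k" by (simp add: df_def)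
    have "J (us (Suc k)) + J (us k) = 2 * J mid + 1/2 * ip (df k) (df k)"
      unfolding J_def mid_def us'[unfolded One_nat_def] VL_comb(2)[OF us(1) dfV] lin[OF usC dfC]
      by (simp add: power2_eq_square algebra_simps)
    then have "1/2 * ip (df k) (df k) \<le> (1/4) ^ k + (1/4) ^ Suc k"
      using m[OF midV] us(2)[of k] us(2)[of "Suc k"] by linarith
    then have "2 * ip (df k) (df k) \<le> 5 * (1/4) ^ k" by simp
    moreover have "0 \<le> (1/4 :: real) ^ k" by simp
    ultimately show ?thesis by linarith
  qed
  \<comment> \<open>A majorant of all \<open>us k\<close> at once; its integrability against
    functions in \<open>VL\<close> justifies the limits below.\<close>
  define G where "G y = ennreal \<bar>us 0 y\<bar> + (\<Sum>k. ennreal \<bar>df k y\<bar>)" for y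
  have G_meas[measurable]: "G \<in> borel_measurable borel" unfolding G_def[abs_def] by measurable
  have absint: "(\<integral>\<^sup>+y. ennreal \<bar>u y\<bar> * ennreal \<bar>w y\<bar> \<partial>lborel) = ennreal (LINT y|lborel. \<bar>u y * w y\<bar>)"
    if "u \<in> VL" "w \<in> VL" for u w :: "(real ^ 'n) \<Rightarrow>\<^sub>C real"
    by (subst nn_integral_eq_integral[OF integrable_abs[OF VL_integrable[OF that]], symmetric])
       (auto simp: abs_mult ennreal_mult)
  have Gw: "(\<integral>\<^sup>+y. G y * ennreal \<bar>w y\<bar> \<partial>lborel) < top" if w: "w \<in> VL" for w
  proof -
    have d: "(\<integral>\<^sup>+y. ennreal \<bar>df k y\<bar> * ennreal \<bar>w y\<bar> \<partial>lborel) \<le> ennreal ((4 + ip w w) * (1/2) ^ k)" for k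
    proof -
      \<comment> \<open>This weight in Young's inequality splits the decay \<open>(1/4) ^ k\<close>
        evenly between the two squares.\<close>
      let ?p = "(2::real) ^ k"
      have p: "?p > 0" by simp
      have "(LINT y|lborel. \<bar>df k y * w y\<bar>) \<le> (LINT y|lborel. ?p * (df k y * df k y) + 1 / ?p * (w y * w y))"
      proof (rule integral_mono)
        fix y
        define s where "s = sqrt ?p"
        have s: "s > 0" "s * s = ?p" by (simp_all add: s_def)
        have "2 * (s * \<bar>df k y\<bar>) * (\<bar>w y\<bar> / s) \<le> (s * \<bar>df k y\<bar>)\<^sup>2 + (\<bar>w y\<bar> / s)\<^sup>2" by (rule sum_squares_bound)
        also have "(s * \<bar>df k y\<bar>)\<^sup>2 = ?p * (df k y * df k y)" by (simp add: power2_eq_square s(2)[symmetric] algebra_simps)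
        also have "(\<bar>w y\<bar> / s)\<^sup>2 = 1 / ?p * (w y * w y)" by (simp add: power2_eq_square s(2)[symmetric])
        also have "2 * (s * \<bar>df k y\<bar>) * (\<bar>w y\<bar> / s) = 2 * \<bar>df k y * w y\<bar>" using s by (simp add: abs_mult)
        finally show "\<bar>df k y * w y\<bar> \<le> ?p * (df k y * df k y) + 1 / ?p * (w y * w y)"
          using abs_ge_zero[of "df k y * w y"] by linarith
      qed (use VL_integrable[OF dfV dfV] VL_integrable[OF w w] VL_integrable[OF dfV w] in auto)
      also have "\<dots> = ?p * ip (df k) (df k) + 1 / ?p * ip w w"
        using VL_integrable[OF dfV dfV] VL_integrable[OF w w] by (simp add: ip_def)
      also have "\<dots> \<le> ?p * (4 * (1/4) ^ k) + 1 / ?p * ip w w" by (intro add_mono mult_left_mono dfs) auto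
      also have "\<dots> = (4 + ip w w) * (1/2) ^ k"
      proof -
        have "?p * (1/4) ^ k = (1/2) ^ k" by (simp flip: power_mult_distrib)
        then show ?thesis by (simp add: power_one_over algebra_simps)
      qed
      finally show ?thesis unfolding absint[OF dfV w] by (rule ennreal_leI)
    qed
    have "(\<integral>\<^sup>+y. G y * ennreal \<bar>w y\<bar> \<partial>lborel)
      = (\<integral>\<^sup>+y. ennreal \<bar>us 0 y\<bar> * ennreal \<bar>w y\<bar> \<partial>lborel) + (\<integral>\<^sup>+y. (\<Sum>k. ennreal \<bar>df k y\<bar> * ennreal \<bar>w y\<bar>) \<partial>lborel)"
      unfolding G_def by (subst nn_integral_add[symmetric]) (auto simp: distrib_right)
    also have "(\<integral>\<^sup>+y. (\<Sum>k. ennreal \<bar>df k y\<bar> * ennreal \<bar>w y\<bar>) \<partial>lborel) = (\<Sum>k. \<integral>\<^sup>+y. ennreal \<bar>df k y\<bar> * ennreal \<bar>w y\<bar> \<partial>lborel)"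
      by (rule nn_integral_suminf) measurable
    also have "\<dots> \<le> (\<Sum>k. ennreal ((4 + ip w w) * (1/2) ^ k))" by (intro suminf_le d) auto
    also have "\<dots> = ennreal ((4 + ip w w) * (1 / (1 - 1/2)))"
      using ip_nonneg[of w] by (intro suminf_ennreal_eq sums_mult geometric_sums) auto
    finally have "(\<integral>\<^sup>+y. G y * ennreal \<bar>w y\<bar> \<partial>lborel) \<le> ennreal (LINT y|lborel. \<bar>us 0 y * w y\<bar>) + ennreal ((4 + ip w w) * (1 / (1 - 1/2)))"
      by (simp add: absint[OF us(1) w] add_left_mono)
    also have "\<dots> < top" by (simp add: ennreal_add_eq_top less_top[symmetric] del: ennreal_plus)
    finally show ?thesis .
  qed
  \<comment> \<open>Against \<open>W n\<close> the majorant is integrable, so it is finite almost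
    everywhere on the set where \<open>W n\<close> is not 0; these countably many sets cover the
    space.\<close>
  have Gfin: "AE y in lborel. G y < top"
  proof -
    have "AE y in lborel. G y * ennreal \<bar>W n y\<bar> \<noteq> top" for n
      using Gw[OF W(1)[of n]] by (intro nn_integral_PInf_AE[unfolded infinity_ennreal_def]) auto
    then have "AE y in lborel. \<forall>n. G y * ennreal \<bar>W n y\<bar> \<noteq> top" by (simp add: AE_all_countable)
    then show ?thesis
    proof eventually_elim
      case (elim y)
      obtain n where "W n y \<noteq> 0" using W(2) by blast
      then have "ennreal \<bar>W n y\<bar> \<noteq> 0" by simp
      then show ?case using elim[rule_format, of n] by (auto simp: ennreal_mult_eq_top_iff less_top)
    qed
  qed
  define g where "g y = lim (\<lambda>k. us k y)" for y
  have g_meas: "g \<in> borel_measurable borel" unfolding g_def[abs_def] by measurable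
  have lim: "(\<lambda>k. us k y) \<longlonglongrightarrow> g y" "\<bar>us k y\<bar> \<le> enn2real (G y)" if fin: "G y < top" for y k
  proof -
    have sfin: "(\<Sum>k. ennreal \<bar>df k y\<bar>) \<noteq> top" using fin by (auto simp: G_def)
    then have summ: "summable (\<lambda>k. \<bar>df k y\<bar>)" by (intro summable_suminf_not_top) auto
    have tele: "us k y = us 0 y + (\<Sum>j<k. df j y)" for k
      by (induction k) (auto simp: df_apply)
    have "summable (\<lambda>k. df k y)" using summ by (rule summable_rabs_cancel)
    then have "(\<lambda>k. us 0 y + (\<Sum>j<k. df j y)) \<longlonglongrightarrow> us 0 y + suminf (\<lambda>k. df k y)"
      by (intro tendsto_intros summable_LIMSEQ)
    then have "convergent (\<lambda>k. us k y)" unfolding tele[symmetric] convergent_def by blast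
    then show "(\<lambda>k. us k y) \<longlonglongrightarrow> g y" unfolding g_def by (simp add: convergent_LIMSEQ_iff)
    have "\<bar>us k y\<bar> \<le> \<bar>us 0 y\<bar> + (\<Sum>j<k. \<bar>df j y\<bar>)"
      unfolding tele[of k] by (intro order_trans[OF abs_triangle_ineq] add_left_mono sum_abs)
    also have "\<dots> \<le> \<bar>us 0 y\<bar> + (\<Sum>k. \<bar>df k y\<bar>)" using summ by (intro add_left_mono sum_le_suminf) auto
    also have "\<dots> = enn2real (G y)"
      unfolding G_def using summ by (subst suminf_ennreal2) (auto simp: suminf_nonneg simp flip: ennreal_plus)
    finally show "\<bar>us k y\<bar> \<le> enn2real (G y)" .
  qed
  have main: "integrable lborel (\<lambda>y. g y * w y) \<and> \<Lambda> w = (LINT y|lborel. g y * w y)" if w: "w \<in> VL" for w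
  proof
    have int: "integrable lborel (\<lambda>y. enn2real (G y) * \<bar>w y\<bar>)"
    proof (rule integrableI_nonneg)
      have "(\<integral>\<^sup>+y. ennreal (enn2real (G y) * \<bar>w y\<bar>) \<partial>lborel) = (\<integral>\<^sup>+y. G y * ennreal \<bar>w y\<bar> \<partial>lborel)"
        by (rule nn_integral_cong_AE) (use Gfin in eventually_elim, simp add: ennreal_mult less_top[symmetric])
      then show "(\<integral>\<^sup>+y. ennreal (enn2real (G y) * \<bar>w y\<bar>) \<partial>lborel) < \<infinity>" using Gw[OF w] by simp
    qed auto
    have mg: "(\<lambda>y. g y * w y) \<in> borel_measurable lborel" using g_meas by measurable
    have 1: "AE y in lborel. (\<lambda>k. us k y * w y) \<longlonglongrightarrow> g y * w y"
      using Gfin by eventually_elim (intro tendsto_intros lim)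
    have 2: "AE y in lborel. norm (us k y * w y) \<le> enn2real (G y) * \<bar>w y\<bar>" for k
      using Gfin by eventually_elim (auto simp: abs_mult intro!: mult_right_mono lim)
    show "integrable lborel (\<lambda>y. g y * w y)"
      by (rule integrable_dominated_convergence[OF mg _ int 1 2]) measurable
    have "(\<lambda>k. LINT y|lborel. us k y * w y) \<longlonglongrightarrow> (LINT y|lborel. g y * w y)"
      by (rule integral_dominated_convergence[OF mg _ int 1 2]) measurable
    then have "(\<lambda>k. ip (us k) w) \<longlonglongrightarrow> (LINT y|lborel. g y * w y)" by (simp only: ip_def)
    moreover have "(\<lambda>k. ip (us k) w) \<longlonglongrightarrow> \<Lambda> w"
    proof -
      have "(\<lambda>k. (1/2) ^ k * (ip w w + 1)) \<longlonglongrightarrow> 0 * (ip w w + 1)"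
        by (intro tendsto_intros LIMSEQ_power_zero) auto
      then have 0: "(\<lambda>k. (1/2) ^ k * (ip w w + 1)) \<longlonglongrightarrow> 0" by (simp only: mult_zero_left)
      have "(\<lambda>k. ip (us k) w - \<Lambda> w) \<longlonglongrightarrow> 0"
        by (rule Lim_null_comparison[OF always_eventually[OF allI] 0])
           (unfold real_norm_def, rule conv[OF w])
      then show ?thesis by (rule LIM_zero_cancel)
    qed
    ultimately show "\<Lambda> w = (LINT y|lborel. g y * w y)" by (rule LIMSEQ_unique[rotated])
  qed
  show thesis
  proof (rule that[OF g_meas us(1)])
    show "AE y in lborel. (\<lambda>k. us k y) \<longlonglongrightarrow> g y" using Gfin by eventually_elim (rule lim)
  qed (use main in auto)
qed

text \<open>The natural test function is the positive part of \<open>g - F\<close>, but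
  \<open>g\<close> is only measurable. It is an almost everywhere limit of the continuous
  \<open>us k\<close>, so \<open>th k\<close> is used instead, truncated at 1 and cut off by
  \<open>W n\<close> to be bounded with compact support. In the limit the nonnegative function
  \<open>(g - F) * th0\<close> has integral at most 0.\<close>

lemma AE_le_by_testing:
  fixes g F :: "real ^ 'n \<Rightarrow> real" and us W :: "nat \<Rightarrow> (real ^ 'n) \<Rightarrow>\<^sub>C real"
  assumes g: "g \<in> borel_measurable borel" and us: "AE y in lborel. (\<lambda>k. us k y) \<longlonglongrightarrow> g y"
    and F: "continuous_on UNIV F" "\<And>y. \<bar>F y\<bar> \<le> B"
    and W: "\<And>n y. 0 \<le> W n y" "\<And>y. \<exists>n. W n y \<noteq> 0" "\<And>n. \<exists>R. \<forall>y. R \<le> norm y \<longrightarrow> W n y = 0"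
    and Wint: "\<And>n. integrable lborel (W n)" "\<And>n. integrable lborel (\<lambda>y. g y * W n y)"
    and test: "\<And>w :: (real ^ 'n) \<Rightarrow>\<^sub>C real. (\<And>y. 0 \<le> w y) \<Longrightarrow> \<exists>R. \<forall>y. R \<le> norm y \<longrightarrow> w y = 0 \<Longrightarrow>
      (LINT y|lborel. g y * w y) \<le> (LINT y|lborel. F y * w y)"
  shows "AE y in lborel. g y \<le> F y"
proof -
  have [measurable]: "g \<in> borel_measurable borel" "F \<in> borel_measurable borel"
    using g F(1) by (auto intro: borel_measurable_continuous_onI)
  have "AE y in lborel. W n y \<noteq> 0 \<longrightarrow> g y \<le> F y" for n
  proof -
    define th where "th k y = max 0 (min 1 (us k y - F y)) * W n y" for k y
    define th0 where "th0 y = max 0 (min 1 (g y - F y)) * W n y" for y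
    have th_bound: "0 \<le> th k y" "th k y \<le> W n y" "\<bar>th k y\<bar> \<le> norm (W n)" for k y
    proof -
      show 1: "0 \<le> th k y" using W(1) by (simp add: th_def)
      show 2: "th k y \<le> W n y" unfolding th_def using W(1)[of n y] by (intro mult_left_le_one_le) auto
      show "\<bar>th k y\<bar> \<le> norm (W n)" using 1 2 abs_bcontfun_le[of "W n" y] by linarith
    qed
    have th_app: "apply_bcontfun (Bcontfun (th k)) = th k" for k
      unfolding th_def[abs_def]
      by (rule Bcontfun_apply[where b = "norm (W n)"])
         (intro continuous_intros F continuous_on_apply_bcontfun, use th_bound(3)[of k, unfolded th_def] in simp)
    have [measurable]: "th k \<in> borel_measurable borel" "th0 \<in> borel_measurable borel" for k
      unfolding th_def[abs_def] th0_def[abs_def] by measurable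
    have le: "(LINT y|lborel. g y * th k y) \<le> (LINT y|lborel. F y * th k y)" for k
    proof -
      obtain R where "\<forall>y. R \<le> norm y \<longrightarrow> W n y = 0" using W(3) by blast
      then have "\<forall>y. R \<le> norm y \<longrightarrow> th k y = 0" by (simp add: th_def)
      then show ?thesis using test[of "Bcontfun (th k)"] th_bound(1) unfolding th_app by blast
    qed
    have conv: "AE y in lborel. (\<lambda>k. th k y) \<longlonglongrightarrow> th0 y"
      using us by eventually_elim (auto simp: th_def th0_def intro!: tendsto_intros)
    have gi: "integrable lborel (\<lambda>y. \<bar>g y * W n y\<bar>)" using Wint(2)[of n] by simp
    have Fi: "integrable lborel (\<lambda>y. B * W n y)" using Wint(1)[of n] by simp
    have g1: "AE y in lborel. (\<lambda>k. g y * th k y) \<longlonglongrightarrow> g y * th0 y"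
      and F1: "AE y in lborel. (\<lambda>k. F y * th k y) \<longlonglongrightarrow> F y * th0 y"
    proof -
      show "AE y in lborel. (\<lambda>k. g y * th k y) \<longlonglongrightarrow> g y * th0 y"
        using conv by eventually_elim (intro tendsto_intros)
      show "AE y in lborel. (\<lambda>k. F y * th k y) \<longlonglongrightarrow> F y * th0 y"
        using conv by eventually_elim (intro tendsto_intros)
    qed
    have g2: "AE y in lborel. norm (g y * th k y) \<le> \<bar>g y * W n y\<bar>" for k
      using th_bound[of k] W(1)[of n] by (intro AE_I2) (auto simp: abs_mult intro!: mult_left_mono)
    have F2: "AE y in lborel. norm (F y * th k y) \<le> B * W n y" for k
      using th_bound[of k] F(2) by (intro AE_I2) (auto simp: abs_mult intro!: mult_mono order_trans[OF abs_ge_zero F(2)])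
    have m: "(\<lambda>y. g y * th0 y) \<in> borel_measurable lborel" "(\<lambda>y. F y * th0 y) \<in> borel_measurable lborel"
      "(\<lambda>y. g y * th k y) \<in> borel_measurable lborel" "(\<lambda>y. F y * th k y) \<in> borel_measurable lborel" for k by measurable
    have lim: "(\<lambda>k. LINT y|lborel. g y * th k y) \<longlonglongrightarrow> (LINT y|lborel. g y * th0 y)"
        "(\<lambda>k. LINT y|lborel. F y * th k y) \<longlonglongrightarrow> (LINT y|lborel. F y * th0 y)"
      by (rule integral_dominated_convergence[OF m(1,3) gi g1 g2], rule integral_dominated_convergence[OF m(2,4) Fi F1 F2])
    have int: "integrable lborel (\<lambda>y. g y * th0 y)" "integrable lborel (\<lambda>y. F y * th0 y)"
      by (rule integrable_dominated_convergence[OF m(1,3) gi g1 g2], rule integrable_dominated_convergence[OF m(2,4) Fi F1 F2])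
    have le0: "(LINT y|lborel. g y * th0 y) \<le> (LINT y|lborel. F y * th0 y)"
      by (rule LIMSEQ_le[OF lim]) (use le in auto)
    have nn: "0 \<le> (g y - F y) * th0 y" for y
      using W(1)[of n y] by (cases "g y \<ge> F y") (auto simp: th0_def)
    have int': "integrable lborel (\<lambda>y. (g y - F y) * th0 y)" using int by (simp add: left_diff_distrib)
    have "(LINT y|lborel. (g y - F y) * th0 y) \<le> 0" using int le0 by (simp add: left_diff_distrib)
    moreover have "0 \<le> (LINT y|lborel. (g y - F y) * th0 y)" using nn by (intro integral_nonneg_AE) auto
    ultimately have "(LINT y|lborel. (g y - F y) * th0 y) = 0" by linarith
    then have "AE y in lborel. (g y - F y) * th0 y = 0"
      using integral_nonneg_eq_0_iff_AE[OF int'] nn by simp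
    then show ?thesis
    proof eventually_elim
      case (elim y)
      show ?case
      proof
        assume "W n y \<noteq> 0"
        then show "g y \<le> F y" using elim by (auto simp: th0_def max_def min_def split: if_splits)
      qed
    qed
  qed
  then have "AE y in lborel. \<forall>n. W n y \<noteq> 0 \<longrightarrow> g y \<le> F y" unfolding AE_all_countable by blast
  then show ?thesis by eventually_elim (use W(2) in blast)
qed

subsection \<open>The transition density\<close>

lemma compact_support_VL:
  fixes w :: "(real ^ 'n) \<Rightarrow>\<^sub>C real"
  assumes w: "\<And>y. R \<le> norm y \<Longrightarrow> w y = 0"
  shows "w \<in> VL" "integrable lborel w"
proof -
  have c: "integrable lborel (indicator (cball 0 R) :: real ^ 'n \<Rightarrow> real)"
    using emeasure_lborel_cball_finite[of 0 R] by (intro integrable_real_indicator) auto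
  have i: "integrable lborel (\<lambda>y. B * indicator (cball 0 R) (y :: real ^ 'n) :: real)" for B
    using c by simp
  have z: "w y = 0" if "y \<notin> cball 0 R" for y using w[of y] that by simp
  show "integrable lborel w"
  proof (rule Bochner_Integration.integrable_bound[OF i[of "norm w"]])
    show "AE y in lborel. norm (w y) \<le> norm (norm w * indicator (cball 0 R) y :: real)"
      using abs_bcontfun_le[of w] z by (intro AE_I2) (auto simp: indicator_def)
  qed measurable
  have "integrable lborel (\<lambda>y. (w y)\<^sup>2)"
  proof (rule Bochner_Integration.integrable_bound[OF i[of "(norm w)\<^sup>2"]])
    show "AE y in lborel. norm ((w y)\<^sup>2) \<le> norm ((norm w)\<^sup>2 * indicator (cball 0 R) y :: real)"
      using abs_bcontfun_le[of w] z by (intro AE_I2) (auto simp: indicator_def abs_le_square_iff[symmetric])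
  qed measurable
  then show "w \<in> VL" using compact_support_C0[OF w] by (simp add: VL_def)
qed

section \<open>Continuity and integrability of the barrier\<close>

context profile
begin

lemma psi_isCont: "z \<noteq> 0 \<Longrightarrow> isCont \<psi> z"
proof -
  assume z: "z \<noteq> 0"
  have "isCont \<phi> (norm z + 1)"
    using phi_C2 z by (intro differentiable_imp_continuous_within) (auto simp: C2_on_halfline_def)
  then have "isCont (\<lambda>z :: real ^ 'n. \<phi> (norm z + 1)) z"
    by (intro isCont_o2[where f = "\<lambda>z. norm z + 1" and g = \<phi>]) (auto intro!: continuous_intros)
  moreover have "isCont (\<lambda>z :: real ^ 'n. norm z powr (- \<beta>)) z"
    using z by (intro continuous_intros) auto
  ultimately show "isCont \<psi> z" unfolding psi by (rule isCont_mult)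
qed

text \<open>Only the origin is delicate: there \<psi> grows beyond every bound, so the plateau fills
  a neighbourhood and \<open>H\<close> is locally constant. Continuity is what admits the barrier as
  the bound in \<open>AE_le_by_testing\<close>.\<close>

lemma H_continuous:
  assumes p: "L > 0" "c > 0" "s > 0"
  shows "continuous_on UNIV (H L c s)"
proof (unfold continuous_on_eq_continuous_at[OF open_UNIV], intro ballI)
  fix z :: "real ^ 'n"
  show "isCont (H L c s) z"
  proof (cases "z = 0")
    case False
    have "isCont (\<lambda>z. min (L * s powr (- dlt)) (c * s * \<psi> z)) z"
      using psi_isCont[OF False] by (intro continuous_intros)
    moreover have "\<forall>\<^sub>F y in nhds z. H L c s y = min (L * s powr (- dlt)) (c * s * \<psi> y)"
      using False by (intro eventually_nhds_in_open[of "- {0}", THEN eventually_mono]) (auto simp: H_def)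
    ultimately show ?thesis by (simp add: isCont_cong)
  next
    case True
    define X where "X = L * s powr (- dlt) * c1 / (c * s)"
    have X: "X > 0" using p c1_ge by (simp add: X_def)
    have big: "H L c s y = L * s powr (- dlt)" if y: "norm y < min 1 (X powr (- 1 / \<beta>))" for y
    proof (cases "y = 0")
      case False
      have "X = (X powr (- 1 / \<beta>)) powr (- \<beta>)" using X beta_pos by (simp add: powr_powr)
      also have "\<dots> \<le> norm y powr (- \<beta>)" using y False beta_pos by (intro powr_mono2') auto
      also have "\<dots> \<le> norm y powr (- \<beta>) * (c1 * \<phi> (norm y + 1))"
        using phi_shift(1)[of "norm y"] y mult_left_mono[of 1 "c1 * \<phi> (norm y + 1)" "norm y powr (- \<beta>)"]
        by (simp add: phi_one)
      also have "\<dots> = c1 * \<psi> y" by (simp add: psi)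
      finally have "L * s powr (- dlt) \<le> c * s * \<psi> y"
        using p c1_ge by (simp add: X_def field_simps)
      then show ?thesis using False by (simp add: H_def)
    qed (simp add: H_def)
    have "\<forall>\<^sub>F y in nhds z. H L c s y = L * s powr (- dlt)"
      using True X big
      by (intro eventually_nhds_in_open[of "ball 0 (min 1 (X powr (- 1 / \<beta>)))", THEN eventually_mono]) auto
    then show ?thesis by (simp add: isCont_cong)
  qed
qed

lemma H_even: "H L c s (- z) = H L c s z"
proof -
  have "\<psi> (- z) = \<psi> z" using fun_cong[OF psi, of "- z"] fun_cong[OF psi, of z] by simp
  then show ?thesis unfolding H_def by simp
qed

lemma H_integrable:
  assumes p: "L > 0" "c > 0" "s > 0"
  shows "integrable lborel (\<lambda>y. H L c s (x - y))"
proof -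
  obtain A where "A > 0" and A: "\<And>L c s. L > 0 \<Longrightarrow> c > 0 \<Longrightarrow> s > 0 \<Longrightarrow>
      (\<integral>\<^sup>+y. ennreal (H L c s y) \<partial>lborel) \<le> ennreal (A * (c * (L / c) powr (\<alpha> / \<beta>)))"
    using H_mass by blast
  have "(\<integral>\<^sup>+y. ennreal (H L c s y) \<partial>lborel) < \<infinity>"
    by (rule le_less_trans[OF A[OF p]]) simp
  then have "integrable lborel (H L c s)"
    using H_bounds(1)[OF p] by (intro integrableI_nonneg) auto
  then have "integrable lborel (\<lambda>y. H L c s (- x + y))" by (subst integrable_shift) auto
  moreover have "H L c s (x - y) = H L c s (- x + y)" for y using H_even[of L c s "x - y"] by simp
  ultimately show ?thesis by simp
qed

text \<open>Removes the time shift of the tent estimate, which ends between \<open>t\<close> and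
  \<open>2 * t\<close> for small \<eta>.\<close>

lemma H_double:
  assumes p: "L > 0" "c > 0" "s > 0" and r: "s \<le> r" "r \<le> 2 * s"
  shows "H L c r z \<le> 2 * H L c s z"
proof -
  have 1: "L * r powr (- dlt) \<le> L * s powr (- dlt)" using p r dlt_pos by (intro mult_left_mono powr_mono2') auto
  have 2: "c * r * \<psi> z \<le> 2 * (c * s * \<psi> z)"
    using mult_right_mono[OF mult_left_mono[OF r(2), of c], of "\<psi> z"] p psi_nonneg by (simp add: mult_ac)
  have 3: "0 \<le> L * s powr (- dlt)" "0 \<le> c * s * \<psi> z" using p psi_nonneg by auto
  show ?thesis using 1 2 3 by (auto simp: H_def)
qed

end

context profile_const
begin

text \<open>A factor 2 comes from \<open>H_double\<close>; the remaining \<open>2 ^ (d + 1)\<close>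
  over the volume of the unit ball is the ratio between \<open>\<eta> ^ d\<close> and the lower
  bound for the integral of a tent.\<close>

definition Kf :: real where "Kf = 2 ^ (CARD('n) + 2) / unit_ball_vol (real CARD('n))"

lemma Kf_pos: "Kf > 0" by (simp add: Kf_def)

end

context jump
begin

lemma tent_sym: "\<eta> > 0 \<Longrightarrow> tent y \<eta> z = tent z \<eta> y"
  by (simp add: tent_apply norm_minus_commute)

lemma tent_VL: "\<eta> > 0 \<Longrightarrow> tent y \<eta> \<in> VL" "\<eta> > 0 \<Longrightarrow> integrable lborel (tent y \<eta>)"
proof -
  assume "\<eta> > 0"
  then have "norm y + \<eta> \<le> norm z \<Longrightarrow> tent y \<eta> z = 0" for z
    using norm_triangle_ineq[of "z - y" y] by (intro tent_facts(3)) auto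
  then show "tent y \<eta> \<in> VL" "integrable lborel (tent y \<eta>)" using compact_support_VL by blast+
qed

lemma Theta_le:
  assumes A: "A > 0" and t: "t > 0" and s: "t \<le> s" "s \<le> 2 * t"
  shows "Theta A s z \<le> 2 * exp (2 * Cb A * t) * H Lb (cb A) t z"
proof -
  note b = barrier_const[OF A]
  have "exp (Cb A * s) \<le> exp (2 * Cb A * t)" using b s by simp
  moreover have "H Lb (cb A) s z \<le> 2 * H Lb (cb A) t z" by (rule H_double[OF b(1,2) t s])
  ultimately have "Theta A s z \<le> exp (2 * Cb A * t) * (2 * H Lb (cb A) t z)"
    unfolding Theta_def using H_bounds(1)[OF b(1,2), of s z] t s by (intro mult_mono) auto
  then show ?thesis by (simp add: mult_ac)
qed

lemma P_abs_le: "t \<ge> 0 \<Longrightarrow> u \<in> C0 \<Longrightarrow> \<bar>P t u x\<bar> \<le> norm u"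
  using abs_bcontfun_le[of "P t u" x] P_contr[of t u] by linarith

lemma P_lin: "t \<ge> 0 \<Longrightarrow> u \<in> C0 \<Longrightarrow> w \<in> C0 \<Longrightarrow> P t (u + r *\<^sub>R w) x = P t u x + r * P t w x"
  by (simp add: P_add P_scale subspace_scale[OF subspace_C0] plus_bcontfun.rep_eq scaleR_bcontfun.rep_eq)

text \<open>\<open>P_L2_bound\<close> asks for a nonnegative function; positivity of
  \<open>P t\<close> allows passing from \<open>u\<close> to its absolute value.\<close>

lemma P_le_ip:
  assumes t: "t > 0" and u: "u \<in> VL"
  shows "2 * P t u x \<le> ip u u + DN t"
proof -
  have uC: "u \<in> C0" using u by (simp add: VL_def)
  define v where "v = Bcontfun (\<lambda>y. \<bar>u y\<bar>)"
  have v: "v y = \<bar>u y\<bar>" for y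
    unfolding v_def by (subst Bcontfun_apply[where b = "norm u"]) (auto intro!: continuous_intros abs_bcontfun_le)
  have vC: "v \<in> C0" by (rule C0_dominated[OF uC]) (simp add: v)
  have "0 \<le> P t (v + (-1) *\<^sub>R u) x"
  proof (rule P_nonneg[OF t])
    show "v + (-1) *\<^sub>R u \<in> C0" by (intro subspace_add[OF subspace_C0] subspace_scale[OF subspace_C0] vC uC)
    show "0 \<le> (v + (-1) *\<^sub>R u) y" for y by (simp add: v plus_bcontfun.rep_eq scaleR_bcontfun.rep_eq)
  qed
  then have "P t u x \<le> P t v x" using P_lin[of t v u "-1" x] t vC uC by simp
  moreover have "2 * P t v x \<le> ip u u + DN t"
  proof (rule P_L2_bound[OF t vC])
    have "(\<integral>\<^sup>+x. (ennreal (v x))\<^sup>2 \<partial>lborel) = (\<integral>\<^sup>+x. ennreal (u x * u x) \<partial>lborel)"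
      by (intro nn_integral_cong) (simp add: v ennreal_power power2_eq_square flip: ennreal_mult)
    also have "\<dots> = ennreal (ip u u)"
      unfolding ip_def using VL_integrable[OF u u] by (intro nn_integral_eq_integral) auto
    finally show "(\<integral>\<^sup>+x. (ennreal (v x))\<^sup>2 \<partial>lborel) \<le> ennreal (ip u u)" by simp
  qed (auto simp: v ip_nonneg)
  ultimately show ?thesis by linarith
qed

text \<open>
  Smearing a test function \<open>w\<close> by tents of radius \<open>\<eta>\<close> turns the bound for tents into a bound for the
  density, up to the constant lost in comparing the volumes of a tent and of a ball.
\<close>

lemma density_test:
  fixes w :: "(real ^ 'n) \<Rightarrow>\<^sub>C real"
  assumes A: "A > 0"
    and bar: "\<And>L c s z \<kappa>. L > 0 \<Longrightarrow> c > 0 \<Longrightarrow> s > 0 \<Longrightarrow> z \<noteq> 0 \<Longrightarrow> admissible \<kappa> \<Longrightarrow>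
      c * s * \<psi> z \<le> L * s powr (- dlt) \<Longrightarrow>
      (LINT v|lborel. (H L c s (z + v) - H L c s z) * \<kappa> v) \<le> c * \<psi> z * A * (s + (L / c) powr (\<alpha> / \<beta>))"
    and t: "t > 0"
    and g[measurable]: "g \<in> borel_measurable borel" and g0: "AE y in lborel. 0 \<le> g y"
    and gi: "\<And>w. w \<in> VL \<Longrightarrow> integrable lborel (\<lambda>y. g y * w y)"
    and gP: "\<And>w. w \<in> VL \<Longrightarrow> P t w x = (LINT y|lborel. g y * w y)"
    and w: "\<And>y. 0 \<le> w y" "\<And>y. R \<le> norm y \<Longrightarrow> w y = 0"
  shows "(LINT y|lborel. g y * w y) \<le> (LINT y|lborel. (Kf * exp (2 * Cb A * t) * H Lb (cb A) t (x - y)) * w y)"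
proof -
  note b = barrier_const[OF A]
  let ?V = "unit_ball_vol (real CARD('n))" and ?d = "CARD('n)"
  define F0 where "F0 y = 2 * exp (2 * Cb A * t) * H Lb (cb A) t (x - y)" for y
  have F0: "0 \<le> F0 y" for y using H_bounds(1)[OF b(1,2) t] by (simp add: F0_def)
  have [measurable]: "F0 \<in> borel_measurable borel"
    unfolding F0_def[abs_def] by (intro borel_measurable_times borel_measurable_const measurable_compose[OF _ H_meas]) measurable
  \<comment> \<open>\<open>\<mu> * \<eta> ^ ?d\<close> is the lower bound of
    \<open>tent_integral_ge\<close> for the integral of a tent.\<close>
  define \<mu> where "\<mu> = ?V / 2 ^ (?d + 1)"
  have mu: "\<mu> > 0" by (simp add: \<mu>_def)
  have V: "?V > 0" by simp
  define Y where "Y = (\<integral>\<^sup>+y. ennreal (w y) * ennreal (F0 y) \<partial>lborel)"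
  define R' where "R' = max 1 R"
  have gw: "ennreal (LINT y|lborel. g y * v y) = (\<integral>\<^sup>+y. ennreal (g y) * ennreal (v y) \<partial>lborel)"
    if v: "v \<in> VL" "\<And>y. 0 \<le> v y" for v :: "(real ^ 'n) \<Rightarrow>\<^sub>C real"
  proof -
    have "ennreal (LINT y|lborel. g y * v y) = (\<integral>\<^sup>+y. ennreal (g y * v y) \<partial>lborel)"
      using gi[OF v(1)] g0 v(2) by (intro nn_integral_eq_integral[symmetric]) (auto elim!: eventually_mono)
    also have "\<dots> = (\<integral>\<^sup>+y. ennreal (g y) * ennreal (v y) \<partial>lborel)"
      by (rule nn_integral_cong_AE) (use g0 v(2) in \<open>auto elim!: eventually_mono simp: ennreal_mult\<close>)
    finally show ?thesis .
  qed
  have wV: "w \<in> VL" by (rule compact_support_VL[OF w(2)])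
  \<comment> \<open>By uniform continuity \<open>w\<close> varies by less than \<open>e\<close> on a
    narrow tent, so \<open>max 0 (w - e)\<close> times \<open>\<mu> * \<eta> ^ ?d\<close> lies below
    the integral of \<open>w\<close> against tents. Exchanging the integrals leaves \<open>g\<close>
    integrated against tents, that is, values of \<open>P t\<close>, to which
    \<open>tent_bound\<close> applies; the powers of \<eta> cancel.\<close>
  have step: "(\<integral>\<^sup>+y. ennreal (g y) * ennreal (max 0 (w y - e)) \<partial>lborel) \<le> ennreal (1 / \<mu>) * Y" if e: "e > 0" for e
  proof -
    have "uniformly_continuous_on (cball 0 (R' + 1)) w"
      by (intro compact_uniformly_continuous continuous_on_apply_bcontfun) simp
    then obtain d where d: "d > 0" "\<And>y z. y \<in> cball 0 (R' + 1) \<Longrightarrow> z \<in> cball 0 (R' + 1) \<Longrightarrow> dist y z < d \<Longrightarrow> dist (w y) (w z) < e"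
      unfolding uniformly_continuous_on_def using e by metis
    define \<eta> where "\<eta> = min (min d 1) (t powr (1 / \<alpha>))"
    have eta: "0 < \<eta>" "\<eta> \<le> 1" "\<eta> \<le> d" using d t by (auto simp: \<eta>_def)
    have etat: "\<eta> powr \<alpha> \<le> t"
    proof -
      have "\<eta> powr \<alpha> \<le> (t powr (1 / \<alpha>)) powr \<alpha>" using eta alpha by (intro powr_mono2) (auto simp: \<eta>_def)
      then show ?thesis using t alpha by (simp add: powr_powr)
    qed
    have near: "w z - e \<le> w y" if yz: "norm (y - z) < \<eta>" for y z
    proof (cases "norm z \<le> R'")
      case True
      have "norm y \<le> R' + 1" using True yz eta norm_triangle_ineq[of "y - z" z] by simp
      then have "dist (w y) (w z) < e" using True yz eta by (intro d(2)) (auto simp: dist_norm norm_minus_commute)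
      then show ?thesis by (simp add: dist_real_def abs_less_iff)
    next
      case False
      then have "w z = 0" by (intro w) (simp add: R'_def)
      then show ?thesis using w(1)[of y] e by simp
    qed
    have [measurable]: "(\<lambda>(z, y). ennreal (tent y \<eta> z)) \<in> borel_measurable (borel \<Otimes>\<^sub>M borel)"
      unfolding tent_apply[OF eta(1)] by measurable
    have low: "ennreal (max 0 (w z - e)) * ennreal (\<mu> * \<eta> ^ ?d) \<le> (\<integral>\<^sup>+y. ennreal (w y) * ennreal (tent y \<eta> z) \<partial>lborel)" for z
    proof -
      have "\<mu> * \<eta> ^ ?d = 1/2 * (?V * (\<eta> / 2) ^ ?d)" by (simp add: \<mu>_def power_divide)
      then have "ennreal (max 0 (w z - e)) * ennreal (\<mu> * \<eta> ^ ?d) \<le> ennreal (max 0 (w z - e)) * (\<integral>\<^sup>+y. ennreal (tent z \<eta> y) \<partial>lborel)"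
        using tent_integral_ge[OF eta(1), of z] by (intro mult_left_mono) (simp_all only:, simp)
      also have "\<dots> = (\<integral>\<^sup>+y. ennreal (max 0 (w z - e)) * ennreal (tent z \<eta> y) \<partial>lborel)"
        by (rule nn_integral_cmult[symmetric]) measurable
      also have "\<dots> \<le> (\<integral>\<^sup>+y. ennreal (w y) * ennreal (tent y \<eta> z) \<partial>lborel)"
      proof (intro nn_integral_mono)
        fix y
        show "ennreal (max 0 (w z - e)) * ennreal (tent z \<eta> y) \<le> ennreal (w y) * ennreal (tent y \<eta> z)"
        proof (cases "norm (y - z) < \<eta>")
          case True
          then have "max 0 (w z - e) \<le> w y" using near w(1) by simp
          then show ?thesis unfolding tent_sym[OF eta(1), of z y] by (intro mult_right_mono ennreal_leI) auto
        next
          case False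
          then have "tent z \<eta> y = 0" using eta by (intro tent_facts) auto
          then show ?thesis by simp
        qed
      qed
      finally show ?thesis .
    qed
    let ?X = "\<integral>\<^sup>+y. ennreal (g y) * ennreal (max 0 (w y - e)) \<partial>lborel"
    have "?X * ennreal (\<mu> * \<eta> ^ ?d) = (\<integral>\<^sup>+z. ennreal (g z) * (ennreal (max 0 (w z - e)) * ennreal (\<mu> * \<eta> ^ ?d)) \<partial>lborel)"
      by (subst nn_integral_multc[symmetric]) (auto simp: mult.assoc)
    also have "\<dots> \<le> (\<integral>\<^sup>+z. ennreal (g z) * (\<integral>\<^sup>+y. ennreal (w y) * ennreal (tent y \<eta> z) \<partial>lborel) \<partial>lborel)"
      by (intro nn_integral_mono mult_left_mono low) auto
    also have "\<dots> = (\<integral>\<^sup>+z. (\<integral>\<^sup>+y. ennreal (g z) * (ennreal (w y) * ennreal (tent y \<eta> z)) \<partial>lborel) \<partial>lborel)"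
      by (intro nn_integral_cong nn_integral_cmult[symmetric]) (simp add: tent_apply[OF eta(1)])
    also have "\<dots> = (\<integral>\<^sup>+y. (\<integral>\<^sup>+z. ennreal (g z) * (ennreal (w y) * ennreal (tent y \<eta> z)) \<partial>lborel) \<partial>lborel)"
      unfolding tent_apply[OF eta(1)] by (rule lborel_pair.Fubini'[symmetric]) (simp cong: measurable_cong_sets)
    also have "\<dots> = (\<integral>\<^sup>+y. ennreal (w y) * (\<integral>\<^sup>+z. ennreal (g z) * ennreal (tent y \<eta> z) \<partial>lborel) \<partial>lborel)"
      by (intro nn_integral_cong) (subst nn_integral_cmult[symmetric], auto simp: mult_ac)
    also have "\<dots> \<le> (\<integral>\<^sup>+y. ennreal (w y) * ennreal (\<eta> ^ ?d * F0 y) \<partial>lborel)"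
    proof (intro nn_integral_mono mult_left_mono)
      fix y
      have "(\<integral>\<^sup>+z. ennreal (g z) * ennreal (tent y \<eta> z) \<partial>lborel) = ennreal (P t (tent y \<eta>) x)"
        using gw[OF tent_VL(1)[OF eta(1)] tent_facts(1)[OF eta(1)]] gP[OF tent_VL(1)[OF eta(1)]] by simp
      also have "\<dots> \<le> ennreal (\<eta> ^ ?d * Theta A (t + \<eta> powr \<alpha>) (x - y))"
        by (intro ennreal_leI tent_bound[OF A bar t eta(1,2)])
      also have "\<dots> \<le> ennreal (\<eta> ^ ?d * F0 y)"
        unfolding F0_def using eta etat t by (intro ennreal_leI mult_left_mono Theta_le A) auto
      finally show "(\<integral>\<^sup>+z. ennreal (g z) * ennreal (tent y \<eta> z) \<partial>lborel) \<le> ennreal (\<eta> ^ ?d * F0 y)" .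
    qed simp
    also have "\<dots> = (\<integral>\<^sup>+y. ennreal (\<eta> ^ ?d) * (ennreal (w y) * ennreal (F0 y)) \<partial>lborel)"
      using eta F0 by (intro nn_integral_cong) (auto simp: ennreal_mult mult_ac)
    also have "\<dots> = ennreal (\<eta> ^ ?d) * Y"
      unfolding Y_def by (rule nn_integral_cmult) measurable
    finally have "?X * ennreal (\<mu> * \<eta> ^ ?d) \<le> ennreal (\<eta> ^ ?d) * Y" .
    then have "(?X * ennreal (\<mu> * \<eta> ^ ?d)) * ennreal (1 / (\<mu> * \<eta> ^ ?d)) \<le> (ennreal (\<eta> ^ ?d) * Y) * ennreal (1 / (\<mu> * \<eta> ^ ?d))"
      by (rule mult_right_mono) simp
    also have "(?X * ennreal (\<mu> * \<eta> ^ ?d)) * ennreal (1 / (\<mu> * \<eta> ^ ?d)) = ?X"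
      using mu eta by (simp add: mult.assoc flip: ennreal_mult)
    also have "(ennreal (\<eta> ^ ?d) * Y) * ennreal (1 / (\<mu> * \<eta> ^ ?d)) = ennreal (1 / \<mu>) * Y"
    proof -
      have "ennreal (\<eta> ^ ?d) * ennreal (1 / (\<mu> * \<eta> ^ ?d)) = ennreal (1 / \<mu>)"
        using mu eta by (simp flip: ennreal_mult)
      then show ?thesis by (metis mult.assoc mult.commute)
    qed
    finally show ?thesis .
  qed
  \<comment> \<open>The loss from replacing \<open>w\<close> by \<open>max 0 (w - e')\<close> is
    dominated by \<open>2 * e'\<close> times a wide tent that is at least 1/2 on the support of
    \<open>w\<close>; its integral against \<open>g\<close> is \<open>e' * Q\<close>.\<close>
  define Q where "Q = 2 * P t (tent 0 (2 * R')) x"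
  have R': "2 * R' > 0" by (simp add: R'_def)
  have Q0: "0 \<le> Q" using P_nonneg[OF t tent_C0[OF R'] tent_facts(1)[OF R']] by (simp add: Q_def)
  have eps: "(\<integral>\<^sup>+y. ennreal (g y) * ennreal (w y) \<partial>lborel) \<le> ennreal (1 / \<mu>) * Y + ennreal e" if e: "e > 0" for e
  proof -
    define e' where "e' = e / (Q + 1)"
    have e': "e' > 0" "e' * Q \<le> e" using e Q0 by (auto simp: e'_def divide_le_eq mult_left_mono)
    have "(\<integral>\<^sup>+y. ennreal (g y) * ennreal (w y) \<partial>lborel)
      \<le> (\<integral>\<^sup>+y. ennreal (g y) * ennreal (max 0 (w y - e')) + ennreal (2 * e') * (ennreal (g y) * ennreal (tent 0 (2 * R') y)) \<partial>lborel)"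
    proof (intro nn_integral_mono)
      fix y
      have "w y \<le> max 0 (w y - e') + 2 * e' * tent 0 (2 * R') y"
      proof (cases "norm y \<le> R'")
        case True
        have "norm y / (2 * R') \<le> 1 / 2" using True R' by (simp add: divide_le_eq)
        then have "1 / 2 \<le> tent 0 (2 * R') y" by (simp add: tent_apply[OF R'])
        then have "e' \<le> 2 * e' * tent 0 (2 * R') y" using mult_left_mono[of "1/2" _ "2 * e'"] e' by simp
        then show ?thesis by linarith
      next
        case False
        then have "w y = 0" by (intro w) (simp add: R'_def)
        then show ?thesis using tent_facts(1)[OF R', of 0 y] e' by simp
      qed
      then have "ennreal (w y) \<le> ennreal (max 0 (w y - e')) + ennreal (2 * e') * ennreal (tent 0 (2 * R') y)"
        using tent_facts(1)[OF R', of 0 y] e' by (simp add: ennreal_leI flip: ennreal_mult ennreal_plus)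
      then have "ennreal (g y) * ennreal (w y) \<le> ennreal (g y) * (ennreal (max 0 (w y - e')) + ennreal (2 * e') * ennreal (tent 0 (2 * R') y))"
        by (rule mult_left_mono) simp
      then show "ennreal (g y) * ennreal (w y) \<le> ennreal (g y) * ennreal (max 0 (w y - e')) + ennreal (2 * e') * (ennreal (g y) * ennreal (tent 0 (2 * R') y))"
        by (simp add: distrib_left mult_ac)
    qed
    also have "\<dots> = (\<integral>\<^sup>+y. ennreal (g y) * ennreal (max 0 (w y - e')) \<partial>lborel) + ennreal (2 * e') * (\<integral>\<^sup>+y. ennreal (g y) * ennreal (tent 0 (2 * R') y) \<partial>lborel)"
      by (subst nn_integral_add) (auto simp: nn_integral_cmult)
    also have "(\<integral>\<^sup>+y. ennreal (g y) * ennreal (tent 0 (2 * R') y) \<partial>lborel) = ennreal (Q / 2)"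
      using gw[OF tent_VL(1)[OF R'] tent_facts(1)[OF R']] gP[OF tent_VL(1)[OF R']] by (simp add: Q_def)
    also have "ennreal (2 * e') * ennreal (Q / 2) = ennreal (e' * Q)" using e' Q0 by (simp flip: ennreal_mult)
    also have "(\<integral>\<^sup>+y. ennreal (g y) * ennreal (max 0 (w y - e')) \<partial>lborel) + ennreal (e' * Q) \<le> ennreal (1 / \<mu>) * Y + ennreal e"
      by (intro add_mono step e' ennreal_leI)
    finally show ?thesis .
  qed
  have "(\<integral>\<^sup>+y. ennreal (g y) * ennreal (w y) \<partial>lborel) \<le> ennreal (1 / \<mu>) * Y"
    by (rule ennreal_le_epsilon) (rule eps)
  then have le: "ennreal (LINT y|lborel. g y * w y) \<le> ennreal (1 / \<mu>) * Y" using gw[OF wV w(1)] by simp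
  have F0b: "\<bar>F0 y\<bar> \<le> 2 * exp (2 * Cb A * t) * (Lb * t powr (- dlt))" for y
    using F0[of y] H_bounds(2)[OF b(1,2) t, of "x - y"] by (simp add: F0_def)
  have iF: "integrable lborel (\<lambda>y. F0 y * w y)"
    by (rule integrable_bounded_mult[OF compact_support_VL(2)[OF w(2)] _ F0b]) measurable
  have "Y = ennreal (LINT y|lborel. F0 y * w y)"
    unfolding Y_def using iF F0 w(1)
    by (subst nn_integral_eq_integral[symmetric]) (auto simp: ennreal_mult mult.commute)
  then have "ennreal (LINT y|lborel. g y * w y) \<le> ennreal (1 / \<mu> * (LINT y|lborel. F0 y * w y))"
    using le mu by (simp only: ennreal_mult'[of "1 / \<mu>"] zero_le_divide_1_iff less_imp_le)
  moreover have n: "0 \<le> 1 / \<mu> * (LINT y|lborel. F0 y * w y)"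
    using F0 w(1) mu by (intro mult_nonneg_nonneg integral_nonneg_AE) auto
  ultimately have "(LINT y|lborel. g y * w y) \<le> 1 / \<mu> * (LINT y|lborel. F0 y * w y)"
    by (subst (asm) ennreal_le_iff) auto
  also have "\<dots> = (LINT y|lborel. 1 / \<mu> * (F0 y * w y))" by simp
  also have "\<dots> = (LINT y|lborel. (Kf * exp (2 * Cb A * t) * H Lb (cb A) t (x - y)) * w y)"
    by (intro Bochner_Integration.integral_cong) (auto simp: F0_def Kf_def \<mu>_def)
  finally show ?thesis .
qed

text \<open>The density \<open>g\<close> is controlled almost everywhere only; clipping it between 0
  and the barrier gives bounds at every point without changing an integral. The representation holds
  first for L2 functions and passes to \<open>C0\<close> by cutting off, since both sides are
  continuous in the supremum norm.\<close>

theorem transition_density: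
  assumes A: "A > 0"
    and bar: "\<And>L c s z \<kappa>. L > 0 \<Longrightarrow> c > 0 \<Longrightarrow> s > 0 \<Longrightarrow> z \<noteq> 0 \<Longrightarrow> admissible \<kappa> \<Longrightarrow>
      c * s * \<psi> z \<le> L * s powr (- dlt) \<Longrightarrow>
      (LINT v|lborel. (H L c s (z + v) - H L c s z) * \<kappa> v) \<le> c * \<psi> z * A * (s + (L / c) powr (\<alpha> / \<beta>))"
    and t: "t > 0"
  obtains p where "\<And>y. 0 \<le> p y" "\<And>y. p y \<le> Kf * exp (2 * Cb A * t) * H Lb (cb A) t (x - y)"
    "\<And>u. u \<in> C0 \<Longrightarrow> integrable lborel (\<lambda>y. u y * p y)"
    "\<And>u. u \<in> C0 \<Longrightarrow> P t u x = (LINT y|lborel. u y * p y)"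
proof -
  note b = barrier_const[OF A]
  define W where "W n = tent (0 :: real ^ 'n) (real (Suc n))" for n
  have Wp: "real (Suc n) > 0" for n by simp
  have W: "W n \<in> VL" "0 \<le> W n y" "W n y \<le> 1" "integrable lborel (W n)" "real (Suc n) \<le> norm y \<Longrightarrow> W n y = 0" for n y
    unfolding W_def using tent_VL[OF Wp[of n]] tent_facts[OF Wp[of n], where y = 0 and x = y] by auto
  have Wn: "W n y = max 0 (1 - norm y / real (Suc n))" for n y
    unfolding W_def by (subst tent_apply[OF Wp]) simp
  have Wex: "\<exists>n. W n y \<noteq> 0" for y
  proof -
    obtain n where "norm y < real n" using reals_Archimedean2 by blast
    then have "norm y / real (Suc n) < 1" by (simp add: divide_less_eq)
    then show ?thesis using Wn[of n y] by (intro exI[of _ n]) simp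
  qed
  have lin: "P t (u + r *\<^sub>R w) x = P t u x + r * P t w x" if "u \<in> C0" "w \<in> C0" for u w r
    using that t by (intro P_lin) auto
  obtain g us where g[measurable]: "g \<in> borel_measurable borel" and us: "\<And>k. us k \<in> VL"
    and lim: "AE y in lborel. (\<lambda>k. us k y) \<longlonglongrightarrow> g y"
    and gi: "\<And>w. w \<in> VL \<Longrightarrow> integrable lborel (\<lambda>y. g y * w y)"
    and gP: "\<And>w. w \<in> VL \<Longrightarrow> P t w x = (LINT y|lborel. g y * w y)"
    using L2_density[of "\<lambda>u. P t u x" "DN t" W, OF lin P_le_ip[OF t] W(1) Wex] by blast
  have Wcs: "\<exists>R. \<forall>y. R \<le> norm y \<longrightarrow> W n y = 0" for n using W(5) by blast
  have g0: "AE y in lborel. 0 \<le> g y"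
  proof -
    have "AE y in lborel. - g y \<le> 0"
    proof (rule AE_le_by_testing[where us = "\<lambda>k. - us k" and W = W and B = 0])
      show "AE y in lborel. (\<lambda>k. (- us k) y) \<longlonglongrightarrow> - g y"
        using lim by eventually_elim (auto simp: uminus_bcontfun.rep_eq intro!: tendsto_intros)
      show "integrable lborel (\<lambda>y. - g y * W n y)" for n using gi[OF W(1)[of n]] by simp
      fix w :: "(real ^ 'n) \<Rightarrow>\<^sub>C real"
      assume w: "\<And>y. 0 \<le> w y" "\<exists>R. \<forall>y. R \<le> norm y \<longrightarrow> w y = 0"
      then have wV: "w \<in> VL" using compact_support_VL(1) by blast
      then have "0 \<le> P t w x" using w(1) by (intro P_nonneg[OF t]) (auto simp: VL_def)
      then show "(LINT y|lborel. - g y * w y) \<le> (LINT y|lborel. 0 * w y)" using gP[OF wV] by simp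
    qed (use W Wex Wcs in auto)
    then show ?thesis by eventually_elim simp
  qed
  define F where "F y = Kf * exp (2 * Cb A * t) * H Lb (cb A) t (x - y)" for y
  have F0: "0 \<le> F y" for y using H_bounds(1)[OF b(1,2) t] Kf_pos by (simp add: F_def)
  have Fi: "integrable lborel F" unfolding F_def using H_integrable[OF b(1,2) t, of x] by simp
  have gF: "AE y in lborel. g y \<le> F y"
  proof (rule AE_le_by_testing[OF g lim, where W = W and B = "Kf * exp (2 * Cb A * t) * (Lb * t powr (- dlt))"])
    show "continuous_on UNIV F"
      unfolding F_def by (intro continuous_intros continuous_on_compose2[OF H_continuous[OF b(1,2) t]]) auto
    show "\<bar>F y\<bar> \<le> Kf * exp (2 * Cb A * t) * (Lb * t powr (- dlt))" for y
      using F0[of y] H_bounds(2)[OF b(1,2) t, of "x - y"] Kf_pos by (simp add: F_def)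
    show "integrable lborel (\<lambda>y. g y * W n y)" for n by (rule gi[OF W(1)])
    fix w :: "(real ^ 'n) \<Rightarrow>\<^sub>C real"
    assume "\<And>y. 0 \<le> w y" "\<exists>R. \<forall>y. R \<le> norm y \<longrightarrow> w y = 0"
    then show "(LINT y|lborel. g y * w y) \<le> (LINT y|lborel. F y * w y)"
      unfolding F_def using density_test[OF A bar t g g0 gi gP] by blast
  qed (use W Wex Wcs in auto)
  define p where "p y = max 0 (min (g y) (F y))" for y
  have p: "0 \<le> p y" "p y \<le> F y" for y using F0[of y] by (auto simp: p_def)
  have [measurable]: "F \<in> borel_measurable borel" using borel_measurable_integrable[OF Fi] by simp
  have p_meas[measurable]: "p \<in> borel_measurable borel" unfolding p_def[abs_def] by measurable
  have pg: "AE y in lborel. p y = g y" using g0 gF by eventually_elim (simp add: p_def)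
  have pi: "integrable lborel p"
    by (rule Bochner_Integration.integrable_bound[OF Fi]) (use p F0 in \<open>auto intro!: AE_I2 order_trans[OF p(2)]\<close>)
  have up: "integrable lborel (\<lambda>y. u y * p y)" for u :: "(real ^ 'n) \<Rightarrow>\<^sub>C real"
    by (rule integrable_bounded_mult[OF pi _ abs_bcontfun_le]) measurable
  have rep: "P t u x = (LINT y|lborel. u y * p y)" if u: "u \<in> C0" for u
  proof -
    \<comment> \<open>The cut-off functions converge uniformly to \<open>u\<close>, because
      \<open>u\<close> vanishes at infinity while \<open>W n\<close> tends to 1 uniformly on bounded
      sets.\<close>
    define un where "un n = Bcontfun (\<lambda>y. u y * W n y)" for n
    have un: "un n y = u y * W n y" for n y
    proof -
      have "\<bar>u y * W n y\<bar> \<le> norm u" for y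
        using abs_bcontfun_le[of u y] W(2,3)[of n y] mult_mono[of "\<bar>u y\<bar>" "norm u" "W n y" 1] by (simp add: abs_mult)
      then show ?thesis unfolding un_def
        by (subst Bcontfun_apply[where b = "norm u"]) (auto intro!: continuous_intros)
    qed
    have unV: "un n \<in> VL" for n
      by (rule compact_support_VL[of "real (Suc n)"]) (simp add: un W(5) del: of_nat_Suc)
    then have unC: "un n \<in> C0" for n by (simp add: VL_def)
    have unp: "P t (un n) x = (LINT y|lborel. un n y * p y)" for n
      unfolding gP[OF unV[of n]] by (rule integral_cong_AE) (use pg in \<open>auto elim!: eventually_mono\<close>)
    have nlim: "(\<lambda>n. norm (un n - u)) \<longlonglongrightarrow> 0"
    proof (rule tendstoI)
      fix e :: real assume e: "e > 0"
      have "\<forall>\<^sub>F y in at_infinity. dist (u y) 0 < e/2" using u e by (intro tendstoD) (auto simp: C0_def)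
      then obtain \<rho> where \<rho>: "\<And>y. norm y \<ge> \<rho> \<Longrightarrow> \<bar>u y\<bar> < e/2" by (auto simp: eventually_at_infinity)
      have "(\<lambda>n. norm u * (\<bar>\<rho>\<bar> * (1 / real (Suc n)))) \<longlonglongrightarrow> norm u * (\<bar>\<rho>\<bar> * 0)"
        by (intro tendsto_intros LIMSEQ_Suc[OF lim_1_over_n])
      then have "\<forall>\<^sub>F n in sequentially. norm u * (\<bar>\<rho>\<bar> * (1 / real (Suc n))) < e/2" using e by (intro order_tendstoD) auto
      then show "\<forall>\<^sub>F n in sequentially. dist (norm (un n - u)) 0 < e"
      proof (rule eventually_mono)
        fix n assume n: "norm u * (\<bar>\<rho>\<bar> * (1 / real (Suc n))) < e/2"
        have "norm (un n - u) \<le> e/2"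
        proof (rule norm_bound)
          fix y
          have "(un n - u) y = - (u y * (1 - W n y))" by (simp add: minus_bcontfun.rep_eq un algebra_simps)
          then have eq: "norm ((un n - u) y) = \<bar>u y\<bar> * (1 - W n y)" using W(3)[of n y] by (simp add: abs_mult)
          show "norm ((un n - u) y) \<le> e/2"
          proof (cases "norm y \<ge> \<rho>")
            case True
            then have "\<bar>u y\<bar> * (1 - W n y) \<le> e/2 * 1" using \<rho>[OF True] W(2,3)[of n y] by (intro mult_mono) auto
            then show ?thesis using eq by simp
          next
            case False
            have "1 - W n y \<le> norm y * (1 / real (Suc n))" unfolding Wn by simp
            also have "\<dots> \<le> \<bar>\<rho>\<bar> * (1 / real (Suc n))" using False by (intro mult_right_mono) auto
            finally have "\<bar>u y\<bar> * (1 - W n y) \<le> norm u * (\<bar>\<rho>\<bar> * (1 / real (Suc n)))"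
              using abs_bcontfun_le[of u y] W(3)[of n y] by (intro mult_mono) auto
            then show ?thesis using n eq by linarith
          qed
        qed
        then show "dist (norm (un n - u)) 0 < e" using e by simp
      qed
    qed
    have "(\<lambda>n. P t (un n) x) \<longlonglongrightarrow> P t u x"
    proof (rule LIM_zero_cancel, rule Lim_null_comparison[OF _ nlim], rule always_eventually, rule allI)
      fix n
      have "P t (un n) x - P t u x = P t (un n - u) x"
        using P_diff[of t "un n" u] t unC u by (simp add: minus_bcontfun.rep_eq)
      then show "norm (P t (un n) x - P t u x) \<le> norm (un n - u)"
        using P_abs_le[of t "un n - u" x] t unC u by (simp add: subspace_diff[OF subspace_C0])
    qed
    moreover have "(\<lambda>n. LINT y|lborel. un n y * p y) \<longlonglongrightarrow> (LINT y|lborel. u y * p y)"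
    proof (rule integral_dominated_convergence[where w = "\<lambda>y. norm u * p y"])
      show "integrable lborel (\<lambda>y. norm u * p y)" using pi by simp
      have "(\<lambda>n. un n y) \<longlonglongrightarrow> u y" for y
      proof (rule LIM_zero_cancel, rule Lim_null_comparison[OF _ nlim], rule always_eventually, rule allI)
        show "norm (un n y - u y) \<le> norm (un n - u)" for n
          using abs_bcontfun_le[of "un n - u" y] by (simp add: minus_bcontfun.rep_eq)
      qed
      then show "AE y in lborel. (\<lambda>n. un n y * p y) \<longlonglongrightarrow> u y * p y" by (intro AE_I2 tendsto_intros)
      show "AE y in lborel. norm (un n y * p y) \<le> norm u * p y" for n
      proof (rule AE_I2)
        fix y
        have "\<bar>un n y\<bar> \<le> norm u * 1" unfolding un abs_mult using abs_bcontfun_le[of u y] W(2,3)[of n y] by (intro mult_mono) auto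
        then show "norm (un n y * p y) \<le> norm u * p y" using p(1)[of y] by (simp add: abs_mult mult_right_mono)
      qed
    qed measurable
    ultimately show ?thesis unfolding unp by (rule LIMSEQ_unique)
  qed
  show thesis using that[of p] p up rep unfolding F_def by blast
qed

end

context profile_const
begin

text \<open>Returns from the shifted \<phi> in \<psi> to \<phi> itself, at the cost of a factor
  \<open>c1\<close>.\<close>

lemma H_le_heat_bound:
  assumes A: "A > 0" and t: "t > 0"
  shows "H Lb (cb A) t z \<le> max Lb (cb A * c1) * heat_bound (real CARD('n)) \<alpha> \<phi> t (norm z)"
proof -
  note b = barrier_const[OF A]
  have T: "Lb * t powr (- dlt) \<le> max Lb (cb A * c1) * t powr (- dlt)" by (intro mult_right_mono) auto
  show ?thesis
  proof (cases "z = 0")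
    case True
    then show ?thesis using T by (simp add: H_def heat_bound_def dlt_def)
  next
    case False
    let ?q = "t * \<phi> (norm z) / norm z powr \<beta>"
    have q: "0 \<le> ?q" using t phi_range(1)[of "norm z"] by simp
    have "cb A * t * \<psi> z = cb A * (t * \<phi> (norm z + 1) / norm z powr \<beta>)"
      by (simp add: fun_cong[OF psi, of z] powr_minus_divide)
    also have "\<dots> \<le> cb A * (t * (c1 * \<phi> (norm z)) / norm z powr \<beta>)"
      using b(2) t phi_shift(2)[of "norm z"] by (intro mult_left_mono divide_right_mono) auto
    also have "\<dots> = cb A * c1 * ?q" by simp
    also have "\<dots> \<le> max Lb (cb A * c1) * ?q" using q by (intro mult_right_mono) auto
    finally have Q: "cb A * t * \<psi> z \<le> max Lb (cb A * c1) * ?q" .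
    have m: "max Lb (cb A * c1) \<ge> 0" using b(1) by simp
    have "H Lb (cb A) t z \<le> min (max Lb (cb A * c1) * t powr (- dlt)) (max Lb (cb A * c1) * ?q)"
      using False T Q by (auto simp: H_def min_le_iff_disj)
    also have "\<dots> = max Lb (cb A * c1) * min (t powr (- dlt)) ?q"
      using m by (simp add: min_mult_distrib_left)
    also have "min (t powr (- dlt)) ?q = heat_bound (real CARD('n)) \<alpha> \<phi> t (norm z)"
      using False by (simp add: heat_bound_def dlt_def beta)
    finally show ?thesis .
  qed
qed

end

theorem theorem2:
  fixes \<alpha> M c\<^sub>4 :: real and \<phi> :: "real \<Rightarrow> real"
  assumes alpha: "0 < \<alpha>" "\<alpha> < 2"
    and phi_borel: "\<phi> \<in> borel_measurable (restrict_space borel {0..})"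
    and phi_range: "\<forall>a\<ge>0. 0 < \<phi> a \<and> \<phi> a \<le> 1"
    and M_pos: "0 < M"
    and c4_pos: "0 < c\<^sub>4"
    and A1_a: "\<forall>a\<in>{0..1}. \<phi> a = 1"
              "\<exists>c\<^sub>1. \<forall>a\<ge>0. \<forall>b\<ge>0. \<bar>a - b\<bar> \<le> 1 \<longrightarrow> \<phi> a \<le> c\<^sub>1 * \<phi> b"
    and A1_b: "C2_on_halfline 1 \<phi>"
              "\<exists>c\<^sub>2. \<forall>a>1. max \<bar>deriv \<phi> a\<bar> \<bar>deriv (deriv \<phi>) a\<bar> \<le> c\<^sub>2 * \<phi> a"
    and A1_c: "\<exists>c\<^sub>3. \<forall>x y :: real ^ 'n. norm (x - y) > 2 \<longrightarrow>
                 (\<integral>\<^sup>+z\<in>{z. norm (x - z) \<ge> 1 \<and> norm (y - z) \<ge> 1}.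
                    ennreal (\<phi> (norm (y - z)) / norm (y - z) powr (\<alpha> + real CARD('n)) *
                             (\<phi> (norm (z - x)) / norm (z - x) powr (\<alpha> + real CARD('n)))) \<partial>lborel)
                 \<le> ennreal (c\<^sub>3 * (\<phi> (norm (y - x)) / norm (y - x) powr (\<alpha> + real CARD('n))))"
  shows "\<exists>C\<^sub>1>0. \<exists>C\<^sub>2>0.
    \<forall>(f :: real ^ 'n \<Rightarrow> real ^ 'n \<Rightarrow> ennreal)
     (P :: real \<Rightarrow> ((real ^ 'n) \<Rightarrow>\<^sub>C real) \<Rightarrow> ((real ^ 'n) \<Rightarrow>\<^sub>C real)).
      (\<lambda>(x, y). f x y) \<in> borel_measurable borel \<longrightarrow>
      (\<forall>x y. x \<noteq> y \<longrightarrow>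
         f x y \<le> ennreal (M * \<phi> (norm (y - x)) * norm (y - x) powr (- \<alpha> - real CARD('n)))) \<longrightarrow>
      ((\<forall>x h. f x (x + h) = f x (x - h)) \<or> \<alpha> < 1) \<longrightarrow>
      (\<forall>x y. f x y = f y x) \<longrightarrow>
      (\<forall>\<epsilon>>0. (INF x. \<integral>\<^sup>+y\<in>{y. norm (y - x) > \<epsilon>}. f x y / ennreal (\<phi> (norm (y - x))) \<partial>lborel)
               \<ge> ennreal (c\<^sub>4 * \<epsilon> powr (- \<alpha>))) \<longrightarrow>
      (\<forall>y. continuous_on (UNIV - {y}) (\<lambda>x. f x y)) \<longrightarrow>
      closable (jump_op_graph f) \<longrightarrow>
      strongly_continuous_contraction_semigroup_on C0 P \<longrightarrow>
      generator_on C0 P = closure (jump_op_graph f) \<longrightarrow>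
      (\<exists>p :: real \<Rightarrow> real ^ 'n \<Rightarrow> real ^ 'n \<Rightarrow> real.
         (\<forall>t>0. \<forall>x y. 0 \<le> p t x y) \<and>
         (\<forall>t>0. \<forall>u\<in>C0. \<forall>x.
            integrable lborel (\<lambda>y. apply_bcontfun u y * p t x y) \<and>
            apply_bcontfun (P t u) x = (LINT y|lborel. apply_bcontfun u y * p t x y)) \<and>
         (\<forall>t>0. \<forall>x y. p t x y \<le> C\<^sub>1 * exp (C\<^sub>2 * t) * heat_bound (real CARD('n)) \<alpha> \<phi> t (norm (y - x))))"
proof -
  let ?\<beta> = "\<alpha> + real CARD('n)"
  let ?\<psi> = "\<lambda>z :: real ^ 'n. \<phi> (norm z + 1) * norm z powr (- ?\<beta>)"
  obtain c1 where c1: "\<And>a b. 0 \<le> a \<Longrightarrow> 0 \<le> b \<Longrightarrow> \<bar>a - b\<bar> \<le> 1 \<Longrightarrow> \<phi> a \<le> c1 * \<phi> b" using A1_a(2) by blast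
  obtain c2 where c2: "\<And>a. a > 1 \<Longrightarrow> max \<bar>deriv \<phi> a\<bar> \<bar>deriv (deriv \<phi>) a\<bar> \<le> c2 * \<phi> a" using A1_b(2) by blast
  obtain c3 where c3: "\<And>x y :: real ^ 'n. norm (x - y) > 2 \<Longrightarrow>
                 (\<integral>\<^sup>+z\<in>{z. norm (x - z) \<ge> 1 \<and> norm (y - z) \<ge> 1}.
                    ennreal (\<phi> (norm (y - z)) / norm (y - z) powr ?\<beta> *
                             (\<phi> (norm (z - x)) / norm (z - x) powr ?\<beta>)) \<partial>lborel)
                 \<le> ennreal (c3 * (\<phi> (norm (y - x)) / norm (y - x) powr ?\<beta>))"
    using A1_c by blast
  \<comment> \<open>The constant of the convolution condition is enlarged to
    \<open>max 0 c3\<close>, as \<open>profile\<close> asks for a nonnegative one.\<close>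
  have profile: "profile \<alpha> ?\<beta> M c1 c2 (max 0 c3) \<phi> ?\<psi>"
  proof
    fix x y :: "real ^ 'n" assume "norm (x - y) > 2"
    from c3[OF this]
    show "(\<integral>\<^sup>+z\<in>{z. norm (x - z) \<ge> 1 \<and> norm (y - z) \<ge> 1}.
                    ennreal (\<phi> (norm (y - z)) / norm (y - z) powr ?\<beta> *
                             (\<phi> (norm (z - x)) / norm (z - x) powr ?\<beta>)) \<partial>lborel)
                 \<le> ennreal (max 0 c3 * (\<phi> (norm (y - x)) / norm (y - x) powr ?\<beta>))"
      by (rule order_trans) (intro ennreal_leI mult_right_mono divide_nonneg_nonneg,
          use phi_range[rule_format, of "norm (y - x)"] in auto)
  next
    fix a :: real assume "a > 1"
    then show "\<bar>deriv \<phi> a\<bar> \<le> c2 * \<phi> a" "\<bar>deriv (deriv \<phi>) a\<bar> \<le> c2 * \<phi> a" using c2[of a] by auto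
  qed (use alpha M_pos phi_borel phi_range A1_a(1) c1 A1_b(1) in auto)
  obtain \<omega> where \<omega>: "\<omega> > 0"
    "\<And>r. r > 0 \<Longrightarrow> (\<integral>\<^sup>+v. ennreal (norm v powr (- \<alpha> - DIM(real ^ 'n))) * indicator {v. r < norm v} (v :: real ^ 'n) \<partial>lborel)
      \<le> ennreal (\<omega> * r powr (- \<alpha>))"
    using nn_integral_norm_powr_tail[OF alpha(1)] by blast
  have exponent: "- ?\<beta> = - \<alpha> - DIM(real ^ 'n)" by simp
  have const: "profile_const \<alpha> ?\<beta> M c1 c2 (max 0 c3) \<phi> ?\<psi> c\<^sub>4 \<omega>"
    by (intro profile_const.intro profile profile_const_axioms.intro c4_pos \<omega>(1))
       (simp only: exponent, rule \<omega>(2))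
  interpret profile_const \<alpha> ?\<beta> M c1 c2 "max 0 c3" \<phi> ?\<psi> c\<^sub>4 \<omega> by (rule const)
  \<comment> \<open>Obtained before kernel and semigroup are introduced, so that the constants below
    cannot depend on them.\<close>
  obtain A where A: "A > 0"
    and bar: "\<And>L c s z \<kappa>. L > 0 \<Longrightarrow> c > 0 \<Longrightarrow> s > 0 \<Longrightarrow> z \<noteq> 0 \<Longrightarrow> admissible \<kappa> \<Longrightarrow>
      c * s * ?\<psi> z \<le> L * s powr (- dlt) \<Longrightarrow>
      (LINT v|lborel. (H L c s (z + v) - H L c s z) * \<kappa> v) \<le> c * ?\<psi> z * A * (s + (L / c) powr (\<alpha> / ?\<beta>))"
  proof (rule barrier)
    fix A :: real
    assume *: "A > 0" "\<And>L c s z \<kappa>. L > 0 \<Longrightarrow> c > 0 \<Longrightarrow> s > 0 \<Longrightarrow> z \<noteq> 0 \<Longrightarrow> admissible \<kappa> \<Longrightarrow>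
      c * s * ?\<psi> z \<le> L * s powr (- dlt) \<Longrightarrow>
      (LINT v|lborel. (H L c s (z + v) - H L c s z) * \<kappa> v) \<le> c * ?\<psi> z * A * (s + (L / c) powr (\<alpha> / ?\<beta>))"
    show thesis by (rule that[OF *])
  qed
  let ?C1 = "Kf * max Lb (cb A * c1)" and ?C2 = "2 * Cb A"
  have C1: "?C1 > 0" using Kf_pos barrier_const(1)[OF A] by simp
  have C2: "?C2 > 0" using barrier_const(5)[OF A] by simp
  show ?thesis
  proof (rule exI[of _ ?C1], rule conjI, rule C1, rule exI[of _ ?C2], rule conjI, rule C2, intro allI impI)
    fix f :: "real ^ 'n \<Rightarrow> real ^ 'n \<Rightarrow> ennreal"
      and P :: "real \<Rightarrow> ((real ^ 'n) \<Rightarrow>\<^sub>C real) \<Rightarrow> ((real ^ 'n) \<Rightarrow>\<^sub>C real)"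
    assume f: "(\<lambda>(x, y). f x y) \<in> borel_measurable borel"
      "\<forall>x y. x \<noteq> y \<longrightarrow> f x y \<le> ennreal (M * \<phi> (norm (y - x)) * norm (y - x) powr (- \<alpha> - real CARD('n)))"
      "(\<forall>x h. f x (x + h) = f x (x - h)) \<or> \<alpha> < 1" "\<forall>x y. f x y = f y x"
      and lower: "\<forall>\<epsilon>>0. (INF x. \<integral>\<^sup>+y\<in>{y. norm (y - x) > \<epsilon>}. f x y / ennreal (\<phi> (norm (y - x))) \<partial>lborel)
               \<ge> ennreal (c\<^sub>4 * \<epsilon> powr (- \<alpha>))"
      and cont: "\<forall>y. continuous_on (UNIV - {y}) (\<lambda>x. f x y)"
      and scs: "strongly_continuous_contraction_semigroup_on C0 P"
      and gen: "generator_on C0 P = closure (jump_op_graph f)"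
    interpret jump \<alpha> ?\<beta> M c1 c2 "max 0 c3" c\<^sub>4 \<omega> \<phi> ?\<psi> P f
    proof (intro jump.intro const jump_axioms.intro contraction_semigroup.intro scs subspace_C0 closed_C0 gen)
      show "case_prod f \<in> borel_measurable borel" by (rule f(1))
      show "f x y \<le> ennreal (M * \<phi> (norm (y - x)) * norm (y - x) powr (- ?\<beta>))" if "x \<noteq> y" for x y
        using f(2) that by simp
      show "ennreal (c\<^sub>4 * \<epsilon> powr (- \<alpha>))
          \<le> (\<integral>\<^sup>+y\<in>{y. norm (y - x) > \<epsilon>}. f x y / ennreal (\<phi> (norm (y - x))) \<partial>lborel)" if "\<epsilon> > 0" for \<epsilon> x
        using lower[rule_format, OF that] by (rule order_trans) (rule INF_lower[OF UNIV_I])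
    qed (use f cont in auto)
    define good where "good t x q \<longleftrightarrow> (\<forall>y. 0 \<le> q y) \<and>
        (\<forall>u\<in>C0. integrable lborel (\<lambda>y. apply_bcontfun u y * q y) \<and>
            apply_bcontfun (P t u) x = (LINT y|lborel. apply_bcontfun u y * q y)) \<and>
        (\<forall>y. q y \<le> ?C1 * exp (?C2 * t) * heat_bound (real CARD('n)) \<alpha> \<phi> t (norm (y - x)))"
      for t :: real and x :: "real ^ 'n" and q :: "real ^ 'n \<Rightarrow> real"
    have ex: "\<exists>q. good t x q" if t: "t > 0" for t x
    proof -
      obtain q where q: "\<And>y. 0 \<le> q y" "\<And>y. q y \<le> Kf * exp (2 * Cb A * t) * H Lb (cb A) t (x - y)"
        "\<And>u. u \<in> C0 \<Longrightarrow> integrable lborel (\<lambda>y. apply_bcontfun u y * q y)"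
        "\<And>u. u \<in> C0 \<Longrightarrow> apply_bcontfun (P t u) x = (LINT y|lborel. apply_bcontfun u y * q y)"
        using transition_density[OF A bar t, where x = x] by blast
      have "q y \<le> ?C1 * exp (?C2 * t) * heat_bound (real CARD('n)) \<alpha> \<phi> t (norm (y - x))" for y
      proof -
        have "q y \<le> Kf * exp (2 * Cb A * t) * H Lb (cb A) t (x - y)" by (rule q(2))
        also have "\<dots> \<le> Kf * exp (2 * Cb A * t) * (max Lb (cb A * c1) * heat_bound (real CARD('n)) \<alpha> \<phi> t (norm (x - y)))"
          using Kf_pos by (intro mult_left_mono H_le_heat_bound A t) auto
        finally show ?thesis by (simp add: mult_ac norm_minus_commute)
      qed
      then have "good t x q" using q unfolding good_def by simp
      then show ?thesis by (rule exI[of _ q])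
    qed
    \<comment> \<open>The densities were constructed for each \<open>t\<close> and \<open>x\<close>
      separately; choice collects them into one function.\<close>
    define p where "p t x = (SOME q. good t x q)" for t x
    have p: "good t x (p t x)" if "t > 0" for t x
      unfolding p_def using someI_ex[OF ex[OF that]] .
    show "\<exists>p :: real \<Rightarrow> real ^ 'n \<Rightarrow> real ^ 'n \<Rightarrow> real.
         (\<forall>t>0. \<forall>x y. 0 \<le> p t x y) \<and>
         (\<forall>t>0. \<forall>u\<in>C0. \<forall>x.
            integrable lborel (\<lambda>y. apply_bcontfun u y * p t x y) \<and>
            apply_bcontfun (P t u) x = (LINT y|lborel. apply_bcontfun u y * p t x y)) \<and>
         (\<forall>t>0. \<forall>x y. p t x y \<le> ?C1 * exp (?C2 * t) * heat_bound (real CARD('n)) \<alpha> \<phi> t (norm (y - x)))"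
      by (rule exI[of _ p], intro conjI allI impI ballI) (insert p, simp_all add: good_def)
  qed
qed

end
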